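(* Let $(\mathfrak H,\boldsymbol P,\boldsymbol Q,\boldsymbol H)$ be an irreducible Bose-like oscillator, and let $\mu\in(-\tfrac12,\infty)$, $\{\phi_n\}_{n\in\mathbb N}$, $\boldsymbol J$, $\mathcal F$ be associated with it as in the context. Define the unitary mapping $\boldsymbol U$ of $\mathfrak H$ onto the Hilbert space $L^2_\mu(\mathbb R)$ by $\boldsymbol U:\phi_n\mapsto\phi_n^\mu$, $n\in\mathbb N$. Then $\boldsymbol U$ maps $\boldsymbol P,\boldsymbol Q,\boldsymbol H,\boldsymbol J,\mathcal F$ onto $\boldsymbol P_\mu,\boldsymbol Q_\mu,\boldsymbol H_\mu,\boldsymbol J_\mu,\mathcal F_\mu$ respectively; that is, $\boldsymbol U\boldsymbol P\boldsymbol U^{-1}=\boldsymbol P_\mu$, $\boldsymbol U\boldsymbol Q\boldsymbol U^{-1}=\boldsymbol Q_\mu$, $\boldsymbol U\boldsymbol H\boldsymbol U^{-1}=\boldsymbol H_\mu$, $\boldsymbol U\boldsymbol J\boldsymbol U^{-1}=\boldsymbol J_\mu$, $\boldsymbol U\mathcal F\boldsymbol U^{-1}=\mathcal F_\mu$.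
   Context: $\mathbb N=\{0,1,2,\dots\}$. Bose-like oscillator: $\mathfrak H$ is a complex Hilbert space and $\boldsymbol P,\boldsymbol Q,\boldsymbol H$ are (possibly unbounded) selfadjoint operators on $\mathfrak H$. Put $\mathfrak S=\bigcup_{n\in\mathbb N}\boldsymbol E((-n,n))\mathfrak H$, where $\boldsymbol E$ is the spectral measure of $\boldsymbol H$. It is required that $\mathfrak S$ is contained in the domains of $\boldsymbol P,\boldsymbol Q,\boldsymbol H$, is mapped into itself by each of them, and consists of analytic vectors for each of them; that $\boldsymbol H=\frac12(\boldsymbol P^2+\boldsymbol Q^2)$ on $\mathfrak S$; and that on $\mathfrak S$ one has $i[\boldsymbol P,\boldsymbol H]=\boldsymbol Q$ and $i[\boldsymbol Q,\boldsymbol H]=-\boldsymbol P$, where $[X,Y]=XY-YX$. Then $(\mathfrak H,\boldsymbol P,\boldsymbol Q,\boldsymbol H)$ is called a Bose-like oscillator. It is irreducible if every bounded operator $\boldsymbol B:\mathfrak H\to\mathfrak H$ that commutes with $\exp(i\lambda\boldsymbol P)$ and $\exp(i\lambda\boldsymbol Q)$ for all real $\lambda$ is a scalar multiple $c\boldsymbol I$ of the identity. On $\mathfrak S$ put $\boldsymbol A=2^{-1/2}(\boldsymbol Q+i\boldsymbol P)$, $\boldsymbol A^\star=2^{-1/2}(\boldsymbol Q-i\boldsymbol P)$. Let $\gamma_\mu(2m)=\frac{2^{2m}m!\,\Gamma(m+\mu+\frac12)}{\Gamma(\mu+\frac12)}$, $\gamma_\mu(2m+1)=\frac{2^{2m+1}m!\,\Gamma(m+\mu+\frac32)}{\Gamma(\mu+\frac12)}$,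 $m\in\mathbb N$. For an irreducible Bose-like oscillator, $\mu\in(-\frac12,\infty)$ is the number (provided by the structure theorem for such oscillators) such that $\mu+\frac12$ is the smallest eigenvalue of $\boldsymbol H$ (the spectrum of $\boldsymbol H$ is $\{\mu+\frac12,\mu+\frac32,\dots\}$), $\phi_0$ is a unit vector with $\boldsymbol H\phi_0=(\mu+\frac12)\phi_0$, and $\phi_n=(\gamma_\mu(n))^{-1/2}\boldsymbol A^{\star n}\phi_0$; the $\phi_n$ form a complete orthonormal set in $\mathfrak H$. Put $\boldsymbol J=\exp(-\pi i(\boldsymbol H-(\mu+\frac12)\boldsymbol I))$ and $\mathcal F=\exp(-\frac12\pi i(\boldsymbol H-(\mu+\frac12)\boldsymbol I))$. Concrete model: $L^2_\mu(\mathbb R)$ is the Hilbert space of Lebesgue measurable $f$ on $\mathbb R$ with $\|f\|_\mu^2=\int_{-\infty}^\infty|f(t)|^2|t|^{2\mu}\,dt<\infty$. The generalized Hermite polynomials are $H_n^\mu(x)=n!\sum_{k=0}^{\lfloor n/2\rfloor}\frac{(-1)^k(2x)^{n-2k}}{k!\,\gamma_\mu(n-2k)}$, and the generalized Hermite functions are $\phi_n^\mu(x)=\left(\frac{\gamma_\mu(n)}{\Gamma(\mu+\frac12)}\right)^{1/2}\frac{1}{2^{n/2}n!}e^{-x^2/2}H_n^\mu(x)$; they form a complete orthonormal set in $L^2_\mu(\mathbb R)$. On the linear span of the $\phi_n^\mu$ define $\boldsymbol P_\mu\phi(x)=-i\left(\phi'(x)+\frac{\mu}{x}(\phi(x)-\phi(-x))\right)$,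 $\boldsymbol Q_\mu\phi(x)=x\phi(x)$, $\boldsymbol H_\mu=\frac12(\boldsymbol Q_\mu^2+\boldsymbol P_\mu^2)$; the same symbols denote the selfadjoint closures of these operators. $\boldsymbol J_\mu\phi(x)=\phi(-x)$ for $\phi\in L^2_\mu(\mathbb R)$. With $\boldsymbol e_\mu(x)=\sum_{m=0}^\infty x^m/\gamma_\mu(m)$, the generalized Fourier transform $\mathcal F_\mu$ is the unitary operator on $L^2_\mu(\mathbb R)$ extending $\mathcal F_\mu f(x)=\left(2^{\mu+\frac12}\Gamma(\mu+\frac12)\right)^{-1}\int_{-\infty}^\infty\boldsymbol e_\mu(-ixt)f(t)|t|^{2\mu}\,dt$ from the linear span of $\{e^{-x^2}x^n:n\in\mathbb N\}$. *)

theory Defs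
  imports "HOL-Analysis.Analysis"
begin

section \<open>Complex Hilbert spaces\<close>

class complex_vector = ab_group_add +
  fixes scaleC :: "complex \<Rightarrow> 'a \<Rightarrow> 'a"  (infixr "*\<^sub>C" 75)
  assumes scaleC_add_right: "a *\<^sub>C (x + y) = a *\<^sub>C x + a *\<^sub>C y"
    and scaleC_add_left: "(a + b) *\<^sub>C x = a *\<^sub>C x + b *\<^sub>C x"
    and scaleC_scaleC: "a *\<^sub>C b *\<^sub>C x = (a * b) *\<^sub>C x"
    and scaleC_one: "1 *\<^sub>C x = x"

text \<open>The inner product is linear in its first argument.\<close>

class complex_hilbert_space = banach + complex_vector +
  fixes cinner :: "'a \<Rightarrow> 'a \<Rightarrow> complex"
  assumes scaleR_scaleC: "r *\<^sub>R x = complex_of_real r *\<^sub>C x"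
    and cinner_add_left: "cinner (x + y) z = cinner x z + cinner y z"
    and cinner_scaleC_left: "cinner (a *\<^sub>C x) y = a * cinner x y"
    and cinner_commute: "cinner x y = cnj (cinner y x)"
    and cinner_self: "cinner x x = complex_of_real ((norm x)\<^sup>2)"

instantiation complex :: complex_hilbert_space
begin

definition "scaleC_complex (a::complex) (x::complex) = a * x"
definition "cinner_complex (x::complex) (y::complex) = x * cnj y"

instance
proof
  fix r :: real and a b x y z :: complex
  show "a *\<^sub>C (x + y) = a *\<^sub>C x + a *\<^sub>C y"
    by (simp add: scaleC_complex_def distrib_left)
  show "(a + b) *\<^sub>C x = a *\<^sub>C x + b *\<^sub>C x"
    by (simp add: scaleC_complex_def distrib_right)
  show "a *\<^sub>C b *\<^sub>C x = (a * b) *\<^sub>C x" "1 *\<^sub>C x = x"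
    by (simp_all add: scaleC_complex_def)
  show "r *\<^sub>R x = complex_of_real r *\<^sub>C x"
    by (simp add: scaleC_complex_def scaleR_conv_of_real)
  show "cinner (x + y) z = cinner x z + cinner y z"
    by (simp add: cinner_complex_def distrib_right)
  show "cinner (a *\<^sub>C x) y = a * cinner x y" "cinner x y = cnj (cinner y x)"
    by (simp_all add: cinner_complex_def scaleC_complex_def)
  show "cinner x x = complex_of_real ((norm x)\<^sup>2)"
    by (simp only: cinner_complex_def complex_norm_square)
qed

end

definition clinear :: "('a::complex_vector \<Rightarrow> 'b::complex_vector) \<Rightarrow> bool" where
  "clinear B \<longleftrightarrow> (\<forall>x y. B (x + y) = B x + B y) \<and> (\<forall>c x. B (c *\<^sub>C x) = c *\<^sub>C B x)"

definition bounded_operator :: "('a::complex_hilbert_space \<Rightarrow> 'a) \<Rightarrow> bool" where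
  "bounded_operator B \<longleftrightarrow> clinear B \<and> (\<exists>K. \<forall>x. norm (B x) \<le> K * norm x)"


section \<open>Unbounded operators\<close>

text \<open>
  An operator with domain \<open>D\<close> is represented by its graph, so that equality of graphs is
  equality of operators including their domains.
\<close>

type_synonym 'a oper = "('a \<times> 'a) set"

definition app :: "'a oper \<Rightarrow> 'a \<Rightarrow> 'a" where
  "app T x = (THE y. (x, y) \<in> T)"

definition linear_operator :: "'a::complex_vector oper \<Rightarrow> bool" where
  "linear_operator T \<longleftrightarrow> single_valued T \<and> (0, 0) \<in> T \<and>
     (\<forall>x y x' y'. (x, y) \<in> T \<longrightarrow> (x', y') \<in> T \<longrightarrow> (x + x', y + y') \<in> T) \<and>
     (\<forall>c x y. (x, y) \<in> T \<longrightarrow> (c *\<^sub>C x, c *\<^sub>C y) \<in> T)"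

definition adjoint_operator :: "'a::complex_hilbert_space oper \<Rightarrow> 'a oper" where
  "adjoint_operator T = {(y, z). \<forall>(x, w) \<in> T. cinner w y = cinner x z}"

definition selfadjoint :: "'a::complex_hilbert_space oper \<Rightarrow> bool" where
  "selfadjoint T \<longleftrightarrow>
     linear_operator T \<and> closure (Domain T) = UNIV \<and> adjoint_operator T = T"

definition is_eigenvalue :: "'a::complex_hilbert_space oper \<Rightarrow> complex \<Rightarrow> bool" where
  "is_eigenvalue T c \<longleftrightarrow> (\<exists>x. x \<noteq> 0 \<and> (x, c *\<^sub>C x) \<in> T)"

text \<open>Analytic vectors in the sense of Nelson.\<close>

definition analytic_vector :: "'a::complex_hilbert_space oper \<Rightarrow> 'a \<Rightarrow> bool" where
  "analytic_vector T x \<longleftrightarrow> (\<forall>n. x \<in> Domain (T ^^ n)) \<and>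
     (\<exists>t>0. summable (\<lambda>n. norm ((app T ^^ n) x) / fact n * t ^ n))"

definition shift_operator :: "'a::complex_vector oper \<Rightarrow> complex \<Rightarrow> 'a oper" where
  \<comment> \<open>\<open>T - c I\<close>\<close>
  "shift_operator T c = {(x, y - c *\<^sub>C x) | x y. (x, y) \<in> T}"


section \<open>Spectral measures and functional calculus\<close>

definition orthogonal_projection :: "('a::complex_hilbert_space \<Rightarrow> 'a) \<Rightarrow> bool" where
  "orthogonal_projection B \<longleftrightarrow>
     clinear B \<and> (\<forall>x. B (B x) = B x) \<and> (\<forall>x y. cinner (B x) y = cinner x (B y))"

definition projection_valued_measure :: "(real set \<Rightarrow> 'a::complex_hilbert_space \<Rightarrow> 'a) \<Rightarrow> bool" where
  "projection_valued_measure E \<longleftrightarrow>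
     (\<forall>A \<in> sets borel. orthogonal_projection (E A)) \<and>
     E UNIV = (\<lambda>x. x) \<and>
     (\<forall>A :: nat \<Rightarrow> real set. range A \<subseteq> sets borel \<longrightarrow> disjoint_family A \<longrightarrow>
        (\<forall>x. (\<lambda>n. E (A n) x) sums E (\<Union>n. A n) x))"

text \<open>The positive measure \<open>\<langle>E(\<cdot>)x, x\<rangle>\<close>, and integration against the complex measure
  \<open>\<langle>E(\<cdot>)x, z\<rangle>\<close>, which is obtained from positive ones by polarization.\<close>

definition diag_measure :: "(real set \<Rightarrow> 'a::complex_hilbert_space \<Rightarrow> 'a) \<Rightarrow> 'a \<Rightarrow> real measure" where
  "diag_measure E x = measure_of UNIV (sets borel) (\<lambda>A. ennreal (Re (cinner (E A x) x)))"

definition sesq_integral ::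
  "(real set \<Rightarrow> 'a::complex_hilbert_space \<Rightarrow> 'a) \<Rightarrow> (real \<Rightarrow> complex) \<Rightarrow> 'a \<Rightarrow> 'a \<Rightarrow> complex" where
  "sesq_integral E f x z =
     (\<Sum>k<4. \<i> ^ k * (LINT t|diag_measure E (x + \<i> ^ k *\<^sub>C z). f t)) / 4"

text \<open>
  The operator \<open>\<integral> f dE\<close> for Borel \<open>f\<close>. Its domain \<open>D\<close> is dense, so testing against \<open>z \<in> D\<close> (for
  which all four integrals in the polarization converge) determines the value.
\<close>

definition spectral_domain ::
  "(real set \<Rightarrow> 'a::complex_hilbert_space \<Rightarrow> 'a) \<Rightarrow> (real \<Rightarrow> complex) \<Rightarrow> 'a set" where
  "spectral_domain E f = {x. (\<integral>\<^sup>+ t. ennreal ((cmod (f t))\<^sup>2) \<partial>diag_measure E x) < \<infinity>}"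

definition spectral_integral ::
  "(real set \<Rightarrow> 'a::complex_hilbert_space \<Rightarrow> 'a) \<Rightarrow> (real \<Rightarrow> complex) \<Rightarrow> 'a oper" where
  "spectral_integral E f = {(x, y). x \<in> spectral_domain E f \<and>
     (\<forall>z \<in> spectral_domain E f. cinner y z = sesq_integral E f x z)}"

definition is_spectral_measure ::
  "(real set \<Rightarrow> 'a::complex_hilbert_space \<Rightarrow> 'a) \<Rightarrow> 'a oper \<Rightarrow> bool" where
  "is_spectral_measure E T \<longleftrightarrow>
     projection_valued_measure E \<and> T = spectral_integral E complex_of_real"

text \<open>
  \<open>f(T)\<close> for selfadjoint \<open>T\<close>. By the spectral theorem there is exactly one \<open>E\<close> as below on the
  Borel sets (other sets do not enter), so this is \<open>\<integral> f dE\<close> for the spectral measure of \<open>T\<close>.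
\<close>

definition op_fun :: "(real \<Rightarrow> complex) \<Rightarrow> 'a::complex_hilbert_space oper \<Rightarrow> 'a oper" where
  "op_fun f T = {(x, y). \<exists>E. is_spectral_measure E T \<and> (x, y) \<in> spectral_integral E f}"

definition exp_op :: "complex \<Rightarrow> 'a::complex_hilbert_space oper \<Rightarrow> 'a oper" where
  \<comment> \<open>\<open>exp(c T)\<close>\<close>
  "exp_op c T = op_fun (\<lambda>t. exp (c * complex_of_real t)) T"


section \<open>Bose-like oscillators\<close>

definition smooth_space :: "(real set \<Rightarrow> 'a \<Rightarrow> 'a) \<Rightarrow> 'a set" where
  "smooth_space E = (\<Union>n::nat. range (E {- real n <..< real n}))"

definition bose_like_oscillator ::
  "'a::complex_hilbert_space oper \<Rightarrow> 'a oper \<Rightarrow> 'a oper \<Rightarrow> bool" where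
  "bose_like_oscillator P Q H \<longleftrightarrow>
     selfadjoint P \<and> selfadjoint Q \<and> selfadjoint H \<and>
     (\<exists>E. is_spectral_measure E H \<and>
       (\<forall>T \<in> {P, Q, H}. \<forall>x \<in> smooth_space E.
          x \<in> Domain T \<and> app T x \<in> smooth_space E \<and> analytic_vector T x) \<and>
       (\<forall>x \<in> smooth_space E.
          app H x = (1 / 2) *\<^sub>C (app P (app P x) + app Q (app Q x)) \<and>
          \<i> *\<^sub>C (app P (app H x) - app H (app P x)) = app Q x \<and>
          \<i> *\<^sub>C (app Q (app H x) - app H (app Q x)) = - app P x))"

definition irreducible_oscillator ::
  "'a::complex_hilbert_space oper \<Rightarrow> 'a oper \<Rightarrow> bool" where
  "irreducible_oscillator P Q \<longleftrightarrow>
     (\<forall>B. bounded_operator B \<longrightarrow>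
        (\<forall>s::real. \<forall>T \<in> {P, Q}. \<forall>(x, y) \<in> exp_op (\<i> * s) T. (B x, B y) \<in> exp_op (\<i> * s) T) \<longrightarrow>
        (\<exists>c. \<forall>x. B x = c *\<^sub>C x))"

definition gamma_mu :: "real \<Rightarrow> nat \<Rightarrow> real" where
  "gamma_mu \<mu> n = (let m = n div 2 in
     if even n then 2 ^ (2 * m) * fact m * Gamma (m + \<mu> + 1 / 2) / Gamma (\<mu> + 1 / 2)
     else 2 ^ (2 * m + 1) * fact m * Gamma (m + \<mu> + 3 / 2) / Gamma (\<mu> + 1 / 2))"

definition creation :: "'a::complex_hilbert_space oper \<Rightarrow> 'a oper \<Rightarrow> 'a \<Rightarrow> 'a" where
  "creation P Q x = complex_of_real (1 / sqrt 2) *\<^sub>C (app Q x - \<i> *\<^sub>C app P x)"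

definition osc_phi ::
  "real \<Rightarrow> 'a::complex_hilbert_space oper \<Rightarrow> 'a oper \<Rightarrow> 'a \<Rightarrow> nat \<Rightarrow> 'a" where
  "osc_phi \<mu> P Q \<phi>0 n =
     complex_of_real (1 / sqrt (gamma_mu \<mu> n)) *\<^sub>C (creation P Q ^^ n) \<phi>0"

definition osc_J :: "real \<Rightarrow> 'a::complex_hilbert_space oper \<Rightarrow> 'a oper" where
  "osc_J \<mu> H = exp_op (- (pi * \<i>)) (shift_operator H (complex_of_real (\<mu> + 1 / 2)))"

definition osc_F :: "real \<Rightarrow> 'a::complex_hilbert_space oper \<Rightarrow> 'a oper" where
  "osc_F \<mu> H = exp_op (- (pi * \<i> / 2)) (shift_operator H (complex_of_real (\<mu> + 1 / 2)))"


section \<open>The space \<open>L\<^sup>2\<^sub>\<mu>(\<real>)\<close>\<close>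

text \<open>
  Classes of Lebesgue measurable functions modulo equality almost everywhere. Since
  \<open>|t| powr (2\<mu>)\<close> is positive almost everywhere, the null sets do not depend on \<open>\<mu>\<close>.
\<close>

definition ae_eq :: "(real \<Rightarrow> complex) \<Rightarrow> (real \<Rightarrow> complex) \<Rightarrow> bool" where
  "ae_eq f g \<longleftrightarrow> f \<in> borel_measurable lebesgue \<and> g \<in> borel_measurable lebesgue \<and>
     (AE t in lebesgue. f t = g t)"

lemma part_equivp_ae_eq: "part_equivp ae_eq"
proof (rule part_equivpI)
  show "\<exists>f. ae_eq f f"
    by (rule exI[of _ "\<lambda>_. 0"]) (simp add: ae_eq_def)
  show "symp ae_eq"
  proof (rule sympI)
    fix f g assume *: "ae_eq f g"
    then have "AE t in lebesgue. f t = g t" by (simp only: ae_eq_def)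
    then have "AE t in lebesgue. g t = f t" by eventually_elim simp
    with * show "ae_eq g f" by (simp only: ae_eq_def)
  qed
  show "transp ae_eq"
  proof (rule transpI)
    fix f g h assume *: "ae_eq f g" "ae_eq g h"
    then have "AE t in lebesgue. f t = g t" "AE t in lebesgue. g t = h t"
      by (simp_all only: ae_eq_def)
    then have "AE t in lebesgue. f t = h t" by eventually_elim simp
    with * show "ae_eq f h" by (simp only: ae_eq_def)
  qed
qed

quotient_type fclass = "real \<Rightarrow> complex" / partial: ae_eq
  by (rule part_equivp_ae_eq)

instantiation fclass :: complex_vector
begin

lift_definition zero_fclass :: fclass is "\<lambda>_. 0"
  by (simp add: ae_eq_def)

lift_definition plus_fclass :: "fclass \<Rightarrow> fclass \<Rightarrow> fclass" is "\<lambda>f g t. f t + g t"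
proof -
  fix f f' g g' :: "real \<Rightarrow> complex"
  assume "ae_eq f f'" and "ae_eq g g'"
  then have m: "f \<in> borel_measurable lebesgue" "f' \<in> borel_measurable lebesgue"
      "g \<in> borel_measurable lebesgue" "g' \<in> borel_measurable lebesgue"
    and ae: "AE t in lebesgue. f t = f' t" "AE t in lebesgue. g t = g' t"
    by (simp_all only: ae_eq_def)
  have "AE t in lebesgue. f t + g t = f' t + g' t" using ae by eventually_elim simp
  then show "ae_eq (\<lambda>t. f t + g t) (\<lambda>t. f' t + g' t)"
    using m by (simp add: ae_eq_def)
qed

lift_definition minus_fclass :: "fclass \<Rightarrow> fclass \<Rightarrow> fclass" is "\<lambda>f g t. f t - g t"
proof -
  fix f f' g g' :: "real \<Rightarrow> complex"
  assume "ae_eq f f'" and "ae_eq g g'"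
  then have m: "f \<in> borel_measurable lebesgue" "f' \<in> borel_measurable lebesgue"
      "g \<in> borel_measurable lebesgue" "g' \<in> borel_measurable lebesgue"
    and ae: "AE t in lebesgue. f t = f' t" "AE t in lebesgue. g t = g' t"
    by (simp_all only: ae_eq_def)
  have "AE t in lebesgue. f t - g t = f' t - g' t" using ae by eventually_elim simp
  then show "ae_eq (\<lambda>t. f t - g t) (\<lambda>t. f' t - g' t)"
    using m by (simp add: ae_eq_def)
qed

lift_definition uminus_fclass :: "fclass \<Rightarrow> fclass" is "\<lambda>f t. - f t"
proof -
  fix f f' :: "real \<Rightarrow> complex"
  assume *: "ae_eq f f'"
  then have "AE t in lebesgue. f t = f' t" by (simp only: ae_eq_def)
  then have "AE t in lebesgue. - f t = - f' t" by eventually_elim simp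
  then show "ae_eq (\<lambda>t. - f t) (\<lambda>t. - f' t)"
    using * by (simp add: ae_eq_def)
qed

lift_definition scaleC_fclass :: "complex \<Rightarrow> fclass \<Rightarrow> fclass" is "\<lambda>c f t. c * f t"
proof -
  fix c :: complex and f f' :: "real \<Rightarrow> complex"
  assume *: "ae_eq f f'"
  then have "AE t in lebesgue. f t = f' t" by (simp only: ae_eq_def)
  then have "AE t in lebesgue. c * f t = c * f' t" by eventually_elim simp
  then show "ae_eq (\<lambda>t. c * f t) (\<lambda>t. c * f' t)"
    using * by (auto simp only: ae_eq_def intro: borel_measurable_times borel_measurable_const)
qed

instance
proof
  fix F G K :: fclass and a b :: complex
  have m: "(\<lambda>t. f t + g t) \<in> borel_measurable lebesgue" "(\<lambda>t. f t - g t) \<in> borel_measurable lebesgue"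
    "(\<lambda>t. - f t) \<in> borel_measurable lebesgue" "(\<lambda>t. c * f t) \<in> borel_measurable lebesgue"
    if "f \<in> borel_measurable lebesgue" "g \<in> borel_measurable lebesgue"
    for f g :: "real \<Rightarrow> complex" and c
    by (intro borel_measurable_add borel_measurable_diff borel_measurable_uminus
        borel_measurable_times borel_measurable_const that)+
  show "F + G + K = F + (G + K)"
    by transfer (simp add: ae_eq_def m add.assoc)
  show "F + G = G + F"
    by transfer (simp add: ae_eq_def m add.commute)
  show "0 + F = F"
    by transfer (simp add: ae_eq_def)
  show "- F + F = 0"
    by transfer (simp add: ae_eq_def)
  show "F - G = F + - G"
    by transfer (simp add: ae_eq_def m)
  show "a *\<^sub>C (F + G) = a *\<^sub>C F + a *\<^sub>C G"
    by transfer (simp add: ae_eq_def m distrib_left)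
  show "(a + b) *\<^sub>C F = a *\<^sub>C F + b *\<^sub>C F"
    by transfer (simp add: ae_eq_def m distrib_right)
  show "a *\<^sub>C b *\<^sub>C F = (a * b) *\<^sub>C F"
    by transfer (simp add: ae_eq_def m mult.assoc)
  show "1 *\<^sub>C F = F"
    by transfer (simp add: ae_eq_def)
qed

end

definition weight_measure :: "real \<Rightarrow> real measure" where
  "weight_measure \<mu> = density lebesgue (\<lambda>t. ennreal (\<bar>t\<bar> powr (2 * \<mu>)))"

lemma borel_measurable_weight: "(\<lambda>t::real. \<bar>t\<bar> powr a) \<in> borel_measurable lebesgue"
  by (rule measurable_completion) simp

lemma AE_weight_measureI:
  assumes "AE t in lebesgue. R t"
  shows "AE t in weight_measure \<mu>. R t"
proof -
  have "AE t in lebesgue. 0 < ennreal (\<bar>t\<bar> powr (2 * \<mu>)) \<longrightarrow> R t"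
    using assms by eventually_elim simp
  then show ?thesis
    unfolding weight_measure_def
    by (rule AE_density[THEN iffD2, OF measurable_compose[OF borel_measurable_weight measurable_ennreal]])
qed

lift_definition l2_sq :: "real \<Rightarrow> fclass \<Rightarrow> ennreal" is
  "\<lambda>\<mu> f. \<integral>\<^sup>+ t. ennreal ((cmod (f t))\<^sup>2) \<partial>weight_measure \<mu>"
proof -
  fix \<mu> :: real and f f' :: "real \<Rightarrow> complex"
  assume "ae_eq f f'"
  then have "AE t in lebesgue. f t = f' t" by (simp only: ae_eq_def)
  then have "AE t in weight_measure \<mu>. f t = f' t" by (rule AE_weight_measureI)
  then have "AE t in weight_measure \<mu>. ennreal ((cmod (f t))\<^sup>2) = ennreal ((cmod (f' t))\<^sup>2)"
    by eventually_elim simp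
  then show "(\<integral>\<^sup>+ t. ennreal ((cmod (f t))\<^sup>2) \<partial>weight_measure \<mu>) =
      (\<integral>\<^sup>+ t. ennreal ((cmod (f' t))\<^sup>2) \<partial>weight_measure \<mu>)"
    by (rule nn_integral_cong_AE)
qed

definition L2 :: "real \<Rightarrow> fclass set" where
  "L2 \<mu> = {F. l2_sq \<mu> F < \<infinity>}"

lift_definition l2_inner :: "real \<Rightarrow> fclass \<Rightarrow> fclass \<Rightarrow> complex" is
  "\<lambda>\<mu> f g. LINT t|weight_measure \<mu>. f t * cnj (g t)"
proof -
  fix \<mu> :: real and f f' g g' :: "real \<Rightarrow> complex"
  assume "ae_eq f f'" and "ae_eq g g'"
  then have m: "f \<in> borel_measurable lebesgue" "f' \<in> borel_measurable lebesgue"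
      "g \<in> borel_measurable lebesgue" "g' \<in> borel_measurable lebesgue"
    and ae: "AE t in lebesgue. f t = f' t" "AE t in lebesgue. g t = g' t"
    by (simp_all only: ae_eq_def)
  have c: "(\<lambda>t. cnj (h t)) \<in> borel_measurable lebesgue" if "h \<in> borel_measurable lebesgue" for h
    by (rule borel_measurable_continuous_on[OF _ that]) (intro continuous_intros)
  have "AE t in lebesgue. f t * cnj (g t) = f' t * cnj (g' t)"
    using ae by eventually_elim simp
  then have "AE t in weight_measure \<mu>. f t * cnj (g t) = f' t * cnj (g' t)"
    by (rule AE_weight_measureI)
  moreover have "(\<lambda>t. f t * cnj (g t)) \<in> borel_measurable (weight_measure \<mu>)"
      "(\<lambda>t. f' t * cnj (g' t)) \<in> borel_measurable (weight_measure \<mu>)"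
    unfolding weight_measure_def measurable_density_eq1
    by (intro borel_measurable_times m c)+
  ultimately show "(LINT t|weight_measure \<mu>. f t * cnj (g t)) =
      (LINT t|weight_measure \<mu>. f' t * cnj (g' t))"
    by (intro integral_cong_AE)
qed

definition l2_norm :: "real \<Rightarrow> fclass \<Rightarrow> real" where
  "l2_norm \<mu> F = sqrt (enn2real (l2_sq \<mu> F))"

definition l2_closure :: "real \<Rightarrow> fclass oper \<Rightarrow> fclass oper" where
  "l2_closure \<mu> T = {(F, G). F \<in> L2 \<mu> \<and> G \<in> L2 \<mu> \<and>
     (\<exists>X Y. (\<forall>n. (X n, Y n) \<in> T) \<and>
        (\<lambda>n::nat. l2_norm \<mu> (X n - F)) \<longlonglongrightarrow> 0 \<and> (\<lambda>n. l2_norm \<mu> (Y n - G)) \<longlonglongrightarrow> 0)}"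

definition unitary_onto_L2 :: "real \<Rightarrow> ('a::complex_hilbert_space \<Rightarrow> fclass) \<Rightarrow> bool" where
  "unitary_onto_L2 \<mu> U \<longleftrightarrow> clinear U \<and> bij_betw U UNIV (L2 \<mu>) \<and>
     (\<forall>x y. l2_inner \<mu> (U x) (U y) = cinner x y)"

definition unitary_operator_L2 :: "real \<Rightarrow> fclass oper \<Rightarrow> bool" where
  "unitary_operator_L2 \<mu> G \<longleftrightarrow> linear_operator G \<and> Domain G = L2 \<mu> \<and> Range G = L2 \<mu> \<and>
     (\<forall>(f, g) \<in> G. \<forall>(f', g') \<in> G. l2_inner \<mu> g g' = l2_inner \<mu> f f')"


section \<open>The concrete model\<close>

definition hermite_mu :: "real \<Rightarrow> nat \<Rightarrow> real \<Rightarrow> real" where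
  "hermite_mu \<mu> n x = fact n *
     (\<Sum>k\<le>n div 2. (- 1) ^ k * (2 * x) ^ (n - 2 * k) / (fact k * gamma_mu \<mu> (n - 2 * k)))"

definition phi_mu :: "real \<Rightarrow> nat \<Rightarrow> real \<Rightarrow> complex" where
  "phi_mu \<mu> n x = complex_of_real
     (sqrt (gamma_mu \<mu> n / Gamma (\<mu> + 1 / 2)) * (1 / (2 powr (n / 2) * fact n)) *
      exp (- x\<^sup>2 / 2) * hermite_mu \<mu> n x)"

definition fspan :: "(nat \<Rightarrow> real \<Rightarrow> complex) \<Rightarrow> (real \<Rightarrow> complex) set" where
  "fspan g = {\<lambda>x. \<Sum>n<N. c n * g n x | N c. True}"

text \<open>
  Pointwise operations; the value of \<open>P_fun\<close> at \<open>0\<close> plays no role, since the results are only used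
  modulo null sets.
\<close>

definition P_fun :: "real \<Rightarrow> (real \<Rightarrow> complex) \<Rightarrow> real \<Rightarrow> complex" where
  "P_fun \<mu> f x =
     - \<i> * (vector_derivative f (at x) + complex_of_real (\<mu> / x) * (f x - f (- x)))"

definition Q_fun :: "(real \<Rightarrow> complex) \<Rightarrow> real \<Rightarrow> complex" where
  "Q_fun f x = complex_of_real x * f x"

definition H_fun :: "real \<Rightarrow> (real \<Rightarrow> complex) \<Rightarrow> real \<Rightarrow> complex" where
  "H_fun \<mu> f x = (1 / 2) * (Q_fun (Q_fun f) x + P_fun \<mu> (P_fun \<mu> f) x)"

definition P_mu :: "real \<Rightarrow> fclass oper" where
  "P_mu \<mu> = l2_closure \<mu> {(abs_fclass f, abs_fclass (P_fun \<mu> f)) | f. f \<in> fspan (phi_mu \<mu>)}"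

definition Q_mu :: "real \<Rightarrow> fclass oper" where
  "Q_mu \<mu> = l2_closure \<mu> {(abs_fclass f, abs_fclass (Q_fun f)) | f. f \<in> fspan (phi_mu \<mu>)}"

definition H_mu :: "real \<Rightarrow> fclass oper" where
  "H_mu \<mu> = l2_closure \<mu> {(abs_fclass f, abs_fclass (H_fun \<mu> f)) | f. f \<in> fspan (phi_mu \<mu>)}"

definition J_mu :: "real \<Rightarrow> fclass oper" where
  "J_mu \<mu> = {(abs_fclass f, abs_fclass (\<lambda>x. f (- x))) | f.
     f \<in> borel_measurable lebesgue \<and> abs_fclass f \<in> L2 \<mu>}"

definition e_mu :: "real \<Rightarrow> complex \<Rightarrow> complex" where
  "e_mu \<mu> z = (\<Sum>m. z ^ m / complex_of_real (gamma_mu \<mu> m))"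

definition fourier_integral :: "real \<Rightarrow> (real \<Rightarrow> complex) \<Rightarrow> real \<Rightarrow> complex" where
  "fourier_integral \<mu> f x =
     complex_of_real (1 / (2 powr (\<mu> + 1 / 2) * Gamma (\<mu> + 1 / 2))) *
     (LINT t|weight_measure \<mu>. e_mu \<mu> (- \<i> * x * t) * f t)"

definition F_mu :: "real \<Rightarrow> fclass oper" where
  "F_mu \<mu> = (THE G. unitary_operator_L2 \<mu> G \<and>
     (\<forall>f \<in> fspan (\<lambda>n x. complex_of_real (exp (- x\<^sup>2) * x ^ n)).
        (abs_fclass f, abs_fclass (fourier_integral \<mu> f)) \<in> G))"

definition conjugate_by :: "('a \<Rightarrow> 'b) \<Rightarrow> 'a oper \<Rightarrow> 'b oper" where
  \<comment> \<open>the graph of \<open>U T U\<inverse>\<close>, for injective \<open>U\<close>\<close>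
  "conjugate_by U T = {(U x, U y) | x y. (x, y) \<in> T}"

end

theory Submission
  imports Defs "HOL-Probability.Levy"
begin

text \<open>
  The ladder operators turn the ground state into an orthonormal sequence \<open>\<phi> n\<close> on which \<open>Q\<close> and \<open>P\<close>
  act as Jacobi matrices with off-diagonal entries of order \<open>\<surd>n\<close>. Entries of this size are small
  enough for truncated expansions to converge in the graph norm along a subsequence. Hence the
  projection onto the closed span of the \<open>\<phi> n\<close> commutes with \<open>P\<close> and \<open>Q\<close>, thus with their spectral
  measures and exponentials, and irreducibility makes \<open>\<phi>\<close> a basis; for the same reason \<open>P\<close>, \<open>Q\<close> and
  \<open>H\<close> are the closures of their restrictions to the span of the \<open>\<phi> n\<close>.

  The generalized Hermite functions obey the same recurrences under multiplication by \<open>x\<close> and the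
  Dunkl operator, and they are complete because characteristic functions determine measures. So
  \<open>U\<close> carries \<open>P\<close>, \<open>Q\<close>, \<open>H\<close> to the concrete closures, and \<open>J\<close>, \<open>F\<close> to the operators multiplying the
  \<open>n\<close>th coefficient by \<open>(-1)\<^sup>n\<close> and \<open>(-i)\<^sup>n\<close>. The Fourier integrals of the functions \<open>x\<^sup>n exp (-x\<^sup>2)\<close>
  have the coefficients required by the latter: for \<open>n = 0\<close> both sides satisfy the same two-step
  recurrence, and the transform exchanges multiplication by \<open>x\<close> with the Dunkl operator.
\<close>

section \<open>Hilbert space\<close>

text \<open>The functional calculus of the statement runs through whatever spectral measure
  represents an operator, so no argument may depend on a particular choice. A projection commuting
  with \<open>P\<close> or \<open>Q\<close> is shown to commute with every spectral measure of that
  operator, from bounds for the operator on spectral subspaces alone; \<open>J\<close> and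
  \<open>F\<close> are computed for an arbitrary spectral measure, and an explicit one supplies the
  converse inclusion. No commutation relation between \<open>P\<close> and \<open>Q\<close> is
  given, only those with \<open>H\<close>. The identity \<open>A A* + A* A = 2 H\<close> takes its
  place: together with the bottom eigenvalue it fixes the norms of all vectors obtained by raising
  the ground state. The functions \<open>x^n exp (- x^2)\<close> that define the Fourier transform,
  and their transforms, which are polynomials times \<open>exp (- x^2 / 4)\<close>, are not finite
  combinations of Hermite functions. An algebraic comparison inside one span is therefore
  impossible, and coefficients are compared instead. Finally \<open>L2 \<mu>\<close> is a subset of
  the type of all function classes rather than a Hilbert space type, so its geometry is developed a
  second time.\<close>

lemma scaleC_complex_times [simp]: "c *\<^sub>C (z::complex) = c * z"
  by (simp add: scaleC_complex_def)

lemma cinner_add_right: "cinner x (y + z) = cinner x y + cinner x z"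
  for x y z :: "'a::complex_hilbert_space"
  by (metis cinner_add_left cinner_commute complex_cnj_add)

lemma cinner_scaleC_right: "cinner x (a *\<^sub>C y) = cnj a * cinner x y"
  for x y :: "'a::complex_hilbert_space"
  by (metis cinner_commute cinner_scaleC_left complex_cnj_mult)

lemma scaleC_zero_left [simp]: "0 *\<^sub>C x = 0" for x :: "'a::complex_vector"
  by (metis add_cancel_right_left scaleC_add_left)

lemma scaleC_zero_right [simp]: "c *\<^sub>C (0::'a::complex_vector) = 0"
  by (metis add_cancel_right_left scaleC_add_right)

lemma scaleC_minus_left: "(- c) *\<^sub>C x = - (c *\<^sub>C x)" for x :: "'a::complex_vector"
  by (metis add.right_inverse add_eq_0_iff scaleC_add_left scaleC_zero_left)

lemma scaleC_minus_right: "c *\<^sub>C (- x) = - (c *\<^sub>C x)" for x :: "'a::complex_vector"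
  by (metis add.right_inverse add_eq_0_iff scaleC_add_right scaleC_zero_right)

lemma scaleC_diff_right: "c *\<^sub>C (x - y) = c *\<^sub>C x - c *\<^sub>C y" for x :: "'a::complex_vector"
  by (simp only: diff_conv_add_uminus scaleC_add_right scaleC_minus_right)

lemma scaleC_diff_left: "(c - d) *\<^sub>C x = c *\<^sub>C x - d *\<^sub>C x" for x :: "'a::complex_vector"
  by (simp only: diff_conv_add_uminus scaleC_add_left scaleC_minus_left)

declare scaleC_one [simp]

lemma cinner_self_nonneg: "Re (cinner x x) = (norm x)\<^sup>2" "Im (cinner x x) = 0"
  for x :: "'a::complex_hilbert_space"
  by (simp_all add: cinner_self)

lemma norm_scaleC [simp]: "norm (c *\<^sub>C x) = cmod c * norm x" for x :: "'a::complex_hilbert_space"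
proof -
  have "complex_of_real ((norm (c *\<^sub>C x))\<^sup>2) = complex_of_real ((cmod c * norm x)\<^sup>2)"
    unfolding cinner_self[symmetric] cinner_scaleC_left cinner_scaleC_right
    by (simp add: cinner_self power_mult_distrib)
      (simp add: complex_norm_square[symmetric] mult.assoc[symmetric] mult.commute[of "cnj _"])
  then have "(norm (c *\<^sub>C x))\<^sup>2 = (cmod c * norm x)\<^sup>2"
    by (simp only: of_real_eq_iff)
  then show ?thesis by (simp add: power2_eq_iff_nonneg)
qed

lemma cinner_0_left [simp]: "cinner 0 x = 0" for x :: "'a::complex_hilbert_space"
  by (metis add_cancel_right_left cinner_add_left)

lemma cinner_0_right [simp]: "cinner x 0 = 0" for x :: "'a::complex_hilbert_space"
  by (metis add_cancel_right_left cinner_add_right)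

lemma norm_add_square:
  "(norm (x + y))\<^sup>2 = (norm x)\<^sup>2 + 2 * Re (cinner x y) + (norm y)\<^sup>2"
  for x y :: "'a::complex_hilbert_space"
proof -
  have "(norm (x + y))\<^sup>2 = Re (cinner (x + y) (x + y))" by (simp add: cinner_self)
  also have "\<dots> = (norm x)\<^sup>2 + Re (cinner x y) + Re (cinner y x) + (norm y)\<^sup>2"
    by (simp add: cinner_add_left cinner_add_right cinner_self_nonneg)
  also have "Re (cinner y x) = Re (cinner x y)" by (subst cinner_commute) simp
  finally show ?thesis by simp
qed

lemma cinner_Cauchy_Schwarz: "cmod (cinner x y) \<le> norm x * norm y"
  for x y :: "'a::complex_hilbert_space"
proof (cases "y = 0")
  case False
  then have ny: "norm y > 0" by simp
  \<comment> \<open>The coefficient for which \<open>x + c *\<^sub>C y\<close> is orthogonal to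
    \<open>y\<close>, hence of least norm.\<close>
  define c where "c = - cinner x y / complex_of_real ((norm y)\<^sup>2)"
  have "0 \<le> (norm (x + c *\<^sub>C y))\<^sup>2" by simp
  also have "\<dots> = (norm x)\<^sup>2 + 2 * Re (cnj c * cinner x y) + (cmod c * norm y)\<^sup>2"
    by (simp add: norm_add_square cinner_scaleC_right)
  also have "cnj c * cinner x y = complex_of_real (- (cmod (cinner x y))\<^sup>2 / (norm y)\<^sup>2)"
    by (simp add: c_def complex_norm_square[symmetric] mult.commute[of "cnj _"])
  also have "(cmod c * norm y)\<^sup>2 = (cmod (cinner x y))\<^sup>2 / (norm y)\<^sup>2"
    using ny by (simp add: c_def norm_divide norm_mult power2_eq_square)
  finally have "(cmod (cinner x y))\<^sup>2 / (norm y)\<^sup>2 \<le> (norm x)\<^sup>2" by simp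
  then have "(cmod (cinner x y))\<^sup>2 \<le> (norm x * norm y)\<^sup>2"
    using ny by (simp add: field_simps power_mult_distrib)
  then show ?thesis by (rule power2_le_imp_le) simp
qed simp

lemma bounded_bilinear_cinner:
  "bounded_bilinear (cinner :: 'a::complex_hilbert_space \<Rightarrow> 'a \<Rightarrow> complex)"
proof
  show "\<exists>K. \<forall>a b::'a. norm (cinner a b) \<le> norm a * norm b * K"
    by (rule exI[of _ 1]) (simp add: cinner_Cauchy_Schwarz)
next
  fix r :: real and a b :: 'a
  show "cinner (r *\<^sub>R a) b = r *\<^sub>R cinner a b" "cinner a (r *\<^sub>R b) = r *\<^sub>R cinner a b"
    by (simp_all add: scaleR_scaleC[where 'a='a] cinner_scaleC_left cinner_scaleC_right
        scaleR_conv_of_real[where 'a=complex])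
qed (simp_all add: cinner_add_left cinner_add_right)

lemmas cinner_diff_left = bounded_bilinear.diff_left[OF bounded_bilinear_cinner]
  and cinner_minus_left = bounded_bilinear.minus_left[OF bounded_bilinear_cinner]
  and cinner_minus_right = bounded_bilinear.minus_right[OF bounded_bilinear_cinner]
  and cinner_sum_left = bounded_bilinear.sum_left[OF bounded_bilinear_cinner]
  and cinner_sum_right = bounded_bilinear.sum_right[OF bounded_bilinear_cinner]
  and tendsto_cinner = bounded_bilinear.tendsto[OF bounded_bilinear_cinner]
  and bounded_linear_cinner_left = bounded_bilinear.bounded_linear_left[OF bounded_bilinear_cinner]

lemma bounded_linear_scaleC: "bounded_linear (\<lambda>x::'a::complex_hilbert_space. c *\<^sub>C x)"
  by (rule bounded_linear_intro[of _ "cmod c"])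
    (simp_all add: scaleC_add_right scaleR_scaleC scaleC_scaleC mult.commute)

text \<open>The difference \<open>x - y\<close> is a limit of members of \<open>D\<close>, all
  orthogonal to it, hence orthogonal to itself. Values of \<open>spectral_integral\<close> are
  tested only against a dense domain, and this recovers them.\<close>

lemma cinner_eq_imp_eq:
  fixes x y :: "'a::complex_hilbert_space"
  assumes "closure D = UNIV" "\<And>z. z \<in> D \<Longrightarrow> cinner x z = cinner y z"
  shows "x = y"
proof -
  have "x - y \<in> closure D" using assms by simp
  then obtain Z where Z: "\<And>n. Z n \<in> D" "Z \<longlonglongrightarrow> x - y"
    unfolding closure_sequential by blast
  have "(\<lambda>n. cinner (x - y) (Z n)) \<longlonglongrightarrow> cinner (x - y) (x - y)"
    by (intro tendsto_cinner tendsto_const Z)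
  moreover have "cinner (x - y) (Z n) = 0" for n
    using assms(2)[OF Z(1)[of n]] by (simp add: cinner_diff_left)
  ultimately have "cinner (x - y) (x - y) = 0"
    by (simp add: LIMSEQ_const_iff)
  then show ?thesis by (simp add: cinner_self)
qed

lemma clinear_sum:
  assumes "clinear B"
  shows "B (\<Sum>i\<in>S. c i *\<^sub>C f i) = (\<Sum>i\<in>S. c i *\<^sub>C B (f i))"
proof -
  have 0: "B 0 = 0" using assms unfolding clinear_def
    by (metis add_cancel_right_left)
  show ?thesis
    by (induction S rule: infinite_finite_induct) (use assms 0 in \<open>auto simp: clinear_def\<close>)
qed

lemma clinear_minus: "clinear B \<Longrightarrow> B (- x) = - B x"
  unfolding clinear_def by (metis scaleC_minus_left scaleC_one)

lemma clinear_diff: "clinear B \<Longrightarrow> B (x - y) = B x - B y"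
  using clinear_minus[of B y] unfolding clinear_def by (metis diff_conv_add_uminus)

text \<open>Idempotence and symmetry turn \<open>cinner (B x) x\<close> into
  \<open>cinner (B x) (B x)\<close>; Cauchy-Schwarz then gives contractivity.\<close>

lemma orthogonal_projection_norm:
  assumes "orthogonal_projection B"
  shows "cinner (B x) x = complex_of_real ((norm (B x))\<^sup>2)" "norm (B x) \<le> norm x"
proof -
  have "cinner (B x) x = cinner (B (B x)) x" using assms by (simp add: orthogonal_projection_def)
  also have "\<dots> = cinner (B x) (B x)" using assms by (simp add: orthogonal_projection_def)
  finally show *: "cinner (B x) x = complex_of_real ((norm (B x))\<^sup>2)" by (simp only: cinner_self)
  have "(norm (B x))\<^sup>2 = cmod (cinner (B x) x)"
    unfolding * norm_of_real by simp
  also have "\<dots> \<le> norm (B x) * norm x" by (rule cinner_Cauchy_Schwarz)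
  finally show "norm (B x) \<le> norm x"
    by (cases "norm (B x) = 0") (auto simp: power2_eq_square mult_le_cancel_left)
qed

lemma orthogonal_projection_bounded_linear:
  assumes "orthogonal_projection B"
  shows "bounded_linear B"
proof (rule bounded_linear_intro[of _ 1])
  show "norm (B x) \<le> norm x * 1" for x using orthogonal_projection_norm(2)[OF assms] by simp
qed (use assms in \<open>simp_all add: orthogonal_projection_def clinear_def scaleR_scaleC\<close>)

section \<open>Orthonormal sequences\<close>

locale orthonormal_sequence =
  fixes \<phi> :: "nat \<Rightarrow> 'a::complex_hilbert_space"
  assumes ortho: "cinner (\<phi> m) (\<phi> n) = (if m = n then 1 else 0)"
begin

lemma cinner_expansion:
  "finite S \<Longrightarrow> cinner (\<Sum>n\<in>S. c n *\<^sub>C \<phi> n) (\<phi> m) = (if m \<in> S then c m else 0)"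
  by (simp add: cinner_sum_left cinner_scaleC_left ortho if_distrib sum.delta cong: if_cong)

lemma norm_expansion:
  assumes "finite S"
  shows "(norm (\<Sum>n\<in>S. c n *\<^sub>C \<phi> n))\<^sup>2 = (\<Sum>n\<in>S. (cmod (c n))\<^sup>2)"
proof -
  have "complex_of_real ((norm (\<Sum>n\<in>S. c n *\<^sub>C \<phi> n))\<^sup>2) =
      (\<Sum>n\<in>S. cnj (c n) * cinner (\<Sum>n\<in>S. c n *\<^sub>C \<phi> n) (\<phi> n))"
    unfolding cinner_self[symmetric] by (simp add: cinner_sum_right[of _ _ S] cinner_scaleC_right)
  also have "\<dots> = (\<Sum>n\<in>S. complex_of_real ((cmod (c n))\<^sup>2))"
    by (rule sum.cong) (simp_all only: cinner_expansion[OF assms] complex_norm_square if_True mult.commute)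
  finally have "complex_of_real ((norm (\<Sum>n\<in>S. c n *\<^sub>C \<phi> n))\<^sup>2) =
      complex_of_real (\<Sum>n\<in>S. (cmod (c n))\<^sup>2)" by simp
  then show ?thesis by (simp only: of_real_eq_iff)
qed

text \<open>Pythagoras for the finite expansion \<open>s\<close> and the remainder
  \<open>x - s\<close>.\<close>

lemma bessel_finite:
  assumes "finite S"
  shows "(\<Sum>n\<in>S. (cmod (cinner x (\<phi> n)))\<^sup>2) \<le> (norm x)\<^sup>2"
proof -
  define s where "s = (\<Sum>n\<in>S. cinner x (\<phi> n) *\<^sub>C \<phi> n)"
  have "cinner (x - s) s = 0"
    unfolding s_def by (simp add: cinner_sum_right[of _ _ S] cinner_scaleC_right cinner_diff_left
        cinner_expansion[OF assms])
  then have "(norm ((x - s) + s))\<^sup>2 = (norm (x - s))\<^sup>2 + (norm s)\<^sup>2"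
    by (simp only: norm_add_square) simp
  then have "(norm s)\<^sup>2 \<le> (norm x)\<^sup>2" by simp
  then show ?thesis by (simp add: s_def norm_expansion[OF assms])
qed

lemma bessel: "summable (\<lambda>n. (cmod (cinner x (\<phi> n)))\<^sup>2)"
  by (rule summableI_nonneg_bounded[where x = "(norm x)\<^sup>2"]) (simp_all add: bessel_finite)

text \<open>By orthonormality the squared norm of a block of the series is a block of the scalar
  series, so the Cauchy criterion carries over to the complete space.\<close>

lemma summable_expansion:
  assumes "summable (\<lambda>n. (cmod (c n))\<^sup>2)"
  shows "summable (\<lambda>n. c n *\<^sub>C \<phi> n)"
  unfolding summable_Cauchy
proof (intro allI impI)
  fix e :: real assume e: "0 < e"
  then have "0 < e\<^sup>2" by simp
  with assms obtain N where N: "\<And>m n. m \<ge> N \<Longrightarrow> norm (\<Sum>k = m..<n. (cmod (c k))\<^sup>2) < e\<^sup>2"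
    unfolding summable_Cauchy by meson
  have "norm (\<Sum>k = m..<n. c k *\<^sub>C \<phi> k) < e" if "m \<ge> N" for m n
  proof -
    have "(norm (\<Sum>k = m..<n. c k *\<^sub>C \<phi> k))\<^sup>2 < e\<^sup>2"
      using N[OF that, of n] by (simp add: norm_expansion sum_nonneg)
    then show ?thesis using e by (simp add: power_less_imp_less_base)
  qed
  then show "\<exists>N. \<forall>m\<ge>N. \<forall>n. norm (\<Sum>k = m..<n. c k *\<^sub>C \<phi> k) < e" by blast
qed

definition proj :: "'a \<Rightarrow> 'a" where
  "proj x = (\<Sum>n. cinner x (\<phi> n) *\<^sub>C \<phi> n)"

lemma sums_proj: "(\<lambda>n. cinner x (\<phi> n) *\<^sub>C \<phi> n) sums proj x"
  unfolding proj_def by (rule summable_sums[OF summable_expansion[OF bessel]])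

lemma cinner_sums:
  assumes "(\<lambda>n. c n *\<^sub>C \<phi> n) sums x"
  shows "cinner x (\<phi> m) = c m"
proof -
  have "(\<lambda>N. cinner (\<Sum>n<N. c n *\<^sub>C \<phi> n) (\<phi> m)) \<longlonglongrightarrow> cinner x (\<phi> m)"
    by (intro tendsto_cinner tendsto_const assms[unfolded sums_def])
  moreover have "(\<lambda>N. cinner (\<Sum>n<N. c n *\<^sub>C \<phi> n) (\<phi> m)) \<longlonglongrightarrow> c m"
    by (rule tendsto_eventually)
      (use eventually_gt_at_top[of m] in \<open>eventually_elim, simp add: cinner_expansion\<close>)
  ultimately show ?thesis by (rule LIMSEQ_unique)
qed

lemma cinner_proj: "cinner (proj x) (\<phi> m) = cinner x (\<phi> m)"
  by (rule cinner_sums[OF sums_proj])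

lemma cinner_proj_sums: "(\<lambda>n. cinner x (\<phi> n) * cnj (cinner y (\<phi> n))) sums cinner (proj x) y"
proof -
  have "(\<lambda>n. cinner (cinner x (\<phi> n) *\<^sub>C \<phi> n) y) sums cinner (proj x) y"
    by (rule bounded_linear.sums[OF bounded_linear_cinner_left sums_proj])
  moreover have "cinner (\<phi> n) y = cnj (cinner y (\<phi> n))" for n by (rule cinner_commute)
  ultimately show ?thesis by (simp add: cinner_scaleC_left)
qed

text \<open>Symmetry is read off from the series for \<open>cinner (proj x) y\<close>, which turns
  into its own conjugate when \<open>x\<close> and \<open>y\<close> are exchanged.\<close>

lemma orthogonal_projection_proj: "orthogonal_projection proj"
  unfolding orthogonal_projection_def clinear_def
proof (intro conjI allI)
  fix x y c
  have "(\<lambda>n. cinner x (\<phi> n) *\<^sub>C \<phi> n + cinner y (\<phi> n) *\<^sub>C \<phi> n) sums (proj x + proj y)"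
    by (intro sums_add sums_proj)
  then show "proj (x + y) = proj x + proj y"
    using sums_proj[of "x + y"] by (simp add: cinner_add_left scaleC_add_left sums_iff)
  have "(\<lambda>n. c *\<^sub>C (cinner x (\<phi> n) *\<^sub>C \<phi> n)) sums (c *\<^sub>C proj x)"
    by (intro bounded_linear.sums[OF bounded_linear_scaleC] sums_proj)
  then show "proj (c *\<^sub>C x) = c *\<^sub>C proj x"
    using sums_proj[of "c *\<^sub>C x"] by (simp add: cinner_scaleC_left scaleC_scaleC sums_iff)
  show "proj (proj x) = proj x"
    by (simp add: proj_def[of "proj x"] cinner_proj) (simp add: proj_def)
  have "(\<lambda>n. cnj (cinner y (\<phi> n) * cnj (cinner x (\<phi> n)))) sums cnj (cinner (proj y) x)"
    by (rule bounded_linear.sums[OF bounded_linear_cnj cinner_proj_sums])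
  then have "(\<lambda>n. cinner x (\<phi> n) * cnj (cinner y (\<phi> n))) sums cinner x (proj y)"
    by (simp add: mult.commute flip: cinner_commute)
  then show "cinner (proj x) y = cinner x (proj y)"
    using cinner_proj_sums sums_unique2 by blast
qed

lemma proj_basis: "proj (\<phi> n) = \<phi> n"
proof -
  have "(\<lambda>m. cinner (\<phi> n) (\<phi> m) *\<^sub>C \<phi> m) sums (\<Sum>m\<in>{n}. cinner (\<phi> n) (\<phi> m) *\<^sub>C \<phi> m)"
    by (rule sums_finite) (auto simp: ortho)
  then show ?thesis using sums_proj[of "\<phi> n"] by (simp add: ortho sums_iff)
qed

end

text \<open>Completeness is put as \<open>proj\<close> being the identity because irreducibility
  delivers it in this form: it makes \<open>proj\<close> a scalar.\<close>

locale orthonormal_basis = orthonormal_sequence +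
  assumes proj_id: "proj x = x"
begin

lemma sums_expansion: "(\<lambda>n. cinner x (\<phi> n) *\<^sub>C \<phi> n) sums x"
  using sums_proj[of x] by (simp add: proj_id)

lemma parseval: "(\<lambda>n. cinner x (\<phi> n) * cnj (cinner y (\<phi> n))) sums cinner x y"
  using cinner_proj_sums[of x y] by (simp add: proj_id)

lemma parseval_norm: "(\<lambda>n. (cmod (cinner x (\<phi> n)))\<^sup>2) sums (norm x)\<^sup>2"
proof -
  have "(\<lambda>n. Re (cinner x (\<phi> n) * cnj (cinner x (\<phi> n)))) sums Re (cinner x x)"
    by (rule sums_Re[OF parseval])
  then show ?thesis
    by (simp add: complex_norm_square[symmetric] cinner_self del: of_real_power)
qed

lemma eqI: "(\<And>n. cinner x (\<phi> n) = cinner y (\<phi> n)) \<Longrightarrow> x = y"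
  using sums_expansion[of x] sums_expansion[of y] by (simp add: sums_iff)

lemma expansion_exists:
  assumes "summable (\<lambda>n. (cmod (c n))\<^sup>2)"
  obtains x where "\<And>n. cinner x (\<phi> n) = c n"
  using summable_sums[OF summable_expansion[OF assms]] cinner_sums by blast

end

section \<open>Spectral integrals\<close>

text \<open>Induction on nonnegative Borel functions. There are two measures on the right because
  the measure of \<open>x + c z\<close> is controlled by those of \<open>x\<close> and
  \<open>z\<close> together, which makes the domain of a spectral integral a linear space. A bound
  by a single measure is the case \<open>d = 0\<close>.\<close>

lemma nn_integral_le_of_emeasure_le:
  fixes c d :: ennreal
  assumes f: "f \<in> borel_measurable borel"
    and sets: "sets M = sets borel" "sets N = sets borel" "sets K = sets borel"
    and le: "\<And>A. A \<in> sets borel \<Longrightarrow> emeasure M A \<le> c * emeasure N A + d * emeasure K A"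
  shows "(\<integral>\<^sup>+ t. f t \<partial>M) \<le> c * (\<integral>\<^sup>+ t. f t \<partial>N) + d * (\<integral>\<^sup>+ t. f t \<partial>K)"
proof -
  note [measurable_cong] = sets
  show ?thesis
    using f
  proof (induction rule: borel_measurable_induct)
    case (cong f g)
    then have "f = g" by auto
    with cong show ?case by simp
  next
    case (set A)
    then show ?case using le by (simp add: sets)
  next
    case (mult u e)
    have "(\<integral>\<^sup>+ t. e * u t \<partial>M) = e * (\<integral>\<^sup>+ t. u t \<partial>M)"
      using mult by (intro nn_integral_cmult) simp
    also have "\<dots> \<le> e * (c * (\<integral>\<^sup>+ t. u t \<partial>N) + d * (\<integral>\<^sup>+ t. u t \<partial>K))"
      using mult by (intro mult_left_mono) auto
    also have "\<dots> = c * (\<integral>\<^sup>+ t. e * u t \<partial>N) + d * (\<integral>\<^sup>+ t. e * u t \<partial>K)"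
      using mult by (simp add: nn_integral_cmult distrib_left ac_simps)
    finally show ?case .
  next
    case (add u v)
    have "(\<integral>\<^sup>+ t. v t + u t \<partial>M) = (\<integral>\<^sup>+ t. v t \<partial>M) + (\<integral>\<^sup>+ t. u t \<partial>M)"
      using add by (intro nn_integral_add) auto
    also have "\<dots> \<le> (c * (\<integral>\<^sup>+ t. v t \<partial>N) + d * (\<integral>\<^sup>+ t. v t \<partial>K)) +
        (c * (\<integral>\<^sup>+ t. u t \<partial>N) + d * (\<integral>\<^sup>+ t. u t \<partial>K))"
      by (intro add_mono add)
    also have "\<dots> = c * (\<integral>\<^sup>+ t. v t + u t \<partial>N) + d * (\<integral>\<^sup>+ t. v t + u t \<partial>K)"
      using add by (simp add: nn_integral_add distrib_left ac_simps)
    finally show ?case .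
  next
    case (seq U)
    have "(\<integral>\<^sup>+ t. (SUP i. U i) t \<partial>M) = (\<integral>\<^sup>+ t. (SUP i. U i t) \<partial>M)"
      by (simp add: image_comp)
    also have "\<dots> = (SUP i. \<integral>\<^sup>+ t. U i t \<partial>M)"
      using seq by (intro nn_integral_monotone_convergence_SUP) auto
    also have "\<dots> \<le> c * (\<integral>\<^sup>+ t. (SUP i. U i) t \<partial>N) + d * (\<integral>\<^sup>+ t. (SUP i. U i) t \<partial>K)"
    proof (rule SUP_least)
      fix i
      have "(\<integral>\<^sup>+ t. U i t \<partial>M) \<le> c * (\<integral>\<^sup>+ t. U i t \<partial>N) + d * (\<integral>\<^sup>+ t. U i t \<partial>K)"
        by (rule seq)
      also have "\<dots> \<le> c * (\<integral>\<^sup>+ t. (SUP i. U i) t \<partial>N) + d * (\<integral>\<^sup>+ t. (SUP i. U i) t \<partial>K)"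
        by (intro add_mono mult_left_mono nn_integral_mono le_funD[OF SUP_upper]) auto
      finally show "(\<integral>\<^sup>+ t. U i t \<partial>M) \<le> \<dots>" .
    qed
    finally show ?case .
  qed
qed

lemma polarization:
  fixes a b :: "'a::complex_hilbert_space"
  shows "(\<Sum>k<4. \<i> ^ k * complex_of_real ((norm (a + \<i> ^ k *\<^sub>C b))\<^sup>2)) = 4 * cinner a b"
proof -
  have "{..<4} = {0, 1, 2, 3::nat}" by auto
  moreover have "\<i> ^ 3 = - \<i>" by (simp add: eval_nat_numeral)
  ultimately show ?thesis
    by (simp only: cinner_self[symmetric])
      (simp add: cinner_add_left cinner_add_right cinner_scaleC_left cinner_scaleC_right
        cinner_minus_left cinner_minus_right scaleC_minus_left algebra_simps)
qed

lemma norm_add_square_le: "(norm (a + b))\<^sup>2 \<le> 2 * (norm a)\<^sup>2 + 2 * (norm b)\<^sup>2"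
  for a b :: "'a::real_normed_vector"
proof -
  have "(norm (a + b))\<^sup>2 \<le> (norm a + norm b)\<^sup>2"
    by (intro power_mono norm_triangle_ineq) auto
  also have "\<dots> \<le> 2 * (norm a)\<^sup>2 + 2 * (norm b)\<^sup>2"
    using sum_squares_bound[of "norm a" "norm b"] by (simp add: power2_sum)
  finally show ?thesis .
qed

section \<open>Projection-valued measures and their scalar measures\<close>

locale spectral =
  fixes E :: "real set \<Rightarrow> 'a::complex_hilbert_space \<Rightarrow> 'a"
  assumes pvm: "projection_valued_measure E"
begin

abbreviation "\<nu> \<equiv> diag_measure E"

lemma orthogonal_projection_E: "A \<in> sets borel \<Longrightarrow> orthogonal_projection (E A)"
  using pvm by (simp add: projection_valued_measure_def)

lemma clinear_E: "A \<in> sets borel \<Longrightarrow> clinear (E A)"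
  using orthogonal_projection_E by (simp add: orthogonal_projection_def)

lemma E_idem: "A \<in> sets borel \<Longrightarrow> E A (E A x) = E A x"
  using orthogonal_projection_E by (simp add: orthogonal_projection_def)

lemma E_selfadjoint: "A \<in> sets borel \<Longrightarrow> cinner (E A x) y = cinner x (E A y)"
  using orthogonal_projection_E by (simp add: orthogonal_projection_def)

lemma norm_E_le: "A \<in> sets borel \<Longrightarrow> norm (E A x) \<le> norm x"
  by (rule orthogonal_projection_norm(2)[OF orthogonal_projection_E])

lemma E_UNIV [simp]: "E UNIV x = x"
  using pvm by (simp add: projection_valued_measure_def)

lemma E_sums:
  fixes A :: "nat \<Rightarrow> real set"
  shows "(\<And>n. A n \<in> sets borel) \<Longrightarrow> disjoint_family A \<Longrightarrow> (\<lambda>n. E (A n) x) sums E (\<Union>n. A n) x"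
  using pvm by (auto simp: projection_valued_measure_def)

text \<open>The empty set is a disjoint union of countably many copies of itself, and a convergent
  series with constant terms has zero terms.\<close>

lemma E_empty [simp]: "E {} x = 0"
proof -
  have "(\<lambda>n::nat. E {} x) sums E (\<Union>n::nat. {}) x"
    by (rule E_sums) (auto simp: disjoint_family_on_def)
  then have "(\<lambda>n::nat. E {} x) \<longlonglongrightarrow> 0" by (intro summable_LIMSEQ_zero sums_summable)
  then show ?thesis by (simp add: LIMSEQ_const_iff)
qed

lemma E_Un:
  assumes "A \<in> sets borel" "B \<in> sets borel" "A \<inter> B = {}"
  shows "E (A \<union> B) x = E A x + E B x"
proof -
  have "(\<lambda>n. E (binaryset A B n) x) sums E (\<Union>n. binaryset A B n) x"
    using assms by (intro E_sums) (auto simp: binaryset_def disjoint_family_on_def)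
  then have "(\<lambda>n. E (binaryset A B n) x) sums E (A \<union> B) x" by (simp add: UN_binaryset_eq)
  moreover have "(\<lambda>n. E (binaryset A B n) x) sums (\<Sum>n\<in>{0,1}. E (binaryset A B n) x)"
    by (rule sums_finite) (auto simp: binaryset_def)
  ultimately show ?thesis by (auto simp: binaryset_def sums_iff)
qed

text \<open>With \<open>w = E B x\<close> additivity gives \<open>\<parallel>E (A \<union> B)
  w\<parallel>^2 = \<parallel>E A w\<parallel>^2 + \<parallel>w\<parallel>^2\<close>, while a
  projection does not increase the norm of \<open>w\<close>.\<close>

lemma E_disjoint:
  assumes "A \<in> sets borel" "B \<in> sets borel" "A \<inter> B = {}"
  shows "E A (E B x) = 0"
proof -
  let ?w = "E B x"
  have "complex_of_real ((norm (E (A \<union> B) ?w))\<^sup>2) = cinner (E (A \<union> B) ?w) ?w"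
    using assms by (subst orthogonal_projection_norm(1)[OF orthogonal_projection_E]) auto
  also have "\<dots> = cinner (E A ?w) ?w + cinner ?w ?w"
    using assms by (simp add: E_Un cinner_add_left E_idem)
  also have "\<dots> = complex_of_real ((norm (E A ?w))\<^sup>2 + (norm ?w)\<^sup>2)"
    using assms by (simp add: orthogonal_projection_norm(1)[OF orthogonal_projection_E] cinner_self)
  finally have "(norm (E (A \<union> B) ?w))\<^sup>2 = (norm (E A ?w))\<^sup>2 + (norm ?w)\<^sup>2"
    by (simp only: of_real_eq_iff)
  moreover have "(norm (E (A \<union> B) ?w))\<^sup>2 \<le> (norm ?w)\<^sup>2"
    using assms by (intro power_mono norm_E_le) auto
  ultimately show ?thesis by simp
qed

text \<open>Multiplicativity is not part of the definition of a projection-valued measure; it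
  follows by splitting both sets along their intersection and dropping the disjoint pieces.\<close>

lemma E_Int:
  assumes [measurable]: "A \<in> sets borel" "B \<in> sets borel"
  shows "E A (E B x) = E (A \<inter> B) x"
proof -
  have "E B x = E (A \<inter> B) x + E (B - A) x"
    using E_Un[of "A \<inter> B" "B - A" x] by (auto simp: Int_commute[of A B] Int_Diff_Un)
  moreover have "E A (E (A \<inter> B) x) = E (A \<inter> B) (E (A \<inter> B) x) + E (A - B) (E (A \<inter> B) x)"
    using E_Un[of "A \<inter> B" "A - B"] by (auto simp: Int_Diff_Un)
  moreover have "E (A - B) (E (A \<inter> B) x) = 0" "E A (E (B - A) x) = 0"
    by (auto intro!: E_disjoint)
  ultimately show ?thesis
    using clinear_E[of A] by (simp add: clinear_def E_idem)
qed

lemma E_Compl: "A \<in> sets borel \<Longrightarrow> E (- A) x = x - E A x"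
  using E_Un[of A "- A" x] by (simp add: algebra_simps)

lemma sets_\<nu> [simp, measurable_cong]: "sets (\<nu> x) = sets borel"
  and space_\<nu> [simp]: "space (\<nu> x) = UNIV"
  using sets.sigma_sets_eq[of "borel :: real measure"]
  by (simp_all add: diag_measure_def)

text \<open>Countable additivity is that of \<open>E\<close> paired with \<open>x\<close>;
  nonnegativity holds because the diagonal form is a squared norm.\<close>

lemma emeasure_\<nu>: "A \<in> sets borel \<Longrightarrow> emeasure (\<nu> x) A = ennreal ((norm (E A x))\<^sup>2)"
proof -
  assume A: "A \<in> sets borel"
  have eq: "Re (cinner (E A x) x) = (norm (E A x))\<^sup>2" if "A \<in> sets borel" for A
    using orthogonal_projection_norm(1)[OF orthogonal_projection_E[OF that]] by simp
  have "emeasure (\<nu> x) A = ennreal (Re (cinner (E A x) x))"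
    unfolding diag_measure_def
  proof (rule emeasure_measure_of_sigma)
    show "sigma_algebra UNIV (sets (borel :: real measure))"
      using sets.sigma_algebra_axioms[of "borel :: real measure"] by simp
    show "positive (sets borel) (\<lambda>A. ennreal (Re (cinner (E A x) x)))"
      by (simp add: positive_def)
    show "countably_additive (sets borel) (\<lambda>A. ennreal (Re (cinner (E A x) x)))"
    proof (rule countably_additiveI)
      fix A :: "nat \<Rightarrow> real set"
      assume A: "range A \<subseteq> sets borel" "disjoint_family A"
      then have Ai: "A i \<in> sets borel" for i by auto
      have "(\<lambda>n. Re (cinner (E (A n) x) x)) sums Re (cinner (E (\<Union>n. A n) x) x)"
        by (intro sums_Re bounded_linear.sums[OF bounded_linear_cinner_left] E_sums Ai A)
      then show "(\<Sum>i. ennreal (Re (cinner (E (A i) x) x))) = ennreal (Re (cinner (E (\<Union>(range A)) x) x))"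
        by (intro suminf_ennreal_eq) (simp_all add: eq[OF Ai])
    qed
  qed (use A in auto)
  then show ?thesis by (simp add: eq[OF A])
qed

lemma finite_measure_\<nu>: "finite_measure (\<nu> x)"
  by (rule finite_measureI) (simp add: emeasure_\<nu>)

lemma measure_\<nu>: "A \<in> sets borel \<Longrightarrow> measure (\<nu> x) A = (norm (E A x))\<^sup>2"
  by (simp add: measure_def emeasure_\<nu>)

text \<open>This is \<open>sesq_integral\<close> for an indicator function: the four squared norms
  polarize to the inner product of \<open>E A x\<close> and \<open>E A z\<close>.\<close>

lemma polarization_E:
  assumes "A \<in> sets borel"
  shows "(\<Sum>k<4. \<i> ^ k * complex_of_real (measure (\<nu> (x + \<i> ^ k *\<^sub>C z)) A)) / 4 = cinner (E A x) z"
proof -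
  have "E A (x + c *\<^sub>C z) = E A x + c *\<^sub>C E A z" for c
    using clinear_E[OF assms] by (simp add: clinear_def)
  then have "(\<Sum>k<4. \<i> ^ k * complex_of_real (measure (\<nu> (x + \<i> ^ k *\<^sub>C z)) A)) / 4 =
      cinner (E A x) (E A z)"
    using polarization[of "E A x" "E A z"] by (simp add: measure_\<nu>[OF assms])
  also have "\<dots> = cinner (E A x) z"
    by (simp add: E_selfadjoint[OF assms, symmetric] E_idem[OF assms])
  finally show ?thesis .
qed

section \<open>Integrals of simple functions and their limits\<close>

definition simple_op :: "(real \<Rightarrow> complex) \<Rightarrow> 'a \<Rightarrow> 'a" where
  "simple_op F x = (\<Sum>c\<in>range F. c *\<^sub>C E (F -` {c}) x)"

lemma simple_function_borelD:
  assumes "simple_function borel F"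
  shows "finite (range F)" "F -` {c} \<in> sets borel"
  using assms simple_functionD[OF assms] by auto

lemma simple_integral_\<nu>:
  fixes F :: "real \<Rightarrow> complex"
  assumes F: "simple_function borel F"
  shows "integrable (\<nu> x) F"
    and "(LINT t|\<nu> x. F t) = (\<Sum>c\<in>range F. c * complex_of_real (measure (\<nu> x) (F -` {c})))"
    and "(LINT t|\<nu> x. (cmod (F t))\<^sup>2) = (\<Sum>c\<in>range F. (cmod c)\<^sup>2 * measure (\<nu> x) (F -` {c}))"
proof -
  interpret finite_measure "\<nu> x" by (rule finite_measure_\<nu>)
  note fin = simple_function_borelD[OF F]
  have ind: "integrable (\<nu> x) (indicator (F -` {c}) :: real \<Rightarrow> real)" for c
    using fin(2) by (simp add: integrable_indicator_iff emeasure_eq_measure)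
  \<comment> \<open>Stated for an arbitrary \<open>g\<close> so that one computation integrates both
    \<open>F\<close> and its squared modulus.\<close>
  have g: "g (F t) = (\<Sum>c\<in>range F. indicator (F -` {c}) t *\<^sub>R g c)"
    for t and g :: "complex \<Rightarrow> 'b::{banach, second_countable_topology}"
  proof -
    have "(\<Sum>c\<in>range F. indicator (F -` {c}) t *\<^sub>R g c) = (\<Sum>c\<in>{F t}. indicator (F -` {c}) t *\<^sub>R g c)"
      using fin by (intro sum.mono_neutral_right) (auto simp: indicator_def)
    then show ?thesis by simp
  qed
  have int: "integrable (\<nu> x) (\<lambda>t. g (F t))"
    "(LINT t|\<nu> x. g (F t)) = (\<Sum>c\<in>range F. measure (\<nu> x) (F -` {c}) *\<^sub>R g c)"
    for g :: "complex \<Rightarrow> 'b::{banach, second_countable_topology}"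
    unfolding g[of g] using ind by (auto intro!: Bochner_Integration.integrable_sum integrable_scaleR_left
        simp: Bochner_Integration.integral_sum integral_scaleR_left)
  show "integrable (\<nu> x) F" using int(1)[of "\<lambda>c. c"] by simp
  show "(LINT t|\<nu> x. F t) = (\<Sum>c\<in>range F. c * complex_of_real (measure (\<nu> x) (F -` {c})))"
    using int(2)[of "\<lambda>c. c"] by (simp add: scaleR_conv_of_real[where 'a=complex] mult.commute)
  show "(LINT t|\<nu> x. (cmod (F t))\<^sup>2) = (\<Sum>c\<in>range F. (cmod c)\<^sup>2 * measure (\<nu> x) (F -` {c}))"
    using int(2)[of "\<lambda>c. (cmod c)\<^sup>2"] by (simp add: mult.commute)
qed

lemma sesq_integral_simple:
  assumes F: "simple_function borel F"
  shows "sesq_integral E F x z = cinner (simple_op F x) z"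
proof -
  have "sesq_integral E F x z =
      (\<Sum>c\<in>range F. c * ((\<Sum>k<4. \<i> ^ k * complex_of_real (measure (\<nu> (x + \<i> ^ k *\<^sub>C z)) (F -` {c}))) / 4))"
    unfolding sesq_integral_def simple_integral_\<nu>(2)[OF F] sum_distrib_left sum_divide_distrib
    by (subst sum.swap) (simp add: ac_simps)
  also have "\<dots> = (\<Sum>c\<in>range F. c * cinner (E (F -` {c}) x) z)"
    using polarization_E[OF simple_function_borelD(2)[OF F]] by simp
  also have "\<dots> = cinner (simple_op F x) z"
    by (simp add: simple_op_def cinner_sum_left cinner_scaleC_left)
  finally show ?thesis .
qed

text \<open>The isometry behind the functional calculus: distinct level sets of \<open>F\<close> are
  disjoint, so the corresponding components of \<open>x\<close> are orthogonal.\<close>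

lemma norm_simple_op:
  assumes F: "simple_function borel F"
  shows "(norm (simple_op F x))\<^sup>2 = (LINT t|\<nu> x. (cmod (F t))\<^sup>2)"
proof -
  note fin = simple_function_borelD[OF F]
  have orth: "cinner (E (F -` {c}) x) (E (F -` {d}) x) =
      (if c = d then complex_of_real ((norm (E (F -` {c}) x))\<^sup>2) else 0)" for c d
  proof (cases "c = d")
    case False
    then have "E (F -` {d}) (E (F -` {c}) x) = 0"
      using fin by (intro E_disjoint) auto
    with False fin show ?thesis by (simp add: E_selfadjoint[symmetric])
  qed (simp add: cinner_self)
  have "complex_of_real ((norm (simple_op F x))\<^sup>2) =
      (\<Sum>d\<in>range F. \<Sum>c\<in>range F. c * cnj d * cinner (E (F -` {c}) x) (E (F -` {d}) x))"
    unfolding cinner_self[symmetric] simple_op_def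
    by (simp add: cinner_sum_left[of _ "range F"] cinner_sum_right[of _ _ "range F"] cinner_scaleC_left
        cinner_scaleC_right sum_distrib_left ac_simps)
  also have "\<dots> = (\<Sum>d\<in>range F. d * cnj d * complex_of_real ((norm (E (F -` {d}) x))\<^sup>2))"
    unfolding orth using fin(1)
    by (intro sum.cong refl) (simp add: if_distrib sum.delta cong: if_cong)
  also have "\<dots> = complex_of_real (\<Sum>d\<in>range F. (cmod d)\<^sup>2 * measure (\<nu> x) (F -` {d}))"
    by (simp add: measure_\<nu>[OF fin(2)] complex_norm_square[symmetric])
  finally show ?thesis
    by (simp only: of_real_eq_iff simple_integral_\<nu>(3)[OF F])
qed

lemma spectral_domain_iff:
  assumes [measurable]: "f \<in> borel_measurable borel"
  shows "x \<in> spectral_domain E f \<longleftrightarrow> integrable (\<nu> x) (\<lambda>t. (cmod (f t))\<^sup>2)"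
  by (simp add: spectral_domain_def integrable_iff_bounded)

text \<open>Square integrable functions are integrable for a finite measure, by
  \<open>c \<le> 1 + c^2\<close>.\<close>

lemma integrable_of_spectral_domain:
  assumes [measurable]: "f \<in> borel_measurable borel" and x: "x \<in> spectral_domain E f"
  shows "integrable (\<nu> x) f"
proof (rule Bochner_Integration.integrable_bound)
  interpret finite_measure "\<nu> x" by (rule finite_measure_\<nu>)
  show "integrable (\<nu> x) (\<lambda>t. 1 + (cmod (f t))\<^sup>2)"
    using x by (simp add: spectral_domain_iff)
  have "c \<le> 1 + c\<^sup>2" for c :: real
    using zero_le_power2[of "c - 1 / 2"] by (simp add: power2_diff power_divide del: zero_le_power2)
  then show "AE t in \<nu> x. norm (f t) \<le> norm (1 + (cmod (f t))\<^sup>2)"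
    by (intro AE_I2) (simp add: abs_of_nonneg add_nonneg_nonneg)
qed simp

text \<open>The measure of \<open>x + c z\<close> is at most twice that of \<open>x\<close> plus
  \<open>2 |c|^2\<close> times that of \<open>z\<close>. Thus all four vectors of the polarization
  in \<open>sesq_integral\<close> stay in the domain.\<close>

lemma spectral_domain_add_scaleC:
  assumes [measurable]: "f \<in> borel_measurable borel"
    and x: "x \<in> spectral_domain E f" and z: "z \<in> spectral_domain E f"
  shows "x + c *\<^sub>C z \<in> spectral_domain E f"
proof -
  have "emeasure (\<nu> (x + c *\<^sub>C z)) A \<le>
      ennreal 2 * emeasure (\<nu> x) A + ennreal (2 * (cmod c)\<^sup>2) * emeasure (\<nu> z) A"
    if A: "A \<in> sets borel" for A
  proof -
    have "(norm (E A (x + c *\<^sub>C z)))\<^sup>2 \<le> 2 * (norm (E A x))\<^sup>2 + 2 * (cmod c)\<^sup>2 * (norm (E A z))\<^sup>2"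
      using clinear_E[OF A] norm_add_square_le[of "E A x" "c *\<^sub>C E A z"]
      by (simp add: clinear_def power_mult_distrib)
    then have "ennreal ((norm (E A (x + c *\<^sub>C z)))\<^sup>2) \<le>
        ennreal (2 * (norm (E A x))\<^sup>2 + 2 * (cmod c)\<^sup>2 * (norm (E A z))\<^sup>2)" by (rule ennreal_leI)
    then show ?thesis by (simp add: emeasure_\<nu>[OF A] ennreal_mult)
  qed
  then have "(\<integral>\<^sup>+ t. ennreal ((cmod (f t))\<^sup>2) \<partial>\<nu> (x + c *\<^sub>C z)) \<le>
      ennreal 2 * (\<integral>\<^sup>+ t. ennreal ((cmod (f t))\<^sup>2) \<partial>\<nu> x) +
      ennreal (2 * (cmod c)\<^sup>2) * (\<integral>\<^sup>+ t. ennreal ((cmod (f t))\<^sup>2) \<partial>\<nu> z)"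
    by (intro nn_integral_le_of_emeasure_le) auto
  also have "\<dots> < \<infinity>"
    using x z by (auto simp: spectral_domain_def ennreal_mult_less_top)
  finally show ?thesis by (simp add: spectral_domain_def)
qed

text \<open>One fixed sequence of simple functions per \<open>f\<close>, so that the same
  approximants serve all vectors; the bound by \<open>2 * cmod (f t)\<close> is the majorant for
  dominated convergence.\<close>

definition approx :: "(real \<Rightarrow> complex) \<Rightarrow> nat \<Rightarrow> real \<Rightarrow> complex" where
  "approx f = (SOME F. (\<forall>i. simple_function borel (F i)) \<and> (\<forall>t. (\<lambda>i. F i t) \<longlonglongrightarrow> f t) \<and>
     (\<forall>i t. cmod (F i t) \<le> 2 * cmod (f t)))"

lemma approx:
  assumes "f \<in> borel_measurable borel"
  shows "simple_function borel (approx f i)" "(\<lambda>i. approx f i t) \<longlonglongrightarrow> f t"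
    "cmod (approx f i t) \<le> 2 * cmod (f t)"
proof -
  have "\<exists>F. (\<forall>i. simple_function borel (F i)) \<and> (\<forall>t. (\<lambda>i. F i t) \<longlonglongrightarrow> f t) \<and>
     (\<forall>i t. cmod (F i t) \<le> 2 * cmod (f t))"
    using borel_measurable_implies_sequence_metric[OF assms, of 0] by (simp add: dist_norm)
  from someI_ex[OF this, folded approx_def]
  show "simple_function borel (approx f i)" "(\<lambda>i. approx f i t) \<longlonglongrightarrow> f t"
    "cmod (approx f i t) \<le> 2 * cmod (f t)" by auto
qed

text \<open>Dominated convergence in each of the four scalar measures of the polarization.\<close>

lemma sesq_integral_approx:
  assumes [measurable]: "f \<in> borel_measurable borel"
    and x: "x \<in> spectral_domain E f" and z: "z \<in> spectral_domain E f"
  shows "(\<lambda>i. cinner (simple_op (approx f i) x) z) \<longlonglongrightarrow> sesq_integral E f x z"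
proof -
  have "(\<lambda>i. sesq_integral E (approx f i) x z) \<longlonglongrightarrow> sesq_integral E f x z"
    unfolding sesq_integral_def
  proof (intro tendsto_intros)
    fix k
    have int: "integrable (\<nu> (x + \<i> ^ k *\<^sub>C z)) f"
      by (intro integrable_of_spectral_domain spectral_domain_add_scaleC x z) auto
    show "(\<lambda>i. LINT t|\<nu> (x + \<i> ^ k *\<^sub>C z). approx f i t) \<longlonglongrightarrow> (LINT t|\<nu> (x + \<i> ^ k *\<^sub>C z). f t)"
    proof (rule integral_dominated_convergence[where w = "\<lambda>t. 2 * cmod (f t)"])
      show "approx f i \<in> borel_measurable (\<nu> (x + \<i> ^ k *\<^sub>C z))" for i
        using borel_measurable_simple_function[OF approx(1)[OF assms(1)]] by simp
    qed (use int approx[OF assms(1)] in auto)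
  qed simp
  then show ?thesis by (simp add: sesq_integral_simple[OF approx(1)[OF assms(1)]])
qed

lemma simple_function_diff_complex:
  "simple_function M F \<Longrightarrow> simple_function M G \<Longrightarrow> simple_function M (\<lambda>t. F t - G t)"
  for F G :: "real \<Rightarrow> complex"
  by (rule simple_function_compose2)

text \<open>Compared through \<open>sesq_integral\<close>, which is linear in the integrand; no
  common refinement of the level sets is needed.\<close>

lemma simple_op_diff:
  assumes F: "simple_function borel F" and G: "simple_function borel G"
  shows "simple_op (\<lambda>t. F t - G t) x = simple_op F x - simple_op G x"
proof (rule cinner_eq_imp_eq[of UNIV])
  fix z
  have "cinner (simple_op (\<lambda>t. F t - G t) x) z = sesq_integral E F x z - sesq_integral E G x z"
    using simple_integral_\<nu>(1)[OF F] simple_integral_\<nu>(1)[OF G]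
    by (simp add: sesq_integral_simple[OF simple_function_diff_complex[OF F G], symmetric])
      (simp add: sesq_integral_def algebra_simps sum_subtractf diff_divide_distrib)
  then show "cinner (simple_op (\<lambda>t. F t - G t) x) z = cinner (simple_op F x - simple_op G x) z"
    by (simp add: sesq_integral_simple F G cinner_diff_left)
qed simp

text \<open>Produces the value of a spectral integral on its domain: the isometry for simple
  functions makes the approximants Cauchy, and norm and defining identity pass to the limit.\<close>

lemma simple_op_approx_tendsto:
  assumes [measurable]: "f \<in> borel_measurable borel" and x: "x \<in> spectral_domain E f"
  obtains y where "(\<lambda>i. simple_op (approx f i) x) \<longlonglongrightarrow> y"
    "(norm y)\<^sup>2 = (LINT t|\<nu> x. (cmod (f t))\<^sup>2)" "(x, y) \<in> spectral_integral E f"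
proof -
  note ap = approx[OF assms(1)]
  have [measurable]: "approx f i \<in> borel_measurable borel" for i
    using borel_measurable_simple_function[OF ap(1)] by simp
  have int: "integrable (\<nu> x) (\<lambda>t. (cmod (f t))\<^sup>2)"
    using x by (simp add: spectral_domain_iff)
  have "Cauchy (\<lambda>i. simple_op (approx f i) x)"
  proof (rule metric_CauchyI)
    fix e :: real assume e: "0 < e"
    have "(\<lambda>i. LINT t|\<nu> x. (cmod (approx f i t - f t))\<^sup>2) \<longlonglongrightarrow> (LINT t|\<nu> x. 0)"
    \<comment> \<open>The approximants are bounded by \<open>2 * cmod (f t)\<close>, so their
      distance to \<open>f t\<close> is at most \<open>3 * cmod (f t)\<close>.\<close>
    proof (rule integral_dominated_convergence[where w = "\<lambda>t. 9 * (cmod (f t))\<^sup>2"])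
      show "AE t in \<nu> x. (\<lambda>i. (cmod (approx f i t - f t))\<^sup>2) \<longlonglongrightarrow> 0"
      proof (rule AE_I2)
        fix t
        have "(\<lambda>i. (cmod (approx f i t - f t))\<^sup>2) \<longlonglongrightarrow> (cmod (f t - f t))\<^sup>2"
          by (intro tendsto_intros ap)
        then show "(\<lambda>i. (cmod (approx f i t - f t))\<^sup>2) \<longlonglongrightarrow> 0" by simp
      qed
      have "(cmod (approx f i t - f t))\<^sup>2 \<le> (3 * cmod (f t))\<^sup>2" for i t
        using ap(3)[of i t] norm_triangle_ineq4[of "approx f i t" "f t"] by (intro power_mono) auto
      then show "AE t in \<nu> x. norm ((cmod (approx f i t - f t))\<^sup>2) \<le> 9 * (cmod (f t))\<^sup>2" for i
        by (simp add: power_mult_distrib)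
    qed (use int in auto)
    then have "(\<lambda>i. LINT t|\<nu> x. (cmod (approx f i t - f t))\<^sup>2) \<longlonglongrightarrow> 0" by simp
    \<comment> \<open>The quarter pays for the factor 2 in
      \<open>|u + v|^2 \<le> 2 |u|^2 + 2 |v|^2\<close> and for the two terms there.\<close>
    then have "eventually (\<lambda>i. (LINT t|\<nu> x. (cmod (approx f i t - f t))\<^sup>2) < e\<^sup>2 / 4) sequentially"
      using e by (intro order_tendstoD) auto
    then obtain N where N: "\<And>i. i \<ge> N \<Longrightarrow> (LINT t|\<nu> x. (cmod (approx f i t - f t))\<^sup>2) < e\<^sup>2 / 4"
      by (auto simp: eventually_sequentially)
    have intd: "integrable (\<nu> x) (\<lambda>t. (cmod (approx f i t - f t))\<^sup>2)" for i
    proof (rule Bochner_Integration.integrable_bound)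
      show "integrable (\<nu> x) (\<lambda>t. 9 * (cmod (f t))\<^sup>2)" using int by simp
      have "(cmod (approx f i t - f t))\<^sup>2 \<le> (3 * cmod (f t))\<^sup>2" for t
        using ap(3)[of i t] norm_triangle_ineq4[of "approx f i t" "f t"] by (intro power_mono) auto
      then show "AE t in \<nu> x. norm ((cmod (approx f i t - f t))\<^sup>2) \<le> norm (9 * (cmod (f t))\<^sup>2)"
        by (simp add: power_mult_distrib)
    qed simp
    have "dist (simple_op (approx f i) x) (simple_op (approx f j) x) < e" if "i \<ge> N" "j \<ge> N" for i j
    proof -
      have "(dist (simple_op (approx f i) x) (simple_op (approx f j) x))\<^sup>2 =
          (LINT t|\<nu> x. (cmod (approx f i t - approx f j t))\<^sup>2)"
        unfolding dist_norm simple_op_diff[OF ap(1) ap(1), symmetric]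
        by (rule norm_simple_op) (intro simple_function_diff_complex ap)
      also have "\<dots> \<le> (LINT t|\<nu> x. 2 * (cmod (approx f i t - f t))\<^sup>2 + 2 * (cmod (approx f j t - f t))\<^sup>2)"
      proof (rule integral_mono')
        fix t
        show "(cmod (approx f i t - approx f j t))\<^sup>2 \<le>
            2 * (cmod (approx f i t - f t))\<^sup>2 + 2 * (cmod (approx f j t - f t))\<^sup>2"
          using norm_add_square_le[of "approx f i t - f t" "f t - approx f j t"]
          by (simp add: norm_minus_commute)
      qed (use intd in auto)
      also have "\<dots> = 2 * (LINT t|\<nu> x. (cmod (approx f i t - f t))\<^sup>2) +
          2 * (LINT t|\<nu> x. (cmod (approx f j t - f t))\<^sup>2)"
        using intd by simp
      also have "\<dots> < e\<^sup>2" using N[OF that(1)] N[OF that(2)] by simp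
      finally show ?thesis using e by (simp add: power_less_imp_less_base)
    qed
    then show "\<exists>M. \<forall>m\<ge>M. \<forall>n\<ge>M. dist (simple_op (approx f m) x) (simple_op (approx f n) x) < e"
      by blast
  qed
  then obtain y where y: "(\<lambda>i. simple_op (approx f i) x) \<longlonglongrightarrow> y"
    using Cauchy_convergent convergent_def by blast
  have "(\<lambda>i. (norm (simple_op (approx f i) x))\<^sup>2) \<longlonglongrightarrow> (norm y)\<^sup>2"
    by (intro tendsto_intros y)
  moreover have "(\<lambda>i. LINT t|\<nu> x. (cmod (approx f i t))\<^sup>2) \<longlonglongrightarrow> (LINT t|\<nu> x. (cmod (f t))\<^sup>2)"
  proof (rule integral_dominated_convergence[where w = "\<lambda>t. 4 * (cmod (f t))\<^sup>2"])
    show "AE t in \<nu> x. (\<lambda>i. (cmod (approx f i t))\<^sup>2) \<longlonglongrightarrow> (cmod (f t))\<^sup>2"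
      by (intro AE_I2 tendsto_intros ap)
    have "(cmod (approx f i t))\<^sup>2 \<le> (2 * cmod (f t))\<^sup>2" for i t
      using ap(3)[of i t] by (intro power_mono) auto
    then show "AE t in \<nu> x. norm ((cmod (approx f i t))\<^sup>2) \<le> 4 * (cmod (f t))\<^sup>2" for i
      by (simp add: power_mult_distrib)
  qed (use int in auto)
  ultimately have "(norm y)\<^sup>2 = (LINT t|\<nu> x. (cmod (f t))\<^sup>2)"
    by (simp add: norm_simple_op[OF ap(1)] LIMSEQ_unique)
  moreover have "cinner y z = sesq_integral E f x z" if z: "z \<in> spectral_domain E f" for z
  proof (rule LIMSEQ_unique)
    show "(\<lambda>i. cinner (simple_op (approx f i) x) z) \<longlonglongrightarrow> cinner y z"
      by (intro tendsto_cinner y tendsto_const)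
  qed (rule sesq_integral_approx[OF assms z])
  ultimately show ?thesis
    using that[OF y] x by (simp add: spectral_integral_def)
qed

text \<open>\<open>B\<close> moves across the inner product and through every
  \<open>simple_op\<close>, so both sides of the defining identity are limits of the same sequence.
  The domain is preserved because the measure of \<open>B z\<close> is at most that of
  \<open>z\<close>.\<close>

lemma spectral_integral_commute:
  assumes [measurable]: "f \<in> borel_measurable borel"
    and B: "orthogonal_projection B"
    and comm: "\<And>A x. A \<in> sets borel \<Longrightarrow> B (E A x) = E A (B x)"
    and xy: "(x, y) \<in> spectral_integral E f"
  shows "(B x, B y) \<in> spectral_integral E f"
proof -
  have dom: "B z \<in> spectral_domain E f" if "z \<in> spectral_domain E f" for z
  proof -
    have "emeasure (\<nu> (B z)) A \<le> 1 * emeasure (\<nu> z) A + 0 * emeasure (\<nu> z) A"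
      if A: "A \<in> sets borel" for A
      using orthogonal_projection_norm(2)[OF B, of "E A z"]
      by (simp add: emeasure_\<nu>[OF A] ennreal_leI power_mono comm[OF A, symmetric])
    then have "(\<integral>\<^sup>+ t. ennreal ((cmod (f t))\<^sup>2) \<partial>\<nu> (B z)) \<le>
      1 * (\<integral>\<^sup>+ t. ennreal ((cmod (f t))\<^sup>2) \<partial>\<nu> z) + 0 * (\<integral>\<^sup>+ t. ennreal ((cmod (f t))\<^sup>2) \<partial>\<nu> z)"
      by (intro nn_integral_le_of_emeasure_le) auto
    then show ?thesis using that by (auto simp: spectral_domain_def)
  qed
  have x: "x \<in> spectral_domain E f" using xy by (simp add: spectral_integral_def)
  have "cinner (B y) z = sesq_integral E f (B x) z" if z: "z \<in> spectral_domain E f" for z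
  proof (rule LIMSEQ_unique)
    have "cinner (B y) z = cinner y (B z)" using B by (simp add: orthogonal_projection_def)
    also have "\<dots> = sesq_integral E f x (B z)"
      using xy dom[OF z] by (simp add: spectral_integral_def)
    finally show "(\<lambda>i. cinner (simple_op (approx f i) x) (B z)) \<longlonglongrightarrow> cinner (B y) z"
      using sesq_integral_approx[OF assms(1) x dom[OF z]] by simp
    have "cinner (simple_op (approx f i) x) (B z) = cinner (simple_op (approx f i) (B x)) z" for i
    proof -
      note ap = simple_function_borelD[OF approx(1)[OF assms(1)]]
      have "cinner (simple_op (approx f i) x) (B z) = cinner (B (simple_op (approx f i) x)) z"
        using B by (simp add: orthogonal_projection_def)
      also have "B (simple_op (approx f i) x) = simple_op (approx f i) (B x)"
        using B unfolding simple_op_def by (simp add: clinear_sum[of B] orthogonal_projection_def comm ap)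
      finally show ?thesis .
    qed
    then show "(\<lambda>i. cinner (simple_op (approx f i) x) (B z)) \<longlonglongrightarrow> sesq_integral E f (B x) z"
      using sesq_integral_approx[OF assms(1) dom[OF x] z] by simp
  qed
  then show ?thesis using dom[OF x] by (simp add: spectral_integral_def)
qed

end

section \<open>The spectral measure of a selfadjoint operator\<close>

text \<open>Density is assumed because only a dense domain determines the value of
  \<open>spectral_integral\<close> uniquely.\<close>

locale spectral_operator = spectral +
  fixes T
  assumes T: "T = spectral_integral E complex_of_real" and dense: "closure (Domain T) = UNIV"
begin

lemma closure_spectral_domain: "closure (spectral_domain E complex_of_real) = UNIV"
proof -
  have "Domain T \<subseteq> spectral_domain E complex_of_real" by (auto simp: T spectral_integral_def)
  then show ?thesis using dense closure_mono by blast
qed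

lemma E_commute_T: "A \<in> sets borel \<Longrightarrow> (x, y) \<in> T \<Longrightarrow> (E A x, E A y) \<in> T"
  unfolding T by (rule spectral_integral_commute) (auto simp: orthogonal_projection_E E_Int Int_commute)

text \<open>The isometry applied to the function \<open>t - c\<close>, whose spectral domain is that
  of \<open>t\<close>. Its integral is \<open>T - c\<close> because \<open>sesq_integral\<close> is
  linear in the integrand and a constant integrates to a multiple of the inner product.\<close>

lemma norm_shift:
  assumes xy: "(x, y) \<in> T"
  shows "integrable (\<nu> x) (\<lambda>t. (t - c)\<^sup>2)" "(norm (y - complex_of_real c *\<^sub>C x))\<^sup>2 = (LINT t|\<nu> x. (t - c)\<^sup>2)"
proof -
  let ?f = "\<lambda>t. complex_of_real t - complex_of_real c"
  have sq: "(cmod (?f t))\<^sup>2 = (t - c)\<^sup>2" for t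
    by (simp flip: of_real_diff)
  have dom: "z \<in> spectral_domain E ?f \<longleftrightarrow> z \<in> spectral_domain E complex_of_real" for z
  proof -
    interpret finite_measure "\<nu> z" by (rule finite_measure_\<nu>)
    have "integrable (\<nu> z) (\<lambda>t. (t - a)\<^sup>2)" if "integrable (\<nu> z) (\<lambda>t. (t - b)\<^sup>2)" for a b :: real
    proof (rule Bochner_Integration.integrable_bound)
      show "integrable (\<nu> z) (\<lambda>t. 2 * (t - b)\<^sup>2 + 2 * (b - a)\<^sup>2)"
        using that by simp
      show "AE t in \<nu> z. norm ((t - a)\<^sup>2) \<le> norm (2 * (t - b)\<^sup>2 + 2 * (b - a)\<^sup>2)"
        using norm_add_square_le[of "_ - b" "b - a"] by (intro AE_I2) (simp add: abs_of_nonneg)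
    qed simp
    from this[of c 0] this[of 0 c] show ?thesis
      by (auto simp: spectral_domain_iff sq)
  qed
  have xd: "x \<in> spectral_domain E complex_of_real" using xy by (simp add: T spectral_integral_def)
  then show "integrable (\<nu> x) (\<lambda>t. (t - c)\<^sup>2)"
    using dom[of x] by (simp add: spectral_domain_iff sq)
  obtain y' where y': "(norm y')\<^sup>2 = (LINT t|\<nu> x. (t - c)\<^sup>2)" "(x, y') \<in> spectral_integral E ?f"
    using simple_op_approx_tendsto[of ?f x] dom[of x] xd by (auto simp: sq)
  have "y' = y - complex_of_real c *\<^sub>C x"
  proof (rule cinner_eq_imp_eq[OF closure_spectral_domain])
    fix z assume z: "z \<in> spectral_domain E complex_of_real"
    have int: "integrable (\<nu> (x + d *\<^sub>C z)) complex_of_real" for d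
      by (intro integrable_of_spectral_domain spectral_domain_add_scaleC xd z) auto
    have intc: "integrable (\<nu> w) (\<lambda>t. complex_of_real c)" for w
      by (rule finite_measure.integrable_const[OF finite_measure_\<nu>])
    have "sesq_integral E (\<lambda>t. complex_of_real c) x z = complex_of_real c * cinner x z"
    proof -
      have "sesq_integral E (\<lambda>t. complex_of_real c) x z =
          complex_of_real c * ((\<Sum>k<4. \<i> ^ k * complex_of_real (measure (\<nu> (x + \<i> ^ k *\<^sub>C z)) UNIV)) / 4)"
        by (simp add: sesq_integral_def sum_distrib_left scaleR_conv_of_real[where 'a=complex] ac_simps)
      then show ?thesis by (subst (asm) polarization_E) simp_all
    qed
    moreover have "sesq_integral E ?f x z =
        sesq_integral E complex_of_real x z - sesq_integral E (\<lambda>t. complex_of_real c) x z"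
      using int intc
      by (simp add: sesq_integral_def algebra_simps sum_subtractf diff_divide_distrib)
    moreover have "cinner y' z = sesq_integral E ?f x z" "cinner y z = sesq_integral E complex_of_real x z"
      using y'(2) xy z dom[of z] by (simp_all add: spectral_integral_def T)
    ultimately show "cinner y' z = cinner (y - complex_of_real c *\<^sub>C x) z"
      by (simp add: cinner_diff_left cinner_scaleC_left)
  qed
  with y' show "(norm (y - complex_of_real c *\<^sub>C x))\<^sup>2 = (LINT t|\<nu> x. (t - c)\<^sup>2)" by simp
qed

lemma AE_\<nu>: "A \<in> sets borel \<Longrightarrow> E A x = x \<Longrightarrow> AE t in \<nu> x. t \<in> A"
  by (rule AE_I[of _ _ "- A"]) (auto simp: emeasure_\<nu> E_Compl)

lemma norm_shift_le:
  assumes xy: "(x, y) \<in> T" and A: "A \<in> sets borel" "E A x = x"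
    and r: "\<And>t. t \<in> A \<Longrightarrow> \<bar>t - c\<bar> \<le> r" "0 \<le> r"
  shows "norm (y - complex_of_real c *\<^sub>C x) \<le> r * norm x"
proof -
  interpret finite_measure "\<nu> x" by (rule finite_measure_\<nu>)
  have "(norm (y - complex_of_real c *\<^sub>C x))\<^sup>2 \<le> (LINT t|\<nu> x. r\<^sup>2)"
    unfolding norm_shift(2)[OF xy]
  proof (rule integral_mono_AE)
    show "AE t in \<nu> x. (t - c)\<^sup>2 \<le> r\<^sup>2"
      using AE_\<nu>[OF A]
    proof eventually_elim
      case (elim t)
      then show ?case using power_mono[OF r(1)[OF elim], of 2] by simp
    qed
  qed (use norm_shift(1)[OF xy] in auto)
  also have "\<dots> = (r * norm x)\<^sup>2"
    using measure_\<nu>[of UNIV x] by (simp add: power_mult_distrib)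
  finally show ?thesis by (rule power2_le_imp_le) (simp add: r)
qed

lemma norm_shift_ge:
  assumes xy: "(x, y) \<in> T" and A: "A \<in> sets borel" "E A x = x"
    and r: "\<And>t. t \<in> A \<Longrightarrow> r \<le> \<bar>t - c\<bar>" "0 \<le> r"
  shows "r * norm x \<le> norm (y - complex_of_real c *\<^sub>C x)"
proof -
  interpret finite_measure "\<nu> x" by (rule finite_measure_\<nu>)
  have "(r * norm x)\<^sup>2 = (LINT t|\<nu> x. r\<^sup>2)"
    using measure_\<nu>[of UNIV x] by (simp add: power_mult_distrib)
  also have "\<dots> \<le> (norm (y - complex_of_real c *\<^sub>C x))\<^sup>2"
    unfolding norm_shift(2)[OF xy]
  proof (rule integral_mono_AE)
    show "AE t in \<nu> x. r\<^sup>2 \<le> (t - c)\<^sup>2"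
      using AE_\<nu>[OF A]
    proof eventually_elim
      case (elim t)
      then show ?case using power_mono[OF r(1)[OF elim] r(2), of 2] by simp
    qed
  qed (use norm_shift(1)[OF xy] in auto)
  finally show ?thesis by (rule power2_le_imp_le) simp
qed

text \<open>The second moment of the measure of \<open>x\<close> about \<open>c\<close> is
  \<open>\<parallel>T x - c x\<parallel>^2 = 0\<close>, so the measure is concentrated at
  \<open>c\<close>.\<close>

lemma E_eigenvector:
  assumes x: "(x, complex_of_real c *\<^sub>C x) \<in> T"
  shows "E {c} x = x"
proof -
  have "AE t in \<nu> x. (t - c)\<^sup>2 = 0"
    using norm_shift(2)[OF x, of c] norm_shift(1)[OF x, of c]
    by (subst integral_nonneg_eq_0_iff_AE[symmetric]) auto
  then have "AE t in \<nu> x. t \<notin> - {c}" by eventually_elim auto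
  then have "emeasure (\<nu> x) (- {c}) = 0"
    by (subst (asm) AE_iff_measurable[of "- {c}"]) auto
  then show ?thesis by (simp add: emeasure_\<nu> E_Compl)
qed

lemma spectral_domain_bounded:
  assumes A: "A \<in> sets borel" "E A x = x" and r: "\<And>t. t \<in> A \<Longrightarrow> \<bar>t\<bar> \<le> r"
  obtains y where "(x, y) \<in> T"
proof -
  interpret finite_measure "\<nu> x" by (rule finite_measure_\<nu>)
  have "integrable (\<nu> x) (\<lambda>t. t\<^sup>2)"
  proof (rule Bochner_Integration.integrable_bound)
    show "integrable (\<nu> x) (\<lambda>t. r\<^sup>2)" by simp
    show "AE t in \<nu> x. norm (t\<^sup>2) \<le> norm (r\<^sup>2)"
      using AE_\<nu>[OF A]
    proof eventually_elim
      case (elim t)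
      then show ?case using power_mono[OF r[OF elim], of 2] by simp
    qed
  qed simp
  then have "x \<in> spectral_domain E complex_of_real" by (simp add: spectral_domain_iff)
  then show ?thesis using simple_op_approx_tendsto[of complex_of_real x] that by (auto simp: T)
qed

text \<open>
  If \<open>B\<close> commutes with \<open>T\<close>, then \<open>X = E(J) B E(I)\<close> with \<open>I = [c - r, c + r]\<close> and
  \<open>J = {t. |t - c| > r + d}\<close> satisfies \<open>(r + d) \<parallel>X\<parallel> \<le> r \<parallel>X\<parallel>\<close>, since \<open>T - c\<close> is bounded by \<open>r\<close> on the
  range of \<open>E(I)\<close> and bounded below by \<open>r + d\<close> on that of \<open>E(J)\<close>.
\<close>

lemma separated_commute:
  assumes B: "bounded_linear B" and comm: "\<And>x y. (x, y) \<in> T \<Longrightarrow> (B x, B y) \<in> T"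
    and Bc: "\<And>c x. B (c *\<^sub>C x) = c *\<^sub>C B x" and r: "0 \<le> r" and d: "0 < d"
  shows "E {t. r + d < \<bar>t - c\<bar>} (B (E {c - r..c + r} x)) = 0"
proof -
  let ?I = "{c - r..c + r}" and ?J = "{t. r + d < \<bar>t - c\<bar>}"
  have I: "?I \<in> sets borel" and J: "?J \<in> sets borel"
    by simp (rule borel_open, intro open_Collect_less continuous_intros)
  define X where "X x = E ?J (B (E ?I x))" for x
  have X: "bounded_linear X"
    unfolding X_def
    by (intro bounded_linear_compose[OF orthogonal_projection_bounded_linear[OF orthogonal_projection_E[OF J]]]
        bounded_linear_compose[OF B] orthogonal_projection_bounded_linear orthogonal_projection_E I)
  have "norm (X u) \<le> onorm X * r / (r + d) * norm u" for u
  proof -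
    define v where "v = E ?I u"
    have v: "E ?I v = v" "norm v \<le> norm u" by (simp_all add: v_def E_idem norm_E_le)
    obtain w where w: "(v, w) \<in> T"
      by (rule spectral_domain_bounded[OF I v(1), of "\<bar>c\<bar> + r"]) auto
    let ?e = "w - complex_of_real c *\<^sub>C v"
    \<comment> \<open>\<open>T\<close> leaves the range of \<open>E ?I\<close> invariant, so
      \<open>X\<close> acts on \<open>w - c v\<close> simply as \<open>E ?J\<close> after
      \<open>B\<close>.\<close>
    have Iw: "E ?I w = w"
    proof -
      have "(v, E ?I w) \<in> T" using E_commute_T[OF I w] by (simp add: v)
      with w have "cinner (E ?I w) z = cinner w z" if "z \<in> spectral_domain E complex_of_real" for z
        using that by (simp add: T spectral_integral_def)
      then show ?thesis by (rule cinner_eq_imp_eq[OF closure_spectral_domain])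
    qed
    have "(E ?J (B v), E ?J (B w)) \<in> T" by (intro E_commute_T comm w J)
    then have "(r + d) * norm (X u) \<le> norm (E ?J (B w) - complex_of_real c *\<^sub>C E ?J (B v))"
      unfolding X_def v_def[symmetric] by (rule norm_shift_ge[where A = ?J]) (use r d J E_idem[OF J] in auto)
    also have "E ?J (B w) - complex_of_real c *\<^sub>C E ?J (B v) = X ?e"
      using clinear_diff[OF clinear_E[OF I]] clinear_diff[OF clinear_E[OF J]] clinear_E[OF I] clinear_E[OF J]
      by (simp add: X_def Iw v linear_diff[OF bounded_linear.linear[OF B]] Bc clinear_def)
    also have "norm (X ?e) \<le> onorm X * norm ?e" by (rule onorm[OF X])
    also have "\<dots> \<le> onorm X * (r * norm v)"
      by (intro mult_left_mono norm_shift_le[OF w I v(1)] onorm_pos_le[OF X] r) (auto simp: abs_le_iff)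
    also have "\<dots> \<le> onorm X * (r * norm u)"
      by (intro mult_left_mono v onorm_pos_le[OF X] r)
    finally show ?thesis using r d by (simp add: field_simps)
  qed
  then have "onorm X \<le> onorm X * r / (r + d)"
    using onorm_pos_le[OF X] r d by (intro onorm_bound) auto
  then have "onorm X * d \<le> 0" using r d by (simp add: field_simps)
  then have "onorm X = 0" using d onorm_pos_le[OF X] by (simp add: mult_le_0_iff)
  then have "X x = 0" using onorm[OF X, of x] by simp
  then show ?thesis by (simp add: X_def)
qed

text \<open>The complement of the interval is a countable union of sets at distance at least
  \<open>1 / Suc n\<close> from it, and each of them is null for the measure of
  \<open>B (E {a..b} x)\<close> by the separated case.\<close>

lemma interval_commute:
  assumes B: "bounded_linear B" and comm: "\<And>x y. (x, y) \<in> T \<Longrightarrow> (B x, B y) \<in> T"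
    and Bc: "\<And>c x. B (c *\<^sub>C x) = c *\<^sub>C B x" and ab: "a \<le> b"
  shows "E {a..b} (B (E {a..b} x)) = B (E {a..b} x)"
proof -
  define c r where "c = (a + b) / 2" and "r = (b - a) / 2"
  have I: "{a..b} = {c - r..c + r}" and r: "0 \<le> r" using ab by (auto simp: c_def r_def field_simps)
  let ?y = "B (E {a..b} x)" and ?J = "\<lambda>n. {t. r + 1 / Suc n < \<bar>t - c\<bar>}"
  have J: "?J n \<in> sets borel" for n
    by (rule borel_open, intro open_Collect_less continuous_intros)
  have "(\<Union>n. ?J n) \<in> null_sets (\<nu> ?y)"
  proof (rule null_sets_UN)
    fix n
    have "E (?J n) ?y = 0"
      unfolding I using separated_commute[OF B comm Bc r, of "1 / Suc n" c x] by simp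
    then show "?J n \<in> null_sets (\<nu> ?y)"
      using J[of n] by (simp add: null_sets_def emeasure_\<nu>)
  qed
  moreover have "(\<Union>n. ?J n) = - {a..b}"
  proof (intro set_eqI iffI)
    fix t assume "t \<in> (\<Union>n. ?J n)"
    then obtain n where "r + 1 / Suc n < \<bar>t - c\<bar>" by auto
    moreover have "0 < 1 / real (Suc n)" by simp
    ultimately have "r < \<bar>t - c\<bar>" by linarith
    then show "t \<in> - {a..b}" unfolding I by auto
  next
    fix t assume "t \<in> - {a..b}"
    then have "0 < \<bar>t - c\<bar> - r" unfolding I by auto
    then obtain n where "inverse (real (Suc n)) < \<bar>t - c\<bar> - r" using reals_Archimedean by blast
    then show "t \<in> (\<Union>n. ?J n)" by (auto simp: inverse_eq_divide algebra_simps)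
  qed
  ultimately show ?thesis by (auto simp: null_sets_def emeasure_\<nu> E_Compl)
qed

text \<open>For a closed interval \<open>I\<close> one has \<open>E I B E I = B E I\<close>; since
  \<open>B\<close> and \<open>E I\<close> are selfadjoint, taking adjoints gives
  \<open>E I B E I = E I B\<close>, so the two commute. Closed intervals generate the Borel
  sets.\<close>

lemma E_commute:
  assumes B: "orthogonal_projection B" and comm: "\<And>x y. (x, y) \<in> T \<Longrightarrow> (B x, B y) \<in> T"
    and A: "A \<in> sets borel"
  shows "B (E A x) = E A (B x)"
proof -
  note bl = orthogonal_projection_bounded_linear[OF B]
  have Bc: "B (c *\<^sub>C x) = c *\<^sub>C B x" for c x
    using B by (simp add: orthogonal_projection_def clinear_def)
  have sa: "cinner (B x) y = cinner x (B y)" for x y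
    using B by (simp add: orthogonal_projection_def)
  have "\<forall>x. B (E A x) = E A (B x)" using A
  proof (induction rule: borel_set_induct)
    case empty
    show ?case using linear_0[OF bounded_linear.linear[OF bl]] by (simp only: E_empty) simp
  next
    case (interval a b)
    let ?I = "{a..b}"
    have 1: "E ?I (B (E ?I x)) = B (E ?I x)" for x
      by (rule interval_commute[OF bl comm Bc interval])
    show ?case
    proof
      fix x
      have "cinner (B (E ?I x)) z = cinner (E ?I (B x)) z" for z
      proof -
        have "cinner (B (E ?I x)) z = cinner (E ?I (B (E ?I x))) z" by (subst 1) (rule refl)
        also have "\<dots> = cinner x (E ?I (B (E ?I z)))"
          using E_selfadjoint[of ?I] by (simp only: sa atLeastAtMost_borel)
        also have "\<dots> = cinner x (B (E ?I z))" by (subst 1) (rule refl)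
        also have "\<dots> = cinner (E ?I (B x)) z"
          using E_selfadjoint[of ?I] by (simp only: sa atLeastAtMost_borel)
        finally show ?thesis .
      qed
      then show "B (E ?I x) = E ?I (B x)" by (rule cinner_eq_imp_eq[of UNIV, OF closure_UNIV])
    qed
  next
    case (compl A)
    then show ?case by (simp only: E_Compl linear_diff[OF bounded_linear.linear[OF bl]]) simp
  next
    case (union f)
    show ?case
    proof
      fix x
      have "(\<lambda>n. B (E (f n) x)) sums B (E (\<Union>n. f n) x)"
        by (rule bounded_linear.sums[OF bl E_sums]) (fact union)+
      moreover have "(\<lambda>n. E (f n) (B x)) sums E (\<Union>n. f n) (B x)"
        by (rule E_sums) (fact union)+
      moreover have "(\<lambda>n. B (E (f n) x)) = (\<lambda>n. E (f n) (B x))"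
        using union.IH by (intro ext) blast
      ultimately show "B (E (\<Union>n. f n) x) = E (\<Union>n. f n) (B x)"
        by (simp add: sums_iff)
    qed
  qed
  then show ?thesis by blast
qed

end

text \<open>Membership in \<open>exp_op\<close> comes with some spectral measure of
  \<open>T\<close>; since \<open>B\<close> commutes with that one, the same measure witnesses the
  image pair.\<close>

lemma exp_op_commute:
  assumes T: "selfadjoint T" and B: "orthogonal_projection B"
    and comm: "\<And>x y. (x, y) \<in> T \<Longrightarrow> (B x, B y) \<in> T"
    and xy: "(x, y) \<in> exp_op c T"
  shows "(B x, B y) \<in> exp_op c T"
proof -
  let ?f = "\<lambda>t. exp (c * complex_of_real t)"
  obtain E where E: "is_spectral_measure E T" "(x, y) \<in> spectral_integral E ?f"
    using xy unfolding exp_op_def op_fun_def by blast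
  interpret spectral_operator E T
    by unfold_locales (use E(1) T in \<open>simp_all only: is_spectral_measure_def selfadjoint_def\<close>)
  have "(B x, B y) \<in> spectral_integral E ?f"
    by (rule spectral_integral_commute[OF _ B E_commute[OF B comm] E(2)]) simp_all
  with E(1) show ?thesis unfolding exp_op_def op_fun_def by blast
qed

section \<open>Jacobi and diagonal operators\<close>

text \<open>Reduces an identity between vectors to one between complex numbers, where ring
  normalisation applies.\<close>

lemma cinner_ext: "(\<And>z. cinner x z = cinner y z) \<Longrightarrow> x = y" for x y :: "'a::complex_hilbert_space"
  by (rule cinner_eq_imp_eq[of UNIV]) auto

text \<open>Otherwise \<open>a N \<ge> e / (N + 1)\<close> from \<open>M\<close> on, and the
  harmonic series would converge.\<close>

lemma summable_harmonic_small:
  fixes a :: "nat \<Rightarrow> real"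
  assumes a: "summable a" and e: "0 < e"
  obtains N where "N \<ge> M" "real (Suc N) * a N < e"
proof (rule ccontr)
  assume no: "\<not> thesis"
  have *: "e \<le> real (Suc N) * a N" if "N \<ge> M" for N
  proof (rule ccontr)
    assume "\<not> e \<le> real (Suc N) * a N"
    then have thesis by (intro \<open>\<And>N. M \<le> N \<Longrightarrow> real (Suc N) * a N < e \<Longrightarrow> thesis\<close>[of N] that) simp
    with no show False by simp
  qed
  have "summable (\<lambda>N. (1 / e) * a N)" using a by (rule summable_mult)
  then have "summable (\<lambda>N. inverse (of_nat (Suc N)) :: real)"
  proof (rule summable_comparison_test'[where N = M])
    fix N assume "N \<ge> M"
    then show "norm (inverse (of_nat (Suc N)) :: real) \<le> (1 / e) * a N"
      using *[of N] e by (simp add: divide_simps) (simp add: algebra_simps)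
  qed
  then show False using not_summable_harmonic[where 'a=real] by (subst (asm) summable_Suc_iff) blast
qed

section \<open>Selfadjoint operators and closures of graphs\<close>

lemma selfadjoint_iff:
  "selfadjoint T \<Longrightarrow> (x, y) \<in> T \<longleftrightarrow> (\<forall>u v. (u, v) \<in> T \<longrightarrow> cinner v x = cinner u y)"
proof -
  assume "selfadjoint T"
  then have "adjoint_operator T = T" unfolding selfadjoint_def by blast
  then have "(x, y) \<in> T \<longleftrightarrow> (x, y) \<in> adjoint_operator T" by simp
  also have "\<dots> \<longleftrightarrow> (\<forall>u v. (u, v) \<in> T \<longrightarrow> cinner v x = cinner u y)"
    unfolding adjoint_operator_def by auto
  finally show ?thesis .
qed

lemma selfadjoint_symmetric:
  "selfadjoint T \<Longrightarrow> (x, y) \<in> T \<Longrightarrow> (u, v) \<in> T \<Longrightarrow> cinner v x = cinner u y"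
  using selfadjoint_iff by blast

lemma selfadjoint_closed:
  assumes T: "selfadjoint T" and XY: "\<And>n. (X n, Y n) \<in> T" "X \<longlonglongrightarrow> x" "Y \<longlonglongrightarrow> y"
  shows "(x, y) \<in> T"
proof (rule iffD2[OF selfadjoint_iff[OF T]], intro allI impI)
  fix u v assume uv: "(u, v) \<in> T"
  have "(\<lambda>n. cinner v (X n)) \<longlonglongrightarrow> cinner v x"
    by (intro tendsto_cinner tendsto_const XY)
  moreover have "(\<lambda>n. cinner v (X n)) = (\<lambda>n. cinner u (Y n))"
    using selfadjoint_symmetric[OF T XY(1) uv] by (rule ext)
  moreover have "(\<lambda>n. cinner u (Y n)) \<longlonglongrightarrow> cinner u y"
    by (intro tendsto_cinner tendsto_const XY)
  ultimately show "cinner v x = cinner u y" by (metis LIMSEQ_unique)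
qed

text \<open>Closure of the graph in the product norm, written with sequences to match
  \<open>l2_closure\<close> on the concrete side.\<close>

definition seq_closure :: "'a::complex_hilbert_space oper \<Rightarrow> 'a oper" where
  "seq_closure T = {(x, y). \<exists>X Y. (\<forall>n. (X n, Y n) \<in> T) \<and> X \<longlonglongrightarrow> x \<and> Y \<longlonglongrightarrow> y}"

lemma seq_closureI:
  "(\<And>n. (X n, Y n) \<in> T) \<Longrightarrow> X \<longlonglongrightarrow> x \<Longrightarrow> Y \<longlonglongrightarrow> y \<Longrightarrow> (x, y) \<in> seq_closure T"
  unfolding seq_closure_def by blast

definition graph_span :: "(nat \<Rightarrow> 'a::complex_vector) \<Rightarrow> (nat \<Rightarrow> 'a) \<Rightarrow> 'a oper" where
  "graph_span \<phi> t = {(\<Sum>n<N. c n *\<^sub>C \<phi> n, \<Sum>n<N. c n *\<^sub>C t n) | N c. True}"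

lemma graph_spanI: "(\<Sum>n<N. c n *\<^sub>C \<phi> n, \<Sum>n<N. c n *\<^sub>C t n) \<in> graph_span \<phi> t"
  unfolding graph_span_def by blast

lemma linear_operatorD:
  assumes "linear_operator T"
  shows "single_valued T" "(0, 0) \<in> T"
    "(x, y) \<in> T \<Longrightarrow> (x', y') \<in> T \<Longrightarrow> (x + x', y + y') \<in> T"
    "(x, y) \<in> T \<Longrightarrow> (c *\<^sub>C x, c *\<^sub>C y) \<in> T"
  using assms unfolding linear_operator_def by blast+

lemma graph_span_subset:
  assumes T: "linear_operator T" and t: "\<And>n. (\<phi> n, t n) \<in> T"
  shows "graph_span \<phi> t \<subseteq> T"
proof -
  have "(\<Sum>n<N. c n *\<^sub>C \<phi> n, \<Sum>n<N. c n *\<^sub>C t n) \<in> T" for N c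
    by (induction N) (simp_all add: linear_operatorD[OF T] t)
  then show ?thesis unfolding graph_span_def by clarify
qed

lemma seq_closure_subset:
  assumes T: "selfadjoint T" and t: "\<And>n. (\<phi> n, t n) \<in> T"
  shows "seq_closure (graph_span \<phi> t) \<subseteq> T"
proof -
  have sub: "graph_span \<phi> t \<subseteq> T"
    using T unfolding selfadjoint_def by (intro graph_span_subset t) blast
  show ?thesis
  proof clarify
    fix x y assume "(x, y) \<in> seq_closure (graph_span \<phi> t)"
    then obtain X Y where "\<And>n. (X n, Y n) \<in> graph_span \<phi> t" and XY: "X \<longlonglongrightarrow> x" "Y \<longlonglongrightarrow> y"
      unfolding seq_closure_def by blast
    then have "(X n, Y n) \<in> T" for n using sub by blast
    then show "(x, y) \<in> T" using XY by (rule selfadjoint_closed[OF T])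
  qed
qed

text \<open>Column \<open>n\<close> of a Hermitian tridiagonal matrix with zero diagonal. The phase
  \<open>\<zeta>\<close> is \<open>1\<close> for the position operator and \<open>- \<i>\<close> for
  the momentum operator. The truncated index \<open>n - 1\<close> at \<open>n = 0\<close> is
  harmless once \<open>b 0 = 0\<close>.\<close>

definition jacobi_image :: "(nat \<Rightarrow> real) \<Rightarrow> complex \<Rightarrow> (nat \<Rightarrow> 'a::complex_vector) \<Rightarrow> nat \<Rightarrow> 'a" where
  "jacobi_image b \<zeta> \<phi> n = (\<zeta> * b n) *\<^sub>C \<phi> (n - 1) + (cnj \<zeta> * b (Suc n)) *\<^sub>C \<phi> (Suc n)"

context orthonormal_sequence
begin

text \<open>
  Truncating the expansion of \<open>x\<close> at \<open>N\<close> produces boundary terms of size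
  \<open>b N * (|c N| + |c (N - 1)|)\<close>. They vanish along a subsequence because \<open>(b N)\<^sup>2\<close> grows at most
  linearly, \<open>|c N|\<^sup>2\<close> is summable, and the harmonic series diverges.
\<close>

lemma jacobi_approx:
  fixes b :: "nat \<Rightarrow> real" and \<zeta> :: complex
  defines "t \<equiv> jacobi_image b \<zeta> \<phi>"
  assumes b0: "b 0 = 0" and b: "\<And>n. (b n)\<^sup>2 \<le> C * real n" and \<zeta>: "cmod \<zeta> = 1"
    and xy: "\<And>n. cinner y (\<phi> n) = cinner x (t n)"
  shows "(proj x, proj y) \<in> seq_closure (graph_span \<phi> t)"
proof -
  define c d where "c n = cinner x (\<phi> n)" and "d n = cinner y (\<phi> n)" for n
  have d: "d n = cnj \<zeta> * b n * c (n - 1) + \<zeta> * b (Suc n) * c (Suc n)" for n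
    by (simp add: d_def c_def xy t_def jacobi_image_def cinner_add_right cinner_scaleC_right)
  \<comment> \<open>The matrix applied to a truncated vector differs from the truncated image only
    in the two entries that couple \<open>M\<close> and \<open>Suc M\<close>.\<close>
  have trunc: "(\<Sum>n<Suc M. c n *\<^sub>C t n) = (\<Sum>n<Suc M. d n *\<^sub>C \<phi> n) -
      (\<zeta> * b (Suc M) * c (Suc M)) *\<^sub>C \<phi> M + (cnj \<zeta> * b (Suc M) * c M) *\<^sub>C \<phi> (Suc M)" for M
  proof (induction M)
    case 0
    show ?case by (simp add: d b0 t_def jacobi_image_def scaleC_scaleC ac_simps)
  next
    case (Suc M)
    show ?case
      unfolding sum.lessThan_Suc[of _ "Suc M"] Suc d[of "Suc M"]
      by (simp add: t_def jacobi_image_def scaleC_scaleC scaleC_add_right scaleC_add_left ac_simps)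
  qed
  have "summable (\<lambda>n. (cmod (c (Suc n)))\<^sup>2 + (cmod (c n))\<^sup>2)"
    using bessel[of x] summable_Suc_iff[of "\<lambda>n. (cmod (c n))\<^sup>2"] unfolding c_def by (intro summable_add) auto
  note small = summable_harmonic_small[OF this]
  have "\<exists>N\<ge>k. real (Suc N) * ((cmod (c (Suc N)))\<^sup>2 + (cmod (c N))\<^sup>2) < inverse (real (Suc k))" for k
    by (rule small[of "inverse (real (Suc k))" k]) auto
  then obtain N where N: "\<And>k. N k \<ge> k"
      "\<And>k. real (Suc (N k)) * ((cmod (c (Suc (N k))))\<^sup>2 + (cmod (c (N k)))\<^sup>2) < inverse (real (Suc k))"
    by metis
  have "filterlim N at_top sequentially"
    using N(1) by (intro filterlim_at_top_mono[OF filterlim_ident]) auto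
  then have lim: "filterlim (\<lambda>k. Suc (N k)) sequentially sequentially"
    by (rule filterlim_compose[OF filterlim_Suc])
  let ?X = "\<lambda>k. \<Sum>n<Suc (N k). c n *\<^sub>C \<phi> n" and ?Y = "\<lambda>k. \<Sum>n<Suc (N k). c n *\<^sub>C t n"
  let ?R = "\<lambda>k. (cnj \<zeta> * b (Suc (N k)) * c (N k)) *\<^sub>C \<phi> (Suc (N k)) -
      (\<zeta> * b (Suc (N k)) * c (Suc (N k))) *\<^sub>C \<phi> (N k)"
  have X: "?X \<longlonglongrightarrow> proj x"
    using filterlim_compose[OF sums_proj[of x, unfolded sums_def] lim] by (simp add: c_def)
  have "(\<lambda>k. \<Sum>n<Suc (N k). d n *\<^sub>C \<phi> n) \<longlonglongrightarrow> proj y"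
    using filterlim_compose[OF sums_proj[of y, unfolded sums_def] lim] by (simp add: d_def)
  moreover have "?R \<longlonglongrightarrow> 0"
  proof (rule Lim_null_comparison)
    have "(\<lambda>k. sqrt (2 * C * inverse (real (Suc k)))) \<longlonglongrightarrow> sqrt (2 * C * 0)"
      by (intro tendsto_intros LIMSEQ_inverse_real_of_nat)
    then show "(\<lambda>k. sqrt (2 * C * inverse (real (Suc k)))) \<longlonglongrightarrow> 0" by simp
    show "\<forall>\<^sub>F k in sequentially. norm (?R k) \<le> sqrt (2 * C * inverse (real (Suc k)))"
    proof (intro always_eventually allI real_le_rsqrt)
      fix k
      have C: "0 \<le> C" using order_trans[OF zero_le_power2 b[of 1]] by simp
      have n1: "norm (\<phi> n) = 1" for n
        using ortho[of n n] by (simp add: cinner_self power2_eq_1_iff flip: of_real_power)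
          (use norm_ge_zero[of "\<phi> n"] in linarith)
      have "(norm (?R k))\<^sup>2 \<le> 2 * (norm ((cnj \<zeta> * b (Suc (N k)) * c (N k)) *\<^sub>C \<phi> (Suc (N k))))\<^sup>2 +
          2 * (norm (- ((\<zeta> * b (Suc (N k)) * c (Suc (N k))) *\<^sub>C \<phi> (N k))))\<^sup>2"
        unfolding diff_conv_add_uminus by (rule norm_add_square_le)
      also have "\<dots> = 2 * ((b (Suc (N k)))\<^sup>2 * ((cmod (c (Suc (N k))))\<^sup>2 + (cmod (c (N k)))\<^sup>2))"
        by (simp add: n1 norm_mult \<zeta> power_mult_distrib algebra_simps)
      also have "\<dots> \<le> 2 * (C * real (Suc (N k)) * ((cmod (c (Suc (N k))))\<^sup>2 + (cmod (c (N k)))\<^sup>2))"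
        by (intro mult_left_mono mult_right_mono b) auto
      also have "\<dots> = 2 * C * (real (Suc (N k)) * ((cmod (c (Suc (N k))))\<^sup>2 + (cmod (c (N k)))\<^sup>2))"
        by (simp only: ac_simps)
      also have "\<dots> \<le> 2 * C * inverse (real (Suc k))"
        using C N(2)[of k] by (intro mult_left_mono) auto
      finally show "(norm (?R k))\<^sup>2 \<le> 2 * C * inverse (real (Suc k))" .
    qed
  qed
  ultimately have "(\<lambda>k. (\<Sum>n<Suc (N k). d n *\<^sub>C \<phi> n) + ?R k) \<longlonglongrightarrow> proj y + 0"
    by (rule tendsto_add)
  moreover have "(\<lambda>k. (\<Sum>n<Suc (N k). d n *\<^sub>C \<phi> n) + ?R k) = ?Y"
    unfolding trunc by (intro ext) (simp only: algebra_simps)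
  ultimately have "?Y \<longlonglongrightarrow> proj y" by simp
  moreover have "(?X k, ?Y k) \<in> graph_span \<phi> t" for k by (rule graph_spanI)
  ultimately show ?thesis using X by (intro seq_closureI)
qed

end

context orthonormal_basis
begin

text \<open>Symmetry against the \<open>\<phi> n\<close> gives the coefficients of the image of
  \<open>x\<close>, and truncation then approximates the pair in the graph norm: the span of the
  \<open>\<phi> n\<close> is a core.\<close>

lemma jacobi_selfadjoint_eq:
  assumes T: "selfadjoint T" and t: "\<And>n. (\<phi> n, jacobi_image b \<zeta> \<phi> n) \<in> T"
    and b: "b 0 = 0" "\<And>n. (b n)\<^sup>2 \<le> C * real n" "cmod \<zeta> = 1"
  shows "T = seq_closure (graph_span \<phi> (jacobi_image b \<zeta> \<phi>))"
proof
  show "T \<subseteq> seq_closure (graph_span \<phi> (jacobi_image b \<zeta> \<phi>))"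
  proof clarify
    fix x y assume "(x, y) \<in> T"
    then have "cinner x (jacobi_image b \<zeta> \<phi> n) = cinner y (\<phi> n)" for n
      using selfadjoint_symmetric[OF T t] by simp
    then show "(x, y) \<in> seq_closure (graph_span \<phi> (jacobi_image b \<zeta> \<phi>))"
      using jacobi_approx[OF b, of y x] by (simp add: proj_id)
  qed
qed (rule seq_closure_subset[OF T t])

text \<open>The maximal diagonal operator: \<open>x\<close> is in its domain exactly when
  \<open>l n * cinner x (\<phi> n)\<close> is square summable.\<close>

definition diag_op :: "(nat \<Rightarrow> complex) \<Rightarrow> 'a oper" where
  "diag_op l = {(x, y). \<forall>n. cinner y (\<phi> n) = l n * cinner x (\<phi> n)}"

lemma diag_op_subset_seq_closure:
  "diag_op l \<subseteq> seq_closure (graph_span \<phi> (\<lambda>n. l n *\<^sub>C \<phi> n))"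
proof (clarsimp simp: diag_op_def)
  fix x y assume xy: "\<forall>n. cinner y (\<phi> n) = l n * cinner x (\<phi> n)"
  let ?X = "\<lambda>N. \<Sum>n<N. cinner x (\<phi> n) *\<^sub>C \<phi> n"
  let ?Y = "\<lambda>N. \<Sum>n<N. cinner x (\<phi> n) *\<^sub>C (l n *\<^sub>C \<phi> n)"
  have "?X \<longlonglongrightarrow> x" "?Y \<longlonglongrightarrow> y"
    using sums_expansion[of x] sums_expansion[of y] xy
    by (simp_all add: sums_def scaleC_scaleC mult.commute)
  moreover have "(?X N, ?Y N) \<in> graph_span \<phi> (\<lambda>n. l n *\<^sub>C \<phi> n)" for N
    by (rule graph_spanI)
  ultimately show "(x, y) \<in> seq_closure (graph_span \<phi> (\<lambda>n. l n *\<^sub>C \<phi> n))"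
    by (intro seq_closureI)
qed

text \<open>A cycle of inclusions: \<open>T\<close> lies in the diagonal operator by symmetry, that
  in the closure of the span by partial sums, and the closure in \<open>T\<close> since
  \<open>T\<close> is closed.\<close>

lemma diagonal_selfadjoint_eq:
  fixes l :: "nat \<Rightarrow> real"
  assumes T: "selfadjoint T" and t: "\<And>n. (\<phi> n, complex_of_real (l n) *\<^sub>C \<phi> n) \<in> T"
  shows "T = diag_op (\<lambda>n. complex_of_real (l n))"
    and "T = seq_closure (graph_span \<phi> (\<lambda>n. complex_of_real (l n) *\<^sub>C \<phi> n))"
proof -
  have "T \<subseteq> diag_op (\<lambda>n. complex_of_real (l n))"
  proof clarify
    fix x y assume "(x, y) \<in> T"
    then have "cinner y (\<phi> n) = complex_of_real (l n) * cinner x (\<phi> n)" for n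
      using selfadjoint_symmetric[OF T t, of x y n] by (simp add: cinner_scaleC_right)
    then show "(x, y) \<in> diag_op (\<lambda>n. complex_of_real (l n))" by (simp add: diag_op_def)
  qed
  with diag_op_subset_seq_closure seq_closure_subset[of T \<phi> "\<lambda>n. complex_of_real (l n) *\<^sub>C \<phi> n", OF T t]
  show "T = diag_op (\<lambda>n. complex_of_real (l n))"
    "T = seq_closure (graph_span \<phi> (\<lambda>n. complex_of_real (l n) *\<^sub>C \<phi> n))" by blast+
qed

end

section \<open>The numbers \<open>\<gamma>\<^sub>\<mu>(n)\<close>\<close>

text \<open>The integer \<open>n\<close> deformed by \<open>\<mu>\<close>: the quotient of
  consecutive values of \<open>gamma_mu\<close>, and the factor in the Dunkl derivative of
  \<open>x ^ n\<close>.\<close>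

definition dunkl_nat :: "real \<Rightarrow> nat \<Rightarrow> real" where
  "dunkl_nat \<mu> n = real n + (if odd n then 2 * \<mu> else 0)"

lemma dunkl_nat_0 [simp]: "dunkl_nat \<mu> 0 = 0"
  by (simp add: dunkl_nat_def)

text \<open>Shaped like \<open>A A* = 2 H - A* A\<close> at level \<open>n\<close>, where
  \<open>H\<close> has the eigenvalue \<open>\<mu> + 1 / 2 + n\<close>.\<close>

lemma dunkl_nat_Suc: "dunkl_nat \<mu> (Suc n) = 2 * (\<mu> + 1 / 2 + real n) - dunkl_nat \<mu> n"
  by (auto simp: dunkl_nat_def)

lemma dunkl_nat_pos: "\<mu> > - 1 / 2 \<Longrightarrow> n > 0 \<Longrightarrow> dunkl_nat \<mu> n > 0"
  by (cases n) (auto simp: dunkl_nat_def)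

lemma dunkl_nat_nonneg: "\<mu> > - 1 / 2 \<Longrightarrow> dunkl_nat \<mu> n \<ge> 0"
  by (cases "n = 0") (auto simp: dunkl_nat_pos less_imp_le)

lemma dunkl_nat_le: "dunkl_nat \<mu> n \<le> (1 + 2 * \<bar>\<mu>\<bar>) * real n"
proof (cases "odd n")
  case True
  then have "1 \<le> real n" by (cases n) auto
  then have "2 * \<bar>\<mu>\<bar> * 1 \<le> 2 * \<bar>\<mu>\<bar> * real n" by (intro mult_left_mono) auto
  then show ?thesis using True by (simp add: dunkl_nat_def algebra_simps)
qed (simp add: dunkl_nat_def algebra_simps)

text \<open>Off-diagonal entry of the Jacobi matrices of position and momentum; the 2 comes from the
  factor \<open>1 / sqrt 2\<close> in the ladder operators.\<close>

definition dunkl_root :: "real \<Rightarrow> nat \<Rightarrow> real" where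
  "dunkl_root \<mu> n = sqrt (dunkl_nat \<mu> n / 2)"

lemma dunkl_root_0 [simp]: "dunkl_root \<mu> 0 = 0"
  by (simp add: dunkl_root_def)

lemma dunkl_root_square: "\<mu> > - 1 / 2 \<Longrightarrow> (dunkl_root \<mu> n)\<^sup>2 = dunkl_nat \<mu> n / 2"
  using dunkl_nat_nonneg[of \<mu> n] by (simp add: dunkl_root_def)

lemma dunkl_root_pos: "\<mu> > - 1 / 2 \<Longrightarrow> n > 0 \<Longrightarrow> dunkl_root \<mu> n > 0"
  using dunkl_nat_pos[of \<mu> n] by (simp add: dunkl_root_def)

lemma gamma_mu_0 [simp]: "\<mu> > - 1 / 2 \<Longrightarrow> gamma_mu \<mu> 0 = 1"
  using Gamma_real_pos[of "\<mu> + 1 / 2"] by (simp add: gamma_mu_def less_imp_neq[symmetric])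

text \<open>For even \<open>n\<close> the Gamma argument advances by one and the functional equation
  gives the factor \<open>n + 1 + 2 * \<mu>\<close>; for odd \<open>n\<close> the Gamma values agree
  and the factorial gives \<open>n + 1\<close>.\<close>

lemma gamma_mu_Suc:
  assumes "\<mu> > - 1 / 2"
  shows "gamma_mu \<mu> (Suc n) = dunkl_nat \<mu> (Suc n) * gamma_mu \<mu> n"
proof (cases "even n")
  case True
  then obtain m where n: "n = 2 * m" by (elim evenE)
  have "Gamma (real m + \<mu> + 1 / 2 + 1) = (real m + \<mu> + 1 / 2) * Gamma (real m + \<mu> + 1 / 2)"
    using assms by (intro Gamma_plus1) (auto simp: nonpos_Ints_def)
  moreover have "real m + \<mu> + 1 / 2 + 1 = real m + \<mu> + 3 / 2" by simp
  ultimately show ?thesis by (simp add: gamma_mu_def n dunkl_nat_def)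
next
  case False
  then obtain m where n: "n = 2 * m + 1" by (elim oddE)
  have "real (Suc m) + \<mu> + 1 / 2 = real m + \<mu> + 3 / 2" by simp
  then show ?thesis by (simp add: gamma_mu_def n dunkl_nat_def field_simps)
qed

lemma gamma_mu_pos: "\<mu> > - 1 / 2 \<Longrightarrow> gamma_mu \<mu> n > 0"
  by (induction n) (simp_all add: gamma_mu_Suc dunkl_nat_pos)

section \<open>The structure of an irreducible oscillator\<close>

lemma app_eq: "linear_operator T \<Longrightarrow> (x, y) \<in> T \<Longrightarrow> app T x = y"
  unfolding app_def by (rule the_equality) (auto dest: linear_operatorD(1) single_valuedD)

lemma sqrt_half_square: "complex_of_real (1 / sqrt 2) * complex_of_real (1 / sqrt 2) = 1 / 2"
proof -
  have "1 / sqrt 2 * (1 / sqrt 2) = (1 / 2 :: real)" by simp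
  then show ?thesis by (simp only: of_real_mult[symmetric]) simp
qed

text \<open>The intervals are nested, so both vectors lie in the range belonging to the larger
  one.\<close>

lemma (in spectral) smooth_space_add_scaleC:
  assumes "x \<in> smooth_space E" "y \<in> smooth_space E"
  shows "x + c *\<^sub>C y \<in> smooth_space E"
proof -
  let ?I = "\<lambda>n::nat. {- real n <..< real n}"
  obtain m n a b where x: "x = E (?I m) a" and y: "y = E (?I n) b"
    using assms by (auto simp: smooth_space_def)
  let ?N = "max m n"
  have "?I ?N \<inter> ?I m = ?I m" "?I ?N \<inter> ?I n = ?I n" by auto
  then have "E (?I ?N) x = x" "E (?I ?N) y = y" by (simp_all add: x y E_Int)
  then have "E (?I ?N) (x + c *\<^sub>C y) = x + c *\<^sub>C y"
    using clinear_E[of "?I ?N"] by (simp add: clinear_def)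
  then have "x + c *\<^sub>C y \<in> range (E (?I ?N))" by (metis rangeI)
  then show ?thesis unfolding smooth_space_def by blast
qed

text \<open>An eigenvector lies in the range of \<open>E {c}\<close>, and \<open>{c}\<close> is
  inside a bounded interval. This admits the ground state to the ladder algebra.\<close>

lemma (in spectral_operator) eigenvector_smooth:
  assumes "(x, complex_of_real c *\<^sub>C x) \<in> T"
  shows "x \<in> smooth_space E"
proof -
  obtain n where "\<bar>c\<bar> < real n" using reals_Archimedean2 by blast
  then have "{- real n <..< real n} \<inter> {c} = {c}" by auto
  then have "E {- real n <..< real n} x = x"
    using E_eigenvector[OF assms] E_Int[of "{- real n <..< real n}" "{c}" x] by simp
  then have "x \<in> range (E {- real n <..< real n})" by (metis rangeI)
  then show ?thesis unfolding smooth_space_def by blast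
qed

text \<open>Keeps of the smooth space what the ladder algebra works with: an invariant set inside
  all three domains, closed under the combinations \<open>x + c *\<^sub>C y\<close>.\<close>

locale oscillator =
  fixes P Q H :: "'a::complex_hilbert_space oper" and S :: "'a set"
  assumes sa: "selfadjoint P" "selfadjoint Q" "selfadjoint H"
    and S_add: "x \<in> S \<Longrightarrow> y \<in> S \<Longrightarrow> x + c *\<^sub>C y \<in> S"
    and dom: "x \<in> S \<Longrightarrow> x \<in> Domain P" "x \<in> S \<Longrightarrow> x \<in> Domain Q" "x \<in> S \<Longrightarrow> x \<in> Domain H"
    and closed: "x \<in> S \<Longrightarrow> app P x \<in> S" "x \<in> S \<Longrightarrow> app Q x \<in> S" "x \<in> S \<Longrightarrow> app H x \<in> S"
    and H_eq: "x \<in> S \<Longrightarrow> app H x = (1 / 2) *\<^sub>C (app P (app P x) + app Q (app Q x))"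
    and comm_P: "x \<in> S \<Longrightarrow> \<i> *\<^sub>C (app P (app H x) - app H (app P x)) = app Q x"
    and comm_Q: "x \<in> S \<Longrightarrow> \<i> *\<^sub>C (app Q (app H x) - app H (app Q x)) = - app P x"
begin

lemma lin: "linear_operator P" "linear_operator Q" "linear_operator H"
  using sa unfolding selfadjoint_def by blast+

lemma S_scaleC: "x \<in> S \<Longrightarrow> c *\<^sub>C x \<in> S"
  using S_add[of x x "c - 1"] by (simp add: scaleC_diff_left)

lemma app_in:
  "x \<in> S \<Longrightarrow> (x, app P x) \<in> P" "x \<in> S \<Longrightarrow> (x, app Q x) \<in> Q" "x \<in> S \<Longrightarrow> (x, app H x) \<in> H"
  using dom app_eq[OF lin(1)] app_eq[OF lin(2)] app_eq[OF lin(3)] by blast+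

lemma app_add:
  "x \<in> S \<Longrightarrow> y \<in> S \<Longrightarrow> app P (x + c *\<^sub>C y) = app P x + c *\<^sub>C app P y"
  "x \<in> S \<Longrightarrow> y \<in> S \<Longrightarrow> app Q (x + c *\<^sub>C y) = app Q x + c *\<^sub>C app Q y"
  "x \<in> S \<Longrightarrow> y \<in> S \<Longrightarrow> app H (x + c *\<^sub>C y) = app H x + c *\<^sub>C app H y"
  by (simp_all add: app_eq[OF lin(1)] app_eq[OF lin(2)] app_eq[OF lin(3)] app_in
      linear_operatorD[OF lin(1)] linear_operatorD[OF lin(2)] linear_operatorD[OF lin(3)])

lemma app_scaleC:
  "x \<in> S \<Longrightarrow> app P (c *\<^sub>C x) = c *\<^sub>C app P x"
  "x \<in> S \<Longrightarrow> app Q (c *\<^sub>C x) = c *\<^sub>C app Q x"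
  "x \<in> S \<Longrightarrow> app H (c *\<^sub>C x) = c *\<^sub>C app H x"
  using app_add[of x x "c - 1"] by (simp_all add: scaleC_diff_left)

lemma symmetric:
  "x \<in> S \<Longrightarrow> y \<in> S \<Longrightarrow> cinner (app P x) y = cinner x (app P y)"
  "x \<in> S \<Longrightarrow> y \<in> S \<Longrightarrow> cinner (app Q x) y = cinner x (app Q y)"
  "x \<in> S \<Longrightarrow> y \<in> S \<Longrightarrow> cinner (app H x) y = cinner x (app H y)"
  by (blast intro: selfadjoint_symmetric[OF sa(1) app_in(1) app_in(1)]
      selfadjoint_symmetric[OF sa(2) app_in(2) app_in(2)] selfadjoint_symmetric[OF sa(3) app_in(3) app_in(3)])+

definition annihilation :: "'a \<Rightarrow> 'a" where
  "annihilation x = complex_of_real (1 / sqrt 2) *\<^sub>C (app Q x + \<i> *\<^sub>C app P x)"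

lemma creation_alt: "creation P Q x = complex_of_real (1 / sqrt 2) *\<^sub>C (app Q x + (- \<i>) *\<^sub>C app P x)"
  by (simp add: creation_def scaleC_minus_left)

lemma creation_in: "x \<in> S \<Longrightarrow> creation P Q x \<in> S"
  and annihilation_in: "x \<in> S \<Longrightarrow> annihilation x \<in> S"
  unfolding creation_alt annihilation_def by (intro S_scaleC S_add closed; assumption)+

lemma creation_scaleC: "x \<in> S \<Longrightarrow> creation P Q (c *\<^sub>C x) = c *\<^sub>C creation P Q x"
  and annihilation_scaleC: "x \<in> S \<Longrightarrow> annihilation (c *\<^sub>C x) = c *\<^sub>C annihilation x"
  by (simp_all add: creation_alt annihilation_def app_scaleC scaleC_add_right scaleC_scaleC ac_simps)

lemma cinner_creation:
  "x \<in> S \<Longrightarrow> y \<in> S \<Longrightarrow> cinner (creation P Q x) y = cinner x (annihilation y)"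
  by (simp add: creation_alt annihilation_def cinner_scaleC_left cinner_scaleC_right cinner_add_left
      cinner_add_right symmetric cinner_diff_left scaleC_minus_left)

lemma app_Q_eq: "app Q x = complex_of_real (1 / sqrt 2) *\<^sub>C (annihilation x + creation P Q x)"
proof (rule cinner_ext)
  fix z
  have "complex_of_real (1 / sqrt 2) * (complex_of_real (1 / sqrt 2) * w) = w / 2" for w
    by (simp only: mult.assoc[symmetric] sqrt_half_square) simp
  then show "cinner (app Q x) z =
      cinner (complex_of_real (1 / sqrt 2) *\<^sub>C (annihilation x + creation P Q x)) z"
    by (simp only: creation_alt annihilation_def cinner_scaleC_left cinner_add_left distrib_left)
      (simp add: field_simps)
qed

lemma app_P_eq: "app P x = (- \<i> * complex_of_real (1 / sqrt 2)) *\<^sub>C (annihilation x - creation P Q x)"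
proof (rule cinner_ext)
  fix z
  have "complex_of_real (1 / sqrt 2) * (complex_of_real (1 / sqrt 2) * w) = w / 2" for w
    by (simp only: mult.assoc[symmetric] sqrt_half_square) simp
  then show "cinner (app P x) z =
      cinner ((- \<i> * complex_of_real (1 / sqrt 2)) *\<^sub>C (annihilation x - creation P Q x)) z"
    by (simp only: creation_alt annihilation_def cinner_scaleC_left cinner_add_left cinner_diff_left
        distrib_left right_diff_distrib mult.assoc) (simp add: field_simps)
qed

lemma app_H_app_Q: "x \<in> S \<Longrightarrow> app H (app Q x) = app Q (app H x) - \<i> *\<^sub>C app P x"
proof -
  assume "x \<in> S"
  then have "(- \<i>) *\<^sub>C (\<i> *\<^sub>C (app Q (app H x) - app H (app Q x))) = (- \<i>) *\<^sub>C (- app P x)"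
    by (simp only: comm_Q)
  then have "app Q (app H x) - app H (app Q x) = \<i> *\<^sub>C app P x"
    by (simp add: scaleC_scaleC scaleC_minus_left scaleC_minus_right)
  then show ?thesis by (simp add: algebra_simps)
qed

lemma app_H_app_P: "x \<in> S \<Longrightarrow> app H (app P x) = app P (app H x) + \<i> *\<^sub>C app Q x"
proof -
  assume "x \<in> S"
  then have "(- \<i>) *\<^sub>C (\<i> *\<^sub>C (app P (app H x) - app H (app P x))) = (- \<i>) *\<^sub>C (app Q x)"
    by (simp only: comm_P)
  then have "app P (app H x) - app H (app P x) = - (\<i> *\<^sub>C app Q x)"
    by (simp add: scaleC_scaleC scaleC_minus_left scaleC_minus_right)
  then show ?thesis by (simp add: algebra_simps)
qed

text \<open>The relation \<open>[H, A*] = A*\<close>: commutation with \<open>H\<close> rotates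
  \<open>Q\<close> and \<open>P\<close> into each other, and \<open>A*\<close> is an eigenvector of
  this rotation.\<close>

lemma H_creation: "x \<in> S \<Longrightarrow> app H (creation P Q x) = creation P Q (app H x) + creation P Q x"
  by (rule cinner_ext)
    (simp add: creation_alt app_scaleC app_add S_add closed app_H_app_Q app_H_app_P cinner_scaleC_left
      cinner_add_left cinner_diff_left algebra_simps)

lemma H_annihilation: "x \<in> S \<Longrightarrow> app H (annihilation x) = annihilation (app H x) - annihilation x"
  by (rule cinner_ext)
    (simp add: annihilation_def app_scaleC app_add S_add closed app_H_app_Q app_H_app_P cinner_scaleC_left
      cinner_add_left cinner_diff_left algebra_simps)

text \<open>In \<open>A A* + A* A\<close> the mixed products \<open>Q P\<close> and
  \<open>P Q\<close> cancel, and the squares add up to \<open>P^2 + Q^2 = 2 H\<close>.\<close>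

lemma annihilation_creation:
  assumes x: "x \<in> S"
  shows "annihilation (creation P Q x) = 2 *\<^sub>C app H x - creation P Q (annihilation x)"
proof (rule cinner_ext)
  fix z
  define r where "r = complex_of_real (1 / sqrt 2)"
  have rr: "r * r = 1 / 2" unfolding r_def by (rule sqrt_half_square)
  \<comment> \<open>The variables stand for the inner products with \<open>z\<close> of the four
    twofold products of \<open>Q\<close> and \<open>P\<close> applied to \<open>x\<close>.\<close>
  have eq: "r * (r * (qq + - \<i> * qp) + \<i> * (r * (pq + - \<i> * pp))) =
      2 * (1 / 2 * (pp + qq)) - r * (r * (qq + \<i> * qp) + - \<i> * (r * (pq + \<i> * pp)))" for qq qp pq pp
  proof -
    have "r * (r * (qq + - \<i> * qp) + \<i> * (r * (pq + - \<i> * pp))) +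
        r * (r * (qq + \<i> * qp) + - \<i> * (r * (pq + \<i> * pp))) = (r * r) * (2 * qq + 2 * pp)"
      by (simp add: algebra_simps)
    then show ?thesis by (simp add: rr algebra_simps)
  qed
  show "cinner (annihilation (creation P Q x)) z = cinner (2 *\<^sub>C app H x - creation P Q (annihilation x)) z"
    unfolding creation_alt annihilation_def r_def[symmetric]
    using x by (simp only: app_scaleC app_add S_add closed H_eq cinner_scaleC_left
      cinner_add_left cinner_diff_left S_scaleC eq)
qed

end

locale oscillator_ground_state = oscillator +
  fixes \<mu> :: real and \<phi>0 :: 'a
  assumes mu: "\<mu> > - 1 / 2" and S0: "\<phi>0 \<in> S" and norm0: "norm \<phi>0 = 1"
    and H0: "app H \<phi>0 = complex_of_real (\<mu> + 1 / 2) *\<^sub>C \<phi>0" and A0: "annihilation \<phi>0 = 0"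
begin

definition v :: "nat \<Rightarrow> 'a" where "v n = (creation P Q ^^ n) \<phi>0"

lemma v_0 [simp]: "v 0 = \<phi>0" and v_Suc: "v (Suc n) = creation P Q (v n)"
  by (simp_all add: v_def)

lemma v_in: "v n \<in> S"
  by (induction n) (simp_all add: S0 v_Suc creation_in)

lemma H_v: "app H (v n) = complex_of_real (\<mu> + 1 / 2 + n) *\<^sub>C v n"
proof (induction n)
  case (Suc n)
  then have "app H (v (Suc n)) = complex_of_real (\<mu> + 1 / 2 + n) *\<^sub>C v (Suc n) + 1 *\<^sub>C v (Suc n)"
    by (simp add: v_Suc H_creation v_in creation_scaleC)
  then show ?case by (simp only: scaleC_add_left[symmetric]) (simp add: ac_simps)
qed (simp add: H0)

text \<open>Induction through \<open>A A* = 2 H - A* A\<close>: twice the eigenvalue of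
  \<open>H\<close> minus the previous factor is the recurrence of \<open>dunkl_nat\<close>.\<close>

lemma annihilation_v: "annihilation (v n) = complex_of_real (dunkl_nat \<mu> n) *\<^sub>C v (n - 1)"
proof (induction n)
  case (Suc n)
  \<comment> \<open>For \<open>n = 0\<close> the index \<open>n - 1\<close> is again
    \<open>0\<close>, but then the coefficient vanishes.\<close>
  have "dunkl_nat \<mu> n = 0 \<or> creation P Q (v (n - 1)) = v n"
    by (cases n) (simp_all add: v_Suc)
  then have "creation P Q (annihilation (v n)) = complex_of_real (dunkl_nat \<mu> n) *\<^sub>C v n"
    unfolding Suc creation_scaleC[OF v_in] by auto
  then have "annihilation (v (Suc n)) =
      (complex_of_real (2 * (\<mu> + 1 / 2 + n)) - complex_of_real (dunkl_nat \<mu> n)) *\<^sub>C v n"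
    by (simp add: v_Suc annihilation_creation v_in H_v scaleC_scaleC scaleC_diff_left)
  then show ?case by (simp only: dunkl_nat_Suc of_real_diff) simp
qed (simp add: A0)

lemma norm_v: "cinner (v n) (v n) = complex_of_real (gamma_mu \<mu> n)"
proof (induction n)
  case 0
  then show ?case using mu norm0 by (simp add: cinner_self)
next
  case (Suc n)
  have "cinner (v (Suc n)) (v (Suc n)) = cinner (v n) (annihilation (v (Suc n)))"
    unfolding v_Suc[of n] by (rule cinner_creation) (simp_all add: v_in creation_in)
  also have "\<dots> = complex_of_real (dunkl_nat \<mu> (Suc n)) * cinner (v n) (v n)"
    by (simp add: annihilation_v cinner_scaleC_right)
  finally show ?case by (simp add: Suc gamma_mu_Suc[OF mu])
qed

text \<open>Eigenvectors of the symmetric operator \<open>H\<close> for different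
  eigenvalues.\<close>

lemma ortho_v: "m \<noteq> n \<Longrightarrow> cinner (v m) (v n) = 0"
proof -
  assume "m \<noteq> n"
  have "complex_of_real (\<mu> + 1 / 2 + m) * cinner (v m) (v n) =
      complex_of_real (\<mu> + 1 / 2 + n) * cinner (v m) (v n)"
    using symmetric(3)[OF v_in v_in, of m n] by (simp only: H_v cinner_scaleC_left cinner_scaleC_right
        complex_cnj_complex_of_real)
  then have "(complex_of_real (\<mu> + 1 / 2 + m) - complex_of_real (\<mu> + 1 / 2 + n)) * cinner (v m) (v n) = 0"
    by (simp only: left_diff_distrib) simp
  then have "cinner (v m) (v n) = 0 \<or> complex_of_real (\<mu> + 1 / 2 + m) = complex_of_real (\<mu> + 1 / 2 + n)"
    by (simp only: mult_eq_0_iff) auto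
  with \<open>m \<noteq> n\<close> show ?thesis by (simp only: of_real_eq_iff) auto
qed

abbreviation "\<phi> \<equiv> osc_phi \<mu> P Q \<phi>0"

lemma phi_eq: "\<phi> n = complex_of_real (1 / sqrt (gamma_mu \<mu> n)) *\<^sub>C v n"
  by (simp add: osc_phi_def v_def)

lemma phi_0: "\<phi> 0 = \<phi>0"
  using mu by (simp add: phi_eq)

lemma phi_in: "\<phi> n \<in> S"
  by (simp only: phi_eq S_scaleC v_in)

lemma H_phi: "(\<phi> n, complex_of_real (\<mu> + 1 / 2 + n) *\<^sub>C \<phi> n) \<in> H"
proof -
  have "app H (\<phi> n) = complex_of_real (\<mu> + 1 / 2 + n) *\<^sub>C \<phi> n"
    unfolding phi_eq app_scaleC[OF v_in] H_v scaleC_scaleC by (simp only: mult.commute)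
  then show ?thesis using app_in(3)[OF phi_in, of n] by simp
qed

sublocale orthonormal_sequence \<phi>
proof
  fix m n
  have "complex_of_real (1 / sqrt (gamma_mu \<mu> n) * (1 / sqrt (gamma_mu \<mu> n)) * gamma_mu \<mu> n) = 1"
    using gamma_mu_pos[OF mu, of n] by (simp add: real_div_sqrt flip: of_real_mult)
  then show "cinner (\<phi> m) (\<phi> n) = (if m = n then 1 else 0)"
    by (cases "m = n") (simp_all only: phi_eq cinner_scaleC_left cinner_scaleC_right norm_v ortho_v
        complex_cnj_complex_of_real of_real_mult mult.assoc if_True if_False mult_zero_right simp_thms)
qed

abbreviation "b \<equiv> dunkl_root \<mu>"

text \<open>The normalisation divides the factor \<open>dunkl_nat\<close> evenly between raising and
  lowering, which makes the resulting matrices Hermitian.\<close>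

lemma creation_phi: "creation P Q (\<phi> n) = complex_of_real (sqrt (dunkl_nat \<mu> (Suc n))) *\<^sub>C \<phi> (Suc n)"
proof -
  have "sqrt (dunkl_nat \<mu> (Suc n)) * (1 / sqrt (gamma_mu \<mu> (Suc n))) = 1 / sqrt (gamma_mu \<mu> n)"
    using dunkl_nat_pos[OF mu, of "Suc n"] by (simp add: gamma_mu_Suc[OF mu] real_sqrt_mult)
  then show ?thesis
    unfolding phi_eq creation_scaleC[OF v_in] v_Suc[symmetric] scaleC_scaleC
    by (simp only: of_real_mult[symmetric])
qed

lemma annihilation_phi: "annihilation (\<phi> n) = complex_of_real (sqrt (dunkl_nat \<mu> n)) *\<^sub>C \<phi> (n - 1)"
proof (cases n)
  case (Suc m)
  have "1 / sqrt (gamma_mu \<mu> (Suc m)) * dunkl_nat \<mu> (Suc m) =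
      sqrt (dunkl_nat \<mu> (Suc m)) * (1 / sqrt (gamma_mu \<mu> m))"
    using dunkl_nat_pos[OF mu, of "Suc m"] gamma_mu_pos[OF mu, of m]
    by (simp add: gamma_mu_Suc[OF mu] real_sqrt_mult field_simps)
  then show ?thesis
    unfolding phi_eq annihilation_scaleC[OF v_in] annihilation_v Suc scaleC_scaleC
    by (simp only: of_real_mult[symmetric] diff_Suc_1)
qed (simp add: phi_0 A0)

lemma Q_phi: "(\<phi> n, jacobi_image b 1 \<phi> n) \<in> Q"
  and P_phi: "(\<phi> n, jacobi_image b (- \<i>) \<phi> n) \<in> P"
proof -
  have r: "1 / sqrt 2 * sqrt (dunkl_nat \<mu> k) = b k" for k
    by (simp add: dunkl_root_def real_sqrt_divide)
  have "app Q (\<phi> n) = jacobi_image b 1 \<phi> n"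
    unfolding app_Q_eq annihilation_phi creation_phi
    by (simp only: scaleC_add_right scaleC_scaleC of_real_mult[symmetric] r jacobi_image_def) simp
  then show "(\<phi> n, jacobi_image b 1 \<phi> n) \<in> Q" using app_in(2)[OF phi_in, of n] by simp
  have "app P (\<phi> n) = jacobi_image b (- \<i>) \<phi> n"
    unfolding app_P_eq annihilation_phi creation_phi
    by (simp only: scaleC_diff_right scaleC_scaleC mult.assoc of_real_mult[symmetric] r jacobi_image_def)
      (simp add: scaleC_minus_left)
  then show "(\<phi> n, jacobi_image b (- \<i>) \<phi> n) \<in> P" using app_in(1)[OF phi_in, of n] by simp
qed

lemma b_0: "b 0 = 0" and b_square: "(b n)\<^sup>2 \<le> ((1 + 2 * \<bar>\<mu>\<bar>) / 2) * real n"
  using dunkl_nat_nonneg[OF mu, of n] dunkl_nat_le[of \<mu> n] by (simp_all add: dunkl_root_def)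

text \<open>Truncation puts the projected pair into the closure of the span of the
  \<open>\<phi> n\<close>, and this closure lies inside the closed operator.\<close>

lemma proj_commute:
  "(x, y) \<in> P \<Longrightarrow> (proj x, proj y) \<in> P" "(x, y) \<in> Q \<Longrightarrow> (proj x, proj y) \<in> Q"
proof -
  have *: "(proj x, proj y) \<in> T"
    if T: "selfadjoint T" and t: "\<And>n. (\<phi> n, jacobi_image b \<zeta> \<phi> n) \<in> T" and z: "cmod \<zeta> = 1"
      and xy: "(x, y) \<in> T" for T \<zeta>
  proof -
    have "cinner y (\<phi> n) = cinner x (jacobi_image b \<zeta> \<phi> n)" for n
      using selfadjoint_symmetric[OF T t xy] .
    from jacobi_approx[OF b_0 b_square z this] seq_closure_subset[of T \<phi> "jacobi_image b \<zeta> \<phi>", OF T t]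
    show ?thesis by blast
  qed
  show "(x, y) \<in> P \<Longrightarrow> (proj x, proj y) \<in> P" "(x, y) \<in> Q \<Longrightarrow> (proj x, proj y) \<in> Q"
    using *[OF sa(1) P_phi] *[OF sa(2) Q_phi] by simp_all
qed

text \<open>By irreducibility the projection is a scalar, and the scalar is \<open>1\<close> because
  the nonzero ground state is fixed.\<close>

lemma irreducible_basis:
  assumes irr: "irreducible_oscillator P Q"
  shows "orthonormal_basis \<phi>"
proof
  fix x
  note op = orthogonal_projection_proj
  have bounded: "bounded_operator proj"
    using op orthogonal_projection_norm(2)[OF op] unfolding bounded_operator_def orthogonal_projection_def
    by (metis mult_1)
  have "(proj x, proj y) \<in> exp_op c T" if "T \<in> {P, Q}" "(x, y) \<in> exp_op c T" for x y c T
  proof -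
    have T: "selfadjoint T" using that sa by auto
    have "(x, y) \<in> T \<Longrightarrow> (proj x, proj y) \<in> T" for x y using that(1) proj_commute by blast
    from exp_op_commute[OF T op this that(2)] show ?thesis by blast
  qed
  then have "\<forall>s::real. \<forall>T\<in>{P, Q}. \<forall>(x, y)\<in>exp_op (\<i> * s) T. (proj x, proj y) \<in> exp_op (\<i> * s) T"
    by blast
  with irr bounded obtain c where c: "\<And>x. proj x = c *\<^sub>C x"
    unfolding irreducible_oscillator_def by blast
  have "c *\<^sub>C \<phi>0 = \<phi>0" using c[of "\<phi> 0"] proj_basis[of 0] by (simp add: phi_0)
  then have "c * cinner \<phi>0 \<phi>0 = cinner \<phi>0 \<phi>0" by (metis cinner_scaleC_left)
  then have "c = 1" using norm0 by (simp add: cinner_self)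
  then show "proj x = x" using c by simp
qed

end

text \<open>If it were nonzero, \<open>annihilation \<phi>0\<close> would be an eigenvector of
  \<open>H\<close> for \<open>\<mu> - 1 / 2\<close>, below the smallest eigenvalue.\<close>

lemma oscillator_ground_stateI:
  assumes osc: "bose_like_oscillator P Q H"
    and mu: "\<mu> > - 1 / 2"
    and min: "\<And>r::real. is_eigenvalue H (complex_of_real r) \<Longrightarrow> \<mu> + 1 / 2 \<le> r"
    and norm: "norm \<phi>0 = 1"
    and H0: "(\<phi>0, complex_of_real (\<mu> + 1 / 2) *\<^sub>C \<phi>0) \<in> H"
  obtains S where "oscillator_ground_state P Q H S \<mu> \<phi>0"
proof -
  obtain E where E: "is_spectral_measure E H"
    and S: "\<forall>T \<in> {P, Q, H}. \<forall>x \<in> smooth_space E.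
          x \<in> Domain T \<and> app T x \<in> smooth_space E \<and> analytic_vector T x"
       "\<forall>x \<in> smooth_space E.
          app H x = (1 / 2) *\<^sub>C (app P (app P x) + app Q (app Q x)) \<and>
          \<i> *\<^sub>C (app P (app H x) - app H (app P x)) = app Q x \<and>
          \<i> *\<^sub>C (app Q (app H x) - app H (app Q x)) = - app P x"
    using osc unfolding bose_like_oscillator_def by blast
  have sa: "selfadjoint P" "selfadjoint Q" "selfadjoint H"
    using osc unfolding bose_like_oscillator_def by blast+
  interpret spectral_operator E H
    by unfold_locales (use E sa(3) in \<open>simp_all only: is_spectral_measure_def selfadjoint_def\<close>)
  interpret oscillator P Q H "smooth_space E"
    by unfold_locales (use S in \<open>blast intro: sa smooth_space_add_scaleC\<close>)+
  have S0: "\<phi>0 \<in> smooth_space E" by (rule eigenvector_smooth[OF H0])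
  have app0: "app H \<phi>0 = complex_of_real (\<mu> + 1 / 2) *\<^sub>C \<phi>0" by (rule app_eq[OF lin(3) H0])
  have "app H (annihilation \<phi>0) = complex_of_real (\<mu> - 1 / 2) *\<^sub>C annihilation \<phi>0"
  proof -
    have "app H (annihilation \<phi>0) = complex_of_real (\<mu> + 1 / 2) *\<^sub>C annihilation \<phi>0 - 1 *\<^sub>C annihilation \<phi>0"
      by (simp only: H_annihilation[OF S0] app0 annihilation_scaleC[OF S0] scaleC_one)
    then show ?thesis by (simp only: scaleC_diff_left[symmetric]) (simp add: of_real_diff)
  qed
  then have "(annihilation \<phi>0, complex_of_real (\<mu> - 1 / 2) *\<^sub>C annihilation \<phi>0) \<in> H"
    using app_in(3)[OF annihilation_in[OF S0]] by simp
  with min[of "\<mu> - 1 / 2"] have A0: "annihilation \<phi>0 = 0"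
    unfolding is_eigenvalue_def by auto
  have "oscillator_ground_state P Q H (smooth_space E) \<mu> \<phi>0"
    by unfold_locales (fact mu S0 norm app0 A0)+
  then show thesis by (rule that)
qed

section \<open>Functions of a diagonal operator\<close>

context spectral
begin

lemma E_atom:
  assumes "E {c} u = u" "A \<in> sets borel"
  shows "E A u = (if c \<in> A then u else 0)"
proof -
  have "E A u = E (A \<inter> {c}) u" using E_Int[of A "{c}" u] assms by simp
  then show ?thesis using assms by (cases "c \<in> A") auto
qed

lemma atom_spectral_domain:
  assumes c: "E {c} u = u" and [measurable]: "f \<in> borel_measurable borel"
  shows "u \<in> spectral_domain E f"
proof -
  interpret finite_measure "\<nu> u" by (rule finite_measure_\<nu>)
  have "AE t in \<nu> u. t \<in> {c}"
    by (rule AE_I[of _ _ "- {c}"]) (auto simp: emeasure_\<nu> E_Compl c)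
  then have "AE t in \<nu> u. ennreal ((cmod (f t))\<^sup>2) = ennreal ((cmod (f c))\<^sup>2)"
    by eventually_elim simp
  then have "(\<integral>\<^sup>+ t. ennreal ((cmod (f t))\<^sup>2) \<partial>\<nu> u) = (\<integral>\<^sup>+ t. ennreal ((cmod (f c))\<^sup>2) \<partial>\<nu> u)"
    by (rule nn_integral_cong_AE)
  also have "\<dots> < \<infinity>" by (simp add: ennreal_mult_less_top emeasure_eq_measure)
  finally show ?thesis by (simp add: spectral_domain_def)
qed

text \<open>Against a vector \<open>u\<close> concentrated at \<open>c\<close>, only the level set
  containing \<open>c\<close> survives in each simple approximant, and its value there tends to
  \<open>f c\<close>.\<close>

lemma spectral_integral_atom:
  assumes c: "E {c} u = u" and f: "f \<in> borel_measurable borel"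
    and xy: "(x, y) \<in> spectral_integral E f"
  shows "cinner y u = f c * cinner x u"
proof (rule LIMSEQ_unique)
  have x: "x \<in> spectral_domain E f" and u: "u \<in> spectral_domain E f"
    using xy atom_spectral_domain[OF c f] by (simp_all add: spectral_integral_def)
  have "cinner y u = sesq_integral E f x u" using xy u by (simp add: spectral_integral_def)
  then show "(\<lambda>i. cinner (simple_op (approx f i) x) u) \<longlonglongrightarrow> cinner y u"
    using sesq_integral_approx[OF f x u] by simp
  have "cinner (simple_op (approx f i) x) u = approx f i c * cinner x u" for i
  proof -
    note ap = simple_function_borelD[OF approx(1)[OF f]]
    have "cinner (simple_op (approx f i) x) u =
        (\<Sum>d\<in>range (approx f i). d * (if approx f i c = d then cinner x u else 0))"
      unfolding simple_op_def cinner_sum_left cinner_scaleC_left E_selfadjoint[OF ap(2)]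
      by (intro sum.cong refl) (simp add: E_atom[OF c ap(2)])
    also have "\<dots> = (\<Sum>d\<in>{approx f i c}. d * (if approx f i c = d then cinner x u else 0))"
      using ap(1) by (intro sum.mono_neutral_right) auto
    finally show ?thesis by simp
  qed
  then show "(\<lambda>i. cinner (simple_op (approx f i) x) u) \<longlonglongrightarrow> f c * cinner x u"
    by (simp add: tendsto_intros approx(2)[OF f])
qed

end

section \<open>The spectral measure of a diagonal operator\<close>

context orthonormal_basis
begin

text \<open>The scalar spectral measure of \<open>x\<close> for the diagonal operator: the squared
  modulus of the \<open>n\<close>th coefficient sits at \<open>l n\<close>. As an image of a
  weighted counting measure it allows repeated values of \<open>l\<close>.\<close>

definition atomic_measure :: "(nat \<Rightarrow> real) \<Rightarrow> 'a \<Rightarrow> real measure" where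
  "atomic_measure l x =
     distr (density (count_space UNIV) (\<lambda>n. ennreal ((cmod (cinner x (\<phi> n)))\<^sup>2))) borel l"

lemma nn_integral_atomic_measure:
  assumes [measurable]: "f \<in> borel_measurable borel"
  shows "(\<integral>\<^sup>+ t. f t \<partial>atomic_measure l x) = (\<Sum>n. ennreal ((cmod (cinner x (\<phi> n)))\<^sup>2) * f (l n))"
  unfolding atomic_measure_def
  by (subst nn_integral_distr) (auto simp: nn_integral_density nn_integral_count_space_nat)

lemma emeasure_atomic_measure:
  assumes A: "A \<in> sets borel"
    and y: "\<And>n. cinner y (\<phi> n) = (if l n \<in> A then cinner x (\<phi> n) else 0)"
  shows "emeasure (atomic_measure l x) A = ennreal ((norm y)\<^sup>2)"
proof -
  have "emeasure (atomic_measure l x) A = (\<integral>\<^sup>+ t. indicator A t \<partial>atomic_measure l x)"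
    using A by (simp add: atomic_measure_def)
  also have "\<dots> = (\<Sum>n. ennreal ((cmod (cinner x (\<phi> n)))\<^sup>2) * indicator A (l n))"
    using A by (intro nn_integral_atomic_measure) simp
  also have "\<dots> = (\<Sum>n. ennreal ((cmod (cinner y (\<phi> n)))\<^sup>2))"
    by (intro suminf_cong) (simp add: y indicator_def)
  also have "\<dots> = ennreal ((norm y)\<^sup>2)"
    by (intro suminf_ennreal_eq parseval_norm) simp
  finally show ?thesis .
qed

text \<open>Testing against each \<open>\<phi> n\<close> gives one inclusion. For the other, the
  measure of \<open>x\<close> is atomic, so the integral of \<open>|f|^2\<close> is
  \<open>\<parallel>y\<parallel>^2\<close> and \<open>x\<close> is in the domain; the value there
  has the coefficients of \<open>y\<close>.\<close>

lemma spectral_integral_eq_diag_op: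
  assumes E: "spectral E" and atom: "\<And>n. E {l n} (\<phi> n) = \<phi> n" and f: "f \<in> borel_measurable borel"
  shows "spectral_integral E f = diag_op (\<lambda>n. f (l n))"
proof -
  interpret spectral E by (rule E)
  have sub: "cinner y (\<phi> n) = f (l n) * cinner x (\<phi> n)" if "(x, y) \<in> spectral_integral E f" for x y n
    by (rule spectral_integral_atom[OF atom f that])
  show ?thesis
  proof (intro equalityI subsetI)
    fix p assume "p \<in> diag_op (\<lambda>n. f (l n))"
    then obtain x y where p: "p = (x, y)" and xy: "\<And>n. cinner y (\<phi> n) = f (l n) * cinner x (\<phi> n)"
      by (auto simp: diag_op_def)
    have \<nu>: "\<nu> x = atomic_measure l x"
    proof (rule measure_eqI)
      fix A assume "A \<in> sets (\<nu> x)"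
      then have A: "A \<in> sets borel" by simp
      have "cinner (E A x) (\<phi> n) = (if l n \<in> A then cinner x (\<phi> n) else 0)" for n
        by (simp add: E_selfadjoint[OF A] E_atom[OF atom A])
      then show "emeasure (\<nu> x) A = emeasure (atomic_measure l x) A"
        by (simp add: emeasure_\<nu>[OF A] emeasure_atomic_measure[OF A, of "E A x"])
    qed (simp add: atomic_measure_def)
    have "(\<integral>\<^sup>+ t. ennreal ((cmod (f t))\<^sup>2) \<partial>\<nu> x) = (\<Sum>n. ennreal ((cmod (cinner y (\<phi> n)))\<^sup>2))"
      using f by (simp add: \<nu> nn_integral_atomic_measure xy norm_mult power_mult_distrib ennreal_mult mult.commute)
    also have "\<dots> = ennreal ((norm y)\<^sup>2)"
      by (intro suminf_ennreal_eq parseval_norm) simp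
    finally have "x \<in> spectral_domain E f" by (simp add: spectral_domain_def)
    then obtain y' where y': "(x, y') \<in> spectral_integral E f"
      using simple_op_approx_tendsto[OF f] by blast
    then have "y' = y" by (intro eqI) (simp add: sub xy)
    with y' p show "p \<in> spectral_integral E f" by simp
  qed (use sub in \<open>auto simp: diag_op_def\<close>)
qed

definition diag_pvm :: "(nat \<Rightarrow> real) \<Rightarrow> real set \<Rightarrow> 'a \<Rightarrow> 'a" where
  "diag_pvm l A x = (\<Sum>n. (if l n \<in> A then cinner x (\<phi> n) else 0) *\<^sub>C \<phi> n)"

lemma cinner_diag_pvm: "cinner (diag_pvm l A x) (\<phi> n) = (if l n \<in> A then cinner x (\<phi> n) else 0)"
proof -
  have "summable (\<lambda>n. (cmod (if l n \<in> A then cinner x (\<phi> n) else 0))\<^sup>2)"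
    by (rule summable_comparison_test'[OF bessel[of x], where N = 0]) auto
  from cinner_sums[OF summable_sums[OF summable_expansion[OF this]]]
  show ?thesis by (simp add: diag_pvm_def)
qed

text \<open>The remainder of the series is the projection for a tail union, and its squared norm is
  the finite measure of sets decreasing to the empty set.\<close>

lemma diag_pvm_sums:
  fixes A :: "nat \<Rightarrow> real set"
  assumes A: "\<And>i. A i \<in> sets borel" "disjoint_family A"
  shows "(\<lambda>i. diag_pvm l (A i) x) sums diag_pvm l (\<Union>i. A i) x"
proof -
  let ?M = "atomic_measure l x" and ?R = "\<lambda>N. (\<Union>i\<in>{N..}. A i)"
  have R [measurable]: "?R N \<in> sets borel" for N using A by auto
  have ms: "emeasure ?M B = ennreal ((norm (diag_pvm l B x))\<^sup>2)" if "B \<in> sets borel" for B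
    by (rule emeasure_atomic_measure[OF that cinner_diag_pvm])
  have sets_M: "sets ?M = sets borel" by (simp add: atomic_measure_def)
  interpret finite_measure ?M
    by (rule finite_measureI) (use ms[of UNIV] in \<open>simp add: atomic_measure_def\<close>)
  have rest: "diag_pvm l (\<Union>i. A i) x - (\<Sum>i<N. diag_pvm l (A i) x) = diag_pvm l (?R N) x" for N
  proof (rule eqI)
    fix n
    show "cinner (diag_pvm l (\<Union>i. A i) x - (\<Sum>i<N. diag_pvm l (A i) x)) (\<phi> n) =
        cinner (diag_pvm l (?R N) x) (\<phi> n)"
    proof (cases "\<exists>i. l n \<in> A i")
      case True
      then obtain i where i: "l n \<in> A i" by blast
      then have "l n \<in> A j \<longleftrightarrow> j = i" for j
        using A(2) by (auto simp: disjoint_family_on_def)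
      then show ?thesis
        by (auto simp: cinner_diff_left cinner_sum_left cinner_diag_pvm)
    qed (simp add: cinner_diff_left cinner_sum_left cinner_diag_pvm)
  qed
  have "(\<lambda>N. measure ?M (?R N)) \<longlonglongrightarrow> measure ?M (\<Inter>N. ?R N)"
  proof (rule finite_Lim_measure_decseq)
    show "range ?R \<subseteq> sets ?M" using R by (auto simp: sets_M)
    show "decseq ?R" unfolding decseq_def by (intro allI impI UN_mono) auto
  qed
  moreover have "(\<Inter>N. ?R N) = {}"
  proof safe
    fix t assume t: "t \<in> (\<Inter>N. ?R N)"
    then obtain i where i: "t \<in> A i" by auto
    from t have "t \<in> ?R (Suc i)" by blast
    then obtain j where "t \<in> A j" "j > i" by auto
    moreover from \<open>j > i\<close> A(2) have "A i \<inter> A j = {}" by (simp add: disjoint_family_on_def)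
    ultimately show "t \<in> {}" using i by blast
  qed
  ultimately have "(\<lambda>N. sqrt (measure ?M (?R N))) \<longlonglongrightarrow> sqrt 0"
    by (intro tendsto_real_sqrt) simp
  moreover have "sqrt (measure ?M (?R N)) = norm (diag_pvm l (?R N) x)" for N
    using ms[OF R] by (simp add: measure_def)
  ultimately have "(\<lambda>N. norm (diag_pvm l (\<Union>i. A i) x - (\<Sum>i<N. diag_pvm l (A i) x))) \<longlonglongrightarrow> 0"
    by (simp add: rest)
  then have "(\<lambda>N. diag_pvm l (\<Union>i. A i) x - (\<Sum>i<N. diag_pvm l (A i) x)) \<longlonglongrightarrow> 0"
    by (simp add: tendsto_norm_zero_iff)
  from tendsto_diff[OF tendsto_const[of "diag_pvm l (\<Union>i. A i) x"] this]
  show ?thesis by (simp add: sums_def)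
qed

lemma spectral_diag_pvm: "spectral (diag_pvm l)"
proof
  have proj: "orthogonal_projection (diag_pvm l A)" for A
    unfolding orthogonal_projection_def clinear_def
  proof (intro conjI allI)
    fix x y c
    show "diag_pvm l A (x + y) = diag_pvm l A x + diag_pvm l A y"
      "diag_pvm l A (c *\<^sub>C x) = c *\<^sub>C diag_pvm l A x" "diag_pvm l A (diag_pvm l A x) = diag_pvm l A x"
      by (rule eqI, simp add: cinner_diag_pvm cinner_add_left cinner_scaleC_left)+
    have "(\<lambda>n. cinner (diag_pvm l A x) (\<phi> n) * cnj (cinner y (\<phi> n))) =
        (\<lambda>n. cinner x (\<phi> n) * cnj (cinner (diag_pvm l A y) (\<phi> n)))"
      by (auto simp: cinner_diag_pvm)
    then show "cinner (diag_pvm l A x) y = cinner x (diag_pvm l A y)"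
      using parseval[of "diag_pvm l A x" y] parseval[of x "diag_pvm l A y"] by (simp add: sums_iff)
  qed
  have "diag_pvm l UNIV = (\<lambda>x. x)"
    by (intro ext eqI) (simp add: cinner_diag_pvm)
  moreover have "(\<lambda>n. diag_pvm l (A n) x) sums diag_pvm l (\<Union>n. A n) x"
    if "range A \<subseteq> sets borel" "disjoint_family A" for A :: "nat \<Rightarrow> real set" and x
    using that by (intro diag_pvm_sums) auto
  ultimately show "projection_valued_measure (diag_pvm l)"
    using proj unfolding projection_valued_measure_def by blast
qed

lemma diag_pvm_atom: "diag_pvm l {l n} (\<phi> n) = \<phi> n"
  by (rule eqI) (auto simp: cinner_diag_pvm ortho)

lemma dense_diag_op: "closure (Domain (diag_op l)) = UNIV"
proof (intro equalityI subsetI)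
  fix x
  let ?X = "\<lambda>N. \<Sum>n<N. cinner x (\<phi> n) *\<^sub>C \<phi> n"
  have "(?X N, \<Sum>n<N. (l n * cinner x (\<phi> n)) *\<^sub>C \<phi> n) \<in> diag_op l" for N
    by (simp add: diag_op_def cinner_expansion)
  then have "?X N \<in> Domain (diag_op l)" for N by blast
  moreover have "?X \<longlonglongrightarrow> x" using sums_expansion[of x] by (simp add: sums_def)
  ultimately show "x \<in> closure (Domain (diag_op l))"
    unfolding closure_sequential by (intro exI[of _ ?X]) simp
qed simp

text \<open>\<open>op_fun\<close> admits every spectral measure of the operator: the inclusion from
  left to right is proved for all of them, and \<open>diag_pvm\<close> shows that there is
  one.\<close>

theorem op_fun_diag_op:
  assumes f: "f \<in> borel_measurable borel"
  shows "op_fun f (diag_op (\<lambda>n. complex_of_real (l n))) = diag_op (\<lambda>n. f (l n))"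
proof (intro equalityI subsetI)
  let ?T = "diag_op (\<lambda>n. complex_of_real (l n))"
  {
    fix p assume "p \<in> op_fun f ?T"
    then obtain E where E: "is_spectral_measure E ?T" and p: "p \<in> spectral_integral E f"
      unfolding op_fun_def by blast
    interpret spectral_operator E ?T
    proof
      show "projection_valued_measure E" "?T = spectral_integral E complex_of_real"
        using E unfolding is_spectral_measure_def by blast+
    qed (rule dense_diag_op)
    have "E {l n} (\<phi> n) = \<phi> n" for n
      by (rule E_eigenvector) (simp add: diag_op_def cinner_scaleC_left ortho)
    from spectral_integral_eq_diag_op[OF spectral_axioms this f] p
    show "p \<in> diag_op (\<lambda>n. f (l n))" by simp
  }
  fix p assume p: "p \<in> diag_op (\<lambda>n. f (l n))"
  have "is_spectral_measure (diag_pvm l) ?T"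
    using spectral_diag_pvm spectral_integral_eq_diag_op[OF spectral_diag_pvm diag_pvm_atom]
    by (simp add: is_spectral_measure_def spectral_def)
  moreover have "p \<in> spectral_integral (diag_pvm l) f"
    using p spectral_integral_eq_diag_op[OF spectral_diag_pvm diag_pvm_atom f] by simp
  ultimately show "p \<in> op_fun f ?T"
    unfolding op_fun_def by (cases p) blast
qed

lemma shift_diag_op: "shift_operator (diag_op l) c = diag_op (\<lambda>n. l n - c)"
proof (intro equalityI subsetI)
  fix p assume "p \<in> diag_op (\<lambda>n. l n - c)"
  then obtain x y where p: "p = (x, y)" and xy: "\<And>n. cinner y (\<phi> n) = (l n - c) * cinner x (\<phi> n)"
    by (auto simp: diag_op_def)
  then have "(x, y + c *\<^sub>C x) \<in> diag_op l"
    by (simp add: diag_op_def cinner_add_left cinner_scaleC_left algebra_simps)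
  then show "p \<in> shift_operator (diag_op l) c"
    unfolding shift_operator_def p by force
qed (auto simp: shift_operator_def diag_op_def cinner_diff_left cinner_scaleC_left algebra_simps)

end

context oscillator_ground_state
begin

text \<open>After the shift the eigenvalues are the natural numbers, so the exponentials are powers
  of \<open>exp c\<close>. \<open>J\<close> and \<open>F\<close> differ only in this base.\<close>

lemma osc_exp_op:
  assumes "orthonormal_basis \<phi>"
  shows "exp_op c (shift_operator H (complex_of_real (\<mu> + 1 / 2))) =
    orthonormal_basis.diag_op \<phi> (\<lambda>n. exp c ^ n)"
proof -
  interpret orthonormal_basis \<phi> by (rule assms)
  have "H = diag_op (\<lambda>n. complex_of_real (\<mu> + 1 / 2 + real n))"
    by (rule diagonal_selfadjoint_eq(1)[OF sa(3) H_phi])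
  then have "shift_operator H (complex_of_real (\<mu> + 1 / 2)) = diag_op (\<lambda>n. complex_of_real (real n))"
    by (simp only: shift_diag_op of_real_diff[symmetric]) simp
  then have "exp_op c (shift_operator H (complex_of_real (\<mu> + 1 / 2))) =
      diag_op (\<lambda>n. exp (c * complex_of_real (real n)))"
    unfolding exp_op_def by (subst op_fun_diag_op[symmetric]) auto
  also have "(\<lambda>n. exp (c * complex_of_real (real n))) = (\<lambda>n. exp c ^ n)"
    by (intro ext) (simp add: exp_of_nat_mult[symmetric] mult.commute)
  finally show ?thesis .
qed

end

section \<open>The Hilbert space \<open>L\<^sup>2\<^sub>\<mu>(\<real>)\<close>\<close>

lemma ae_eq_refl [simp]: "ae_eq f f \<longleftrightarrow> f \<in> borel_measurable lebesgue"
  by (simp add: ae_eq_def)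

lemma abs_fclass_eqI:
  "f \<in> borel_measurable lebesgue \<Longrightarrow> g \<in> borel_measurable lebesgue \<Longrightarrow> (AE t in lebesgue. f t = g t) \<Longrightarrow>
    abs_fclass f = abs_fclass g"
  by (rule Quotient_rel_abs[OF Quotient_fclass]) (simp add: ae_eq_def)

lemma abs_fclass_eqD:
  "f \<in> borel_measurable lebesgue \<Longrightarrow> g \<in> borel_measurable lebesgue \<Longrightarrow> abs_fclass f = abs_fclass g \<Longrightarrow>
    AE t in lebesgue. f t = g t"
  using Quotient_rel[OF Quotient_fclass, of f g] by (simp add: ae_eq_def)

lemma rep_fclass_measurable: "rep_fclass F \<in> borel_measurable lebesgue"
  using Quotient_rep_reflp[OF Quotient_fclass, of F] by simp

lemma abs_rep_fclass: "abs_fclass (rep_fclass F) = F"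
  by (rule Quotient_abs_rep[OF Quotient_fclass])

lemma fclass_cases:
  obtains f where "f \<in> borel_measurable lebesgue" "F = abs_fclass f"
  using rep_fclass_measurable[of F] abs_rep_fclass[of F] by metis

lemma measurable_weight_measure [simp]:
  "g \<in> measurable (weight_measure \<mu>) N \<longleftrightarrow> g \<in> measurable lebesgue N"
  unfolding weight_measure_def by (rule measurable_density_eq1)

lemma borel_measurable_cnj_lebesgue:
  "f \<in> borel_measurable M \<Longrightarrow> (\<lambda>t. cnj (f t)) \<in> borel_measurable M"
  by (rule borel_measurable_continuous_on[where f = cnj]) (intro continuous_intros)

lemma abs_fclass_ops:
  assumes "f \<in> borel_measurable lebesgue" "g \<in> borel_measurable lebesgue"
  shows "abs_fclass f + abs_fclass g = abs_fclass (\<lambda>t. f t + g t)"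
    "abs_fclass f - abs_fclass g = abs_fclass (\<lambda>t. f t - g t)"
    "c *\<^sub>C abs_fclass f = abs_fclass (\<lambda>t. c * f t)"
  using assms by (simp_all add: plus_fclass.abs_eq minus_fclass.abs_eq scaleC_fclass.abs_eq)

lemma abs_fclass_0: "0 = abs_fclass (\<lambda>t. 0)"
  by (rule zero_fclass.abs_eq)

lemma measurable_sum_scaled:
  fixes f :: "nat \<Rightarrow> real \<Rightarrow> complex"
  assumes "\<And>n. f n \<in> borel_measurable lebesgue"
  shows "(\<lambda>t. \<Sum>n\<in>A. c n * f n t) \<in> borel_measurable lebesgue"
  by (intro borel_measurable_sum borel_measurable_times borel_measurable_const assms)

lemma abs_fclass_sum:
  fixes f :: "nat \<Rightarrow> real \<Rightarrow> complex"
  assumes f: "\<And>n. f n \<in> borel_measurable lebesgue"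
  shows "(\<Sum>n\<in>A. c n *\<^sub>C abs_fclass (f n)) = abs_fclass (\<lambda>t. \<Sum>n\<in>A. c n * f n t)"
proof (induction A rule: infinite_finite_induct)
  case (insert x A)
  have "(\<lambda>t. c x * f x t) \<in> borel_measurable lebesgue"
    by (intro borel_measurable_times borel_measurable_const f)
  with insert show ?case
    using measurable_sum_scaled[of f, OF f] by (simp add: abs_fclass_ops(3)[OF f f] abs_fclass_ops(1))
qed (simp_all add: abs_fclass_0)

lemma l2_sq_abs:
  "f \<in> borel_measurable lebesgue \<Longrightarrow> l2_sq \<mu> (abs_fclass f) = (\<integral>\<^sup>+ t. ennreal ((cmod (f t))\<^sup>2) \<partial>weight_measure \<mu>)"
  by (simp add: l2_sq.abs_eq)

lemma l2_inner_abs: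
  "f \<in> borel_measurable lebesgue \<Longrightarrow> g \<in> borel_measurable lebesgue \<Longrightarrow>
    l2_inner \<mu> (abs_fclass f) (abs_fclass g) = (LINT t|weight_measure \<mu>. f t * cnj (g t))"
  by (simp add: l2_inner.abs_eq)

lemma borel_measurable_cmod_square:
  fixes f :: "_ \<Rightarrow> complex"
  shows "f \<in> borel_measurable M \<Longrightarrow> (\<lambda>t. (cmod (f t))\<^sup>2) \<in> borel_measurable M"
  by measurable

lemma L2_abs_iff:
  assumes "f \<in> borel_measurable lebesgue"
  shows "abs_fclass f \<in> L2 \<mu> \<longleftrightarrow> integrable (weight_measure \<mu>) (\<lambda>t. (cmod (f t))\<^sup>2)"
  using assms borel_measurable_cmod_square[OF assms]
  by (simp add: L2_def l2_sq_abs integrable_iff_bounded)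

lemma L2_integrable_mult:
  fixes f g :: "real \<Rightarrow> complex"
  assumes m: "f \<in> borel_measurable lebesgue" "g \<in> borel_measurable lebesgue"
    and f: "integrable (weight_measure \<mu>) (\<lambda>t. (cmod (f t))\<^sup>2)"
    and g: "integrable (weight_measure \<mu>) (\<lambda>t. (cmod (g t))\<^sup>2)"
  shows "integrable (weight_measure \<mu>) (\<lambda>t. f t * g t)"
proof (rule Bochner_Integration.integrable_bound)
  show "integrable (weight_measure \<mu>) (\<lambda>t. (cmod (f t))\<^sup>2 + (cmod (g t))\<^sup>2)"
    by (intro Bochner_Integration.integrable_add f g)
  have "cmod a * cmod b \<le> (cmod a)\<^sup>2 + (cmod b)\<^sup>2" for a b
    using sum_squares_bound[of "cmod a" "cmod b"] mult_nonneg_nonneg[OF norm_ge_zero[of a] norm_ge_zero[of b]]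
    by linarith
  then show "AE t in weight_measure \<mu>. norm (f t * g t) \<le> norm ((cmod (f t))\<^sup>2 + (cmod (g t))\<^sup>2)"
    by (intro AE_I2) (simp add: norm_mult)
  show "(\<lambda>t. f t * g t) \<in> borel_measurable (weight_measure \<mu>)"
    using borel_measurable_times[OF m] by simp
qed

lemma L2_integrable_inner:
  assumes "f \<in> borel_measurable lebesgue" "g \<in> borel_measurable lebesgue"
    and "abs_fclass f \<in> L2 \<mu>" "abs_fclass g \<in> L2 \<mu>"
  shows "integrable (weight_measure \<mu>) (\<lambda>t. f t * cnj (g t))"
  using assms by (intro L2_integrable_mult) (simp_all add: L2_abs_iff borel_measurable_cnj_lebesgue)

lemma L2_zero: "0 \<in> L2 \<mu>"
  by (simp add: abs_fclass_0 L2_abs_iff)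

lemma L2_scaleC: "F \<in> L2 \<mu> \<Longrightarrow> c *\<^sub>C F \<in> L2 \<mu>"
  by (rule fclass_cases[of F])
    (simp add: abs_fclass_ops(3) L2_abs_iff norm_mult power_mult_distrib borel_measurable_times)

lemma L2_add: "F \<in> L2 \<mu> \<Longrightarrow> G \<in> L2 \<mu> \<Longrightarrow> F + G \<in> L2 \<mu>"
proof (rule fclass_cases[of F], rule fclass_cases[of G])
  fix f g assume FG: "F \<in> L2 \<mu>" "G \<in> L2 \<mu>" "F = abs_fclass f" "G = abs_fclass g"
    and m: "f \<in> borel_measurable lebesgue" "g \<in> borel_measurable lebesgue"
  have "integrable (weight_measure \<mu>) (\<lambda>t. (cmod (f t + g t))\<^sup>2)"
  proof (rule Bochner_Integration.integrable_bound)
    show "integrable (weight_measure \<mu>) (\<lambda>t. 2 * (cmod (f t))\<^sup>2 + 2 * (cmod (g t))\<^sup>2)"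
      using FG m by (simp add: L2_abs_iff)
    show "AE t in weight_measure \<mu>. norm ((cmod (f t + g t))\<^sup>2) \<le> norm (2 * (cmod (f t))\<^sup>2 + 2 * (cmod (g t))\<^sup>2)"
      using norm_add_square_le[of "f _" "g _"] by (intro AE_I2) (simp add: abs_of_nonneg)
    show "(\<lambda>t. (cmod (f t + g t))\<^sup>2) \<in> borel_measurable (weight_measure \<mu>)"
      using borel_measurable_cmod_square[OF borel_measurable_add[OF m]] by simp
  qed
  then show "F + G \<in> L2 \<mu>"
    using FG m by (simp add: abs_fclass_ops L2_abs_iff borel_measurable_add)
qed

lemma L2_diff: "F \<in> L2 \<mu> \<Longrightarrow> G \<in> L2 \<mu> \<Longrightarrow> F - G \<in> L2 \<mu>"
  using L2_add[of F \<mu> "(- 1) *\<^sub>C G"] L2_scaleC[of G \<mu> "- 1"] by (simp add: scaleC_minus_left)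

lemma L2_sum: "(\<And>n. n \<in> A \<Longrightarrow> F n \<in> L2 \<mu>) \<Longrightarrow> (\<Sum>n\<in>A. c n *\<^sub>C F n) \<in> L2 \<mu>"
  by (induction A rule: infinite_finite_induct) (simp_all add: L2_zero L2_add L2_scaleC)

lemma l2_inner_add_left:
  assumes "F \<in> L2 \<mu>" "G \<in> L2 \<mu>" "K \<in> L2 \<mu>"
  shows "l2_inner \<mu> (F + G) K = l2_inner \<mu> F K + l2_inner \<mu> G K"
proof (rule fclass_cases[of F], rule fclass_cases[of G], rule fclass_cases[of K])
  fix f g k assume *: "F = abs_fclass f" "G = abs_fclass g" "K = abs_fclass k"
    and m: "f \<in> borel_measurable lebesgue" "g \<in> borel_measurable lebesgue" "k \<in> borel_measurable lebesgue"
  show ?thesis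
    using L2_integrable_inner[OF m(1,3), of \<mu>] L2_integrable_inner[OF m(2,3), of \<mu>] assms m
    by (simp add: * abs_fclass_ops l2_inner_abs borel_measurable_add distrib_right)
qed

lemma l2_inner_scaleC_left: "l2_inner \<mu> (c *\<^sub>C F) K = c * l2_inner \<mu> F K"
proof (rule fclass_cases[of F], rule fclass_cases[of K])
  fix f k assume *: "F = abs_fclass f" "K = abs_fclass k"
    and m: "f \<in> borel_measurable lebesgue" "k \<in> borel_measurable lebesgue"
  show ?thesis
    using m by (simp add: * abs_fclass_ops l2_inner_abs borel_measurable_times mult.assoc)
qed

lemma l2_inner_commute: "l2_inner \<mu> F G = cnj (l2_inner \<mu> G F)"
proof (rule fclass_cases[of F], rule fclass_cases[of G])
  fix f g assume *: "F = abs_fclass f" "G = abs_fclass g"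
    and m: "f \<in> borel_measurable lebesgue" "g \<in> borel_measurable lebesgue"
  have "(LINT t|weight_measure \<mu>. f t * cnj (g t)) = (LINT t|weight_measure \<mu>. cnj (g t * cnj (f t)))"
    by (simp add: mult.commute)
  also have "\<dots> = cnj (LINT t|weight_measure \<mu>. g t * cnj (f t))"
    by (rule Bochner_Integration.integral_cnj)
  finally show ?thesis using m by (simp only: * l2_inner_abs)
qed

lemma l2_inner_minus_left: "l2_inner \<mu> (- F) K = - l2_inner \<mu> F K"
  using l2_inner_scaleC_left[of \<mu> "- 1" F K] by (simp add: scaleC_minus_left)

lemma l2_inner_diff_left:
  assumes "F \<in> L2 \<mu>" "G \<in> L2 \<mu>" "K \<in> L2 \<mu>"
  shows "l2_inner \<mu> (F - G) K = l2_inner \<mu> F K - l2_inner \<mu> G K"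
  using l2_inner_add_left[of F \<mu> "- G" K] assms L2_scaleC[of G \<mu> "- 1"]
  by (simp add: l2_inner_minus_left scaleC_minus_left)

lemma l2_inner_0_left [simp]: "l2_inner \<mu> 0 K = 0"
  using l2_inner_scaleC_left[of \<mu> 0 0 K] by simp

lemma l2_inner_sum_left:
  assumes "\<And>n. n \<in> A \<Longrightarrow> F n \<in> L2 \<mu>" "K \<in> L2 \<mu>"
  shows "l2_inner \<mu> (\<Sum>n\<in>A. c n *\<^sub>C F n) K = (\<Sum>n\<in>A. c n * l2_inner \<mu> (F n) K)"
  using assms
  by (induction A rule: infinite_finite_induct)
    (simp_all add: l2_inner_add_left l2_inner_scaleC_left L2_sum L2_scaleC)

lemma l2_inner_add_right:
  assumes "F \<in> L2 \<mu>" "G \<in> L2 \<mu>" "K \<in> L2 \<mu>"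
  shows "l2_inner \<mu> K (F + G) = l2_inner \<mu> K F + l2_inner \<mu> K G"
  by (subst (1 2 3) l2_inner_commute) (simp add: l2_inner_add_left assms)

lemma l2_inner_scaleC_right: "l2_inner \<mu> K (c *\<^sub>C F) = cnj c * l2_inner \<mu> K F"
  by (subst (1 2) l2_inner_commute) (simp add: l2_inner_scaleC_left)

lemma l2_inner_sum_right:
  assumes "\<And>n. n \<in> A \<Longrightarrow> F n \<in> L2 \<mu>" "K \<in> L2 \<mu>"
  shows "l2_inner \<mu> K (\<Sum>n\<in>A. c n *\<^sub>C F n) = (\<Sum>n\<in>A. cnj (c n) * l2_inner \<mu> K (F n))"
  by (subst (1 2) l2_inner_commute) (simp add: l2_inner_sum_left assms)

lemma l2_norm_nonneg: "0 \<le> l2_norm \<mu> F"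
  by (simp add: l2_norm_def)

lemma l2_sq_eq: "F \<in> L2 \<mu> \<Longrightarrow> l2_sq \<mu> F = ennreal ((l2_norm \<mu> F)\<^sup>2)"
  by (simp add: L2_def l2_norm_def)

lemma l2_inner_self: "F \<in> L2 \<mu> \<Longrightarrow> l2_inner \<mu> F F = complex_of_real ((l2_norm \<mu> F)\<^sup>2)"
proof (rule fclass_cases[of F])
  fix f assume F: "F \<in> L2 \<mu>" "F = abs_fclass f" and m: "f \<in> borel_measurable lebesgue"
  have "l2_inner \<mu> F F = (LINT t|weight_measure \<mu>. complex_of_real ((cmod (f t))\<^sup>2))"
    using m by (simp add: F l2_inner_abs complex_norm_square[symmetric] del: of_real_power)
  also have "\<dots> = complex_of_real (LINT t|weight_measure \<mu>. (cmod (f t))\<^sup>2)"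
    by (rule integral_complex_of_real)
  also have "(LINT t|weight_measure \<mu>. (cmod (f t))\<^sup>2) = enn2real (l2_sq \<mu> F)"
    using m by (subst integral_eq_nn_integral)
      (auto simp: F l2_sq_abs intro: borel_measurable_cmod_square)
  finally show ?thesis by (simp add: l2_norm_def)
qed

text \<open>The weight is positive off the null set \<open>{0}\<close>.\<close>

lemma AE_weight_measure_iff:
  assumes R: "{t. R t} \<in> sets lebesgue"
  shows "(AE t in weight_measure \<mu>. R t) \<longleftrightarrow> (AE t in lebesgue. R t)"
proof
  assume "AE t in weight_measure \<mu>. R t"
  then have "AE t in lebesgue. 0 < ennreal (\<bar>t\<bar> powr (2 * \<mu>)) \<longrightarrow> R t"
    unfolding weight_measure_def
    by (subst (asm) AE_density) (rule measurable_compose[OF borel_measurable_weight measurable_ennreal])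
  moreover have "AE t in lebesgue. t \<noteq> (0::real)"
    using AE_lborel_singleton[of "0::real"] by (rule AE_completion)
  ultimately show "AE t in lebesgue. R t"
    by eventually_elim auto
qed (rule AE_weight_measureI)

lemma l2_norm_eq_0: 
  assumes "F \<in> L2 \<mu>" "l2_norm \<mu> F = 0"
  shows "F = 0"
proof (rule fclass_cases[of F])
  fix f assume F: "F = abs_fclass f" and m: "f \<in> borel_measurable lebesgue"
  have "(\<integral>\<^sup>+ t. ennreal ((cmod (f t))\<^sup>2) \<partial>weight_measure \<mu>) = 0"
    using l2_sq_eq[OF assms(1)] assms(2) m by (simp add: F l2_sq_abs)
  then have "AE t in weight_measure \<mu>. ennreal ((cmod (f t))\<^sup>2) = 0"
    using m by (subst (asm) nn_integral_0_iff_AE)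
      (auto intro: measurable_compose[OF borel_measurable_cmod_square])
  then have "AE t in weight_measure \<mu>. f t = 0" by eventually_elim simp
  moreover have "{t. f t = 0} \<in> sets lebesgue"
    using measurable_sets[OF m, of "{0}"] by (simp add: vimage_def)
  ultimately have "AE t in lebesgue. f t = 0" by (simp add: AE_weight_measure_iff)
  then show ?thesis unfolding F abs_fclass_0 using m by (intro abs_fclass_eqI) auto
qed

lemma l2_norm_add_square:
  assumes "F \<in> L2 \<mu>" "G \<in> L2 \<mu>"
  shows "(l2_norm \<mu> (F + G))\<^sup>2 = (l2_norm \<mu> F)\<^sup>2 + 2 * Re (l2_inner \<mu> F G) + (l2_norm \<mu> G)\<^sup>2"
proof -
  have "(l2_norm \<mu> (F + G))\<^sup>2 = Re (l2_inner \<mu> (F + G) (F + G))"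
    by (simp only: l2_inner_self[OF L2_add[OF assms]] Re_complex_of_real)
  also have "\<dots> = Re (l2_inner \<mu> F F) + Re (l2_inner \<mu> F G) + Re (l2_inner \<mu> G F) + Re (l2_inner \<mu> G G)"
    by (simp add: l2_inner_add_left l2_inner_add_right assms L2_add)
  also have "Re (l2_inner \<mu> G F) = Re (l2_inner \<mu> F G)" by (subst l2_inner_commute) simp
  finally show ?thesis by (simp only: l2_inner_self[OF assms(1)] l2_inner_self[OF assms(2)] Re_complex_of_real)
qed

lemma l2_norm_scaleC: "F \<in> L2 \<mu> \<Longrightarrow> (l2_norm \<mu> (c *\<^sub>C F))\<^sup>2 = (cmod c)\<^sup>2 * (l2_norm \<mu> F)\<^sup>2"
proof -
  assume F: "F \<in> L2 \<mu>"
  have "complex_of_real ((l2_norm \<mu> (c *\<^sub>C F))\<^sup>2) = (c * cnj c) * l2_inner \<mu> F F"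
    by (simp only: l2_inner_self[OF L2_scaleC[OF F], symmetric] l2_inner_scaleC_left l2_inner_scaleC_right ac_simps)
  also have "\<dots> = complex_of_real ((cmod c)\<^sup>2 * (l2_norm \<mu> F)\<^sup>2)"
    by (simp only: l2_inner_self[OF F] complex_norm_square[symmetric] of_real_mult)
  finally show ?thesis by (simp only: of_real_eq_iff)
qed

lemma l2_Cauchy_Schwarz:
  assumes F: "F \<in> L2 \<mu>" and G: "G \<in> L2 \<mu>"
  shows "cmod (l2_inner \<mu> F G) \<le> l2_norm \<mu> F * l2_norm \<mu> G"
proof (cases "l2_norm \<mu> G = 0")
  case True
  then have "G = 0" by (rule l2_norm_eq_0[OF G])
  then show ?thesis using l2_inner_scaleC_right[of \<mu> F 0 0] by (simp add: l2_norm_nonneg)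
next
  case False
  then have ny: "l2_norm \<mu> G > 0" using l2_norm_nonneg[of \<mu> G] by simp
  define c where "c = - l2_inner \<mu> F G / complex_of_real ((l2_norm \<mu> G)\<^sup>2)"
  have "0 \<le> (l2_norm \<mu> (F + c *\<^sub>C G))\<^sup>2" by simp
  also have "\<dots> = (l2_norm \<mu> F)\<^sup>2 + 2 * Re (cnj c * l2_inner \<mu> F G) + (cmod c)\<^sup>2 * (l2_norm \<mu> G)\<^sup>2"
    by (simp add: l2_norm_add_square L2_scaleC F G l2_inner_scaleC_right l2_norm_scaleC)
  also have "cnj c * l2_inner \<mu> F G = complex_of_real (- (cmod (l2_inner \<mu> F G))\<^sup>2 / (l2_norm \<mu> G)\<^sup>2)"
    by (simp add: c_def complex_norm_square[symmetric] mult.commute[of "cnj _"])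
  also have "(cmod c)\<^sup>2 * (l2_norm \<mu> G)\<^sup>2 = (cmod (l2_inner \<mu> F G))\<^sup>2 / (l2_norm \<mu> G)\<^sup>2"
    using ny by (simp add: c_def norm_divide norm_mult power2_eq_square)
  finally have "(cmod (l2_inner \<mu> F G))\<^sup>2 / (l2_norm \<mu> G)\<^sup>2 \<le> (l2_norm \<mu> F)\<^sup>2" by simp
  then have "(cmod (l2_inner \<mu> F G))\<^sup>2 \<le> (l2_norm \<mu> F * l2_norm \<mu> G)\<^sup>2"
    using ny by (simp add: field_simps power_mult_distrib)
  then show ?thesis by (rule power2_le_imp_le) (simp add: l2_norm_nonneg)
qed

section \<open>Orthonormal sequences in \<open>L\<^sup>2\<^sub>\<mu>(\<real>)\<close> and the Riesz--Fischer theorem\<close>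

locale l2_orthonormal =
  fixes \<mu> :: real and e :: "nat \<Rightarrow> fclass"
  assumes e_L2: "e n \<in> L2 \<mu>"
    and e_ortho: "l2_inner \<mu> (e m) (e n) = (if m = n then 1 else 0)"
begin

lemma inner_expansion:
  "finite A \<Longrightarrow> l2_inner \<mu> (\<Sum>n\<in>A. c n *\<^sub>C e n) (e m) = (if m \<in> A then c m else 0)"
  by (simp add: l2_inner_sum_left e_L2 e_ortho if_distrib sum.delta cong: if_cong)

lemma norm_expansion:
  assumes "finite A"
  shows "(l2_norm \<mu> (\<Sum>n\<in>A. c n *\<^sub>C e n))\<^sup>2 = (\<Sum>n\<in>A. (cmod (c n))\<^sup>2)"
proof -
  have "complex_of_real ((l2_norm \<mu> (\<Sum>n\<in>A. c n *\<^sub>C e n))\<^sup>2) =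
      (\<Sum>n\<in>A. cnj (c n) * l2_inner \<mu> (\<Sum>n\<in>A. c n *\<^sub>C e n) (e n))"
    by (simp only: l2_inner_self[OF L2_sum, OF e_L2, symmetric] l2_inner_sum_right e_L2 L2_sum)
  also have "\<dots> = (\<Sum>n\<in>A. complex_of_real ((cmod (c n))\<^sup>2))"
    by (rule sum.cong) (simp_all only: inner_expansion[OF assms] complex_norm_square if_True mult.commute)
  finally have "complex_of_real ((l2_norm \<mu> (\<Sum>n\<in>A. c n *\<^sub>C e n))\<^sup>2) =
      complex_of_real (\<Sum>n\<in>A. (cmod (c n))\<^sup>2)" by simp
  then show ?thesis by (simp only: of_real_eq_iff)
qed

lemma bessel_finite:
  assumes F: "F \<in> L2 \<mu>" and A: "finite A"
  shows "(\<Sum>n\<in>A. (cmod (l2_inner \<mu> F (e n)))\<^sup>2) \<le> (l2_norm \<mu> F)\<^sup>2"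
proof -
  define s where "s = (\<Sum>n\<in>A. l2_inner \<mu> F (e n) *\<^sub>C e n)"
  have s: "s \<in> L2 \<mu>" unfolding s_def by (intro L2_sum e_L2)
  have "l2_inner \<mu> (F - s) s = (\<Sum>n\<in>A. cnj (l2_inner \<mu> F (e n)) * l2_inner \<mu> (F - s) (e n))"
    unfolding s_def by (intro l2_inner_sum_right e_L2 L2_diff F L2_sum)
  also have "\<dots> = 0"
    by (intro sum.neutral ballI) (simp add: l2_inner_diff_left F s e_L2, simp add: s_def inner_expansion[OF A])
  finally have "(l2_norm \<mu> ((F - s) + s))\<^sup>2 = (l2_norm \<mu> (F - s))\<^sup>2 + (l2_norm \<mu> s)\<^sup>2"
    by (subst l2_norm_add_square) (simp_all add: L2_diff F s)
  then have "(l2_norm \<mu> s)\<^sup>2 \<le> (l2_norm \<mu> F)\<^sup>2" by simp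
  then show ?thesis by (simp add: s_def norm_expansion[OF A])
qed

lemma bessel:
  assumes "F \<in> L2 \<mu>"
  shows "summable (\<lambda>n. (cmod (l2_inner \<mu> F (e n)))\<^sup>2)"
  by (rule summableI_nonneg_bounded[where x = "(l2_norm \<mu> F)\<^sup>2"]) (simp_all add: bessel_finite[OF assms])


text \<open>
  The partial sums \<open>s N\<close> along a subsequence with \<open>\<parallel>s (N (k + 1)) - s (N k)\<parallel>\<^sup>2 \<le> 8 ^ (- k)\<close> converge
  almost everywhere, because \<open>\<Sum>k. 4 ^ k * |s (N (k + 1)) - s (N k)|\<^sup>2\<close> has a finite integral. By
  Fatou's lemma the pointwise limit is also the limit in the mean.
\<close>

lemma riesz_fischer:
  assumes c: "summable (\<lambda>n. (cmod (c n))\<^sup>2)"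
  obtains F where "F \<in> L2 \<mu>" "(\<lambda>N. l2_norm \<mu> (F - (\<Sum>n<N. c n *\<^sub>C e n))) \<longlonglongrightarrow> 0"
proof -
  define r where "r N = (\<Sum>n. (cmod (c (n + N)))\<^sup>2)" for N
  have r: "r N = (\<Sum>n. (cmod (c n))\<^sup>2) - (\<Sum>n<N. (cmod (c n))\<^sup>2)" for N
    unfolding r_def by (rule suminf_minus_initial_segment[OF c])
  have r_nonneg: "0 \<le> r N" for N
    unfolding r_def by (intro suminf_nonneg summable_ignore_initial_segment c) auto
  have r_mono: "r N \<le> r M" if "M \<le> N" for M N
  proof -
    have "(\<Sum>n<M. (cmod (c n))\<^sup>2) \<le> (\<Sum>n<N. (cmod (c n))\<^sup>2)" using that by (intro sum_mono2) auto
    then show ?thesis by (simp add: r)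
  qed
  have r_lim: "r \<longlonglongrightarrow> 0"
    unfolding r_def by (rule suminf_exist_split2[OF c])
  have "\<exists>K. \<forall>N\<ge>K. r N < inverse (8 ^ k)" for k :: nat
    using order_tendstoD(2)[OF r_lim, of "inverse (8 ^ k)"] by (simp add: eventually_sequentially)
  then obtain K where K: "\<And>k N. K k \<le> N \<Longrightarrow> r N < inverse (8 ^ k)" by metis
  \<comment> \<open>Cumulative sums make the indices increase while \<open>N k\<close> stays beyond
    \<open>K k\<close>.\<close>
  define N where "N k = (\<Sum>j\<le>k. Suc (K j))" for k
  have N_Suc: "N (Suc k) = N k + Suc (K (Suc k))" for k by (simp add: N_def)
  have "K k \<le> N k" for k by (cases k) (simp_all add: N_def)
  then have rN: "r (N k) \<le> inverse (8 ^ k)" for k using K less_imp_le by blast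
  have N_ge: "k \<le> N k" for k by (induction k) (simp_all add: N_Suc)
  have N_mono: "N k \<le> N (Suc k)" for k by (simp add: N_Suc)
  define f where "f n = rep_fclass (e n)" for n
  have f: "f n \<in> borel_measurable lebesgue" and ef: "e n = abs_fclass (f n)" for n
    unfolding f_def by (simp_all only: rep_fclass_measurable abs_rep_fclass)
  define s where "s M t = (\<Sum>n<M. c n * f n t)" for M t
  have s_meas: "s M \<in> borel_measurable lebesgue" for M
    unfolding s_def[abs_def] by (rule measurable_sum_scaled[of f, OF f])
  have s_abs: "abs_fclass (s M) = (\<Sum>n<M. c n *\<^sub>C e n)" for M
    unfolding ef s_def[abs_def] by (rule abs_fclass_sum[of f, OF f, symmetric])
  have s_diff: "(\<integral>\<^sup>+ t. ennreal ((cmod (s M' t - s M t))\<^sup>2) \<partial>weight_measure \<mu>) \<le> ennreal (r M)"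
    if "M \<le> M'" for M M'
  proof -
    have set: "{..<M'} = {..<M} \<union> {M..<M'}" "{..<M} \<inter> {M..<M'} = {}" using that by auto
    have "abs_fclass (s M') - abs_fclass (s M) = (\<Sum>n\<in>{M..<M'}. c n *\<^sub>C e n)"
      unfolding s_abs by (simp add: set sum.union_disjoint)
    then have abs: "abs_fclass (\<lambda>t. s M' t - s M t) = (\<Sum>n\<in>{M..<M'}. c n *\<^sub>C e n)"
      by (simp add: abs_fclass_ops s_meas)
    have "(\<integral>\<^sup>+ t. ennreal ((cmod (s M' t - s M t))\<^sup>2) \<partial>weight_measure \<mu>) =
        l2_sq \<mu> (\<Sum>n\<in>{M..<M'}. c n *\<^sub>C e n)"
      unfolding abs[symmetric] by (rule l2_sq_abs[symmetric]) (intro borel_measurable_diff s_meas)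
    also have "\<dots> = ennreal (\<Sum>n\<in>{M..<M'}. (cmod (c n))\<^sup>2)"
      by (simp add: l2_sq_eq L2_sum e_L2 norm_expansion)
    also have "(\<Sum>n\<in>{M..<M'}. (cmod (c n))\<^sup>2) = r M - r M'"
      by (simp add: r set sum.union_disjoint)
    also have "ennreal (r M - r M') \<le> ennreal (r M)"
      using r_nonneg[of M'] by (intro ennreal_leI) simp
    finally show ?thesis .
  qed
  define d where "d k t = 4 ^ k * (cmod (s (N (Suc k)) t - s (N k) t))\<^sup>2" for k t
  have d_meas: "d k \<in> borel_measurable (weight_measure \<mu>)" for k
    unfolding d_def[abs_def] measurable_weight_measure
    by (intro borel_measurable_times borel_measurable_const borel_measurable_cmod_square
        borel_measurable_diff s_meas)
  have d_int: "(\<integral>\<^sup>+ t. ennreal (d k t) \<partial>weight_measure \<mu>) \<le> ennreal ((1 / 2) ^ k)" for k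
  proof -
    have "(\<integral>\<^sup>+ t. ennreal (d k t) \<partial>weight_measure \<mu>) =
        ennreal (4 ^ k) * (\<integral>\<^sup>+ t. ennreal ((cmod (s (N (Suc k)) t - s (N k) t))\<^sup>2) \<partial>weight_measure \<mu>)"
      unfolding d_def ennreal_mult[OF zero_le_power[OF zero_le_numeral] zero_le_power2]
      by (rule nn_integral_cmult, rule measurable_compose[OF _ measurable_ennreal], unfold measurable_weight_measure,
          intro borel_measurable_cmod_square borel_measurable_diff s_meas)
    also have "\<dots> \<le> ennreal (4 ^ k) * ennreal (inverse (8 ^ k))"
      by (intro mult_left_mono order_trans[OF s_diff[OF N_mono]] ennreal_leI rN) auto
    also have "\<dots> = ennreal (4 ^ k * inverse (8 ^ k))" by (simp add: ennreal_mult)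
    also have "4 ^ k * inverse (8 ^ k) = (1 / 2 :: real) ^ k"
      by (simp add: power_divide[symmetric] divide_inverse[symmetric])
    finally show ?thesis .
  qed
  have "(\<integral>\<^sup>+ t. (\<Sum>k. ennreal (d k t)) \<partial>weight_measure \<mu>) = (\<Sum>k. \<integral>\<^sup>+ t. ennreal (d k t) \<partial>weight_measure \<mu>)"
    by (rule nn_integral_suminf) (rule measurable_compose[OF d_meas measurable_ennreal])
  also have "\<dots> \<le> (\<Sum>k. ennreal ((1 / 2) ^ k))"
    by (intro suminf_le d_int) auto
  also have "\<dots> = ennreal 2"
    using geometric_sums[of "1 / 2 :: real"] by (intro suminf_ennreal_eq) auto
  finally have "(\<integral>\<^sup>+ t. (\<Sum>k. ennreal (d k t)) \<partial>weight_measure \<mu>) \<noteq> \<infinity>"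
    using ennreal_less_top[of 2] by (auto simp: top_unique)
  then have "AE t in weight_measure \<mu>. (\<Sum>k. ennreal (d k t)) \<noteq> \<infinity>"
    by (intro nn_integral_PInf_AE borel_measurable_suminf_order)
      (rule measurable_compose[OF d_meas measurable_ennreal])
  then have conv: "AE t in weight_measure \<mu>. convergent (\<lambda>k. s (N k) t)"
  proof eventually_elim
    case (elim t)
    have d0: "0 \<le> d k t" for k by (simp add: d_def)
    then have "summable (\<lambda>k. d k t)" using elim by (intro summable_suminf_not_top) auto
    then have "(\<lambda>k. d k t) \<longlonglongrightarrow> 0" by (rule summable_LIMSEQ_zero)
    \<comment> \<open>The terms \<open>d k t\<close> are bounded, by \<open>C\<close> say; taking
      roots makes the increments at most \<open>sqrt C / 2 ^ k\<close>.\<close>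
    then have "Bseq (\<lambda>k. d k t)" by (intro convergent_imp_Bseq convergentI)
    then obtain C where C: "0 < C" "\<And>k. norm (d k t) \<le> C" unfolding Bseq_def by blast
    have "summable (\<lambda>k. s (N (Suc k)) t - s (N k) t)"
    proof (rule summable_comparison_test'[where N = 0])
      show "summable (\<lambda>k. sqrt C * (1 / 2) ^ k)" by (intro summable_mult summable_geometric) simp
      fix k
      have "(2 ^ k * cmod (s (N (Suc k)) t - s (N k) t))\<^sup>2 = d k t"
        by (simp add: d_def power_mult_distrib power_mult[symmetric] mult.commute[of k])
          (simp add: power_mult)
      also have "\<dots> \<le> C" using C(2)[of k] by simp
      finally have "2 ^ k * cmod (s (N (Suc k)) t - s (N k) t) \<le> sqrt C" by (rule real_le_rsqrt)
      then show "norm (s (N (Suc k)) t - s (N k) t) \<le> sqrt C * (1 / 2) ^ k"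
        by (simp add: field_simps power_divide)
    qed
    then have "convergent (\<lambda>n. \<Sum>k<n. s (N (Suc k)) t - s (N k) t)"
      by (simp only: summable_iff_convergent)
    then have "convergent (\<lambda>n. s (N n) t - s (N 0) t)"
      using sum_lessThan_telescope[of "\<lambda>k. s (N k) t"] by simp
    then show ?case by (simp only: convergent_diff_const_right_iff)
  qed
  \<comment> \<open>Where the subsequence diverges, \<open>lim\<close> takes some default value;
    this happens only on a null set for the weighted measure.\<close>
  define g where "g t = lim (\<lambda>k. s (N k) t)" for t
  have g_meas: "g \<in> borel_measurable lebesgue"
    unfolding g_def[abs_def] by (rule borel_measurable_lim_metric) (rule s_meas)
  have g_int: "(\<integral>\<^sup>+ t. ennreal ((cmod (g t - s M t))\<^sup>2) \<partial>weight_measure \<mu>) \<le> ennreal (r M)" for M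
  proof -
    have m: "(\<lambda>t. ennreal ((cmod (s (N k) t - s M t))\<^sup>2)) \<in> borel_measurable (weight_measure \<mu>)" for k
      unfolding measurable_weight_measure
      by (rule measurable_compose[OF _ measurable_ennreal])
        (intro borel_measurable_cmod_square borel_measurable_diff s_meas)
    have "(\<integral>\<^sup>+ t. ennreal ((cmod (g t - s M t))\<^sup>2) \<partial>weight_measure \<mu>) =
        (\<integral>\<^sup>+ t. liminf (\<lambda>k. ennreal ((cmod (s (N k) t - s M t))\<^sup>2)) \<partial>weight_measure \<mu>)"
    proof (rule nn_integral_cong_AE)
      show "AE t in weight_measure \<mu>. ennreal ((cmod (g t - s M t))\<^sup>2) =
          liminf (\<lambda>k. ennreal ((cmod (s (N k) t - s M t))\<^sup>2))"
        using conv
      proof eventually_elim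
        case (elim t)
        then have "(\<lambda>k. s (N k) t) \<longlonglongrightarrow> g t" unfolding g_def convergent_LIMSEQ_iff .
        then have "(\<lambda>k. ennreal ((cmod (s (N k) t - s M t))\<^sup>2)) \<longlonglongrightarrow> ennreal ((cmod (g t - s M t))\<^sup>2)"
          by (intro tendsto_ennrealI tendsto_intros)
        then show ?case by (intro lim_imp_Liminf[symmetric]) auto
      qed
    qed
    also have "\<dots> \<le> liminf (\<lambda>k. \<integral>\<^sup>+ t. ennreal ((cmod (s (N k) t - s M t))\<^sup>2) \<partial>weight_measure \<mu>)"
      by (rule nn_integral_liminf) (rule m)
    also have "\<dots> \<le> liminf (\<lambda>k. ennreal (r M))"
    proof (rule Liminf_mono)
      show "\<forall>\<^sub>F k in sequentially. (\<integral>\<^sup>+ t. ennreal ((cmod (s (N k) t - s M t))\<^sup>2) \<partial>weight_measure \<mu>) \<le> ennreal (r M)"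
        using eventually_ge_at_top[of M]
      proof eventually_elim
        case (elim k)
        then show ?case using N_ge[of k] by (intro s_diff) simp
      qed
    qed
    also have "\<dots> = ennreal (r M)" by (intro lim_imp_Liminf) auto
    finally show ?thesis .
  qed
  have diff: "abs_fclass (\<lambda>t. g t - s M t) = abs_fclass g - (\<Sum>n<M. c n *\<^sub>C e n)" for M
    unfolding s_abs[symmetric] by (simp add: abs_fclass_ops g_meas s_meas)
  have sq: "l2_sq \<mu> (abs_fclass g - (\<Sum>n<M. c n *\<^sub>C e n)) \<le> ennreal (r M)" for M
    unfolding diff[symmetric] by (subst l2_sq_abs) (intro borel_measurable_diff g_meas s_meas, rule g_int)
  show thesis
  proof (rule that)
    show "abs_fclass g \<in> L2 \<mu>"
      using sq[of 0] by (auto simp: L2_def intro: le_less_trans)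
    show "(\<lambda>M. l2_norm \<mu> (abs_fclass g - (\<Sum>n<M. c n *\<^sub>C e n))) \<longlonglongrightarrow> 0"
    proof (rule tendsto_sandwich[of "\<lambda>_. 0" _ _ "\<lambda>M. sqrt (r M)"])
      show "\<forall>\<^sub>F M in sequentially. l2_norm \<mu> (abs_fclass g - (\<Sum>n<M. c n *\<^sub>C e n)) \<le> sqrt (r M)"
        unfolding l2_norm_def using enn2real_mono[OF sq] r_nonneg by (intro always_eventually allI real_sqrt_le_mono) simp
      show "(\<lambda>M. sqrt (r M)) \<longlonglongrightarrow> 0" using tendsto_real_sqrt[OF r_lim] by simp
    qed (simp_all add: l2_norm_nonneg)
  qed
qed

end

text \<open>Completeness is put as a trivial orthogonal complement, the form that the moment
  argument yields; expansions then follow from the Riesz-Fischer theorem.\<close>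

locale l2_basis = l2_orthonormal +
  assumes e_complete: "F \<in> L2 \<mu> \<Longrightarrow> (\<And>n. l2_inner \<mu> F (e n) = 0) \<Longrightarrow> F = 0"
begin

lemma L2_eqI:
  assumes "F \<in> L2 \<mu>" "G \<in> L2 \<mu>" "\<And>n. l2_inner \<mu> F (e n) = l2_inner \<mu> G (e n)"
  shows "F = G"
  using e_complete[of "F - G"] assms by (simp add: L2_diff l2_inner_diff_left e_L2)

text \<open>The Riesz-Fischer limit of the expansion of \<open>F\<close> has the coefficients of
  \<open>F\<close> and therefore equals \<open>F\<close>. The same construction realises every
  square summable sequence.\<close>

lemma L2_expansion:
  assumes F: "F \<in> L2 \<mu>"
  shows "(\<lambda>N. l2_norm \<mu> (F - (\<Sum>n<N. l2_inner \<mu> F (e n) *\<^sub>C e n))) \<longlonglongrightarrow> 0"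
    and L2_with_coefficients: "summable (\<lambda>n. (cmod (c n))\<^sup>2) \<Longrightarrow> \<exists>G\<in>L2 \<mu>. \<forall>n. l2_inner \<mu> G (e n) = c n"
proof -
  have *: "\<exists>G\<in>L2 \<mu>. (\<forall>n. l2_inner \<mu> G (e n) = c n) \<and>
      (\<lambda>N. l2_norm \<mu> (G - (\<Sum>n<N. c n *\<^sub>C e n))) \<longlonglongrightarrow> 0"
    if c: "summable (\<lambda>n. (cmod (c n))\<^sup>2)" for c
  proof -
    obtain G where G: "G \<in> L2 \<mu>" "(\<lambda>N. l2_norm \<mu> (G - (\<Sum>n<N. c n *\<^sub>C e n))) \<longlonglongrightarrow> 0"
      using riesz_fischer[OF c] by blast
    have "l2_inner \<mu> G (e m) - c m = 0" for m
    proof -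
      have "(\<lambda>N. l2_inner \<mu> (G - (\<Sum>n<N. c n *\<^sub>C e n)) (e m)) \<longlonglongrightarrow> 0"
      proof (rule Lim_null_comparison)
        show "(\<lambda>N. l2_norm \<mu> (G - (\<Sum>n<N. c n *\<^sub>C e n)) * l2_norm \<mu> (e m)) \<longlonglongrightarrow> 0"
          using tendsto_mult_left_zero[OF G(2)] .
      qed (auto intro!: always_eventually l2_Cauchy_Schwarz L2_diff L2_sum e_L2 G)
      moreover have "\<forall>\<^sub>F N in sequentially. l2_inner \<mu> (G - (\<Sum>n<N. c n *\<^sub>C e n)) (e m) = l2_inner \<mu> G (e m) - c m"
        using eventually_gt_at_top[of m]
        by eventually_elim (simp add: l2_inner_diff_left G L2_sum e_L2 inner_expansion)
      ultimately have "(\<lambda>N::nat. l2_inner \<mu> G (e m) - c m) \<longlonglongrightarrow> 0"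
        by (rule Lim_transform_eventually)
      then show ?thesis by (simp only: LIMSEQ_const_iff)
    qed
    then have "\<forall>m. l2_inner \<mu> G (e m) = c m" by simp
    with G show ?thesis by blast
  qed
  show "summable (\<lambda>n. (cmod (c n))\<^sup>2) \<Longrightarrow> \<exists>G\<in>L2 \<mu>. \<forall>n. l2_inner \<mu> G (e n) = c n"
    using * by blast
  obtain G where "G \<in> L2 \<mu>" "\<forall>n. l2_inner \<mu> G (e n) = l2_inner \<mu> F (e n)"
      "(\<lambda>N. l2_norm \<mu> (G - (\<Sum>n<N. l2_inner \<mu> F (e n) *\<^sub>C e n))) \<longlonglongrightarrow> 0"
    using *[OF bessel[OF F]] by blast
  moreover from this F have "G = F" by (intro L2_eqI) auto
  ultimately show "(\<lambda>N. l2_norm \<mu> (F - (\<Sum>n<N. l2_inner \<mu> F (e n) *\<^sub>C e n))) \<longlonglongrightarrow> 0"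
    by simp
qed

lemma l2_parseval:
  assumes F: "F \<in> L2 \<mu>" and G: "G \<in> L2 \<mu>"
  shows "(\<lambda>n. l2_inner \<mu> F (e n) * cnj (l2_inner \<mu> G (e n))) sums l2_inner \<mu> F G"
proof -
  let ?S = "\<lambda>N. \<Sum>n<N. l2_inner \<mu> F (e n) *\<^sub>C e n"
  have "(\<lambda>N. l2_inner \<mu> (F - ?S N) G) \<longlonglongrightarrow> 0"
  proof (rule Lim_null_comparison)
    show "(\<lambda>N. l2_norm \<mu> (F - ?S N) * l2_norm \<mu> G) \<longlonglongrightarrow> 0"
      using tendsto_mult_left_zero[OF L2_expansion(1)[OF F]] .
  qed (auto intro!: always_eventually l2_Cauchy_Schwarz L2_diff L2_sum e_L2 F G)
  moreover have "l2_inner \<mu> (F - ?S N) G =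
      l2_inner \<mu> F G - (\<Sum>n<N. l2_inner \<mu> F (e n) * cnj (l2_inner \<mu> G (e n)))" for N
    by (simp add: l2_inner_diff_left F G L2_sum e_L2 l2_inner_sum_left l2_inner_commute[of \<mu> "e _" G])
  ultimately have "(\<lambda>N. l2_inner \<mu> F G - (\<Sum>n<N. l2_inner \<mu> F (e n) * cnj (l2_inner \<mu> G (e n)))) \<longlonglongrightarrow> 0"
    by simp
  from tendsto_diff[OF tendsto_const[of "l2_inner \<mu> F G"] this] show ?thesis
    by (simp add: sums_def)
qed

end

section \<open>Unitary maps onto \<open>L\<^sup>2\<^sub>\<mu>(\<real>)\<close>\<close>

text \<open>\<open>U x\<close> is the class with the coefficients of \<open>x\<close>. Completeness
  on both sides makes \<open>U\<close> bijective, and any other such map produces the same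
  coefficients.\<close>

lemma unitary_ex1:
  fixes \<phi> :: "nat \<Rightarrow> 'a::complex_hilbert_space"
  assumes "orthonormal_basis \<phi>" "l2_basis \<mu> e"
  shows "\<exists>!U. unitary_onto_L2 \<mu> U \<and> (\<forall>n. U (\<phi> n) = e n)"
proof -
  interpret orthonormal_basis \<phi> by fact
  interpret L: l2_basis \<mu> e by fact
  have coef: "l2_inner \<mu> (U x) (e n) = cinner x (\<phi> n)" "U x \<in> L2 \<mu>"
    if "unitary_onto_L2 \<mu> U \<and> (\<forall>n. U (\<phi> n) = e n)" for U x n
  proof -
    show "l2_inner \<mu> (U x) (e n) = cinner x (\<phi> n)"
      using that unfolding unitary_onto_L2_def by metis
    show "U x \<in> L2 \<mu>"
      using that unfolding unitary_onto_L2_def bij_betw_def by blast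
  qed
  have "\<exists>G\<in>L2 \<mu>. \<forall>n. l2_inner \<mu> G (e n) = cinner x (\<phi> n)" for x
    by (rule L.L2_with_coefficients[OF L2_zero bessel])
  then obtain U where U: "\<And>x. U x \<in> L2 \<mu>" "\<And>x n. l2_inner \<mu> (U x) (e n) = cinner x (\<phi> n)"
    by metis
  have "clinear U"
    unfolding clinear_def
    by (intro conjI allI L.L2_eqI U L2_add L2_scaleC)
      (simp_all add: l2_inner_add_left l2_inner_scaleC_left U L.e_L2 cinner_add_left cinner_scaleC_left)
  moreover have "bij_betw U UNIV (L2 \<mu>)"
    unfolding bij_betw_def
  proof
    show "inj U"
    proof (rule injI)
      fix x y assume "U x = U y"
      then show "x = y" using U(2) by (intro eqI) metis
    qed
    show "range U = L2 \<mu>"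
    proof (intro equalityI subsetI)
      fix F assume F: "F \<in> L2 \<mu>"
      obtain x where "\<And>n. cinner x (\<phi> n) = l2_inner \<mu> F (e n)"
        using expansion_exists[OF L.bessel[OF F]] by blast
      then have "U x = F" by (intro L.L2_eqI U F) (simp add: U)
      then show "F \<in> range U" by blast
    qed (use U in auto)
  qed
  moreover have "l2_inner \<mu> (U x) (U y) = cinner x y" for x y
    using L.l2_parseval[OF U(1) U(1), of x y] parseval[of x y] by (simp add: U sums_iff)
  ultimately have "unitary_onto_L2 \<mu> U" by (simp add: unitary_onto_L2_def)
  moreover have "U (\<phi> n) = e n" for n
    by (intro L.L2_eqI U L.e_L2) (simp add: U L.e_ortho ortho)
  moreover have "V = U" if V: "unitary_onto_L2 \<mu> V \<and> (\<forall>n. V (\<phi> n) = e n)" for V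
    by (intro ext L.L2_eqI U coef(2)[OF V]) (simp add: coef(1)[OF V] U)
  ultimately show ?thesis by blast
qed

context
  fixes \<mu> :: real and U :: "'a::complex_hilbert_space \<Rightarrow> fclass"
  assumes U: "unitary_onto_L2 \<mu> U"
begin

lemma unitary_clinear: "clinear U" and unitary_inner: "l2_inner \<mu> (U x) (U y) = cinner x y"
  and unitary_range: "range U = L2 \<mu>"
  using U unfolding unitary_onto_L2_def bij_betw_def by blast+

lemma unitary_in: "U x \<in> L2 \<mu>"
  using unitary_range by blast

lemma unitary_norm: "l2_norm \<mu> (U x) = norm x"
proof -
  have "complex_of_real ((l2_norm \<mu> (U x))\<^sup>2) = complex_of_real ((norm x)\<^sup>2)"
    by (simp only: l2_inner_self[OF unitary_in, symmetric] unitary_inner cinner_self)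
  then have "(l2_norm \<mu> (U x))\<^sup>2 = (norm x)\<^sup>2" by (simp only: of_real_eq_iff)
  then show ?thesis by (simp add: power2_eq_iff_nonneg l2_norm_nonneg)
qed

text \<open>A unitary map is isometric in both directions, so convergent sequences of graph points
  correspond to each other.\<close>

lemma l2_closure_conjugate: "l2_closure \<mu> (conjugate_by U T) = conjugate_by U (seq_closure T)"
proof (intro equalityI subsetI)
  fix p assume "p \<in> l2_closure \<mu> (conjugate_by U T)"
  then obtain F G X Y where p: "p = (F, G)" and FG: "F \<in> L2 \<mu>" "G \<in> L2 \<mu>"
    and XY: "\<And>n. (X n, Y n) \<in> conjugate_by U T"
      "(\<lambda>n. l2_norm \<mu> (X n - F)) \<longlonglongrightarrow> 0" "(\<lambda>n. l2_norm \<mu> (Y n - G)) \<longlonglongrightarrow> 0"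
    by (auto simp: l2_closure_def)
  obtain x y where xy: "F = U x" "G = U y" using FG unitary_range by blast
  have "\<exists>a b. X n = U a \<and> Y n = U b \<and> (a, b) \<in> T" for n
    using XY(1)[of n] by (auto simp: conjugate_by_def)
  then obtain a b where ab: "\<And>n. X n = U (a n)" "\<And>n. Y n = U (b n)" "\<And>n. (a n, b n) \<in> T"
    by metis
  have "a \<longlonglongrightarrow> x" "b \<longlonglongrightarrow> y"
    using XY(2,3) by (simp_all add: ab xy clinear_diff[OF unitary_clinear, symmetric] unitary_norm
        tendsto_norm_zero_iff LIM_zero_iff)
  with ab(3) have "(x, y) \<in> seq_closure T" by (rule seq_closureI)
  then show "p \<in> conjugate_by U (seq_closure T)" by (auto simp: p xy conjugate_by_def)
next
  fix p assume "p \<in> conjugate_by U (seq_closure T)"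
  then obtain x y a b where p: "p = (U x, U y)" and ab: "\<And>n. (a n, b n) \<in> T" "a \<longlonglongrightarrow> x" "b \<longlonglongrightarrow> y"
    by (auto simp: conjugate_by_def seq_closure_def)
  have "(\<lambda>n. l2_norm \<mu> (U (a n) - U x)) \<longlonglongrightarrow> 0" "(\<lambda>n. l2_norm \<mu> (U (b n) - U y)) \<longlonglongrightarrow> 0"
    using ab(2,3) by (simp_all add: clinear_diff[OF unitary_clinear, symmetric] unitary_norm
        tendsto_norm_zero_iff LIM_zero_iff)
  moreover have "(U (a n), U (b n)) \<in> conjugate_by U T" for n
    using ab(1) by (auto simp: conjugate_by_def)
  ultimately show "p \<in> l2_closure \<mu> (conjugate_by U T)"
    unfolding p l2_closure_def using unitary_in
    by (simp, intro exI[of _ "\<lambda>n. U (a n)"] exI[of _ "\<lambda>n. U (b n)"]) simp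
qed

lemma conjugate_graph_span:
  "conjugate_by U (graph_span \<phi> t) =
    {(\<Sum>n<N. c n *\<^sub>C U (\<phi> n), \<Sum>n<N. c n *\<^sub>C U (t n)) | N c. True}"
proof (intro equalityI subsetI)
  fix p assume "p \<in> conjugate_by U (graph_span \<phi> t)"
  then obtain N c where "p = (U (\<Sum>n<N. c n *\<^sub>C \<phi> n), U (\<Sum>n<N. c n *\<^sub>C t n))"
    unfolding conjugate_by_def graph_span_def by blast
  then show "p \<in> {(\<Sum>n<N. c n *\<^sub>C U (\<phi> n), \<Sum>n<N. c n *\<^sub>C U (t n)) | N c. True}"
    by (simp only: clinear_sum[OF unitary_clinear]) blast
next
  fix p assume "p \<in> {(\<Sum>n<N. c n *\<^sub>C U (\<phi> n), \<Sum>n<N. c n *\<^sub>C U (t n)) | N c. True}"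
  then obtain N c where "p = (\<Sum>n<N. c n *\<^sub>C U (\<phi> n), \<Sum>n<N. c n *\<^sub>C U (t n))"
    by blast
  then have "p = (U (\<Sum>n<N. c n *\<^sub>C \<phi> n), U (\<Sum>n<N. c n *\<^sub>C t n))"
    by (simp only: clinear_sum[OF unitary_clinear])
  then show "p \<in> conjugate_by U (graph_span \<phi> t)"
    unfolding conjugate_by_def using graph_spanI by blast
qed

end

section \<open>Gaussian moments\<close>

text \<open>Carries weighted integrals of Borel functions to \<open>lborel\<close>, where
  substitution and characteristic functions are available.\<close>

lemma integrable_weight_measure_iff:
  fixes f :: "real \<Rightarrow> 'b::{banach, second_countable_topology}"
  assumes [measurable]: "f \<in> borel_measurable borel"
  shows "integrable (weight_measure \<mu>) f \<longleftrightarrow> integrable lborel (\<lambda>t. (\<bar>t\<bar> powr (2 * \<mu>)) *\<^sub>R f t)"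
    and "(LINT t|weight_measure \<mu>. f t) = (LINT t|lborel. (\<bar>t\<bar> powr (2 * \<mu>)) *\<^sub>R f t)"
proof -
  have f: "f \<in> borel_measurable lebesgue" by (rule measurable_completion) simp
  have m: "(\<lambda>t. (\<bar>t\<bar> powr (2 * \<mu>)) *\<^sub>R f t) \<in> borel_measurable lborel" by measurable
  show "integrable (weight_measure \<mu>) f \<longleftrightarrow> integrable lborel (\<lambda>t. (\<bar>t\<bar> powr (2 * \<mu>)) *\<^sub>R f t)"
    unfolding weight_measure_def integrable_completion[OF m, symmetric]
    by (rule integrable_density[OF f borel_measurable_weight]) simp
  show "(LINT t|weight_measure \<mu>. f t) = (LINT t|lborel. (\<bar>t\<bar> powr (2 * \<mu>)) *\<^sub>R f t)"
    unfolding weight_measure_def integral_completion[OF m, symmetric]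
    by (rule integral_density[OF f borel_measurable_weight]) simp
qed

text \<open>The substitution \<open>u = a t^2\<close> in the Gamma integral.\<close>

lemma gaussian_moment_half:
  fixes a s :: real
  assumes a: "a > 0" and s: "s > 0"
  shows "has_bochner_integral lborel (\<lambda>t. indicator {0<..} t * (t powr (2 * s - 1) * exp (- (a * t\<^sup>2))))
    (a powr (- s) * Gamma s / 2)"
proof -
  let ?f = "\<lambda>u::real. u powr (s - 1) / exp u" and ?g = "\<lambda>t. a * t\<^sup>2" and ?g' = "\<lambda>t. 2 * a * t"
  let ?h = "\<lambda>t::real. t powr (2 * s - 1) * exp (- (a * t\<^sup>2))"
  have img: "?g ` {0<..} = {0<..}"
  proof (intro equalityI subsetI)
    fix u :: real assume u: "u \<in> {0<..}"
    then have "u = ?g (sqrt (u / a))" "sqrt (u / a) > 0" using a by auto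
    then show "u \<in> ?g ` {0<..}" by blast
  qed (use a in auto)
  \<comment> \<open>The Gamma integral runs over the closed half-line; the point \<open>0\<close> is
    removed to match the image of the substitution.\<close>
  have "(?f has_integral Gamma s) {0<..}"
  proof (rule iffD1[OF has_integral_spike_set_eq Gamma_integral_real[OF s]])
    show "negligible {x \<in> {0..} - {0<..}. ?f x \<noteq> 0}" "negligible {x \<in> {0<..} - {0..}. ?f x \<noteq> 0}"
      by (rule negligible_subset[of "{0}"]; auto)+
  qed
  then have A: "?f absolutely_integrable_on ?g ` {0<..} \<and> integral (?g ` {0<..}) ?f = Gamma s"
    unfolding img by (auto intro!: nonnegative_absolutely_integrable_1 has_integral_integrable integral_unique)
  have *: "(\<lambda>t. \<bar>?g' t\<bar> * ?f (?g t)) absolutely_integrable_on {0<..}"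
      "integral {0<..} (\<lambda>t. \<bar>?g' t\<bar> * ?f (?g t)) = Gamma s"
  proof -
    have "inj_on ?g {0<..}"
      using a by (auto simp: inj_on_def power2_eq_iff)
    moreover have "(?g has_field_derivative ?g' x) (at x within {0<..})" for x
      by (auto intro!: derivative_eq_intros)
    ultimately have "(\<lambda>t. \<bar>?g' t\<bar> * ?f (?g t)) absolutely_integrable_on {0<..} \<and>
        integral {0<..} (\<lambda>t. \<bar>?g' t\<bar> * ?f (?g t)) = Gamma s \<longleftrightarrow>
        ?f absolutely_integrable_on ?g ` {0<..} \<and> integral (?g ` {0<..}) ?f = Gamma s"
      by (intro has_absolute_integral_change_of_variables_1') auto
    with A show "(\<lambda>t. \<bar>?g' t\<bar> * ?f (?g t)) absolutely_integrable_on {0<..}"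
      "integral {0<..} (\<lambda>t. \<bar>?g' t\<bar> * ?f (?g t)) = Gamma s" by blast+
  qed
  let ?k = "\<lambda>t. (2 * a powr s) * (indicator {0<..} t * ?h t)"
  have eq: "indicator {0<..} t *\<^sub>R (\<bar>?g' t\<bar> * ?f (?g t)) = ?k t" for t
  proof (cases "t > 0")
    case True
    have "(a * t\<^sup>2) powr (s - 1) = a powr (s - 1) * (t powr 2) powr (s - 1)"
      using a True by (simp add: powr_mult)
    also have "(t powr 2) powr (s - 1) = t powr (2 * s - 2)"
      by (simp add: powr_powr algebra_simps)
    finally have "\<bar>?g' t\<bar> * ?f (?g t) = 2 * (a powr 1 * a powr (s - 1)) * (t powr 1 * t powr (2 * s - 2)) * exp (- (a * t\<^sup>2))"
      using a True by (simp add: exp_minus divide_inverse)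
    also have "\<dots> = 2 * a powr s * (t powr (2 * s - 1) * exp (- (a * t\<^sup>2)))"
      by (simp only: powr_add[symmetric]) simp
    finally show ?thesis using True by simp
  qed simp
  have meas: "?k \<in> borel_measurable lborel" by measurable
  have "integrable lebesgue ?k" "(LINT t|lebesgue. ?k t) = Gamma s"
    using *(1) set_lebesgue_integral_eq_integral(2)[OF *(1)] *(2)
    by (simp_all only: set_integrable_def set_lebesgue_integral_def eq)
  then have "has_bochner_integral lborel ?k (Gamma s)"
    using integrable_completion[OF meas] integral_completion[OF meas]
    by (simp add: has_bochner_integral_iff)
  then have "has_bochner_integral lborel (\<lambda>t. inverse (2 * a powr s) * ?k t) (inverse (2 * a powr s) * Gamma s)"
    by (rule has_bochner_integral_mult_right)
  moreover have "(\<lambda>t. inverse (2 * a powr s) * ?k t) = (\<lambda>t. indicator {0<..} t * ?h t)"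
    using a by (intro ext) (simp add: field_simps)
  moreover have "inverse (2 * a powr s) * Gamma s = a powr (- s) * Gamma s / 2"
    using a by (simp add: powr_minus field_simps)
  ultimately show ?thesis by (simp only:)
qed

text \<open>The integral of \<open>t^n exp (- a t^2)\<close> against the weight.\<close>

definition gaussian_moment :: "real \<Rightarrow> real \<Rightarrow> nat \<Rightarrow> real" where
  "gaussian_moment \<mu> a n =
     (if even n then a powr (- (n / 2 + \<mu> + 1 / 2)) * Gamma (n / 2 + \<mu> + 1 / 2) else 0)"

lemma gaussian_moment_odd: "odd n \<Longrightarrow> gaussian_moment \<mu> a n = 0"
  by (simp add: gaussian_moment_def)

text \<open>The functional equation of Gamma. It later takes the place of an integration by
  parts.\<close>

lemma gaussian_moment_rec:
  assumes "\<mu> > - 1 / 2" "a > 0" "even n"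
  shows "2 * a * gaussian_moment \<mu> a (n + 2) = (n + 1 + 2 * \<mu>) * gaussian_moment \<mu> a n"
proof -
  let ?s = "real n / 2 + \<mu> + 1 / 2"
  have "?s > 0" using assms by (simp add: add_nonneg_pos)
  then have G: "Gamma (?s + 1) = ?s * Gamma ?s" by (intro Gamma_plus1) (auto simp: nonpos_Ints_def)
  have p: "a powr (- (?s + 1)) * a = a powr (- ?s)"
    using assms(2) powr_add[of a "- (?s + 1)" 1] by simp
  have "real (n + 2) / 2 + \<mu> + 1 / 2 = ?s + 1" by (simp add: add_divide_distrib)
  then have "2 * a * gaussian_moment \<mu> a (n + 2) = 2 * (a powr (- (?s + 1)) * a) * Gamma (?s + 1)"
    using assms(3) by (simp only: gaussian_moment_def) simp
  also have "\<dots> = (2 * ?s) * (a powr (- ?s) * Gamma ?s)" by (simp only: p G) simp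
  finally show ?thesis using assms(3) by (simp add: gaussian_moment_def)
qed

definition gauss_poly :: "real \<Rightarrow> nat \<Rightarrow> real \<Rightarrow> complex" where
  "gauss_poly a n x = complex_of_real (exp (- (a * x\<^sup>2)) * x ^ n)"

lemma gauss_poly_borel [measurable]: "gauss_poly a n \<in> borel_measurable borel"
  unfolding gauss_poly_def[abs_def] by measurable

lemma gauss_poly_mult: "gauss_poly a m x * gauss_poly b n x = gauss_poly (a + b) (m + n) x"
proof -
  have "exp (- ((a + b) * x\<^sup>2)) = exp (- (a * x\<^sup>2)) * exp (- (b * x\<^sup>2))"
    by (simp add: algebra_simps flip: exp_add)
  then show ?thesis by (simp add: gauss_poly_def power_add ac_simps)
qed

lemma gauss_poly_cnj [simp]: "cnj (gauss_poly a n x) = gauss_poly a n x"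
  by (simp add: gauss_poly_def)

text \<open>The integral over the negative half-line is \<open>(- 1) ^ n\<close> times that over the
  positive one, so the halves add up or cancel.\<close>

lemma gauss_poly_moment:
  assumes mu: "\<mu> > - 1 / 2" and a: "a > 0"
  shows "has_bochner_integral (weight_measure \<mu>) (gauss_poly a n) (complex_of_real (gaussian_moment \<mu> a n))"
proof -
  let ?s = "real n / 2 + \<mu> + 1 / 2"
  let ?h = "\<lambda>t. indicator {0<..} t * (t powr (2 * ?s - 1) * exp (- (a * t\<^sup>2)))"
  let ?I = "a powr (- ?s) * Gamma ?s / 2"
  have "?s > 0" using mu by (simp add: add_nonneg_pos)
  then have h: "has_bochner_integral lborel ?h ?I" by (rule gaussian_moment_half[OF a])
  have "has_bochner_integral lborel (\<lambda>t. ?h (0 + (- 1) * t)) (?I /\<^sub>R \<bar>- 1\<bar>)"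
    by (rule iffD1[OF lborel_has_bochner_integral_real_affine_iff h]) simp
  then have h': "has_bochner_integral lborel (\<lambda>t. (- 1) ^ n * ?h (- t)) ((- 1) ^ n * ?I)"
    by (intro has_bochner_integral_mult_right) simp
  let ?k = "\<lambda>t. \<bar>t\<bar> powr (2 * \<mu>) * (exp (- (a * t\<^sup>2)) * t ^ n)"
  have pos: "t powr (2 * ?s - 1) * exp (- (a * t\<^sup>2)) = ?k t" if "t > 0" for t
  proof -
    have "t powr (2 * ?s - 1) = t powr (2 * \<mu> + real n)" by (rule arg_cong) simp
    also have "\<dots> = t powr (2 * \<mu>) * t ^ n" by (simp only: powr_add powr_realpow[OF that])
    finally have p: "t powr (2 * ?s - 1) = t powr (2 * \<mu>) * t ^ n" .
    show ?thesis unfolding p using that by simp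
  qed
  have "AE t in lborel. t \<noteq> (0::real)" by (rule AE_lborel_singleton)
  then have eq: "AE t in lborel. ?h t + (- 1) ^ n * ?h (- t) = ?k t"
  proof eventually_elim
    case (elim t)
    show ?case
    proof (cases "t > 0")
      case True
      then show ?thesis using pos[OF True] by simp
    next
      case False
      then have t: "- t > 0" using elim by simp
      have "(- t) ^ n = (- 1) ^ n * t ^ n" by (rule power_minus)
      then have "(- 1) ^ n * ?k (- t) = ((- 1) ^ n * (- 1) ^ n) * ?k t" by simp
      also have "(- 1) ^ n * (- 1 :: real) ^ n = 1" by (simp flip: power_add)
      finally show ?thesis using t pos[OF t] by simp
    qed
  qed
  have "has_bochner_integral lborel (\<lambda>t. ?h t + (- 1) ^ n * ?h (- t)) (?I + (- 1) ^ n * ?I)"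
    by (rule has_bochner_integral_add[OF h h'])
  moreover have "integrable lborel (\<lambda>t. ?h t + (- 1) ^ n * ?h (- t)) \<longleftrightarrow> integrable lborel ?k"
    "(LINT t|lborel. ?h t + (- 1) ^ n * ?h (- t)) = (LINT t|lborel. ?k t)"
    by (rule integrable_cong_AE, measurable, rule eq) (rule integral_cong_AE, measurable, rule eq)
  ultimately have "has_bochner_integral lborel ?k (?I + (- 1) ^ n * ?I)"
    by (simp only: has_bochner_integral_iff)
  also have "?I + (- 1) ^ n * ?I = gaussian_moment \<mu> a n"
    by (simp add: gaussian_moment_def)
  finally have "has_bochner_integral lborel (\<lambda>t. complex_of_real (?k t)) (complex_of_real (gaussian_moment \<mu> a n))"
    by (rule has_bochner_integral_of_real)
  moreover have "(\<lambda>t. complex_of_real (?k t)) = (\<lambda>t. (\<bar>t\<bar> powr (2 * \<mu>)) *\<^sub>R gauss_poly a n t)"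
    by (intro ext) (simp add: gauss_poly_def scaleR_conv_of_real[where 'a=complex])
  ultimately show ?thesis
    by (simp add: has_bochner_integral_iff integrable_weight_measure_iff)
qed

section \<open>Completeness of polynomials times a Gaussian\<close>

lemma power_le_fact_exp: "0 \<le> y \<Longrightarrow> y ^ n \<le> fact n * exp y" for y :: real
proof -
  assume y: "0 \<le> y"
  have "y ^ n /\<^sub>R fact n = (\<Sum>k\<in>{n}. y ^ k /\<^sub>R fact k)" by simp
  also have "\<dots> \<le> exp y"
    unfolding exp_def using y by (intro sum_le_suminf[OF summable_exp_generic]) auto
  finally show ?thesis by (simp add: field_simps)
qed

text \<open>Every partial sum of the exponential series integrates to zero, and all of them are
  dominated by \<open>exp (\<bar>s\<bar> * \<bar>t\<bar>) * \<bar>h t\<bar>\<close>.\<close>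

lemma integral_iexp_eq_0:
  fixes h :: "real \<Rightarrow> real"
  assumes [measurable]: "h \<in> borel_measurable borel"
    and int: "\<And>r. integrable lborel (\<lambda>t. exp (r * \<bar>t\<bar>) * \<bar>h t\<bar>)"
    and mom: "\<And>n. (LINT t|lborel. t ^ n * h t) = 0"
  shows "(CLINT t|lborel. complex_of_real (h t) * iexp (s * t)) = 0"
proof -
  let ?z = "\<lambda>t. \<i> * complex_of_real (s * t)"
  let ?S = "\<lambda>N t. \<Sum>k<N. ?z t ^ k / fact k"
  have pow_le: "\<bar>t\<bar> ^ n \<le> fact n * exp (1 * \<bar>t\<bar>)" for t :: real and n
    using power_le_fact_exp[of "\<bar>t\<bar>" n] by simp
  have int_pow: "integrable lborel (\<lambda>t. t ^ n * h t)" for n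
  proof (rule Bochner_Integration.integrable_bound)
    show "integrable lborel (\<lambda>t. fact n * (exp (1 * \<bar>t\<bar>) * \<bar>h t\<bar>))"
      by (intro integrable_mult_right int)
    have "\<bar>t\<bar> ^ n * \<bar>h t\<bar> \<le> fact n * exp (1 * \<bar>t\<bar>) * \<bar>h t\<bar>" for t
      by (intro mult_right_mono pow_le) simp
    then show "AE t in lborel. norm (t ^ n * h t) \<le> norm (fact n * (exp (1 * \<bar>t\<bar>) * \<bar>h t\<bar>))"
      by (intro AE_I2) (simp add: abs_mult power_abs mult.assoc)
  qed measurable
  have "(\<lambda>N. CLINT t|lborel. complex_of_real (h t) * ?S N t) \<longlonglongrightarrow> (CLINT t|lborel. complex_of_real (h t) * exp (?z t))"
  proof (rule integral_dominated_convergence)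
    show "integrable lborel (\<lambda>t. exp (\<bar>s\<bar> * \<bar>t\<bar>) * \<bar>h t\<bar>)" by (rule int)
    have "(\<lambda>k. ?z t ^ k / fact k) sums exp (?z t)" for t
      using exp_converges[of "?z t"] by (simp add: scaleR_conv_of_real divide_inverse mult.commute)
    then show "AE t in lborel. (\<lambda>N. complex_of_real (h t) * ?S N t) \<longlonglongrightarrow> complex_of_real (h t) * exp (?z t)"
      by (intro AE_I2 tendsto_intros) (simp add: sums_def)
    show "AE t in lborel. norm (complex_of_real (h t) * ?S N t) \<le> exp (\<bar>s\<bar> * \<bar>t\<bar>) * \<bar>h t\<bar>" for N
    proof (rule AE_I2)
      fix t
      have "norm (?S N t) \<le> (\<Sum>k<N. norm (?z t ^ k / fact k))" by (rule norm_sum)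
      also have "\<dots> = (\<Sum>k<N. (\<bar>s\<bar> * \<bar>t\<bar>) ^ k /\<^sub>R fact k)"
        by (simp add: norm_divide norm_power norm_mult abs_mult divide_inverse norm_inverse mult.commute)
      also have "\<dots> \<le> exp (\<bar>s\<bar> * \<bar>t\<bar>)"
        unfolding exp_def by (rule sum_le_suminf[OF summable_exp_generic]) auto
      finally show "norm (complex_of_real (h t) * ?S N t) \<le> exp (\<bar>s\<bar> * \<bar>t\<bar>) * \<bar>h t\<bar>"
        by (simp add: norm_mult mult.commute mult_left_mono)
    qed
  qed measurable
  moreover have "(CLINT t|lborel. complex_of_real (h t) * ?S N t) = 0" for N
  proof -
    have "(CLINT t|lborel. complex_of_real (h t) * ?S N t) =
        (CLINT t|lborel. \<Sum>k<N. ((\<i> * s) ^ k / fact k) * complex_of_real (t ^ k * h t))"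
      by (simp add: sum_distrib_left power_mult_distrib ac_simps)
    also have "\<dots> = (\<Sum>k<N. ((\<i> * s) ^ k / fact k) * (CLINT t|lborel. complex_of_real (t ^ k * h t)))"
      using integrable_of_real[OF int_pow, where 'a=complex]
      by (subst Bochner_Integration.integral_sum) (auto intro!: integrable_mult_right)
    also have "\<dots> = 0" by (simp only: integral_complex_of_real mom) simp
    finally show ?thesis .
  qed
  ultimately show ?thesis by (simp add: LIMSEQ_const_iff)
qed

text \<open>The positive and negative parts of \<open>h\<close> have the same mass by the zeroth
  moment. Divided by it they are probability densities with equal characteristic functions, and
  Levy's uniqueness theorem identifies them.\<close>

lemma moments_zero_imp_AE_zero:
  fixes h :: "real \<Rightarrow> real"
  assumes h [measurable]: "h \<in> borel_measurable borel"
    and int: "\<And>r. integrable lborel (\<lambda>t. exp (r * \<bar>t\<bar>) * \<bar>h t\<bar>)"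
    and mom: "\<And>n. (LINT t|lborel. t ^ n * h t) = 0"
  shows "AE t in lborel. h t = 0"
proof -
  define p q where "p t = max (h t) 0" and "q t = max (- h t) 0" for t
  have pq [measurable]: "p \<in> borel_measurable borel" "q \<in> borel_measurable borel"
    unfolding p_def[abs_def] q_def[abs_def] by measurable
  have nn: "0 \<le> p t" "0 \<le> q t" and h_eq: "h t = p t - q t" for t
    by (auto simp: p_def q_def)
  have inth: "integrable lborel (\<lambda>t. \<bar>h t\<bar>)" using int[of 0] by simp
  have intp: "integrable lborel p" and intq: "integrable lborel q"
    by (rule Bochner_Integration.integrable_bound[OF inth], simp, rule AE_I2, simp add: p_def q_def)+
  define c where "c = (LINT t|lborel. p t)"
  have cq: "c = (LINT t|lborel. q t)"
  proof -
    have "(LINT t|lborel. p t - q t) = 0" using mom[of 0] by (simp add: h_eq)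
    then show ?thesis using intp intq by (simp add: c_def)
  qed
  have c0: "0 \<le> c" unfolding c_def by (rule Bochner_Integration.integral_nonneg) (rule nn)
  show ?thesis
  proof (cases "c = 0")
    case True
    then have "AE t in lborel. p t = 0" "AE t in lborel. q t = 0"
      using integral_nonneg_eq_0_iff_AE[OF intp] integral_nonneg_eq_0_iff_AE[OF intq] nn cq
      by (auto simp: c_def)
    then show ?thesis by eventually_elim (simp add: h_eq)
  next
    case False
    then have c: "c > 0" using c0 by simp
    let ?D = "\<lambda>u. density lborel (\<lambda>t. ennreal (u t / c))"
    have dist: "real_distribution (?D u)"
      if [measurable]: "u \<in> borel_measurable borel" and u: "\<And>t. 0 \<le> u t" "integrable lborel u" "c = (LINT t|lborel. u t)" for u
    proof -
      have "(\<integral>\<^sup>+ t. ennreal (u t / c) \<partial>lborel) = ennreal (LINT t|lborel. u t / c)"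
        using u c by (intro nn_integral_eq_integral) auto
      also have "(LINT t|lborel. u t / c) = 1" using u(3) c by simp
      finally have "emeasure (?D u) (space (?D u)) = 1" by (simp add: emeasure_density)
      then interpret prob_space "?D u" by (rule prob_spaceI)
      show ?thesis by unfold_locales simp
    qed
    have char: "char (?D u) s = (CLINT t|lborel. complex_of_real (u t) * iexp (s * t)) / c"
      if [measurable]: "u \<in> borel_measurable borel" and u: "\<And>t. 0 \<le> u t" for u s
    proof -
      have "char (?D u) s = (CLINT t|lborel. (u t / c) *\<^sub>R iexp (s * t))"
        unfolding char_def using u c by (intro integral_density) auto
      also have "(\<lambda>t. (u t / c) *\<^sub>R iexp (s * t)) = (\<lambda>t. complex_of_real (u t) * iexp (s * t) / c)"
        by (simp add: scaleR_conv_of_real[where 'a=complex])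
      also have "(CLINT t|lborel. complex_of_real (u t) * iexp (s * t) / c) =
          (CLINT t|lborel. complex_of_real (u t) * iexp (s * t)) / c"
        by (rule integral_divide_zero)
      finally show ?thesis .
    qed
    have "char (?D p) s = char (?D q) s" for s
    proof -
      have i: "integrable lborel (\<lambda>t. complex_of_real (u t) * iexp (s * t))"
        if [measurable]: "u \<in> borel_measurable borel" and "integrable lborel u" for u
        by (rule Bochner_Integration.integrable_bound[OF that(2)]) (simp_all add: norm_mult)
      have "(CLINT t|lborel. complex_of_real (p t) * iexp (s * t)) - (CLINT t|lborel. complex_of_real (q t) * iexp (s * t)) =
          (CLINT t|lborel. complex_of_real (h t) * iexp (s * t))"
        using i[OF pq(1) intp] i[OF pq(2) intq]
        by (subst Bochner_Integration.integral_diff[symmetric]) (simp_all add: h_eq left_diff_distrib)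
      also have "\<dots> = 0" by (rule integral_iexp_eq_0[OF h int mom])
      finally show ?thesis by (simp add: char nn pq)
    qed
    then have "?D p = ?D q"
      by (intro Levy_uniqueness dist pq nn intp intq cq ext) (auto simp: c_def)
    then have "AE t in lborel. ennreal (p t / c) = ennreal (q t / c)"
      by (subst (asm) sigma_finite_measure.density_unique_iff[OF sigma_finite_lborel]) auto
    then show ?thesis
    proof eventually_elim
      case (elim t)
      then have "p t / c = q t / c" using nn[of t] c by simp
      then show ?case using c by (simp add: h_eq)
    qed
  qed
qed

text \<open>A Borel representative allows the passage to \<open>lborel\<close> and the reflection of
  integrals; real and imaginary parts are corrected separately on null sets.\<close>

lemma fclass_borel_cases:
  obtains f where "f \<in> borel_measurable borel" "f \<in> borel_measurable lebesgue" "F = abs_fclass f"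
proof -
  obtain g where g: "g \<in> borel_measurable lebesgue" "F = abs_fclass g" by (rule fclass_cases)
  have "(\<lambda>t. Re (g t)) \<in> borel_measurable lebesgue" "(\<lambda>t. Im (g t)) \<in> borel_measurable lebesgue"
    using g(1) by (simp_all add: borel_measurable_complex_iff)
  then obtain u v where uv [measurable]: "u \<in> borel_measurable lborel" "v \<in> borel_measurable lborel"
    and ae: "AE t in lborel. Re (g t) = u t" "AE t in lborel. Im (g t) = v t"
    using completion_ex_borel_measurable_real by metis
  define f where "f t = Complex (u t) (v t)" for t
  have f: "f \<in> borel_measurable lborel" "AE t in lborel. g t = f t"
  proof -
    show "f \<in> borel_measurable lborel"
      using uv by (simp add: borel_measurable_complex_iff f_def)
    show "AE t in lborel. g t = f t"
      using ae by eventually_elim (simp add: f_def complex_eq_iff)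
  qed
  have fl: "f \<in> borel_measurable lebesgue" by (rule measurable_completion[OF f(1)])
  moreover have "F = abs_fclass f"
    unfolding g(2) by (rule abs_fclass_eqI[OF g(1) fl AE_completion[OF f(2)]])
  ultimately show thesis using that f(1) by simp
qed

lemma gauss_poly_lebesgue: "gauss_poly a n \<in> borel_measurable lebesgue"
  by (rule measurable_completion) simp

lemma gauss_poly_L2: "\<mu> > - 1 / 2 \<Longrightarrow> a > 0 \<Longrightarrow> abs_fclass (gauss_poly a n) \<in> L2 \<mu>"
proof -
  assume mu: "\<mu> > - 1 / 2" and a: "a > 0"
  have "integrable (weight_measure \<mu>) (\<lambda>t. Re (gauss_poly (a + a) (n + n) t))"
    using gauss_poly_moment[OF mu, of "a + a" "n + n"] a by (intro integrable_Re) (auto simp: has_bochner_integral_iff)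
  also have "(\<lambda>t. Re (gauss_poly (a + a) (n + n) t)) = (\<lambda>t. (cmod (gauss_poly a n t))\<^sup>2)"
    unfolding gauss_poly_mult[symmetric]
    by (simp only: gauss_poly_def norm_of_real power2_abs power2_eq_square of_real_mult[symmetric] Re_complex_of_real
      abs_mult_self_eq)
  finally show ?thesis by (simp add: L2_abs_iff gauss_poly_lebesgue)
qed

text \<open>The real and imaginary parts of \<open>f\<close>, times weight and Gaussian, have
  vanishing moments. They are exponentially integrable because \<open>f\<close> is square integrable
  and the Gaussian absorbs \<open>exp (r * \<bar>t\<bar>)\<close>.\<close>

theorem gauss_poly_complete:
  assumes mu: "\<mu> > - 1 / 2" and a: "a > 0" and F: "F \<in> L2 \<mu>"
    and orth: "\<And>n. l2_inner \<mu> F (abs_fclass (gauss_poly a n)) = 0"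
  shows "F = 0"
proof -
  obtain f where f [measurable]: "f \<in> borel_measurable borel" and fl: "f \<in> borel_measurable lebesgue"
    and F_eq: "F = abs_fclass f"
    by (rule fclass_borel_cases)
  let ?w = "\<lambda>t::real. \<bar>t\<bar> powr (2 * \<mu>)"
  have L: "integrable (weight_measure \<mu>) (\<lambda>t. (cmod (f t))\<^sup>2)"
    using F fl by (simp add: F_eq L2_abs_iff)
  have int: "integrable (weight_measure \<mu>) (\<lambda>t. exp (r * \<bar>t\<bar>) * exp (- (a * t\<^sup>2)) * cmod (f t))" for r
  proof (rule Bochner_Integration.integrable_bound)
    \<comment> \<open>From completing the square:
      \<open>2 r \<bar>t\<bar> - a t^2 \<le> r^2 / a\<close>.\<close>
    let ?C = "exp (r\<^sup>2 / a)"
    show "integrable (weight_measure \<mu>) (\<lambda>t. (cmod (f t))\<^sup>2 + ?C * Re (gauss_poly a 0 t))"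
      using gauss_poly_moment[OF mu a, of 0] L
      by (intro Bochner_Integration.integrable_add integrable_mult_right integrable_Re) (auto simp: has_bochner_integral_iff)
    show "AE t in weight_measure \<mu>. norm (exp (r * \<bar>t\<bar>) * exp (- (a * t\<^sup>2)) * cmod (f t)) \<le>
        norm ((cmod (f t))\<^sup>2 + ?C * Re (gauss_poly a 0 t))"
    proof (rule AE_I2)
      fix t
      let ?u = "exp (r * \<bar>t\<bar>) * exp (- (a * t\<^sup>2))"
      have "0 \<le> (r / a - \<bar>t\<bar>)\<^sup>2 * a" using a by simp
      also have "\<dots> = r\<^sup>2 / a - 2 * r * \<bar>t\<bar> + a * t\<^sup>2"
        using a by (simp add: power2_diff field_simps power2_eq_square)
      finally have "2 * (r * \<bar>t\<bar>) - 2 * (a * t\<^sup>2) \<le> r\<^sup>2 / a - a * t\<^sup>2" by simp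
      then have "exp (2 * (r * \<bar>t\<bar>) - 2 * (a * t\<^sup>2)) \<le> exp (r\<^sup>2 / a - a * t\<^sup>2)" by simp
      moreover have "?u\<^sup>2 = exp (2 * (r * \<bar>t\<bar>) - 2 * (a * t\<^sup>2))"
      proof -
        have "?u = exp (r * \<bar>t\<bar> - a * t\<^sup>2)" by (simp add: exp_diff exp_minus divide_inverse)
        then have "?u\<^sup>2 = exp (2 * (r * \<bar>t\<bar> - a * t\<^sup>2))" by (simp only: exp_double)
        then show ?thesis by (simp add: algebra_simps)
      qed
      moreover have "exp (r\<^sup>2 / a - a * t\<^sup>2) = ?C * exp (- (a * t\<^sup>2))"
        by (simp add: exp_add[symmetric])
      ultimately have "?u\<^sup>2 \<le> ?C * exp (- (a * t\<^sup>2))" by simp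
      moreover have "?u * cmod (f t) \<le> (cmod (f t))\<^sup>2 + ?u\<^sup>2"
      proof -
        have "0 \<le> ?u * cmod (f t)" by simp
        with sum_squares_bound[of ?u "cmod (f t)"] show ?thesis by linarith
      qed
      ultimately have "?u * cmod (f t) \<le> (cmod (f t))\<^sup>2 + ?C * exp (- (a * t\<^sup>2))" by linarith
      then show "norm (?u * cmod (f t)) \<le> norm ((cmod (f t))\<^sup>2 + ?C * Re (gauss_poly a 0 t))"
        by (simp add: gauss_poly_def)
    qed
    show "(\<lambda>t. exp (r * \<bar>t\<bar>) * exp (- (a * t\<^sup>2)) * cmod (f t)) \<in> borel_measurable (weight_measure \<mu>)"
      unfolding measurable_weight_measure by (rule measurable_completion) measurable
  qed
  have zero: "AE t in lborel. ?w t * (exp (- (a * t\<^sup>2)) * g (f t)) = 0"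
    if g: "bounded_linear g" "\<And>z. \<bar>g z\<bar> \<le> cmod z" for g :: "complex \<Rightarrow> real"
  proof (rule moments_zero_imp_AE_zero)
    have [measurable]: "g \<in> borel_measurable borel"
      using linear_continuous_on[OF g(1)] by (rule borel_measurable_continuous_onI)
    show "(\<lambda>t. ?w t * (exp (- (a * t\<^sup>2)) * g (f t))) \<in> borel_measurable borel" by measurable
    show "integrable lborel (\<lambda>t. exp (r * \<bar>t\<bar>) * \<bar>?w t * (exp (- (a * t\<^sup>2)) * g (f t))\<bar>)" for r
    proof (rule Bochner_Integration.integrable_bound)
      show "integrable lborel (\<lambda>t. ?w t *\<^sub>R (exp (r * \<bar>t\<bar>) * exp (- (a * t\<^sup>2)) * cmod (f t)))"
        using int[of r] by (subst (asm) integrable_weight_measure_iff) auto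
      show "AE t in lborel. norm (exp (r * \<bar>t\<bar>) * \<bar>?w t * (exp (- (a * t\<^sup>2)) * g (f t))\<bar>) \<le>
          norm (?w t *\<^sub>R (exp (r * \<bar>t\<bar>) * exp (- (a * t\<^sup>2)) * cmod (f t)))"
        by (intro AE_I2) (simp add: abs_mult ac_simps, intro mult_right_mono g(2), simp)
    qed measurable
    fix n
    have "integrable (weight_measure \<mu>) (\<lambda>t. f t * cnj (gauss_poly a n t))"
      using F fl gauss_poly_L2[OF mu a, of n] by (intro L2_integrable_inner gauss_poly_lebesgue) (auto simp: F_eq)
    then have "integrable lborel (\<lambda>t. ?w t *\<^sub>R (f t * gauss_poly a n t))"
      by (subst (asm) integrable_weight_measure_iff) auto
    moreover have "(LINT t|lborel. ?w t *\<^sub>R (f t * gauss_poly a n t)) = 0"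
      using orth[of n] fl by (simp add: F_eq l2_inner_abs gauss_poly_lebesgue integrable_weight_measure_iff)
    ultimately have "(LINT t|lborel. g (?w t *\<^sub>R (f t * gauss_poly a n t))) = 0"
      by (simp only: integral_bounded_linear[OF g(1)] linear_0[OF bounded_linear.linear[OF g(1)]])
    moreover have "g (?w t *\<^sub>R (f t * gauss_poly a n t)) = t ^ n * (?w t * (exp (- (a * t\<^sup>2)) * g (f t)))" for t
    proof -
      have "?w t *\<^sub>R (f t * gauss_poly a n t) = (t ^ n * (?w t * exp (- (a * t\<^sup>2)))) *\<^sub>R f t"
        by (simp add: gauss_poly_def scaleR_conv_of_real[where 'a=complex])
      then show ?thesis using linear_cmul[OF bounded_linear.linear[OF g(1)]] by simp
    qed
    ultimately show "(LINT t|lborel. t ^ n * (?w t * (exp (- (a * t\<^sup>2)) * g (f t)))) = 0" by simp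
  qed
  have "AE t in lborel. ?w t * (exp (- (a * t\<^sup>2)) * Re (f t)) = 0"
    by (rule zero[OF bounded_linear_Re abs_Re_le_cmod])
  moreover have "AE t in lborel. ?w t * (exp (- (a * t\<^sup>2)) * Im (f t)) = 0"
    by (rule zero[OF bounded_linear_Im abs_Im_le_cmod])
  moreover have "AE t in lborel. t \<noteq> (0::real)" by (rule AE_lborel_singleton)
  ultimately have "AE t in lborel. f t = 0"
    by eventually_elim (auto simp: complex_eq_iff)
  then have "AE t in lebesgue. f t = 0" by (rule AE_completion)
  then show ?thesis unfolding F_eq abs_fclass_0 using fl by (intro abs_fclass_eqI) auto
qed

section \<open>The Dunkl operator on Gaussian polynomials\<close>

text \<open>\<open>f'\<close> is the Dunkl derivative of \<open>f\<close> off \<open>0\<close>. As a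
  relation it carries differentiability along in linear combinations, and it leaves the values of
  \<open>f'\<close> at \<open>0\<close> free.\<close>

definition has_dunkl :: "real \<Rightarrow> (real \<Rightarrow> complex) \<Rightarrow> (real \<Rightarrow> complex) \<Rightarrow> bool" where
  "has_dunkl \<mu> f f' \<longleftrightarrow> (\<forall>x. x \<noteq> 0 \<longrightarrow>
     (\<exists>d. (f has_vector_derivative d) (at x) \<and> f' x = d + complex_of_real (\<mu> / x) * (f x - f (- x))))"

lemma P_fun_has_dunkl: "has_dunkl \<mu> f f' \<Longrightarrow> x \<noteq> 0 \<Longrightarrow> P_fun \<mu> f x = - \<i> * f' x"
  unfolding has_dunkl_def P_fun_def by (metis vector_derivative_at)

lemma has_dunkl_unique: "has_dunkl \<mu> f f' \<Longrightarrow> has_dunkl \<mu> f f'' \<Longrightarrow> x \<noteq> 0 \<Longrightarrow> f' x = f'' x"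
  using P_fun_has_dunkl[of \<mu> f f' x] P_fun_has_dunkl[of \<mu> f f'' x] by simp

lemma has_dunkl_sum:
  assumes "\<And>n. n \<in> A \<Longrightarrow> has_dunkl \<mu> (f n) (f' n)"
  shows "has_dunkl \<mu> (\<lambda>x. \<Sum>n\<in>A. c n * f n x) (\<lambda>x. \<Sum>n\<in>A. c n * f' n x)"
  unfolding has_dunkl_def
proof (intro allI impI)
  fix x :: real assume x: "x \<noteq> 0"
  define d where "d n = vector_derivative (f n) (at x)" for n
  have d: "(f n has_vector_derivative d n) (at x)"
    "f' n x = d n + complex_of_real (\<mu> / x) * (f n x - f n (- x))" if n: "n \<in> A" for n
  proof -
    obtain e where "(f n has_vector_derivative e) (at x)"
        "f' n x = e + complex_of_real (\<mu> / x) * (f n x - f n (- x))"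
      using assms[OF n] x unfolding has_dunkl_def by blast
    moreover from this(1) have "e = d n" by (simp add: d_def vector_derivative_at)
    ultimately show "(f n has_vector_derivative d n) (at x)"
      "f' n x = d n + complex_of_real (\<mu> / x) * (f n x - f n (- x))" by simp_all
  qed
  have "((\<lambda>x. \<Sum>n\<in>A. c n * f n x) has_vector_derivative (\<Sum>n\<in>A. c n * d n)) (at x)"
    by (intro has_vector_derivative_sum has_vector_derivative_mult_right d)
  moreover have "(\<Sum>n\<in>A. c n * f' n x) =
      (\<Sum>n\<in>A. c n * d n) + complex_of_real (\<mu> / x) * ((\<Sum>n\<in>A. c n * f n x) - (\<Sum>n\<in>A. c n * f n (- x)))"
    unfolding sum_subtractf[symmetric] sum_distrib_left sum.distrib[symmetric]
    by (intro sum.cong refl) (simp add: d algebra_simps)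
  ultimately show "\<exists>d. ((\<lambda>x. \<Sum>n\<in>A. c n * f n x) has_vector_derivative d) (at x) \<and>
      (\<Sum>n\<in>A. c n * f' n x) = d + complex_of_real (\<mu> / x) *
        ((\<Sum>n\<in>A. c n * f n x) - (\<Sum>n\<in>A. c n * f n (- x)))" by blast
qed

lemma has_dunkl_diff:
  assumes "has_dunkl \<mu> f f'" "has_dunkl \<mu> g g'"
  shows "has_dunkl \<mu> (\<lambda>x. a * f x - b * g x) (\<lambda>x. a * f' x - b * g' x)"
proof -
  have "has_dunkl \<mu> (\<lambda>x. \<Sum>k\<in>{True, False}. (if k then a else - b) * (if k then f else g) x)
      (\<lambda>x. \<Sum>k\<in>{True, False}. (if k then a else - b) * (if k then f' else g') x)"
    by (rule has_dunkl_sum) (use assms in simp)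
  then show ?thesis by simp
qed

text \<open>Only values off \<open>0\<close> enter, and the complement of \<open>0\<close> is open
  and symmetric.\<close>

lemma has_dunkl_cong:
  assumes "has_dunkl \<mu> f f'" "\<And>x. x \<noteq> 0 \<Longrightarrow> g x = f x"
  shows "has_dunkl \<mu> g f'"
  unfolding has_dunkl_def
proof (intro allI impI)
  fix x :: real assume x: "x \<noteq> 0"
  then obtain d where d: "(f has_vector_derivative d) (at x)"
    "f' x = d + complex_of_real (\<mu> / x) * (f x - f (- x))"
    using assms(1) unfolding has_dunkl_def by blast
  have "(g has_vector_derivative d) (at x)"
    by (rule has_vector_derivative_transform_within_open[OF d(1), of "- {0}"]) (use x assms(2) in auto)
  with d x show "\<exists>d. (g has_vector_derivative d) (at x) \<and> f' x = d + complex_of_real (\<mu> / x) * (g x - g (- x))"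
    by (auto simp: assms(2))
qed

definition dunkl_gauss :: "real \<Rightarrow> real \<Rightarrow> nat \<Rightarrow> real \<Rightarrow> complex" where
  "dunkl_gauss \<mu> a n x = complex_of_real (dunkl_nat \<mu> n) * gauss_poly a (n - 1) x -
     complex_of_real (2 * a) * gauss_poly a (Suc n) x"

text \<open>For odd \<open>n\<close> the reflection term adds
  \<open>2 * \<mu> * x ^ (n - 1)\<close>, completing \<open>n\<close> to
  \<open>dunkl_nat \<mu> n\<close>. The truncated exponent \<open>n - 1\<close> at
  \<open>n = 0\<close> carries the coefficient \<open>0\<close>.\<close>

lemma has_dunkl_gauss_poly: "has_dunkl \<mu> (gauss_poly a n) (dunkl_gauss \<mu> a n)"
  unfolding has_dunkl_def
proof (intro allI impI exI conjI)
  fix x :: real assume x: "x \<noteq> 0"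
  let ?E = "exp (- (a * x\<^sup>2))"
  let ?d = "?E * (real n * x ^ (n - 1)) - 2 * a * x * ?E * x ^ n"
  have "((\<lambda>x. exp (- (a * x\<^sup>2)) * x ^ n) has_real_derivative ?d) (at x)"
    by (auto intro!: derivative_eq_intros simp: algebra_simps)
  then show "(gauss_poly a n has_vector_derivative complex_of_real ?d) (at x)"
    unfolding gauss_poly_def[abs_def] has_real_derivative_iff_has_vector_derivative
    by (rule bounded_linear.has_vector_derivative[OF bounded_linear_of_real])
  have refl: "\<mu> / x * (x ^ n - (- x) ^ n) = (if odd n then 2 * \<mu> else 0) * x ^ (n - 1)"
    using x by (cases n) auto
  have "dunkl_nat \<mu> n * (?E * x ^ (n - 1)) - 2 * a * (?E * x ^ Suc n) =
      ?d + \<mu> / x * (?E * x ^ n - exp (- (a * (- x)\<^sup>2)) * (- x) ^ n)"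
  proof -
    have "\<mu> / x * (?E * x ^ n - exp (- (a * (- x)\<^sup>2)) * (- x) ^ n) = ?E * (\<mu> / x * (x ^ n - (- x) ^ n))"
      by (simp add: algebra_simps)
    then show ?thesis unfolding refl by (simp add: dunkl_nat_def algebra_simps)
  qed
  then show "dunkl_gauss \<mu> a n x = complex_of_real ?d +
      complex_of_real (\<mu> / x) * (gauss_poly a n x - gauss_poly a n (- x))"
    unfolding dunkl_gauss_def gauss_poly_def of_real_mult[symmetric] of_real_diff[symmetric] of_real_add[symmetric]
    by (simp only:)
qed

lemma fspanI: "(\<lambda>x. \<Sum>n<N. c n * g n x) \<in> fspan g"
  unfolding fspan_def by blast

text \<open>Coefficient sequences are padded with zeros; the sum of their lengths serves as the
  common bound.\<close>

lemma fspan_sum: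
  assumes "finite A" "\<And>k. k \<in> A \<Longrightarrow> f k \<in> fspan g"
  shows "(\<lambda>x. \<Sum>k\<in>A. c k * f k x) \<in> fspan g"
proof -
  from assms(2) have "\<exists>N d. \<forall>x. f k x = (\<Sum>n<N. d n * g n x)" if "k \<in> A" for k
    using that unfolding fspan_def by fastforce
  then obtain N d where Nd: "\<And>k x. k \<in> A \<Longrightarrow> f k x = (\<Sum>n<N k. d k n * g n x)"
    by metis
  let ?M = "\<Sum>k\<in>A. N k"
  have "(\<Sum>k\<in>A. c k * f k x) = (\<Sum>n<?M. (\<Sum>k\<in>A. if n < N k then c k * d k n else 0) * g n x)" for x
  proof -
    have "f k x = (\<Sum>n<?M. (if n < N k then d k n else 0) * g n x)" if k: "k \<in> A" for k
    proof -
      have "N k \<le> ?M" using member_le_sum[OF k, of N] assms(1) by simp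
      then show ?thesis unfolding Nd[OF k] by (intro sum.mono_neutral_cong_left) auto
    qed
    then have "(\<Sum>k\<in>A. c k * f k x) = (\<Sum>k\<in>A. \<Sum>n<?M. (if n < N k then c k * d k n else 0) * g n x)"
      by (intro sum.cong refl) (auto simp: sum_distrib_left intro!: sum.cong)
    also have "\<dots> = (\<Sum>n<?M. (\<Sum>k\<in>A. if n < N k then c k * d k n else 0) * g n x)"
      by (subst sum.swap) (simp add: sum_distrib_right)
    finally show ?thesis .
  qed
  then have "(\<lambda>x. \<Sum>k\<in>A. c k * f k x) =
      (\<lambda>x. \<Sum>n<?M. (\<Sum>k\<in>A. if n < N k then c k * d k n else 0) * g n x)" by (rule ext)
  then show ?thesis by (simp only: fspanI)
qed

lemma fspan_scale: "f \<in> fspan g \<Longrightarrow> (\<lambda>x. c * f x) \<in> fspan g"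
  using fspan_sum[of "{()}" "\<lambda>_. f" g "\<lambda>_. c"] by simp

lemma fspan_add: "f \<in> fspan g \<Longrightarrow> f' \<in> fspan g \<Longrightarrow> (\<lambda>x. c * f x + d * f' x) \<in> fspan g"
  using fspan_sum[of "{True, False}" "\<lambda>k. if k then f else f'" g "\<lambda>k. if k then c else d"] by simp

lemma fspan_base: "g n \<in> fspan g"
proof -
  have "g n = (\<lambda>x. \<Sum>k<Suc n. (if k = n then 1 else 0) * g k x)"
    by (intro ext) (auto simp: if_distribR)
  then show ?thesis using fspanI by metis
qed

lemma fspan_cases:
  assumes "f \<in> fspan g"
  obtains N c where "f = (\<lambda>x. \<Sum>n<N. c n * g n x)"
  using assms unfolding fspan_def by blast

lemma Q_fun_gauss_poly: "Q_fun (gauss_poly a n) = gauss_poly a (Suc n)"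
  by (intro ext) (simp add: Q_fun_def gauss_poly_def)

lemma Q_fun_sum: "Q_fun (\<lambda>x. \<Sum>n\<in>A. c n * f n x) = (\<lambda>x. \<Sum>n\<in>A. c n * Q_fun (f n) x)"
  by (intro ext) (simp add: Q_fun_def sum_distrib_left ac_simps)

lemma fspan_Q_fun:
  assumes "f \<in> fspan g" "\<And>n. Q_fun (g n) \<in> fspan g"
  shows "Q_fun f \<in> fspan g"
proof -
  obtain N c where "f = (\<lambda>x. \<Sum>n<N. c n * g n x)" using assms(1) by (rule fspan_cases)
  then show ?thesis unfolding Q_fun_sum using assms(2) by (simp only: Q_fun_sum) (intro fspan_sum, auto)
qed

lemma dunkl_gauss_fspan: "dunkl_gauss \<mu> a n \<in> fspan (gauss_poly a)"
  using fspan_add[OF fspan_base[of "gauss_poly a" "n - 1"] fspan_base[of "gauss_poly a" "Suc n"],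
      of "complex_of_real (dunkl_nat \<mu> n)" "- complex_of_real (2 * a)"]
  by (simp add: dunkl_gauss_def[abs_def])

lemma fspan_has_dunkl:
  assumes "f \<in> fspan (gauss_poly a)"
  obtains f' where "f' \<in> fspan (gauss_poly a)" "has_dunkl \<mu> f f'"
proof -
  obtain N c where f: "f = (\<lambda>x. \<Sum>n<N. c n * gauss_poly a n x)" using assms by (rule fspan_cases)
  show thesis
  proof (rule that)
    show "(\<lambda>x. \<Sum>n<N. c n * dunkl_gauss \<mu> a n x) \<in> fspan (gauss_poly a)"
      by (intro fspan_sum dunkl_gauss_fspan) simp
    show "has_dunkl \<mu> f (\<lambda>x. \<Sum>n<N. c n * dunkl_gauss \<mu> a n x)"
      unfolding f by (intro has_dunkl_sum has_dunkl_gauss_poly)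
  qed
qed

lemma fspan_gauss_poly_borel:
  assumes "f \<in> fspan (gauss_poly a)"
  shows "f \<in> borel_measurable borel"
proof -
  obtain N c where f: "f = (\<lambda>x. \<Sum>n<N. c n * gauss_poly a n x)" using assms by (rule fspan_cases)
  show ?thesis unfolding f by measurable
qed

lemma fspan_gauss_poly_lebesgue: "f \<in> fspan (gauss_poly a) \<Longrightarrow> f \<in> borel_measurable lebesgue"
  by (rule measurable_completion) (simp add: fspan_gauss_poly_borel)

lemma abs_fclass_fspan:
  fixes g :: "nat \<Rightarrow> real \<Rightarrow> complex"
  assumes "\<And>n. g n \<in> borel_measurable lebesgue"
  shows "abs_fclass (\<lambda>x. \<Sum>n<N. c n * g n x) = (\<Sum>n<N. c n *\<^sub>C abs_fclass (g n))"
  by (rule abs_fclass_sum[of g, OF assms, symmetric])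

lemma fspan_gauss_poly_L2:
  assumes "\<mu> > - 1 / 2" "a > 0" "f \<in> fspan (gauss_poly a)"
  shows "abs_fclass f \<in> L2 \<mu>"
proof -
  obtain N c where f: "f = (\<lambda>x. \<Sum>n<N. c n * gauss_poly a n x)" using assms(3) by (rule fspan_cases)
  show ?thesis unfolding f abs_fclass_fspan[of "gauss_poly a", OF gauss_poly_lebesgue]
    by (intro L2_sum gauss_poly_L2 assms)
qed

lemma abs_fclass_cong_nonzero:
  assumes f: "f \<in> borel_measurable lebesgue" and eq: "\<And>x. x \<noteq> 0 \<Longrightarrow> g x = f x"
  shows "g \<in> borel_measurable lebesgue" "abs_fclass g = abs_fclass f"
proof -
  show g: "g \<in> borel_measurable lebesgue"
    by (rule measurable_discrete_difference[OF f, of "{0}"]) (use eq in auto)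
  have "AE t in lebesgue. t \<noteq> (0::real)"
    using AE_lborel_singleton[of "0::real"] by (rule AE_completion)
  then have "AE t in lebesgue. g t = f t" by eventually_elim (rule eq)
  then show "abs_fclass g = abs_fclass f" using f g by (intro abs_fclass_eqI)
qed

lemma integrable_fspan_mult:
  assumes mu: "\<mu> > - 1 / 2" and ab: "a > 0" "b > 0"
    and f: "f \<in> fspan (gauss_poly a)" and g: "g \<in> fspan (gauss_poly b)"
  shows "integrable (weight_measure \<mu>) (\<lambda>t. f t * g t)"
  using fspan_gauss_poly_L2[OF mu ab(1) f] fspan_gauss_poly_L2[OF mu ab(2) g]
  by (intro L2_integrable_mult fspan_gauss_poly_lebesgue[OF f] fspan_gauss_poly_lebesgue[OF g])
    (simp_all add: L2_abs_iff fspan_gauss_poly_lebesgue[OF f] fspan_gauss_poly_lebesgue[OF g])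

text \<open>Antisymmetry is checked on moments, which avoids boundary terms at the singularity of
  the weight. For even \<open>j + k\<close> all moments vanish; for odd \<open>j + k = n + 1\<close>
  the claim is the moment recurrence, because
  \<open>dunkl_nat \<mu> j + dunkl_nat \<mu> k = n + 1 + 2 * \<mu>\<close>.\<close>

lemma dunkl_skew_monomials:
  assumes mu: "\<mu> > - 1 / 2" and ab: "a > 0" "b > 0"
  shows "(LINT t|weight_measure \<mu>. dunkl_gauss \<mu> a j t * gauss_poly b k t) =
    - (LINT t|weight_measure \<mu>. gauss_poly a j t * dunkl_gauss \<mu> b k t)"
proof -
  let ?M = "gaussian_moment \<mu> (a + b)"
  have m: "integrable (weight_measure \<mu>) (gauss_poly (a + b) n)"
    "(LINT t|weight_measure \<mu>. gauss_poly (a + b) n t) = complex_of_real (?M n)" for n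
    using gauss_poly_moment[OF mu, of "a + b" n] ab by (simp_all add: has_bochner_integral_iff)
  have 1: "(LINT t|weight_measure \<mu>. dunkl_gauss \<mu> a j t * gauss_poly b k t) =
      complex_of_real (dunkl_nat \<mu> j * ?M (j - 1 + k) - 2 * a * ?M (Suc (j + k)))"
    by (simp add: dunkl_gauss_def left_diff_distrib mult.assoc gauss_poly_mult m)
  have 2: "(LINT t|weight_measure \<mu>. gauss_poly a j t * dunkl_gauss \<mu> b k t) =
      complex_of_real (dunkl_nat \<mu> k * ?M (j + (k - 1)) - 2 * b * ?M (Suc (j + k)))"
    by (simp add: dunkl_gauss_def right_diff_distrib mult.left_commute[of "gauss_poly a j _"] gauss_poly_mult m)
  have "dunkl_nat \<mu> j * ?M (j - 1 + k) + dunkl_nat \<mu> k * ?M (j + (k - 1)) = 2 * (a + b) * ?M (Suc (j + k))"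
  proof (cases "even (j + k)")
    case True
    have "dunkl_nat \<mu> j * ?M (j - 1 + k) = 0"
      using True by (cases j) (auto simp: gaussian_moment_odd)
    moreover have "dunkl_nat \<mu> k * ?M (j + (k - 1)) = 0"
      using True by (cases k) (auto simp: gaussian_moment_odd)
    moreover have "?M (Suc (j + k)) = 0" using True by (intro gaussian_moment_odd) simp
    ultimately show ?thesis by (simp only: mult_zero_right add_0_right)
  next
    case False
    then obtain n where n: "j + k = Suc n" "even n" by (cases "j + k") auto
    have e1: "dunkl_nat \<mu> j * ?M (j - 1 + k) = dunkl_nat \<mu> j * ?M n"
      using n by (cases j) auto
    have e2: "dunkl_nat \<mu> k * ?M (j + (k - 1)) = dunkl_nat \<mu> k * ?M n"
      using n by (cases k) auto
    have e3: "dunkl_nat \<mu> j + dunkl_nat \<mu> k = real n + 1 + 2 * \<mu>"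
    proof -
      have "real j + real k = real n + 1" using n by (metis of_nat_add of_nat_Suc add.commute)
      moreover have "odd j \<longleftrightarrow> even k" using False by auto
      ultimately show ?thesis by (auto simp: dunkl_nat_def)
    qed
    have "dunkl_nat \<mu> j * ?M (j - 1 + k) + dunkl_nat \<mu> k * ?M (j + (k - 1)) = (real n + 1 + 2 * \<mu>) * ?M n"
      unfolding e1 e2 distrib_right[symmetric] e3 ..
    also have "\<dots> = 2 * (a + b) * ?M (n + 2)"
      using gaussian_moment_rec[OF mu _ n(2), of "a + b"] ab by simp
    finally show ?thesis by (simp only: n(1) add_2_eq_Suc')
  qed
  then have "dunkl_nat \<mu> j * ?M (j - 1 + k) - 2 * a * ?M (Suc (j + k)) =
      - (dunkl_nat \<mu> k * ?M (j + (k - 1)) - 2 * b * ?M (Suc (j + k)))"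
    by (simp add: algebra_simps)
  then show ?thesis unfolding 1 2 by (simp only: of_real_minus)
qed

text \<open>Bilinear extension from monomials. Two exponents \<open>a\<close> and \<open>b\<close>
  are allowed since Hermite functions, with \<open>1 / 2\<close>, are also paired with functions for
  \<open>1\<close> and \<open>1 / 4\<close>.\<close>

lemma dunkl_skew:
  assumes mu: "\<mu> > - 1 / 2" and ab: "a > 0" "b > 0"
    and f: "f \<in> fspan (gauss_poly a)" "has_dunkl \<mu> f f'" "f' \<in> borel_measurable lebesgue"
    and g: "g \<in> fspan (gauss_poly b)" "has_dunkl \<mu> g g'" "g' \<in> borel_measurable lebesgue"
  shows "(LINT t|weight_measure \<mu>. f' t * g t) = - (LINT t|weight_measure \<mu>. f t * g' t)"
proof -
  obtain N c where fe: "f = (\<lambda>x. \<Sum>n<N. c n * gauss_poly a n x)" using f(1) by (rule fspan_cases)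
  obtain K d where ge: "g = (\<lambda>x. \<Sum>n<K. d n * gauss_poly b n x)" using g(1) by (rule fspan_cases)
  let ?f' = "\<lambda>x. \<Sum>n<N. c n * dunkl_gauss \<mu> a n x" and ?g' = "\<lambda>x. \<Sum>n<K. d n * dunkl_gauss \<mu> b n x"
  have F: "has_dunkl \<mu> f ?f'" and G: "has_dunkl \<mu> g ?g'"
    unfolding fe ge by (intro has_dunkl_sum has_dunkl_gauss_poly)+
  have dg: "dunkl_gauss \<mu> a' n \<in> borel_measurable lebesgue" for a' n
    by (rule fspan_gauss_poly_lebesgue[OF dunkl_gauss_fspan])
  have fm: "f \<in> borel_measurable lebesgue" "g \<in> borel_measurable lebesgue"
      "?f' \<in> borel_measurable lebesgue" "?g' \<in> borel_measurable lebesgue"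
    using f(1) g(1) by (simp_all only: fspan_gauss_poly_lebesgue)
      (intro measurable_sum_scaled[of "dunkl_gauss \<mu> a"] measurable_sum_scaled[of "dunkl_gauss \<mu> b"] dg)+
  have nz: "AE t in weight_measure \<mu>. t \<noteq> 0"
    by (rule AE_weight_measureI[OF AE_completion[OF AE_lborel_singleton]])
  have int: "integrable (weight_measure \<mu>) (\<lambda>t. dunkl_gauss \<mu> a i t * gauss_poly b j t)"
     "integrable (weight_measure \<mu>) (\<lambda>t. gauss_poly a i t * dunkl_gauss \<mu> b j t)" for i j
    by (intro integrable_fspan_mult[OF mu ab] dunkl_gauss_fspan fspan_base)+
  have "(LINT t|weight_measure \<mu>. f' t * g t) = (LINT t|weight_measure \<mu>. ?f' t * g t)"
  proof (rule integral_cong_AE)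
    show "AE t in weight_measure \<mu>. f' t * g t = ?f' t * g t"
      using nz by eventually_elim (simp add: has_dunkl_unique[OF f(2) F])
  qed (simp_all only: measurable_weight_measure borel_measurable_times f(3) fm)
  also have "\<dots> = (LINT t|weight_measure \<mu>. (\<Sum>i<N. \<Sum>j<K. (c i * d j) * (dunkl_gauss \<mu> a i t * gauss_poly b j t)))"
    unfolding ge sum_product by (intro Bochner_Integration.integral_cong sum.cong refl) (simp only: ac_simps)
  also have "\<dots> = (\<Sum>i<N. \<Sum>j<K. (c i * d j) * (LINT t|weight_measure \<mu>. dunkl_gauss \<mu> a i t * gauss_poly b j t))"
    using int(1) by (simp add: Bochner_Integration.integral_sum)
  also have "\<dots> = - (\<Sum>i<N. \<Sum>j<K. (c i * d j) * (LINT t|weight_measure \<mu>. gauss_poly a i t * dunkl_gauss \<mu> b j t))"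
    unfolding dunkl_skew_monomials[OF mu ab] by (simp add: sum_negf)
  also have "(\<Sum>i<N. \<Sum>j<K. (c i * d j) * (LINT t|weight_measure \<mu>. gauss_poly a i t * dunkl_gauss \<mu> b j t)) =
      (LINT t|weight_measure \<mu>. (\<Sum>i<N. \<Sum>j<K. (c i * d j) * (gauss_poly a i t * dunkl_gauss \<mu> b j t)))"
    using int(2) by (simp add: Bochner_Integration.integral_sum)
  also have "\<dots> = (LINT t|weight_measure \<mu>. f t * ?g' t)"
    unfolding fe sum_product by (intro Bochner_Integration.integral_cong sum.cong refl) (simp only: ac_simps)
  also have "\<dots> = (LINT t|weight_measure \<mu>. f t * g' t)"
  proof (rule integral_cong_AE)
    show "AE t in weight_measure \<mu>. f t * ?g' t = f t * g' t"
      using nz by eventually_elim (simp add: has_dunkl_unique[OF g(2) G])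
  qed (simp_all only: measurable_weight_measure borel_measurable_times g(3) fm)
  finally show ?thesis .
qed

section \<open>Generalized Hermite functions\<close>

text \<open>Summand of the Hermite polynomial without \<open>fact n\<close>, continued by
  \<open>0\<close> beyond \<open>n div 2\<close> so that sums for neighbouring \<open>n\<close> can
  be compared over one index range.\<close>

definition hermite_term :: "real \<Rightarrow> nat \<Rightarrow> nat \<Rightarrow> real \<Rightarrow> real" where
  "hermite_term \<mu> n k x =
     (if 2 * k \<le> n then (- 1) ^ k * (2 * x) ^ (n - 2 * k) / (fact k * gamma_mu \<mu> (n - 2 * k)) else 0)"

definition hermite_q :: "real \<Rightarrow> nat \<Rightarrow> real \<Rightarrow> real" where
  "hermite_q \<mu> n x = (\<Sum>k\<le>n. hermite_term \<mu> n k x)"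

lemma hermite_mu_eq: "hermite_mu \<mu> n x = fact n * hermite_q \<mu> n x"
proof -
  have "(\<Sum>k\<le>n div 2. (- 1) ^ k * (2 * x) ^ (n - 2 * k) / (fact k * gamma_mu \<mu> (n - 2 * k))) = hermite_q \<mu> n x"
    unfolding hermite_q_def by (intro sum.mono_neutral_cong_left) (auto simp: hermite_term_def)
  then show ?thesis by (simp add: hermite_mu_def)
qed

lemma hermite_q_extend: "n \<le> K \<Longrightarrow> hermite_q \<mu> n x = (\<Sum>k\<le>K. hermite_term \<mu> n k x)"
  unfolding hermite_q_def by (intro sum.mono_neutral_cong_left) (auto simp: hermite_term_def)

context
  fixes \<mu> :: real
  assumes mu: "\<mu> > - 1 / 2"
begin

text \<open>Rests on \<open>dunkl_nat \<mu> (Suc n) - 2 * k = dunkl_nat \<mu> (Suc n - 2 *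
  k)\<close>: removing an even number keeps the parity. The assumption excludes \<open>n = 0\<close>
  with positive \<open>k\<close>, where \<open>n - 1\<close> would be truncated.\<close>

lemma hermite_term_rec:
  assumes "k \<ge> 1 \<Longrightarrow> n \<ge> 1"
  shows "2 * x * hermite_term \<mu> n k x =
    dunkl_nat \<mu> (Suc n) * hermite_term \<mu> (Suc n) k x + 2 * (if k = 0 then 0 else hermite_term \<mu> (n - 1) (k - 1) x)"
proof (cases "2 * k \<le> Suc n")
  case True
  define r where "r = Suc n - 2 * k"
  let ?A = "(- 1) ^ k * (2 * x) ^ r / (fact k * gamma_mu \<mu> r)"
  have 1: "hermite_term \<mu> (Suc n) k x = ?A" using True by (simp add: hermite_term_def r_def)
  have 2: "(if k = 0 then 0 else hermite_term \<mu> (n - 1) (k - 1) x) = - real k * ?A"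
  proof (cases k)
    case (Suc j)
    then have "n - 1 - 2 * (k - 1) = r" "2 * (k - 1) \<le> n - 1" using True by (auto simp: r_def)
    moreover have "fact k = real k * fact (k - 1)" "(- 1 :: real) ^ k = - ((- 1) ^ (k - 1))" "k \<noteq> 0"
      by (simp_all add: Suc)
    ultimately show ?thesis using gamma_mu_pos[OF mu, of r] by (simp add: hermite_term_def field_simps)
  qed simp
  have 3: "dunkl_nat \<mu> (Suc n) - 2 * real k = dunkl_nat \<mu> r"
    using True by (simp add: dunkl_nat_def r_def of_nat_diff)
  have 4: "2 * x * hermite_term \<mu> n k x = dunkl_nat \<mu> r * ?A"
  proof (cases r)
    case 0
    then have "\<not> 2 * k \<le> n" using True by (simp add: r_def)
    then show ?thesis by (simp add: hermite_term_def 0)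
  next
    case (Suc j)
    then have "2 * k \<le> n" "n - 2 * k = j" by (auto simp: r_def)
    then show ?thesis
      using dunkl_nat_pos[OF mu, of r] gamma_mu_pos[OF mu, of j]
      by (simp add: hermite_term_def Suc gamma_mu_Suc[OF mu] field_simps)
  qed
  have "(dunkl_nat \<mu> (Suc n) - 2 * real k) * y = dunkl_nat \<mu> (Suc n) * y + 2 * (- real k * y)" for y
    by (simp add: algebra_simps)
  then show ?thesis unfolding 1 2 4 3[symmetric] .
next
  case False
  then show ?thesis using assms by (cases k) (auto simp: hermite_term_def)
qed

lemma hermite_q_rec:
  "2 * x * hermite_q \<mu> n x =
    dunkl_nat \<mu> (Suc n) * hermite_q \<mu> (Suc n) x + (if n = 0 then 0 else 2 * hermite_q \<mu> (n - 1) x)"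
proof (cases n)
  case 0
  then show ?thesis
    using mu dunkl_nat_pos[OF mu, of 1] by (simp add: hermite_q_def hermite_term_def gamma_mu_Suc)
next
  case (Suc m)
  have "2 * x * hermite_q \<mu> n x = (\<Sum>k\<le>Suc n. 2 * x * hermite_term \<mu> n k x)"
    by (simp only: hermite_q_extend[of n "Suc n", OF le_SucI[OF order_refl]] sum_distrib_left)
  also have "\<dots> = dunkl_nat \<mu> (Suc n) * hermite_q \<mu> (Suc n) x +
      2 * (\<Sum>k\<le>Suc n. if k = 0 then 0 else hermite_term \<mu> (n - 1) (k - 1) x)"
    unfolding hermite_q_def[of \<mu> "Suc n"] sum_distrib_left sum.distrib[symmetric]
    by (intro sum.cong refl hermite_term_rec) (simp add: Suc)
  also have "(\<Sum>k\<le>Suc n. if k = 0 then 0 else hermite_term \<mu> (n - 1) (k - 1) x) =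
      (\<Sum>k\<le>n. hermite_term \<mu> (n - 1) k x)"
    by (subst sum.atMost_Suc_shift) simp
  also have "\<dots> = hermite_q \<mu> (n - 1) x" by (rule hermite_q_extend[symmetric]) simp
  finally show ?thesis by (simp add: Suc)
qed

text \<open>The normalising factor of \<open>phi_mu\<close> after \<open>fact n\<close> has
  cancelled against the one in \<open>hermite_mu\<close>.\<close>

definition hermite_scale :: "nat \<Rightarrow> real" where
  "hermite_scale n = sqrt (gamma_mu \<mu> n / Gamma (\<mu> + 1 / 2)) / 2 powr (n / 2)"

lemma phi_mu_eq: "phi_mu \<mu> n x = complex_of_real (hermite_scale n * exp (- (1 / 2 * x\<^sup>2)) * hermite_q \<mu> n x)"
  unfolding phi_mu_def hermite_mu_eq by (simp add: hermite_scale_def)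

lemma hermite_scale_Suc: "hermite_scale (Suc n) = dunkl_root \<mu> (Suc n) * hermite_scale n"
proof -
  have "2 powr (real (Suc n) / 2) = sqrt 2 * 2 powr (n / 2)"
    by (simp add: add_divide_distrib powr_add powr_half_sqrt)
  then show ?thesis
    by (simp add: hermite_scale_def gamma_mu_Suc[OF mu] dunkl_root_def real_sqrt_divide real_sqrt_mult)
qed

lemma Q_phi_mu:
  "Q_fun (phi_mu \<mu> n) x = complex_of_real (dunkl_root \<mu> n) * phi_mu \<mu> (n - 1) x +
    complex_of_real (dunkl_root \<mu> (Suc n)) * phi_mu \<mu> (Suc n) x"
proof -
  let ?E = "exp (- (1 / 2 * x\<^sup>2))"
  have s: "hermite_scale (Suc n) * dunkl_root \<mu> (Suc n) = dunkl_nat \<mu> (Suc n) / 2 * hermite_scale n"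
    using dunkl_root_square[OF mu, of "Suc n"] by (simp add: hermite_scale_Suc power2_eq_square)
  have p: "dunkl_root \<mu> n * (hermite_scale (n - 1) * hermite_q \<mu> (n - 1) x) =
      hermite_scale n * (if n = 0 then 0 else hermite_q \<mu> (n - 1) x)"
    by (cases n) (simp_all add: hermite_scale_Suc)
  have "x * (hermite_scale n * ?E * hermite_q \<mu> n x) = hermite_scale n * ?E * (2 * x * hermite_q \<mu> n x) / 2"
    by simp
  also have "\<dots> = ?E * (hermite_scale n * (if n = 0 then 0 else hermite_q \<mu> (n - 1) x)) +
      ?E * ((dunkl_nat \<mu> (Suc n) / 2 * hermite_scale n) * hermite_q \<mu> (Suc n) x)"
    unfolding hermite_q_rec by (simp add: algebra_simps)
  also have "\<dots> = dunkl_root \<mu> n * (hermite_scale (n - 1) * ?E * hermite_q \<mu> (n - 1) x) +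
      dunkl_root \<mu> (Suc n) * (hermite_scale (Suc n) * ?E * hermite_q \<mu> (Suc n) x)"
    unfolding p[symmetric] s[symmetric] by (simp only: ac_simps)
  finally show ?thesis
    unfolding Q_fun_def phi_mu_eq by (simp only: of_real_mult[symmetric] of_real_add[symmetric])
qed

definition hermite_coeff :: "nat \<Rightarrow> nat \<Rightarrow> real" where
  "hermite_coeff n k = (if 2 * k \<le> n then hermite_scale n * ((- 1) ^ k * 2 ^ (n - 2 * k) / (fact k * gamma_mu \<mu> (n - 2 * k))) else 0)"

lemma phi_mu_gauss: "phi_mu \<mu> n = (\<lambda>x. \<Sum>k\<le>n. complex_of_real (hermite_coeff n k) * gauss_poly (1 / 2) (n - 2 * k) x)"
proof
  fix x
  have "hermite_scale n * exp (- (1 / 2 * x\<^sup>2)) * hermite_q \<mu> n x =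
      (\<Sum>k\<le>n. hermite_coeff n k * (exp (- (1 / 2 * x\<^sup>2)) * x ^ (n - 2 * k)))"
    unfolding hermite_q_def sum_distrib_left
    by (intro sum.cong refl) (simp add: hermite_term_def hermite_coeff_def power_mult_distrib)
  then show "phi_mu \<mu> n x = (\<Sum>k\<le>n. complex_of_real (hermite_coeff n k) * gauss_poly (1 / 2) (n - 2 * k) x)"
    unfolding phi_mu_eq gauss_poly_def by (simp only: of_real_mult[symmetric] of_real_sum[symmetric])
qed

lemma phi_mu_fspan: "phi_mu \<mu> n \<in> fspan (gauss_poly (1 / 2))"
  unfolding phi_mu_gauss by (intro fspan_sum fspan_base) simp

text \<open>The Dunkl factor of the monomial with exponent \<open>n - 2 * k\<close> turns its
  coefficient into one of index \<open>n - 1\<close>, up to \<open>2 * dunkl_root \<mu> n\<close>.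
  If the exponent is \<open>0\<close>, both sides vanish.\<close>

lemma hermite_coeff_lower:
  "dunkl_nat \<mu> (n - 2 * k) * hermite_coeff n k = 2 * dunkl_root \<mu> n * (if 2 * k < n then hermite_coeff (n - 1) k else 0)"
proof (cases "2 * k < n")
  case True
  then obtain j where j: "n - 2 * k = Suc j" "n - 1 - 2 * k = j" by (cases "n - 2 * k") auto
  obtain m where m: "n = Suc m" using True by (cases n) auto
  show ?thesis
    using True j m dunkl_nat_pos[OF mu, of "Suc j"] gamma_mu_pos[OF mu, of j]
    by (simp add: hermite_coeff_def hermite_scale_Suc gamma_mu_Suc[OF mu] field_simps)
next
  case False
  then have "n - 2 * k = 0" by simp
  then show ?thesis using False by simp
qed

text \<open>Writing \<open>b\<close> for \<open>dunkl_root \<mu>\<close>: the Dunkl operator on the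
  monomials contributes \<open>2 b_n\<close> times the function of index \<open>n - 1\<close>, and
  differentiating the Gaussian subtracts multiplication by \<open>x\<close>, whose recurrence is
  known.\<close>

lemma has_dunkl_phi_mu:
  "has_dunkl \<mu> (phi_mu \<mu> n) (\<lambda>x. complex_of_real (dunkl_root \<mu> n) * phi_mu \<mu> (n - 1) x -
    complex_of_real (dunkl_root \<mu> (Suc n)) * phi_mu \<mu> (Suc n) x)"
proof -
  have "has_dunkl \<mu> (phi_mu \<mu> n) (\<lambda>x. \<Sum>k\<le>n. complex_of_real (hermite_coeff n k) * dunkl_gauss \<mu> (1 / 2) (n - 2 * k) x)"
    unfolding phi_mu_gauss by (intro has_dunkl_sum has_dunkl_gauss_poly)
  moreover have "(\<Sum>k\<le>n. complex_of_real (hermite_coeff n k) * dunkl_gauss \<mu> (1 / 2) (n - 2 * k) x) =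
      complex_of_real (dunkl_root \<mu> n) * phi_mu \<mu> (n - 1) x -
      complex_of_real (dunkl_root \<mu> (Suc n)) * phi_mu \<mu> (Suc n) x" for x
  proof -
    let ?c = "\<lambda>n k. complex_of_real (hermite_coeff n k)" and ?g = "\<lambda>n. gauss_poly (1 / 2) n x"
    have "(\<Sum>k\<le>n. ?c n k * dunkl_gauss \<mu> (1 / 2) (n - 2 * k) x) =
        (\<Sum>k\<le>n. complex_of_real (dunkl_nat \<mu> (n - 2 * k) * hermite_coeff n k) * ?g (n - 2 * k - 1)) -
        (\<Sum>k\<le>n. ?c n k * (complex_of_real x * ?g (n - 2 * k)))"
      unfolding sum_subtractf[symmetric]
      by (intro sum.cong refl) (simp add: dunkl_gauss_def gauss_poly_def algebra_simps)
    also have "(\<Sum>k\<le>n. ?c n k * (complex_of_real x * ?g (n - 2 * k))) = Q_fun (phi_mu \<mu> n) x"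
      unfolding Q_fun_def phi_mu_gauss sum_distrib_left by (intro sum.cong refl) (simp only: ac_simps)
    also have "(\<Sum>k\<le>n. complex_of_real (dunkl_nat \<mu> (n - 2 * k) * hermite_coeff n k) * ?g (n - 2 * k - 1)) =
        2 * complex_of_real (dunkl_root \<mu> n) * phi_mu \<mu> (n - 1) x"
    proof (cases n)
      case (Suc m)
      have "(\<Sum>k\<le>n. complex_of_real (dunkl_nat \<mu> (n - 2 * k) * hermite_coeff n k) * ?g (n - 2 * k - 1)) =
          (\<Sum>k\<le>m. 2 * complex_of_real (dunkl_root \<mu> n) * (?c m k * ?g (m - 2 * k)))"
        unfolding hermite_coeff_lower
      proof (intro sum.mono_neutral_cong_right ballI)
        fix k assume "k \<in> {..m}"
        show "complex_of_real (2 * dunkl_root \<mu> n * (if 2 * k < n then hermite_coeff (n - 1) k else 0)) *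
            ?g (n - 2 * k - 1) = 2 * complex_of_real (dunkl_root \<mu> n) * (?c m k * ?g (m - 2 * k))"
          by (auto simp: Suc hermite_coeff_def)
      qed (auto simp: Suc)
      then show ?thesis unfolding phi_mu_gauss sum_distrib_left by (simp add: Suc)
    qed simp
    finally show ?thesis by (simp add: Q_phi_mu)
  qed
  ultimately show ?thesis by simp
qed

section \<open>Orthonormality and completeness of the generalized Hermite functions\<close>

lemma phi_mu_lebesgue: "phi_mu \<mu> n \<in> borel_measurable lebesgue"
  by (rule fspan_gauss_poly_lebesgue[OF phi_mu_fspan])

lemma phi_mu_cnj [simp]: "cnj (phi_mu \<mu> n x) = phi_mu \<mu> n x"
  by (simp add: phi_mu_eq)

lemma hermite_scale_0: "hermite_scale 0 = 1 / sqrt (Gamma (\<mu> + 1 / 2))"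
  using mu by (simp add: hermite_scale_def real_sqrt_divide)

lemma phi_mu_0: "phi_mu \<mu> 0 x = complex_of_real (1 / sqrt (Gamma (\<mu> + 1 / 2))) * gauss_poly (1 / 2) 0 x"
  using mu by (simp add: phi_mu_eq hermite_q_def hermite_term_def gauss_poly_def hermite_scale_0)

lemma Gamma_mu_pos: "Gamma (\<mu> + 1 / 2) > 0"
  using mu by (intro Gamma_real_pos) simp

text \<open>Antisymmetry of the Dunkl operator and symmetry of multiplication by \<open>x\<close>
  together say that raising and lowering are adjoint, which reduces every inner product to one with
  an index \<open>0\<close>.\<close>

lemma phi_mu_ortho:
  "(LINT t|weight_measure \<mu>. phi_mu \<mu> m t * phi_mu \<mu> n t) = (if m = n then 1 else 0)"
proof -
  define I where "I m n = (LINT t|weight_measure \<mu>. phi_mu \<mu> m t * phi_mu \<mu> n t)" for m n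
  let ?b = "\<lambda>n. complex_of_real (dunkl_root \<mu> n)"
  have int: "integrable (weight_measure \<mu>) (\<lambda>t. phi_mu \<mu> m t * phi_mu \<mu> n t)" for m n
    by (intro integrable_fspan_mult[OF mu, of "1 / 2" "1 / 2"] phi_mu_fspan) auto
  have meas: "(\<lambda>x. ?b n * phi_mu \<mu> (n - 1) x - ?b (Suc n) * phi_mu \<mu> (Suc n) x) \<in> borel_measurable lebesgue" for n
    by (intro borel_measurable_diff borel_measurable_times borel_measurable_const phi_mu_lebesgue)
  have "(LINT t|weight_measure \<mu>. (?b m * phi_mu \<mu> (m - 1) t - ?b (Suc m) * phi_mu \<mu> (Suc m) t) * phi_mu \<mu> n t) =
      - (LINT t|weight_measure \<mu>. phi_mu \<mu> m t * (?b n * phi_mu \<mu> (n - 1) t - ?b (Suc n) * phi_mu \<mu> (Suc n) t))" for m n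
    by (rule dunkl_skew[OF mu _ _ phi_mu_fspan has_dunkl_phi_mu meas phi_mu_fspan has_dunkl_phi_mu meas]) simp_all
  then have A: "?b m * I (m - 1) n - ?b (Suc m) * I (Suc m) n = - (?b n * I m (n - 1) - ?b (Suc n) * I m (Suc n))" for m n
    using int by (simp add: I_def left_diff_distrib right_diff_distrib mult.assoc mult.left_commute[of "phi_mu \<mu> m _"])
  have "(LINT t|weight_measure \<mu>. Q_fun (phi_mu \<mu> m) t * phi_mu \<mu> n t) =
      (LINT t|weight_measure \<mu>. phi_mu \<mu> m t * Q_fun (phi_mu \<mu> n) t)" for m n
    by (simp add: Q_fun_def ac_simps)
  then have B: "?b m * I (m - 1) n + ?b (Suc m) * I (Suc m) n = ?b n * I m (n - 1) + ?b (Suc n) * I m (Suc n)" for m n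
    unfolding Q_phi_mu using int
    by (simp add: I_def distrib_right distrib_left mult.assoc mult.left_commute[of "phi_mu \<mu> m _"])
  \<comment> \<open>The sum of \<open>A\<close> and \<open>B\<close>; the terms with raised
    \<open>m\<close> and those with lowered \<open>n\<close> cancel.\<close>
  have C: "?b (Suc n) * I m (Suc n) = ?b m * I (m - 1) n" for m n
  proof -
    have "2 * (?b (Suc n) * I m (Suc n)) = 2 * (?b m * I (m - 1) n)"
      using A[of m n] B[of m n] by (simp add: algebra_simps) algebra
    then show ?thesis by simp
  qed
  have b0: "?b (Suc n) \<noteq> 0" for n using dunkl_root_pos[OF mu, of "Suc n"] by simp
  have sym: "I m n = I n m" for m n by (simp add: I_def mult.commute)
  have I0: "I 0 (Suc n) = 0" for n using C[of n 0] b0[of n] by simp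
  have "I 0 0 = complex_of_real (1 / sqrt (Gamma (\<mu> + 1 / 2)) * (1 / sqrt (Gamma (\<mu> + 1 / 2)))) *
      (LINT t|weight_measure \<mu>. gauss_poly 1 0 t)"
  proof -
    have "phi_mu \<mu> 0 t * phi_mu \<mu> 0 t =
        complex_of_real (1 / sqrt (Gamma (\<mu> + 1 / 2)) * (1 / sqrt (Gamma (\<mu> + 1 / 2)))) * gauss_poly 1 0 t" for t
    proof -
      have g: "gauss_poly 1 0 t = gauss_poly (1 / 2) 0 t * gauss_poly (1 / 2) 0 t"
        using gauss_poly_mult[of "1 / 2" 0 t "1 / 2" 0] by simp
      then show ?thesis unfolding g by (simp only: phi_mu_0 of_real_mult ac_simps)
    qed
    then show ?thesis by (simp add: I_def)
  qed
  also have "(LINT t|weight_measure \<mu>. gauss_poly 1 0 t) = complex_of_real (gaussian_moment \<mu> 1 0)"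
    using gauss_poly_moment[OF mu zero_less_one, of 0] by (simp add: has_bochner_integral_iff)
  also have "complex_of_real (1 / sqrt (Gamma (\<mu> + 1 / 2)) * (1 / sqrt (Gamma (\<mu> + 1 / 2)))) *
      complex_of_real (gaussian_moment \<mu> 1 0) = 1"
    using Gamma_mu_pos by (simp add: gaussian_moment_def flip: of_real_mult)
  finally have I00: "I 0 0 = 1" .
  have "I m n = (if m = n then 1 else 0)" for m n
  proof (induction n arbitrary: m)
    case 0
    then show ?case using I00 I0 sym by (cases m) auto
  next
    case (Suc n)
    show ?case
    proof (cases m)
      case 0
      then show ?thesis using I0 by simp
    next
      case (Suc k)
      then show ?thesis using C[of n m] Suc.IH[of k] b0[of n] b0[of k] by auto
    qed
  qed
  then show ?thesis by (simp add: I_def)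
qed

text \<open>The function of index \<open>0\<close> is a multiple of the Gaussian, and the span is
  closed under multiplication by \<open>x\<close>.\<close>

lemma gauss_poly_fspan_phi: "gauss_poly (1 / 2) n \<in> fspan (phi_mu \<mu>)"
proof (induction n)
  case 0
  have "gauss_poly (1 / 2) 0 = (\<lambda>x. complex_of_real (sqrt (Gamma (\<mu> + 1 / 2))) * phi_mu \<mu> 0 x)"
    using Gamma_mu_pos by (intro ext) (simp add: phi_mu_0)
  then show ?case using fspan_scale[OF fspan_base] by metis
next
  case (Suc n)
  have "Q_fun (phi_mu \<mu> k) \<in> fspan (phi_mu \<mu>)" for k
    unfolding Q_phi_mu[abs_def] by (intro fspan_add fspan_base)
  then show ?case using fspan_Q_fun[OF Suc] by (simp add: Q_fun_gauss_poly)
qed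

lemma phi_mu_basis: "l2_basis \<mu> (\<lambda>n. abs_fclass (phi_mu \<mu> n))"
proof
  show L2: "abs_fclass (phi_mu \<mu> n) \<in> L2 \<mu>" for n
    by (rule fspan_gauss_poly_L2[OF mu _ phi_mu_fspan]) simp
  show "l2_inner \<mu> (abs_fclass (phi_mu \<mu> m)) (abs_fclass (phi_mu \<mu> n)) = (if m = n then 1 else 0)" for m n
    by (simp add: l2_inner_abs phi_mu_lebesgue phi_mu_ortho)
  fix F assume F: "F \<in> L2 \<mu>" and orth: "\<And>n. l2_inner \<mu> F (abs_fclass (phi_mu \<mu> n)) = 0"
  show "F = 0"
  proof (rule gauss_poly_complete[OF mu _ F])
    fix n
    obtain N c where "gauss_poly (1 / 2) n = (\<lambda>x. \<Sum>k<N. c k * phi_mu \<mu> k x)"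
      using gauss_poly_fspan_phi by (rule fspan_cases)
    then have "abs_fclass (gauss_poly (1 / 2) n) = (\<Sum>k<N. c k *\<^sub>C abs_fclass (phi_mu \<mu> k))"
      using abs_fclass_fspan[of "phi_mu \<mu>", OF phi_mu_lebesgue] by simp
    then show "l2_inner \<mu> F (abs_fclass (gauss_poly (1 / 2) n)) = 0"
      by (simp add: l2_inner_sum_right L2 F orth)
  qed simp
qed

end

section \<open>The generalized Fourier transform of Gaussian polynomials\<close>

context
  fixes \<mu> :: real
  assumes mu: "\<mu> > - 1 / 2"
begin

text \<open>The first factor is \<open>1 + 2 * \<mu>\<close>, and each further
  \<open>dunkl_nat \<mu> (n + 2)\<close> is at least \<open>n + 1\<close> because
  \<open>2 * \<mu> > - 1\<close>. So the series of \<open>e_mu\<close> converges everywhere.\<close>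

lemma gamma_mu_Suc_ge: "(1 + 2 * \<mu>) * fact n \<le> gamma_mu \<mu> (Suc n)"
proof (induction n)
  case 0
  then show ?case using mu by (simp add: gamma_mu_Suc dunkl_nat_def)
next
  case (Suc n)
  have "real (Suc n) \<le> dunkl_nat \<mu> (Suc (Suc n))" using mu by (simp add: dunkl_nat_def)
  then have "real (Suc n) * ((1 + 2 * \<mu>) * fact n) \<le> dunkl_nat \<mu> (Suc (Suc n)) * gamma_mu \<mu> (Suc n)"
    using Suc mu by (intro mult_mono) (auto intro: dunkl_nat_nonneg)
  then show ?case by (simp add: gamma_mu_Suc[OF mu, of "Suc n"] ac_simps)
qed

text \<open>A bound uniform in \<open>N\<close>, for dominated convergence. The factor
  \<open>y\<close> left over by the index shift is absorbed by \<open>y \<le> exp y\<close>, hence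
  \<open>exp (2 * y)\<close>.\<close>

lemma e_mu_partial_bound:
  fixes y :: real
  assumes y: "0 \<le> y"
  shows "(\<Sum>m<N. y ^ m / gamma_mu \<mu> m) \<le> (1 + 1 / (1 + 2 * \<mu>)) * exp (2 * y)"
proof -
  have k: "1 + 2 * \<mu> > 0" using mu by simp
  have "(\<Sum>m<N. y ^ m / gamma_mu \<mu> m) \<le> (\<Sum>m<Suc N. y ^ m / gamma_mu \<mu> m)"
    using y gamma_mu_pos[OF mu, of N] by simp
  also have "\<dots> = 1 + (\<Sum>m<N. y ^ Suc m / gamma_mu \<mu> (Suc m))"
    using mu by (subst sum.lessThan_Suc_shift) simp
  also have "(\<Sum>m<N. y ^ Suc m / gamma_mu \<mu> (Suc m)) \<le> (\<Sum>m<N. (y / (1 + 2 * \<mu>)) * (y ^ m /\<^sub>R fact m))"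
  proof (rule sum_mono)
    fix m
    have "y ^ Suc m / gamma_mu \<mu> (Suc m) \<le> y ^ Suc m / ((1 + 2 * \<mu>) * fact m)"
      using y k gamma_mu_Suc_ge[of m] by (intro divide_left_mono mult_pos_pos gamma_mu_pos mu) auto
    then show "y ^ Suc m / gamma_mu \<mu> (Suc m) \<le> (y / (1 + 2 * \<mu>)) * (y ^ m /\<^sub>R fact m)"
      by (simp add: divide_inverse ac_simps)
  qed
  also have "\<dots> = (y / (1 + 2 * \<mu>)) * (\<Sum>m<N. y ^ m /\<^sub>R fact m)" by (simp add: sum_distrib_left)
  also have "\<dots> \<le> (y / (1 + 2 * \<mu>)) * exp y"
    unfolding exp_def using y k by (intro mult_left_mono sum_le_suminf[OF summable_exp_generic]) auto
  also have "\<dots> \<le> (exp y / (1 + 2 * \<mu>)) * exp y"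
  proof (intro mult_right_mono divide_right_mono)
    show "y \<le> exp y" using exp_ge_add_one_self[of y] by linarith
  qed (use k in auto)
  also have "\<dots> = 1 / (1 + 2 * \<mu>) * exp (2 * y)" by (simp add: exp_double power2_eq_square)
  also have "1 + 1 / (1 + 2 * \<mu>) * exp (2 * y) \<le> (1 + 1 / (1 + 2 * \<mu>)) * exp (2 * y)"
    using y by (simp add: distrib_right)
  finally show ?thesis by simp
qed

lemma e_mu_sums: "(\<lambda>m. z ^ m / complex_of_real (gamma_mu \<mu> m)) sums e_mu \<mu> z"
proof -
  have "summable (\<lambda>m. norm (z ^ m / complex_of_real (gamma_mu \<mu> m)))"
  proof (rule summableI_nonneg_bounded)
    fix N
    show "(\<Sum>m<N. norm (z ^ m / complex_of_real (gamma_mu \<mu> m))) \<le> (1 + 1 / (1 + 2 * \<mu>)) * exp (2 * cmod z)"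
      using e_mu_partial_bound[of "cmod z" N] gamma_mu_pos[OF mu]
      by (simp add: norm_divide norm_power abs_of_pos)
  qed simp
  then show ?thesis unfolding e_mu_def by (rule summable_sums[OF summable_norm_cancel])
qed

text \<open>Power series coefficient of the transform without its constant prefactor: the series of
  \<open>e_mu\<close> integrated termwise against \<open>gauss_poly 1 n\<close>.\<close>

definition fourier_coeff :: "nat \<Rightarrow> nat \<Rightarrow> complex" where
  "fourier_coeff n m = (- \<i>) ^ m * complex_of_real (gaussian_moment \<mu> 1 (m + n) / gamma_mu \<mu> m)"

lemma fourier_gauss_poly:
  "integrable (weight_measure \<mu>) (\<lambda>t. e_mu \<mu> (- \<i> * x * t) * gauss_poly 1 n t)"
  "(\<lambda>m. fourier_coeff n m * complex_of_real x ^ m) sums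
    (LINT t|weight_measure \<mu>. e_mu \<mu> (- \<i> * x * t) * gauss_poly 1 n t)"
proof -
  let ?z = "\<lambda>t::real. - \<i> * complex_of_real x * complex_of_real t"
  let ?S = "\<lambda>N t. \<Sum>m<N. ?z t ^ m / complex_of_real (gamma_mu \<mu> m)"
  \<comment> \<open>\<open>fact n * exp \<bar>t\<bar>\<close> bounds
    \<open>\<bar>t\<bar> ^ n\<close>, and the square of
    \<open>(2 * \<bar>x\<bar> + 1) - \<bar>t\<bar>\<close> shows that half of the Gaussian exponent
    absorbs both exponentials.\<close>
  let ?K = "(1 + 1 / (1 + 2 * \<mu>)) * fact n * exp ((2 * \<bar>x\<bar> + 1)\<^sup>2 / 2)"
  have k: "1 + 2 * \<mu> > 0" using mu by simp
  have bound: "norm (?S N t * gauss_poly 1 n t) \<le> ?K * Re (gauss_poly (1 / 2) 0 t)" for N t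
  proof -
    have "norm (?S N t) \<le> (\<Sum>m<N. norm (?z t ^ m / complex_of_real (gamma_mu \<mu> m)))"
      by (rule norm_sum)
    also have "\<dots> = (\<Sum>m<N. (\<bar>x\<bar> * \<bar>t\<bar>) ^ m / gamma_mu \<mu> m)"
      using gamma_mu_pos[OF mu] by (simp add: norm_divide norm_power norm_mult abs_of_pos)
    also have "\<dots> \<le> (1 + 1 / (1 + 2 * \<mu>)) * exp (2 * (\<bar>x\<bar> * \<bar>t\<bar>))"
      by (rule e_mu_partial_bound) simp
    finally have 1: "norm (?S N t) \<le> (1 + 1 / (1 + 2 * \<mu>)) * exp (2 * (\<bar>x\<bar> * \<bar>t\<bar>))" .
    have 2: "norm (gauss_poly 1 n t) \<le> fact n * exp \<bar>t\<bar> * exp (- t\<^sup>2)"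
    proof -
      have "norm (gauss_poly 1 n t) = exp (- t\<^sup>2) * \<bar>t\<bar> ^ n"
        by (simp add: gauss_poly_def norm_mult norm_power)
      also have "\<dots> \<le> exp (- t\<^sup>2) * (fact n * exp \<bar>t\<bar>)"
        by (intro mult_left_mono power_le_fact_exp) auto
      finally show ?thesis by (simp only: mult.commute)
    qed
    have "0 \<le> ((2 * \<bar>x\<bar> + 1) - \<bar>t\<bar>)\<^sup>2 / 2" by simp
    also have "\<dots> = (2 * \<bar>x\<bar> + 1)\<^sup>2 / 2 + t\<^sup>2 / 2 - (2 * (\<bar>x\<bar> * \<bar>t\<bar>) + \<bar>t\<bar>)"
      by (simp add: power2_eq_square algebra_simps diff_divide_distrib add_divide_distrib)
    finally have 3: "exp (2 * (\<bar>x\<bar> * \<bar>t\<bar>) + \<bar>t\<bar> - t\<^sup>2) \<le> exp ((2 * \<bar>x\<bar> + 1)\<^sup>2 / 2 - t\<^sup>2 / 2)" by simp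
    have "norm (?S N t * gauss_poly 1 n t) \<le>
        ((1 + 1 / (1 + 2 * \<mu>)) * exp (2 * (\<bar>x\<bar> * \<bar>t\<bar>))) * (fact n * exp \<bar>t\<bar> * exp (- t\<^sup>2))"
      unfolding norm_mult using k by (intro mult_mono 1 2) auto
    also have "\<dots> = ((1 + 1 / (1 + 2 * \<mu>)) * fact n) * exp (2 * (\<bar>x\<bar> * \<bar>t\<bar>) + \<bar>t\<bar> - t\<^sup>2)"
      by (simp add: exp_add exp_diff exp_minus divide_inverse)
    also have "\<dots> \<le> ((1 + 1 / (1 + 2 * \<mu>)) * fact n) * exp ((2 * \<bar>x\<bar> + 1)\<^sup>2 / 2 - t\<^sup>2 / 2)"
      using k by (intro mult_left_mono 3) auto
    also have "exp ((2 * \<bar>x\<bar> + 1)\<^sup>2 / 2 - t\<^sup>2 / 2) = exp ((2 * \<bar>x\<bar> + 1)\<^sup>2 / 2) * Re (gauss_poly (1 / 2) 0 t)"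
    proof -
      have "Re (gauss_poly (1 / 2) 0 t) = exp (- (t\<^sup>2 / 2))" by (simp add: gauss_poly_def)
      then show ?thesis by (simp only: exp_add[symmetric] diff_conv_add_uminus)
    qed
    also have "(1 + 1 / (1 + 2 * \<mu>)) * fact n * (exp ((2 * \<bar>x\<bar> + 1)\<^sup>2 / 2) * Re (gauss_poly (1 / 2) 0 t)) =
        ?K * Re (gauss_poly (1 / 2) 0 t)" by (simp only: mult.assoc)
    finally show ?thesis .
  qed
  have lim: "AE t in weight_measure \<mu>. (\<lambda>N. ?S N t * gauss_poly 1 n t) \<longlonglongrightarrow> e_mu \<mu> (?z t) * gauss_poly 1 n t"
    using e_mu_sums by (intro AE_I2 tendsto_mult tendsto_const) (simp add: sums_def)
  have meas_S: "(\<lambda>t. ?S N t * gauss_poly 1 n t) \<in> borel_measurable borel" for N by measurable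
  have meas: "(\<lambda>t. ?S N t * gauss_poly 1 n t) \<in> borel_measurable (weight_measure \<mu>)" for N
    unfolding measurable_weight_measure by (rule measurable_completion) (use meas_S in simp)
  have meas_e: "(\<lambda>t. e_mu \<mu> (?z t) * gauss_poly 1 n t) \<in> borel_measurable (weight_measure \<mu>)"
  proof -
    have "(\<lambda>t. e_mu \<mu> (?z t) * gauss_poly 1 n t) \<in> borel_measurable borel"
    proof (rule borel_measurable_LIMSEQ_metric[OF meas_S])
      show "(\<lambda>N. ?S N t * gauss_poly 1 n t) \<longlonglongrightarrow> e_mu \<mu> (?z t) * gauss_poly 1 n t" for t
        using e_mu_sums by (intro tendsto_mult tendsto_const) (simp add: sums_def)
    qed
    then show ?thesis unfolding measurable_weight_measure by (intro measurable_completion) simp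
  qed
  have w: "integrable (weight_measure \<mu>) (\<lambda>t. ?K * Re (gauss_poly (1 / 2) 0 t))"
    using gauss_poly_moment[OF mu, of "1 / 2" 0]
    by (intro integrable_mult_right integrable_Re) (auto simp: has_bochner_integral_iff)
  show "integrable (weight_measure \<mu>) (\<lambda>t. e_mu \<mu> (- \<i> * x * t) * gauss_poly 1 n t)"
    by (rule integrable_dominated_convergence[OF meas_e meas w lim]) (rule AE_I2, rule bound)
  have "(\<lambda>N. LINT t|weight_measure \<mu>. ?S N t * gauss_poly 1 n t) \<longlonglongrightarrow>
      (LINT t|weight_measure \<mu>. e_mu \<mu> (- \<i> * x * t) * gauss_poly 1 n t)"
    by (rule integral_dominated_convergence[OF meas_e meas w lim]) (rule AE_I2, rule bound)
  moreover have "(LINT t|weight_measure \<mu>. ?S N t * gauss_poly 1 n t) =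
      (\<Sum>m<N. fourier_coeff n m * complex_of_real x ^ m)" for N
  proof -
    have "?S N t * gauss_poly 1 n t =
        (\<Sum>m<N. ((- \<i> * complex_of_real x) ^ m / complex_of_real (gamma_mu \<mu> m)) * gauss_poly 1 (m + n) t)" for t
    proof -
      have "?z t ^ m / complex_of_real (gamma_mu \<mu> m) * gauss_poly 1 n t =
          ((- \<i> * complex_of_real x) ^ m / complex_of_real (gamma_mu \<mu> m)) * gauss_poly 1 (m + n) t" for m
      proof -
        have "gauss_poly 1 (m + n) t = complex_of_real t ^ m * gauss_poly 1 n t"
          by (simp add: gauss_poly_def power_add)
        moreover have "?z t ^ m = (- \<i> * complex_of_real x) ^ m * complex_of_real t ^ m"
          by (rule power_mult_distrib)
        ultimately show ?thesis by (simp only: times_divide_eq_left mult.assoc)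
      qed
      then show ?thesis unfolding sum_distrib_right by (simp only:)
    qed
    then have "(LINT t|weight_measure \<mu>. ?S N t * gauss_poly 1 n t) = (\<Sum>m<N.
        ((- \<i> * complex_of_real x) ^ m / complex_of_real (gamma_mu \<mu> m)) * complex_of_real (gaussian_moment \<mu> 1 (m + n)))"
      using gauss_poly_moment[OF mu zero_less_one]
      by (simp add: has_bochner_integral_iff Bochner_Integration.integral_sum)
    also have "\<dots> = (\<Sum>m<N. fourier_coeff n m * complex_of_real x ^ m)"
    proof (intro sum.cong refl)
      fix m
      have "(- \<i> * complex_of_real x) ^ m = (- \<i>) ^ m * complex_of_real x ^ m"
        by (rule power_mult_distrib)
      then show "(- \<i> * complex_of_real x) ^ m / complex_of_real (gamma_mu \<mu> m) * complex_of_real (gaussian_moment \<mu> 1 (m + n)) =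
          fourier_coeff n m * complex_of_real x ^ m"
        unfolding fourier_coeff_def by (simp only: of_real_divide) (simp add: field_simps)
    qed
    finally show ?thesis .
  qed
  ultimately show "(\<lambda>m. fourier_coeff n m * complex_of_real x ^ m) sums
      (LINT t|weight_measure \<mu>. e_mu \<mu> (- \<i> * x * t) * gauss_poly 1 n t)"
    by (simp add: sums_def)
qed

definition fourier_series :: "nat \<Rightarrow> real \<Rightarrow> complex" where
  "fourier_series n x = (LINT t|weight_measure \<mu>. e_mu \<mu> (- \<i> * x * t) * gauss_poly 1 n t)"

lemma fourier_series_sums: "(\<lambda>m. fourier_coeff n m * complex_of_real x ^ m) sums fourier_series n x"
  unfolding fourier_series_def by (rule fourier_gauss_poly)

text \<open>Only even powers have nonzero moments; there the Gamma values of moment and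
  \<open>gamma_mu\<close> cancel and leave the exponential series of
  \<open>- x^2 / 4\<close>.\<close>

lemma fourier_series_0: "fourier_series 0 x = complex_of_real (Gamma (\<mu> + 1 / 2)) * gauss_poly (1 / 4) 0 x"
proof -
  let ?f = "\<lambda>m. fourier_coeff 0 m * complex_of_real x ^ m"
  have "?f m = 0" if "m \<notin> range (\<lambda>j::nat. 2 * j)" for m
  proof -
    have "odd m" using that by (metis evenE rangeI)
    then show ?thesis by (simp add: fourier_coeff_def gaussian_moment_odd)
  qed
  then have "(\<lambda>j. ?f (2 * j)) sums fourier_series 0 x"
    using fourier_series_sums[of 0 x]
    by (subst sums_mono_reindex[of "\<lambda>j. 2 * j"]) (auto simp: strict_mono_def)
  moreover have "?f (2 * j) = complex_of_real (Gamma (\<mu> + 1 / 2) * ((- (1 / 4 * x\<^sup>2)) ^ j /\<^sub>R fact j))" for j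
  proof -
    have G: "Gamma (real j + \<mu> + 1 / 2) > 0" using mu by (intro Gamma_real_pos) (simp add: add_nonneg_pos)
    have a: "gaussian_moment \<mu> 1 (2 * j) / gamma_mu \<mu> (2 * j) = Gamma (\<mu> + 1 / 2) * ((1 / 4) ^ j / fact j)"
    proof -
      have "(2 :: real) ^ (2 * j) = 4 ^ j" by (simp add: power_mult)
      then show ?thesis
        using G Gamma_mu_pos[OF mu] by (simp add: gaussian_moment_def gamma_mu_def power_divide)
    qed
    have b: "(- \<i>) ^ (2 * j) = complex_of_real ((- 1) ^ j)" by (simp add: power_mult)
    have c: "complex_of_real x ^ (2 * j) = complex_of_real ((x\<^sup>2) ^ j)" by (simp add: power_mult)
    have "?f (2 * j) = complex_of_real ((- 1) ^ j * (Gamma (\<mu> + 1 / 2) * ((1 / 4) ^ j / fact j)) * (x\<^sup>2) ^ j)"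
      unfolding fourier_coeff_def add_0_right a b c of_real_mult ..
    also have "(- 1) ^ j * (Gamma (\<mu> + 1 / 2) * ((1 / 4) ^ j / fact j)) * (x\<^sup>2) ^ j =
        Gamma (\<mu> + 1 / 2) * (((- 1) ^ j * ((1 / 4) ^ j * (x\<^sup>2) ^ j)) /\<^sub>R fact j)"
      by (simp only: real_scaleR_def divide_inverse ac_simps)
    also have "(- 1) ^ j * ((1 / 4) ^ j * (x\<^sup>2) ^ j) = (- (1 / 4 * x\<^sup>2)) ^ j"
      unfolding power_mult_distrib[symmetric] by (rule arg_cong) simp
    finally show ?thesis .
  qed
  moreover have "(\<lambda>j. complex_of_real (Gamma (\<mu> + 1 / 2) * ((- (1 / 4 * x\<^sup>2)) ^ j /\<^sub>R fact j))) sums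
      complex_of_real (Gamma (\<mu> + 1 / 2) * exp (- (1 / 4 * x\<^sup>2)))"
    by (intro sums_of_real sums_mult exp_converges)
  ultimately have "fourier_series 0 x = complex_of_real (Gamma (\<mu> + 1 / 2) * exp (- (1 / 4 * x\<^sup>2)))"
    using sums_unique2 by simp
  then show ?thesis by (simp add: gauss_poly_def)
qed

text \<open>The Dunkl operator multiplies the coefficient of index \<open>m + 1\<close> by
  \<open>dunkl_nat \<mu> (m + 1)\<close>, which cancels against \<open>gamma_mu\<close>; lowering
  the power by one then reads as passing from \<open>n\<close> to \<open>n + 1\<close> in the
  moment.\<close>

lemma has_dunkl_fourier_series: "has_dunkl \<mu> (fourier_series n) (\<lambda>x. - \<i> * fourier_series (Suc n) x)"
  unfolding has_dunkl_def
proof (intro allI impI)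
  fix x :: real assume x: "x \<noteq> 0"
  let ?a = "fourier_coeff n" and ?x = "complex_of_real x"
  have summable: "summable (\<lambda>m. ?a m * z ^ m)" for z
  \<comment> \<open>Convergence at \<open>z\<close> follows from convergence at a real point of
    larger modulus, where the sum is the transform itself.\<close>
  proof (rule powser_inside)
    show "summable (\<lambda>m. ?a m * complex_of_real (cmod z + 1) ^ m)"
      using fourier_series_sums by (rule sums_summable)
    show "norm z < norm (complex_of_real (cmod z + 1))"
      unfolding norm_of_real using norm_ge_zero[of z] by linarith
  qed
  let ?F = "\<lambda>z. \<Sum>m. ?a m * z ^ m" and ?D = "\<Sum>m. diffs ?a m * ?x ^ m"
  have "(?F has_field_derivative ?D) (at ?x)"
    by (rule termdiffs_strong_converges_everywhere) (rule summable)
  then have "((\<lambda>x. ?F (complex_of_real x)) has_vector_derivative ?D) (at x)"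
    by (rule has_vector_derivative_real_field)
  moreover have F: "?F (complex_of_real y) = fourier_series n y" for y
    using fourier_series_sums[of n y] by (simp add: sums_iff)
  ultimately have der: "(fourier_series n has_vector_derivative ?D) (at x)" by simp
  have "(\<lambda>m. complex_of_real (\<mu> / x) * (?a m * ?x ^ m - ?a m * complex_of_real (- x) ^ m)) sums
      (complex_of_real (\<mu> / x) * (fourier_series n x - fourier_series n (- x)))"
    by (intro sums_mult sums_diff fourier_series_sums)
  then have "(\<lambda>m. complex_of_real (\<mu> / x) * (?a (Suc m) * ?x ^ Suc m - ?a (Suc m) * complex_of_real (- x) ^ Suc m)) sums
      (complex_of_real (\<mu> / x) * (fourier_series n x - fourier_series n (- x)))"
    by (subst sums_Suc_iff) simp
  moreover have "(\<lambda>m. diffs ?a m * ?x ^ m) sums ?D"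
    by (intro summable_sums termdiff_converges_all summable)
  ultimately have "(\<lambda>m. diffs ?a m * ?x ^ m +
      complex_of_real (\<mu> / x) * (?a (Suc m) * ?x ^ Suc m - ?a (Suc m) * complex_of_real (- x) ^ Suc m)) sums
      (?D + complex_of_real (\<mu> / x) * (fourier_series n x - fourier_series n (- x)))"
    by (intro sums_add)
  moreover have "diffs ?a m * ?x ^ m +
      complex_of_real (\<mu> / x) * (?a (Suc m) * ?x ^ Suc m - ?a (Suc m) * complex_of_real (- x) ^ Suc m) =
      - \<i> * (fourier_coeff (Suc n) m * ?x ^ m)" for m
  proof -
    have "\<mu> / x * (x ^ Suc m - (- x) ^ Suc m) = (if odd (Suc m) then 2 * \<mu> else 0) * x ^ m"
      using x by auto
    then have "complex_of_real (\<mu> / x) * (?x ^ Suc m - complex_of_real (- x) ^ Suc m) =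
        complex_of_real ((if odd (Suc m) then 2 * \<mu> else 0) * x ^ m)"
      by (simp only: of_real_mult[symmetric] of_real_power[symmetric] of_real_diff[symmetric])
    then have "complex_of_real (\<mu> / x) * (?a (Suc m) * ?x ^ Suc m - ?a (Suc m) * complex_of_real (- x) ^ Suc m) =
        ?a (Suc m) * complex_of_real ((if odd (Suc m) then 2 * \<mu> else 0) * x ^ m)"
      by (metis mult.left_commute right_diff_distrib)
    moreover have "diffs ?a m * ?x ^ m = ?a (Suc m) * complex_of_real (real (Suc m) * x ^ m)"
      by (simp add: diffs_def)
    ultimately have "diffs ?a m * ?x ^ m +
        complex_of_real (\<mu> / x) * (?a (Suc m) * ?x ^ Suc m - ?a (Suc m) * complex_of_real (- x) ^ Suc m) =
        ?a (Suc m) * complex_of_real (dunkl_nat \<mu> (Suc m)) * ?x ^ m"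
      by (simp only: distrib_left[symmetric] of_real_add[symmetric] dunkl_nat_def distrib_right[symmetric])
        simp
    also have "?a (Suc m) * complex_of_real (dunkl_nat \<mu> (Suc m)) = - \<i> * fourier_coeff (Suc n) m"
    proof -
      have "gaussian_moment \<mu> 1 (Suc m + n) / gamma_mu \<mu> (Suc m) * dunkl_nat \<mu> (Suc m) =
          gaussian_moment \<mu> 1 (m + Suc n) / gamma_mu \<mu> m"
        using dunkl_nat_pos[OF mu, of "Suc m"] gamma_mu_pos[OF mu, of m] by (simp add: gamma_mu_Suc[OF mu])
      then show ?thesis
        unfolding fourier_coeff_def power_Suc mult.assoc of_real_mult[symmetric] by simp
    qed
    finally show ?thesis by (simp only: mult.assoc)
  qed
  ultimately have "(\<lambda>m. - \<i> * (fourier_coeff (Suc n) m * ?x ^ m)) sums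
      (?D + complex_of_real (\<mu> / x) * (fourier_series n x - fourier_series n (- x)))"
    by simp
  moreover have "(\<lambda>m. - \<i> * (fourier_coeff (Suc n) m * ?x ^ m)) sums (- \<i> * fourier_series (Suc n) x)"
    by (intro sums_mult fourier_series_sums)
  ultimately have "- \<i> * fourier_series (Suc n) x =
      ?D + complex_of_real (\<mu> / x) * (fourier_series n x - fourier_series n (- x))"
    by (rule sums_unique2[rotated])
  with der show "\<exists>d. (fourier_series n has_vector_derivative d) (at x) \<and>
      - \<i> * fourier_series (Suc n) x = d + complex_of_real (\<mu> / x) * (fourier_series n x - fourier_series n (- x))"
    by blast
qed

definition fourier_gauss :: "nat \<Rightarrow> real \<Rightarrow> complex" where
  "fourier_gauss n = fourier_integral \<mu> (gauss_poly 1 n)"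

lemma fourier_gauss_eq:
  "fourier_gauss n x = complex_of_real (1 / (2 powr (\<mu> + 1 / 2) * Gamma (\<mu> + 1 / 2))) * fourier_series n x"
  by (simp add: fourier_gauss_def fourier_integral_def fourier_series_def)

lemma fourier_gauss_0: "fourier_gauss 0 x = complex_of_real (2 powr - (\<mu> + 1 / 2)) * gauss_poly (1 / 4) 0 x"
proof -
  have "1 / (2 powr (\<mu> + 1 / 2) * Gamma (\<mu> + 1 / 2)) * Gamma (\<mu> + 1 / 2) = 2 powr - (\<mu> + 1 / 2)"
    using Gamma_mu_pos[OF mu] by (simp only: powr_minus) (simp add: field_simps)
  then show ?thesis
    unfolding fourier_gauss_eq fourier_series_0 mult.assoc[symmetric] of_real_mult[symmetric] by (simp only:)
qed

lemma has_dunkl_fourier_gauss: "has_dunkl \<mu> (fourier_gauss n) (\<lambda>x. - \<i> * fourier_gauss (Suc n) x)"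
proof -
  have "has_dunkl \<mu> (\<lambda>x. \<Sum>k\<in>{()}. complex_of_real (1 / (2 powr (\<mu> + 1 / 2) * Gamma (\<mu> + 1 / 2))) * fourier_series n x)
      (\<lambda>x. \<Sum>k\<in>{()}. complex_of_real (1 / (2 powr (\<mu> + 1 / 2) * Gamma (\<mu> + 1 / 2))) * (- \<i> * fourier_series (Suc n) x))"
    by (intro has_dunkl_sum has_dunkl_fourier_series)
  then show ?thesis by (simp add: fourier_gauss_eq[abs_def] mult.left_commute)
qed

text \<open>Induction along the Dunkl relation, starting from the transformed Gaussian. Agreement is
  claimed off \<open>0\<close> only, since the relation says nothing about the value there.\<close>

lemma fourier_gauss_fspan:
  obtains f where "f \<in> fspan (gauss_poly (1 / 4))" "\<And>x. x \<noteq> 0 \<Longrightarrow> fourier_gauss n x = f x"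
proof -
  have "\<exists>f\<in>fspan (gauss_poly (1 / 4)). \<forall>x. x \<noteq> 0 \<longrightarrow> fourier_gauss n x = f x"
  proof (induction n)
    case 0
    have "fourier_gauss 0 \<in> fspan (gauss_poly (1 / 4))"
      unfolding fourier_gauss_0[abs_def] by (intro fspan_scale fspan_base)
    then show ?case by blast
  next
    case (Suc n)
    then obtain f where f: "f \<in> fspan (gauss_poly (1 / 4))" "\<And>x. x \<noteq> 0 \<Longrightarrow> fourier_gauss n x = f x" by blast
    obtain f' where f': "f' \<in> fspan (gauss_poly (1 / 4))" "has_dunkl \<mu> f f'"
      using fspan_has_dunkl[OF f(1)] by blast
    have "- \<i> * fourier_gauss (Suc n) x = f' x" if "x \<noteq> 0" for x
      using has_dunkl_unique[OF has_dunkl_fourier_gauss has_dunkl_cong[OF f'(2) f(2)]] that by blast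
    then have "\<i> * (- \<i> * fourier_gauss (Suc n) x) = \<i> * f' x" if "x \<noteq> 0" for x using that by simp
    then have "\<forall>x. x \<noteq> 0 \<longrightarrow> fourier_gauss (Suc n) x = \<i> * f' x" by simp
    then show ?case by (rule bexI[OF _ fspan_scale[OF f'(1)]])
  qed
  then obtain f where "f \<in> fspan (gauss_poly (1 / 4))" "\<forall>x. x \<noteq> 0 \<longrightarrow> fourier_gauss n x = f x" ..
  then show thesis by (intro that[of f]) simp_all
qed

lemma fourier_gauss_lebesgue: "fourier_gauss n \<in> borel_measurable lebesgue"
  and fourier_gauss_L2: "abs_fclass (fourier_gauss n) \<in> L2 \<mu>"
proof -
  obtain f where f: "f \<in> fspan (gauss_poly (1 / 4))" "\<And>x. x \<noteq> 0 \<Longrightarrow> fourier_gauss n x = f x"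
    by (rule fourier_gauss_fspan[of n]) blast
  note * = abs_fclass_cong_nonzero[of f "fourier_gauss n", OF fspan_gauss_poly_lebesgue[OF f(1)] f(2)]
  show "fourier_gauss n \<in> borel_measurable lebesgue" by (rule *(1))
  have eq: "abs_fclass (fourier_gauss n) = abs_fclass f" by (rule *(2))
  show "abs_fclass (fourier_gauss n) \<in> L2 \<mu>"
    unfolding eq by (rule fspan_gauss_poly_L2[OF mu _ f(1)]) simp
qed

section \<open>Hermite coefficients of Gaussian polynomials and of their transforms\<close>

abbreviation phi_coeff :: "(real \<Rightarrow> complex) \<Rightarrow> nat \<Rightarrow> complex" where
  "phi_coeff f k \<equiv> LINT t|weight_measure \<mu>. f t * phi_mu \<mu> k t"

text \<open>The Dunkl derivative of \<open>exp (- a x^2)\<close> is \<open>- 2 a x\<close> times it.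
  Paired with \<open>phi_mu \<mu> k\<close>, antisymmetry on one side and the recurrence for
  \<open>x\<close> on the other leave a two-term relation of step two.\<close>

lemma gauss_phi_coeff:
  assumes a: "a > 0"
  shows "complex_of_real ((1 + 2 * a) * dunkl_root \<mu> (Suc k)) * phi_coeff (gauss_poly a 0) (Suc k) =
    complex_of_real ((1 - 2 * a) * dunkl_root \<mu> k) * phi_coeff (gauss_poly a 0) (k - 1)"
proof -
  let ?b = "\<lambda>n. complex_of_real (dunkl_root \<mu> n)" and ?m = "phi_coeff (gauss_poly a 0)"
  have int: "integrable (weight_measure \<mu>) (\<lambda>t. gauss_poly a n t * phi_mu \<mu> k t)" for n k
    by (intro integrable_fspan_mult[OF mu a, of "1 / 2"] phi_mu_fspan fspan_base mu) auto
  have meas: "(\<lambda>x. ?b k * phi_mu \<mu> (k - 1) x - ?b (Suc k) * phi_mu \<mu> (Suc k) x) \<in> borel_measurable lebesgue"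
    by (intro borel_measurable_diff borel_measurable_times borel_measurable_const phi_mu_lebesgue mu)
  have "(LINT t|weight_measure \<mu>. dunkl_gauss \<mu> a 0 t * phi_mu \<mu> k t) =
      - (LINT t|weight_measure \<mu>. gauss_poly a 0 t * (?b k * phi_mu \<mu> (k - 1) t - ?b (Suc k) * phi_mu \<mu> (Suc k) t))"
    by (rule dunkl_skew[OF mu a _ fspan_base has_dunkl_gauss_poly fspan_gauss_poly_lebesgue[OF dunkl_gauss_fspan]
          phi_mu_fspan[OF mu] has_dunkl_phi_mu[OF mu] meas]) simp
  also have "(LINT t|weight_measure \<mu>. gauss_poly a 0 t * (?b k * phi_mu \<mu> (k - 1) t - ?b (Suc k) * phi_mu \<mu> (Suc k) t)) =
      ?b k * ?m (k - 1) - ?b (Suc k) * ?m (Suc k)"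
    using int by (simp add: right_diff_distrib mult.left_commute[of "gauss_poly a 0 _"])
  also have "(LINT t|weight_measure \<mu>. dunkl_gauss \<mu> a 0 t * phi_mu \<mu> k t) =
      (LINT t|weight_measure \<mu>. - complex_of_real (2 * a) * (gauss_poly a 0 t * Q_fun (phi_mu \<mu> k) t))"
    by (intro Bochner_Integration.integral_cong refl)
      (simp add: dunkl_gauss_def Q_fun_gauss_poly[symmetric] Q_fun_def ac_simps)
  also have "\<dots> = - complex_of_real (2 * a) * (?b k * ?m (k - 1) + ?b (Suc k) * ?m (Suc k))"
    unfolding Q_phi_mu[OF mu] using int by (simp add: distrib_left mult.left_commute[of "gauss_poly a 0 _"])
  finally show ?thesis by (simp add: algebra_simps)
qed

lemma gauss_phi_coeff_0:
  assumes a: "a > 0"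
  shows "phi_coeff (gauss_poly a 0) 0 = complex_of_real ((a + 1 / 2) powr - (\<mu> + 1 / 2) * sqrt (Gamma (\<mu> + 1 / 2)))"
proof -
  have "gauss_poly a 0 t * phi_mu \<mu> 0 t = complex_of_real (1 / sqrt (Gamma (\<mu> + 1 / 2))) * gauss_poly (a + 1 / 2) 0 t" for t
    using gauss_poly_mult[of a 0 t "1 / 2" 0] by (simp add: phi_mu_0[OF mu] mult.left_commute)
  then have "phi_coeff (gauss_poly a 0) 0 =
      complex_of_real (1 / sqrt (Gamma (\<mu> + 1 / 2)) * gaussian_moment \<mu> (a + 1 / 2) 0)"
    using gauss_poly_moment[OF mu, of "a + 1 / 2" 0] a by (simp add: has_bochner_integral_iff)
  also have "1 / sqrt (Gamma (\<mu> + 1 / 2)) * gaussian_moment \<mu> (a + 1 / 2) 0 =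
      (a + 1 / 2) powr - (\<mu> + 1 / 2) * (Gamma (\<mu> + 1 / 2) / sqrt (Gamma (\<mu> + 1 / 2)))"
    by (simp add: gaussian_moment_def)
  also have "Gamma (\<mu> + 1 / 2) / sqrt (Gamma (\<mu> + 1 / 2)) = sqrt (Gamma (\<mu> + 1 / 2))"
    using Gamma_mu_pos[OF mu] by (intro real_div_sqrt) simp
  finally show ?thesis .
qed

text \<open>The ratio \<open>(1 - 2 a) / (1 + 2 a)\<close> is \<open>- 1 / 3\<close> for
  \<open>a = 1\<close> and \<open>1 / 3\<close> for \<open>a = 1 / 4\<close>, so a double step
  differs by \<open>(- \<i>)^2\<close>. At index \<open>0\<close> the prefactor fits because
  \<open>2 * (3 / 4) = 1 + 1 / 2\<close>; at index \<open>1\<close> both sides vanish.\<close>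

lemma fourier_gauss_coeff_0: "phi_coeff (fourier_gauss 0) k = (- \<i>) ^ k * phi_coeff (gauss_poly 1 0) k"
proof -
  let ?b = "\<lambda>n. complex_of_real (dunkl_root \<mu> n)"
  let ?m = "phi_coeff (gauss_poly 1 0)" and ?m' = "phi_coeff (gauss_poly (1 / 4) 0)"
  let ?\<alpha> = "complex_of_real (2 powr - (\<mu> + 1 / 2))"
  have b: "?b (Suc k) \<noteq> 0" for k using dunkl_root_pos[OF mu, of "Suc k"] by simp
  have m: "3 * ?b (Suc k) * ?m (Suc k) = - ?b k * ?m (k - 1)" for k
    using gauss_phi_coeff[of 1 k] by simp
  have m': "3 * ?b (Suc k) * ?m' (Suc k) = ?b k * ?m' (k - 1)" for k
    using gauss_phi_coeff[of "1 / 4" k] by (simp add: field_simps)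
  have "?\<alpha> * ?m' k = (- \<i>) ^ k * ?m k"
  proof (induction k rule: induct_nat_012)
    case 0
    have "2 powr - (\<mu> + 1 / 2) * (3 / 4) powr - (\<mu> + 1 / 2) = (2 * (3 / 4)) powr - (\<mu> + 1 / 2)"
      by (rule powr_mult[symmetric])
    then show ?case
      unfolding gauss_phi_coeff_0[OF zero_less_one] gauss_phi_coeff_0[of "1 / 4", simplified]
      by (simp add: mult.assoc[symmetric] flip: of_real_mult)
  next
    case 1
    show ?case using m[of 0] m'[of 0] b[of 0] by simp
  next
    case (ge2 k)
    have "3 * ?b (Suc (Suc k)) * (?\<alpha> * ?m' (Suc (Suc k))) = ?\<alpha> * (3 * ?b (Suc (Suc k)) * ?m' (Suc (Suc k)))"
      by (simp only: ac_simps)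
    also have "\<dots> = ?b (Suc k) * (?\<alpha> * ?m' k)" unfolding m' by (simp add: ac_simps)
    also have "\<dots> = - ((- \<i>) ^ k * (- ?b (Suc k) * ?m k))" unfolding ge2(1) by (simp add: ac_simps)
    also have "\<dots> = - ((- \<i>) ^ k * (3 * ?b (Suc (Suc k)) * ?m (Suc (Suc k))))"
      unfolding m[of "Suc k"] by simp
    also have "\<dots> = 3 * ?b (Suc (Suc k)) * ((- \<i>) ^ Suc (Suc k) * ?m (Suc (Suc k)))"
      by simp
    finally show ?case using b[of "Suc k"] by (auto simp only: mult_cancel_left mult_eq_0_iff numeral_neq_zero)
  qed
  moreover have "phi_coeff (fourier_gauss 0) k = ?\<alpha> * ?m' k"
    by (simp add: fourier_gauss_0 mult.assoc)
  ultimately show ?thesis by simp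
qed

text \<open>The transform turns multiplication by \<open>x\<close> into \<open>\<i>\<close> times
  the Dunkl operator. On coefficients this is a difference of the neighbours \<open>k - 1\<close>
  and \<open>k + 1\<close>, and their phases \<open>(- \<i>)^(k - 1)\<close> and
  \<open>(- \<i>)^(k + 1)\<close> convert it into the sum that represents \<open>x\<close>.\<close>

lemma fourier_gauss_coeff: "phi_coeff (fourier_gauss n) k = (- \<i>) ^ k * phi_coeff (gauss_poly 1 n) k"
proof (induction n arbitrary: k)
  case 0
  show ?case by (rule fourier_gauss_coeff_0)
next
  case (Suc n)
  let ?b = "\<lambda>n. complex_of_real (dunkl_root \<mu> n)"
  let ?D = "\<lambda>t. ?b k * phi_mu \<mu> (k - 1) t - ?b (Suc k) * phi_mu \<mu> (Suc k) t"
  have nz: "AE t in weight_measure \<mu>. t \<noteq> 0"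
    by (rule AE_weight_measureI[OF AE_completion[OF AE_lborel_singleton]])
  obtain f where f: "f \<in> fspan (gauss_poly (1 / 4))" "\<And>x. x \<noteq> 0 \<Longrightarrow> fourier_gauss n x = f x"
    by (rule fourier_gauss_fspan[of n]) blast
  have fm: "f \<in> borel_measurable lebesgue" by (rule fspan_gauss_poly_lebesgue[OF f(1)])
  have meas: "?D \<in> borel_measurable lebesgue" "(\<lambda>x. - \<i> * fourier_gauss (Suc n) x) \<in> borel_measurable lebesgue"
    by (intro borel_measurable_diff borel_measurable_times borel_measurable_const phi_mu_lebesgue mu fourier_gauss_lebesgue)+
  have cong: "phi_coeff (fourier_gauss n) j = phi_coeff f j" for j
  proof (rule integral_cong_AE)
    show "AE t in weight_measure \<mu>. fourier_gauss n t * phi_mu \<mu> j t = f t * phi_mu \<mu> j t"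
      using nz by eventually_elim (simp add: f(2))
  qed (simp_all only: measurable_weight_measure borel_measurable_times fourier_gauss_lebesgue phi_mu_lebesgue[OF mu] fm)
  have int: "integrable (weight_measure \<mu>) (\<lambda>t. f t * phi_mu \<mu> j t)"
    "integrable (weight_measure \<mu>) (\<lambda>t. gauss_poly 1 n t * phi_mu \<mu> j t)" for j
    by (rule integrable_fspan_mult[OF mu _ _ f(1) phi_mu_fspan[OF mu]]; simp)
      (rule integrable_fspan_mult[OF mu _ _ fspan_base phi_mu_fspan[OF mu]]; simp)
  have "- \<i> * phi_coeff (fourier_gauss (Suc n)) k =
      (LINT t|weight_measure \<mu>. (- \<i> * fourier_gauss (Suc n) t) * phi_mu \<mu> k t)"
    by (simp add: mult.assoc)
  also have "\<dots> = - (LINT t|weight_measure \<mu>. f t * ?D t)"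
  proof (rule dunkl_skew[OF mu _ _ f(1) _ meas(2) phi_mu_fspan[OF mu] has_dunkl_phi_mu[OF mu] meas(1)])
    show "has_dunkl \<mu> f (\<lambda>x. - \<i> * fourier_gauss (Suc n) x)"
      by (rule has_dunkl_cong[OF has_dunkl_fourier_gauss]) (simp add: f(2))
  qed simp_all
  also have "(LINT t|weight_measure \<mu>. f t * ?D t) = ?b k * phi_coeff f (k - 1) - ?b (Suc k) * phi_coeff f (Suc k)"
    using int(1) by (simp add: right_diff_distrib mult.left_commute[of "f _"])
  also have "\<dots> = ?b k * ((- \<i>) ^ (k - 1) * phi_coeff (gauss_poly 1 n) (k - 1)) -
      ?b (Suc k) * ((- \<i>) ^ Suc k * phi_coeff (gauss_poly 1 n) (Suc k))"
    unfolding cong[symmetric] Suc.IH ..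
  finally have "\<i> * (- \<i> * phi_coeff (fourier_gauss (Suc n)) k) =
      \<i> * - (?b k * ((- \<i>) ^ (k - 1) * phi_coeff (gauss_poly 1 n) (k - 1)) -
      ?b (Suc k) * ((- \<i>) ^ Suc k * phi_coeff (gauss_poly 1 n) (Suc k)))" by (rule arg_cong)
  then have "phi_coeff (fourier_gauss (Suc n)) k =
      ?b k * ((- \<i> * (- \<i>) ^ (k - 1)) * phi_coeff (gauss_poly 1 n) (k - 1)) +
      ?b (Suc k) * ((- \<i>) ^ k * phi_coeff (gauss_poly 1 n) (Suc k))"
    by (simp add: algebra_simps)
  also have "?b k * ((- \<i> * (- \<i>) ^ (k - 1)) * phi_coeff (gauss_poly 1 n) (k - 1)) =
      (- \<i>) ^ k * (?b k * phi_coeff (gauss_poly 1 n) (k - 1))"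
    by (cases k) simp_all
  also have "(- \<i>) ^ k * (?b k * phi_coeff (gauss_poly 1 n) (k - 1)) +
      ?b (Suc k) * ((- \<i>) ^ k * phi_coeff (gauss_poly 1 n) (Suc k)) =
      (- \<i>) ^ k * (LINT t|weight_measure \<mu>. gauss_poly 1 n t * Q_fun (phi_mu \<mu> k) t)"
    unfolding Q_phi_mu[OF mu] using int(2)
    by (simp add: distrib_left mult.left_commute[of "gauss_poly 1 n _"] mult.left_commute[of "(- \<i>) ^ k"])
  also have "(LINT t|weight_measure \<mu>. gauss_poly 1 n t * Q_fun (phi_mu \<mu> k) t) = phi_coeff (gauss_poly 1 (Suc n)) k"
    by (simp add: Q_fun_gauss_poly[symmetric] Q_fun_def ac_simps)
  finally show ?case .
qed

lemma fourier_integral_fspan: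
  "fourier_integral \<mu> (\<lambda>t. \<Sum>n<N. c n * gauss_poly 1 n t) = (\<lambda>x. \<Sum>n<N. c n * fourier_gauss n x)"
proof
  fix x :: real
  have "(LINT t|weight_measure \<mu>. e_mu \<mu> (- \<i> * x * t) * (\<Sum>n<N. c n * gauss_poly 1 n t)) =
      (LINT t|weight_measure \<mu>. (\<Sum>n<N. c n * (e_mu \<mu> (- \<i> * x * t) * gauss_poly 1 n t)))"
    unfolding sum_distrib_left by (simp only: mult.left_commute)
  also have "\<dots> = (\<Sum>n<N. c n * (LINT t|weight_measure \<mu>. e_mu \<mu> (- \<i> * x * t) * gauss_poly 1 n t))"
    using fourier_gauss_poly(1) by (simp add: Bochner_Integration.integral_sum)
  finally have eq: "(LINT t|weight_measure \<mu>. e_mu \<mu> (- \<i> * x * t) * (\<Sum>n<N. c n * gauss_poly 1 n t)) =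
      (\<Sum>n<N. c n * (LINT t|weight_measure \<mu>. e_mu \<mu> (- \<i> * x * t) * gauss_poly 1 n t))" .
  show "fourier_integral \<mu> (\<lambda>t. \<Sum>n<N. c n * gauss_poly 1 n t) x = (\<Sum>n<N. c n * fourier_gauss n x)"
    unfolding fourier_integral_def fourier_gauss_def eq unfolding sum_distrib_left
    by (intro sum.cong refl) (rule mult.left_commute)
qed

end

section \<open>Diagonal operators on \<open>L\<^sup>2\<^sub>\<mu>(\<real>)\<close>\<close>

context l2_basis
begin

definition l2_diag :: "(nat \<Rightarrow> complex) \<Rightarrow> fclass oper" where
  "l2_diag l = {(F, G). F \<in> L2 \<mu> \<and> G \<in> L2 \<mu> \<and> (\<forall>n. l2_inner \<mu> G (e n) = l n * l2_inner \<mu> F (e n))}"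

lemma l2_diag_unique: "(F, G) \<in> l2_diag l \<Longrightarrow> (F, G') \<in> l2_diag l \<Longrightarrow> G = G'"
  by (rule L2_eqI) (auto simp: l2_diag_def)

lemma l2_diag_total:
  assumes l: "\<And>n. cmod (l n) = 1" and F: "F \<in> L2 \<mu>"
  shows "\<exists>G. (F, G) \<in> l2_diag l"
proof -
  have "summable (\<lambda>n. (cmod (l n * l2_inner \<mu> F (e n)))\<^sup>2)"
    using bessel[OF F] by (simp add: norm_mult l)
  from L2_with_coefficients[OF F this] show ?thesis using F by (auto simp: l2_diag_def)
qed

text \<open>Unimodular factors leave the Parseval sum unchanged, and their conjugates provide
  preimages.\<close>

lemma unitary_l2_diag:
  assumes l: "\<And>n. cmod (l n) = 1"
  shows "unitary_operator_L2 \<mu> (l2_diag l)"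
proof -
  have "linear_operator (l2_diag l)"
    unfolding linear_operator_def
  proof (intro conjI allI impI)
    show "single_valued (l2_diag l)" using l2_diag_unique by (intro single_valuedI)
  qed (auto simp: l2_diag_def L2_zero L2_add L2_scaleC l2_inner_add_left l2_inner_scaleC_left e_L2 algebra_simps)
  moreover have "Domain (l2_diag l) = L2 \<mu>"
    using l2_diag_total[OF l] by (auto simp: l2_diag_def)
  moreover have "Range (l2_diag l) = L2 \<mu>"
  proof (intro equalityI subsetI)
    fix G assume "G \<in> L2 \<mu>"
    moreover have "cmod (cnj (l n)) = 1" for n by (simp add: l)
    ultimately obtain F where F: "(G, F) \<in> l2_diag (\<lambda>n. cnj (l n))"
      using l2_diag_total[of "\<lambda>n. cnj (l n)" G] by blast
    have "l n * cnj (l n) = 1" for n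
      using complex_norm_square[of "l n"] l[of n] by simp
    then have "l n * (cnj (l n) * z) = z" for n z by (simp add: mult.assoc[symmetric])
    with F have "(F, G) \<in> l2_diag l" by (auto simp: l2_diag_def)
    then show "G \<in> Range (l2_diag l)" by blast
  qed (auto simp: l2_diag_def)
  moreover have "l2_inner \<mu> g g' = l2_inner \<mu> f f'" if "(f, g) \<in> l2_diag l" "(f', g') \<in> l2_diag l" for f g f' g'
  proof -
    have "l2_inner \<mu> g (e n) * cnj (l2_inner \<mu> g' (e n)) = l2_inner \<mu> f (e n) * cnj (l2_inner \<mu> f' (e n))" for n
    proof -
      have "l n * cnj (l n) = 1" using complex_norm_square[of "l n"] l[of n] by simp
      then have "(l n * cnj (l n)) * (l2_inner \<mu> f (e n) * cnj (l2_inner \<mu> f' (e n))) =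
          l2_inner \<mu> f (e n) * cnj (l2_inner \<mu> f' (e n))" by simp
      then show ?thesis using that by (simp add: l2_diag_def ac_simps)
    qed
    then show ?thesis
      using l2_parseval[of g g'] l2_parseval[of f f'] that by (simp add: l2_diag_def sums_iff)
  qed
  ultimately show ?thesis unfolding unitary_operator_L2_def by blast
qed

lemma conjugate_diag_op:
  assumes "orthonormal_basis \<phi>" and U: "unitary_onto_L2 \<mu> U" "\<And>n. U (\<phi> n) = e n"
  shows "conjugate_by U (orthonormal_basis.diag_op \<phi> l) = l2_diag l"
proof -
  interpret B: orthonormal_basis \<phi> by fact
  have c: "l2_inner \<mu> (U x) (e n) = cinner x (\<phi> n)" for x n
    unfolding U(2)[symmetric] by (rule unitary_inner[OF U(1)])
  show ?thesis
  proof (intro equalityI subsetI)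
    fix p assume "p \<in> l2_diag l"
    then obtain F G where p: "p = (F, G)" "F \<in> L2 \<mu>" "G \<in> L2 \<mu>"
      and coef: "\<And>n. l2_inner \<mu> G (e n) = l n * l2_inner \<mu> F (e n)"
      by (auto simp: l2_diag_def)
    then obtain x y where "F = U x" "G = U y" using unitary_range[OF U(1)] by blast
    moreover from this coef have "(x, y) \<in> B.diag_op l" by (simp add: B.diag_op_def c)
    ultimately show "p \<in> conjugate_by U (B.diag_op l)" unfolding conjugate_by_def p by blast
  qed (auto simp: conjugate_by_def l2_diag_def B.diag_op_def c unitary_in[OF U(1)])
qed

end

section \<open>The concrete operators\<close>

context
  fixes \<mu> :: real
  assumes mu: "\<mu> > - 1 / 2"
begin

abbreviation "phi_class \<equiv> \<lambda>n. abs_fclass (phi_mu \<mu> n)"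

interpretation L: l2_basis \<mu> phi_class
  by (rule phi_mu_basis[OF mu])

text \<open>Only the powers \<open>x^(n - 2 k)\<close> occur, all of the parity of
  \<open>n\<close>.\<close>

lemma phi_mu_parity: "phi_mu \<mu> n (- x) = (- 1) ^ n * phi_mu \<mu> n x"
proof -
  have "gauss_poly (1 / 2) (n - 2 * k) (- x) = (- 1) ^ n * gauss_poly (1 / 2) (n - 2 * k) x" if "2 * k \<le> n" for k
  proof -
    have "(- x) ^ (n - 2 * k) = (- 1) ^ n * x ^ (n - 2 * k)"
      using that by (subst power_minus) (simp add: minus_one_power_iff)
    then show ?thesis by (simp add: gauss_poly_def)
  qed
  then show ?thesis
    unfolding phi_mu_gauss[OF mu] sum_distrib_left
    by (intro sum.cong refl) (auto simp: hermite_coeff_def[OF mu])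
qed

lemma weight_measure_reflect:
  fixes f :: "real \<Rightarrow> 'b::{banach, second_countable_topology}"
  assumes [measurable]: "f \<in> borel_measurable borel"
  shows "integrable (weight_measure \<mu>) (\<lambda>t. f (- t)) \<longleftrightarrow> integrable (weight_measure \<mu>) f"
    and "(LINT t|weight_measure \<mu>. f (- t)) = (LINT t|weight_measure \<mu>. f t)"
proof -
  show "integrable (weight_measure \<mu>) (\<lambda>t. f (- t)) \<longleftrightarrow> integrable (weight_measure \<mu>) f"
    using lborel_integrable_real_affine_iff[of "- 1" "\<lambda>t. (\<bar>t\<bar> powr (2 * \<mu>)) *\<^sub>R f t" 0]
    by (simp add: integrable_weight_measure_iff)
  show "(LINT t|weight_measure \<mu>. f (- t)) = (LINT t|weight_measure \<mu>. f t)"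
    using lborel_integral_real_affine[of "- 1" "\<lambda>t. (\<bar>t\<bar> powr (2 * \<mu>)) *\<^sub>R f t" 0]
    by (simp add: integrable_weight_measure_iff)
qed

lemma lebesgue_reflect: "f \<in> measurable lebesgue M \<Longrightarrow> (\<lambda>t::real. f (- t)) \<in> measurable lebesgue M"
  using measurable_compose[OF lebesgue_measurable_scaling[of "- 1 :: real"]] by simp

text \<open>Reflection maps negligible sets to negligible sets, so it is well defined on
  classes.\<close>

lemma AE_lebesgue_reflect:
  assumes "AE t in lebesgue. R (t :: real)"
  shows "AE t in lebesgue. R (- t)"
proof -
  obtain N where N: "{t. \<not> R t} \<subseteq> N" "negligible N"
    using assms by (auto simp: eventually_ae_filter negligible_iff_null_sets)
  have "negligible (uminus ` N)"
    by (rule negligible_differentiable_image_negligible[OF _ N(2)])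
      (auto intro!: derivative_intros)
  moreover have "{t. \<not> R (- t)} \<subseteq> uminus ` N"
  proof
    fix t assume "t \<in> {t. \<not> R (- t)}"
    then have "- t \<in> N" using N by blast
    then show "t \<in> uminus ` N" by (intro image_eqI[of _ _ "- t"]) simp_all
  qed
  ultimately show ?thesis
    by (auto simp: eventually_ae_filter negligible_iff_null_sets)
qed

text \<open>Reflection multiplies the \<open>n\<close>th coefficient by the parity sign of the
  \<open>n\<close>th Hermite function. This is computed for a Borel representative, whose integrals
  can be reflected.\<close>

lemma J_mu_eq: "J_mu \<mu> = L.l2_diag (\<lambda>n. (- 1) ^ n)"
proof -
  have refl: "(abs_fclass f, abs_fclass (\<lambda>t. f (- t))) \<in> L.l2_diag (\<lambda>n. (- 1) ^ n)"
    if f [measurable]: "f \<in> borel_measurable borel" and F: "abs_fclass f \<in> L2 \<mu>" for f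
  proof -
    have fl: "f \<in> borel_measurable lebesgue" by (rule measurable_completion) simp
    have fr: "(\<lambda>t. f (- t)) \<in> borel_measurable lebesgue" by (rule lebesgue_reflect[OF fl])
    have [measurable]: "phi_mu \<mu> n \<in> borel_measurable borel" for n
      by (rule fspan_gauss_poly_borel[OF phi_mu_fspan[OF mu]])
    have "integrable (weight_measure \<mu>) (\<lambda>t. (cmod (f (- t)))\<^sup>2)"
      using F fl weight_measure_reflect(1)[of "\<lambda>t. (cmod (f t))\<^sup>2"] by (simp add: L2_abs_iff)
    then have "abs_fclass (\<lambda>t. f (- t)) \<in> L2 \<mu>" by (simp add: L2_abs_iff fr)
    moreover have "l2_inner \<mu> (abs_fclass (\<lambda>t. f (- t))) (phi_class n) = (- 1) ^ n * l2_inner \<mu> (abs_fclass f) (phi_class n)" for n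
    proof -
      have "(LINT t|weight_measure \<mu>. f (- t) * phi_mu \<mu> n t) =
          (LINT t|weight_measure \<mu>. f t * phi_mu \<mu> n (- t))"
        using weight_measure_reflect(2)[of "\<lambda>t. f t * phi_mu \<mu> n (- t)"] by simp
      also have "\<dots> = (LINT t|weight_measure \<mu>. (- 1) ^ n * (f t * phi_mu \<mu> n t))"
        by (simp only: phi_mu_parity mult.left_commute)
      finally show ?thesis
        using fl fr by (simp add: l2_inner_abs phi_mu_lebesgue[OF mu] phi_mu_cnj[OF mu])
    qed
    ultimately show ?thesis using F by (simp add: L.l2_diag_def)
  qed
  show ?thesis
  proof (intro equalityI subsetI)
    fix p assume "p \<in> J_mu \<mu>"
    then obtain f where p: "p = (abs_fclass f, abs_fclass (\<lambda>x. f (- x)))"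
      and f: "f \<in> borel_measurable lebesgue" "abs_fclass f \<in> L2 \<mu>"
      by (auto simp: J_mu_def)
    obtain g where g: "g \<in> borel_measurable borel" "g \<in> borel_measurable lebesgue" "abs_fclass f = abs_fclass g"
      by (rule fclass_borel_cases)
    have "AE t in lebesgue. f (- t) = g (- t)"
      by (rule AE_lebesgue_reflect[OF abs_fclass_eqD[OF f(1) g(2,3)]])
    then have "abs_fclass (\<lambda>x. f (- x)) = abs_fclass (\<lambda>x. g (- x))"
      by (intro abs_fclass_eqI lebesgue_reflect f g)
    then show "p \<in> L.l2_diag (\<lambda>n. (- 1) ^ n)" using refl[OF g(1)] f(2) by (simp add: p g(3))
  next
    fix p assume p: "p \<in> L.l2_diag (\<lambda>n. (- 1) ^ n)"
    obtain F G where FG: "p = (F, G)" by (cases p)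
    obtain g where g: "g \<in> borel_measurable borel" "g \<in> borel_measurable lebesgue" "F = abs_fclass g"
      by (rule fclass_borel_cases)
    have F: "F \<in> L2 \<mu>" using p by (simp add: FG L.l2_diag_def)
    then have "G = abs_fclass (\<lambda>t. g (- t))"
      using L.l2_diag_unique[OF p[unfolded FG]] refl[OF g(1)] by (simp add: g(3))
    then show "p \<in> J_mu \<mu>" using F g by (auto simp: FG J_mu_def)
  qed
qed

text \<open>\<open>F_mu\<close> is a definite description, so existence and uniqueness are both due:
  the diagonal operator extends the integral transform by the coefficient formula, and no other
  unitary operator does because the functions \<open>exp (- x^2) x^n\<close> are complete.\<close>

lemma F_mu_eq: "F_mu \<mu> = L.l2_diag (\<lambda>n. (- \<i>) ^ n)"
proof -
  let ?G = "L.l2_diag (\<lambda>n. (- \<i>) ^ n)"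
  let ?f = "\<lambda>n. abs_fclass (gauss_poly 1 n)" and ?h = "\<lambda>n. abs_fclass (fourier_gauss \<mu> n)"
  have gp: "(\<lambda>n x. complex_of_real (exp (- x\<^sup>2) * x ^ n)) = gauss_poly 1"
    by (intro ext) (simp add: gauss_poly_def)
  have G: "unitary_operator_L2 \<mu> ?G" by (rule L.unitary_l2_diag) (simp add: norm_power)
  have lin: "linear_operator ?G" using G by (simp add: unitary_operator_L2_def)
  have fh: "(?f n, ?h n) \<in> ?G" for n
    using fourier_gauss_coeff[OF mu, of n] gauss_poly_L2[OF mu zero_less_one] fourier_gauss_L2[OF mu]
    by (simp add: L.l2_diag_def l2_inner_abs phi_mu_lebesgue[OF mu] phi_mu_cnj[OF mu] gauss_poly_lebesgue
        fourier_gauss_lebesgue[OF mu])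
  have ext: "(abs_fclass f, abs_fclass (fourier_integral \<mu> f)) \<in> ?G" if f1: "f \<in> fspan (gauss_poly 1)" for f
  proof -
    obtain N c where f: "f = (\<lambda>x. \<Sum>n<N. c n * gauss_poly 1 n x)" using f1 by (rule fspan_cases)
    have "(\<Sum>n<N. c n *\<^sub>C ?f n, \<Sum>n<N. c n *\<^sub>C ?h n) \<in> graph_span ?f ?h" by (rule graph_spanI)
    also have "graph_span ?f ?h \<subseteq> ?G" by (rule graph_span_subset[OF lin fh])
    finally show ?thesis
      unfolding f fourier_integral_fspan[OF mu]
      by (simp add: abs_fclass_fspan[of "gauss_poly 1", OF gauss_poly_lebesgue]
          abs_fclass_fspan[of "fourier_gauss \<mu>", OF fourier_gauss_lebesgue[OF mu]])
  qed
  show ?thesis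
    unfolding F_mu_def gp
  proof (rule the_equality)
    show "unitary_operator_L2 \<mu> ?G \<and>
        (\<forall>f\<in>fspan (gauss_poly 1). (abs_fclass f, abs_fclass (fourier_integral \<mu> f)) \<in> ?G)"
      using G ext by blast
  next
    fix G' assume *: "unitary_operator_L2 \<mu> G' \<and>
        (\<forall>f\<in>fspan (gauss_poly 1). (abs_fclass f, abs_fclass (fourier_integral \<mu> f)) \<in> G')"
    have fh': "(?f n, ?h n) \<in> G'" for n
      using * fspan_base[of "gauss_poly 1" n] unfolding fourier_gauss_def[OF mu] by blast
    have iso: "l2_inner \<mu> g g' = l2_inner \<mu> f f'" if "(f, g) \<in> G'" "(f', g') \<in> G'" for f g f' g'
      using * that unfolding unitary_operator_L2_def by blast
    have iso0: "l2_inner \<mu> g g' = l2_inner \<mu> f f'" if "(f, g) \<in> ?G" "(f', g') \<in> ?G" for f g f' g'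
      using G that unfolding unitary_operator_L2_def by blast
    have ran: "Domain G' = L2 \<mu>" "Range G' = L2 \<mu>" "Range ?G = L2 \<mu>" "Domain ?G = L2 \<mu>"
      using * G unfolding unitary_operator_L2_def by blast+
    \<comment> \<open>\<open>B - A\<close> is orthogonal to the images of the \<open>e\<^bsup>-x\<^sup>2\<^esup> x\<^sup>n\<close>, so its preimage is orthogonal to all of these.\<close>
    have eq: "A = B" if A: "(F, A) \<in> ?G" and B: "(F, B) \<in> G'" for F A B
    proof -
      have AB: "A \<in> L2 \<mu>" "B \<in> L2 \<mu>" using A B ran by blast+
      then have "B - A \<in> Range ?G" by (simp add: ran L2_diff)
      then obtain C where C: "(C, B - A) \<in> ?G" by blast
      have "l2_inner \<mu> C (?f n) = 0" for n
      proof -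
        have "l2_inner \<mu> C (?f n) = l2_inner \<mu> (B - A) (?h n)" by (rule iso0[OF C fh, symmetric])
        also have "\<dots> = l2_inner \<mu> B (?h n) - l2_inner \<mu> A (?h n)"
          by (rule l2_inner_diff_left[OF AB(2,1) fourier_gauss_L2[OF mu]])
        finally show ?thesis using iso[OF B fh'] iso0[OF A fh] by simp
      qed
      moreover have "C \<in> L2 \<mu>" using C ran by blast
      ultimately have "C = 0" by (intro gauss_poly_complete[OF mu zero_less_one])
      moreover have "(0, 0) \<in> ?G" using lin by (rule linear_operatorD)
      ultimately have "B - A = 0" using C L.l2_diag_unique by blast
      then show ?thesis by simp
    qed
    show "G' = ?G"
    proof (intro equalityI subrelI)
      fix F B assume B: "(F, B) \<in> G'"
      then obtain A where A: "(F, A) \<in> ?G" using ran by blast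
      with eq[OF A B] show "(F, B) \<in> ?G" by simp
    next
      fix F A assume A: "(F, A) \<in> ?G"
      then obtain B where B: "(F, B) \<in> G'" using ran by blast
      with eq[OF A B] show "(F, A) \<in> G'" by simp
    qed
  qed
qed

section \<open>Action of the concrete operators on finite combinations\<close>

lemma P_fun_phi_sum:
  "x \<noteq> 0 \<Longrightarrow> P_fun \<mu> (\<lambda>x. \<Sum>n<N. c n * phi_mu \<mu> n x) x =
    (\<Sum>n<N. c n * (- \<i> * (complex_of_real (dunkl_root \<mu> n) * phi_mu \<mu> (n - 1) x -
      complex_of_real (dunkl_root \<mu> (Suc n)) * phi_mu \<mu> (Suc n) x)))"
  by (subst P_fun_has_dunkl[OF has_dunkl_sum[OF has_dunkl_phi_mu[OF mu]]])
    (simp_all add: sum_distrib_left mult.left_commute)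

lemma Q_fun_phi: "Q_fun (phi_mu \<mu> n) = (\<lambda>x. complex_of_real (dunkl_root \<mu> n) * phi_mu \<mu> (n - 1) x +
    complex_of_real (dunkl_root \<mu> (Suc n)) * phi_mu \<mu> (Suc n) x)"
  by (intro ext) (rule Q_phi_mu[OF mu])

lemma jacobi_image_e:
  "abs_fclass (\<lambda>x. (\<zeta> * complex_of_real (dunkl_root \<mu> n)) * phi_mu \<mu> (n - 1) x +
     (cnj \<zeta> * complex_of_real (dunkl_root \<mu> (Suc n))) * phi_mu \<mu> (Suc n) x) =
   jacobi_image (dunkl_root \<mu>) \<zeta> phi_class n"
  "(\<lambda>x. (\<zeta> * complex_of_real (dunkl_root \<mu> n)) * phi_mu \<mu> (n - 1) x +
     (cnj \<zeta> * complex_of_real (dunkl_root \<mu> (Suc n))) * phi_mu \<mu> (Suc n) x) \<in> borel_measurable lebesgue"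
proof -
  have m: "(\<lambda>x. c * phi_mu \<mu> k x) \<in> borel_measurable lebesgue" for c k
    by (intro borel_measurable_times borel_measurable_const phi_mu_lebesgue mu)
  show "(\<lambda>x. (\<zeta> * complex_of_real (dunkl_root \<mu> n)) * phi_mu \<mu> (n - 1) x +
     (cnj \<zeta> * complex_of_real (dunkl_root \<mu> (Suc n))) * phi_mu \<mu> (Suc n) x) \<in> borel_measurable lebesgue"
    by (intro borel_measurable_add m)
  show "abs_fclass (\<lambda>x. (\<zeta> * complex_of_real (dunkl_root \<mu> n)) * phi_mu \<mu> (n - 1) x +
     (cnj \<zeta> * complex_of_real (dunkl_root \<mu> (Suc n))) * phi_mu \<mu> (Suc n) x) =
   jacobi_image (dunkl_root \<mu>) \<zeta> phi_class n"
    unfolding jacobi_image_def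
    by (simp only: abs_fclass_ops(3)[OF phi_mu_lebesgue[OF mu] phi_mu_lebesgue[OF mu]] abs_fclass_ops(1)[OF m m])
qed

text \<open>Describes the graph by coefficient sequences, so that the pointwise operation
  \<open>T\<close> is evaluated only on explicit combinations.\<close>

lemma fspan_graph:
  assumes "\<And>N c. abs_fclass (T (\<lambda>x. \<Sum>n<N. c n * phi_mu \<mu> n x)) = (\<Sum>n<N. c n *\<^sub>C t n)"
  shows "{(abs_fclass f, abs_fclass (T f)) | f. f \<in> fspan (phi_mu \<mu>)} =
    {(\<Sum>n<N. c n *\<^sub>C phi_class n, \<Sum>n<N. c n *\<^sub>C t n) | N c. True}"
proof -
  have "abs_fclass (\<lambda>x. \<Sum>n<N. c n * phi_mu \<mu> n x) = (\<Sum>n<N. c n *\<^sub>C phi_class n)" for N c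
    by (rule abs_fclass_fspan[of "phi_mu \<mu>", OF phi_mu_lebesgue[OF mu]])
  then have *: "(abs_fclass (\<lambda>x. \<Sum>n<N. c n * phi_mu \<mu> n x), abs_fclass (T (\<lambda>x. \<Sum>n<N. c n * phi_mu \<mu> n x))) =
      (\<Sum>n<N. c n *\<^sub>C phi_class n, \<Sum>n<N. c n *\<^sub>C t n)" for N c
    by (simp only: assms)
  show ?thesis
  proof (intro equalityI subsetI)
    fix p assume "p \<in> {(abs_fclass f, abs_fclass (T f)) | f. f \<in> fspan (phi_mu \<mu>)}"
    then obtain f where p: "p = (abs_fclass f, abs_fclass (T f))" and f: "f \<in> fspan (phi_mu \<mu>)" by blast
    from f obtain N c where "f = (\<lambda>x. \<Sum>n<N. c n * phi_mu \<mu> n x)" by (rule fspan_cases)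
    with p have "p = (\<Sum>n<N. c n *\<^sub>C phi_class n, \<Sum>n<N. c n *\<^sub>C t n)" by (simp only: *)
    then show "p \<in> {(\<Sum>n<N. c n *\<^sub>C phi_class n, \<Sum>n<N. c n *\<^sub>C t n) | N c. True}" by blast
  next
    fix p assume "p \<in> {(\<Sum>n<N. c n *\<^sub>C phi_class n, \<Sum>n<N. c n *\<^sub>C t n) | N c. True}"
    then obtain N c where "p = (\<Sum>n<N. c n *\<^sub>C phi_class n, \<Sum>n<N. c n *\<^sub>C t n)" by blast
    then show "p \<in> {(abs_fclass f, abs_fclass (T f)) | f. f \<in> fspan (phi_mu \<mu>)}"
      unfolding *[symmetric] using fspanI[where N = N and c = c and g = "phi_mu \<mu>"] by blast
  qed
qed

text \<open>Shared by the three unbounded operators: equal matrices on the two bases give spans, and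
  hence closures, that correspond under \<open>U\<close>.\<close>

lemma conjugate_closure:
  fixes \<phi> :: "nat \<Rightarrow> 'a::complex_hilbert_space"
  assumes U: "unitary_onto_L2 \<mu> U" "\<And>n. U (\<phi> n) = phi_class n"
    and t: "\<And>n. U (s n) = t n"
    and T: "\<And>N c. abs_fclass (T (\<lambda>x. \<Sum>n<N. c n * phi_mu \<mu> n x)) = (\<Sum>n<N. c n *\<^sub>C t n)"
  shows "conjugate_by U (seq_closure (graph_span \<phi> s)) =
    l2_closure \<mu> {(abs_fclass f, abs_fclass (T f)) | f. f \<in> fspan (phi_mu \<mu>)}"
  unfolding l2_closure_conjugate[OF U(1), symmetric] conjugate_graph_span[OF U(1)] fspan_graph[of T t, OF T] U(2) t ..

lemma unitary_jacobi_image: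
  assumes U: "unitary_onto_L2 \<mu> U" "\<And>n. U (\<phi> n) = phi_class n"
  shows "U (jacobi_image b \<zeta> \<phi> n) = jacobi_image b \<zeta> phi_class n"
  using unitary_clinear[OF U(1)] by (simp add: jacobi_image_def clinear_def U(2))

lemma P_fun_class:
  "abs_fclass (P_fun \<mu> (\<lambda>x. \<Sum>n<N. c n * phi_mu \<mu> n x)) =
    (\<Sum>n<N. c n *\<^sub>C jacobi_image (dunkl_root \<mu>) (- \<i>) phi_class n)"
proof -
  let ?p = "\<lambda>n x. (- \<i> * complex_of_real (dunkl_root \<mu> n)) * phi_mu \<mu> (n - 1) x +
     (cnj (- \<i>) * complex_of_real (dunkl_root \<mu> (Suc n))) * phi_mu \<mu> (Suc n) x"
  have "abs_fclass (P_fun \<mu> (\<lambda>x. \<Sum>n<N. c n * phi_mu \<mu> n x)) = abs_fclass (\<lambda>x. \<Sum>n<N. c n * ?p n x)"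
  proof (rule abs_fclass_cong_nonzero(2)[OF measurable_sum_scaled[of ?p, OF jacobi_image_e(2)]])
    fix x :: real assume "x \<noteq> 0"
    then show "P_fun \<mu> (\<lambda>x. \<Sum>n<N. c n * phi_mu \<mu> n x) x = (\<Sum>n<N. c n * ?p n x)"
      by (subst P_fun_phi_sum, assumption) (intro sum.cong refl, simp add: algebra_simps)
  qed
  also have "\<dots> = (\<Sum>n<N. c n *\<^sub>C abs_fclass (?p n))"
    by (rule abs_fclass_fspan[of ?p, OF jacobi_image_e(2)])
  finally show ?thesis by (simp only: jacobi_image_e(1))
qed

lemma Q_fun_class:
  "abs_fclass (Q_fun (\<lambda>x. \<Sum>n<N. c n * phi_mu \<mu> n x)) =
    (\<Sum>n<N. c n *\<^sub>C jacobi_image (dunkl_root \<mu>) 1 phi_class n)"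
proof -
  have Q: "Q_fun (phi_mu \<mu> n) = (\<lambda>x. (1 * complex_of_real (dunkl_root \<mu> n)) * phi_mu \<mu> (n - 1) x +
     (cnj 1 * complex_of_real (dunkl_root \<mu> (Suc n))) * phi_mu \<mu> (Suc n) x)" for n
    by (simp add: Q_fun_phi)
  have "Q_fun (phi_mu \<mu> n) \<in> borel_measurable lebesgue" for n
    unfolding Q by (rule jacobi_image_e(2))
  from abs_fclass_fspan[of "\<lambda>n. Q_fun (phi_mu \<mu> n)", OF this] show ?thesis
    unfolding Q_fun_sum by (simp only: Q jacobi_image_e(1))
qed

text \<open>The square of the Dunkl operator is \<open>x^2 - 2 H\<close> here. Expanding both
  squares in neighbours, the outer terms agree and the diagonal ones differ by twice
  \<open>b_n^2 + b_(n+1)^2 = \<mu> + 1 / 2 + n\<close>, with \<open>b\<close> for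
  \<open>dunkl_root \<mu>\<close>.\<close>

lemma dunkl_square_phi:
  "complex_of_real (dunkl_root \<mu> n) * (complex_of_real (dunkl_root \<mu> (n - 1)) * phi_mu \<mu> (n - 1 - 1) x -
       complex_of_real (dunkl_root \<mu> (Suc (n - 1))) * phi_mu \<mu> (Suc (n - 1)) x) -
     complex_of_real (dunkl_root \<mu> (Suc n)) * (complex_of_real (dunkl_root \<mu> (Suc n)) * phi_mu \<mu> n x -
       complex_of_real (dunkl_root \<mu> (Suc (Suc n))) * phi_mu \<mu> (Suc (Suc n)) x) =
   Q_fun (Q_fun (phi_mu \<mu> n)) x - 2 * complex_of_real (\<mu> + 1 / 2 + n) * phi_mu \<mu> n x"
proof -
  let ?b = "\<lambda>n. complex_of_real (dunkl_root \<mu> n)" and ?p = "\<lambda>n. phi_mu \<mu> n x"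
  have QQ: "Q_fun (Q_fun (phi_mu \<mu> n)) x = ?b n * Q_fun (phi_mu \<mu> (n - 1)) x + ?b (Suc n) * Q_fun (phi_mu \<mu> (Suc n)) x"
    unfolding Q_fun_phi[of n] by (simp add: Q_fun_def algebra_simps)
  have sq: "?b n * ?b n + ?b (Suc n) * ?b (Suc n) = complex_of_real (\<mu> + 1 / 2 + n)"
  proof -
    have "dunkl_root \<mu> n * dunkl_root \<mu> n + dunkl_root \<mu> (Suc n) * dunkl_root \<mu> (Suc n) = \<mu> + 1 / 2 + n"
      using dunkl_root_square[OF mu, of n] dunkl_root_square[OF mu, of "Suc n"] dunkl_nat_Suc[of \<mu> n]
      unfolding power2_eq_square by (simp add: field_simps)
    then show ?thesis by (simp only: of_real_mult[symmetric] of_real_add[symmetric])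
  qed
  \<comment> \<open>At \<open>n = 0\<close> the index \<open>Suc (n - 1)\<close> is
    \<open>1\<close>, but the factor \<open>dunkl_root \<mu> 0\<close> is zero.\<close>
  have n: "?b n * (?b (Suc (n - 1)) * ?p (Suc (n - 1))) = ?b n * ?b n * ?p n"
    by (cases n) simp_all
  have "?b n * (?b (n - 1) * ?p (n - 1 - 1) - ?b (Suc (n - 1)) * ?p (Suc (n - 1))) -
      ?b (Suc n) * (?b (Suc n) * ?p n - ?b (Suc (Suc n)) * ?p (Suc (Suc n))) =
    Q_fun (Q_fun (phi_mu \<mu> n)) x - 2 * ((?b n * ?b n + ?b (Suc n) * ?b (Suc n)) * ?p n)"
    unfolding QQ Q_phi_mu[OF mu] right_diff_distrib distrib_left n diff_Suc_1 by (simp add: algebra_simps)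
  then show ?thesis by (simp only: sq mult.assoc)
qed

text \<open>\<open>P_fun\<close> is applied twice and the inner result is known only off
  \<open>0\<close>; \<open>has_dunkl_cong\<close> lets the outer derivative be taken of the explicit
  combination instead.\<close>

lemma H_fun_class:
  "abs_fclass (H_fun \<mu> (\<lambda>x. \<Sum>n<N. c n * phi_mu \<mu> n x)) =
    (\<Sum>n<N. c n *\<^sub>C (complex_of_real (\<mu> + 1 / 2 + n) *\<^sub>C phi_class n))"
proof -
  let ?f = "\<lambda>x. \<Sum>n<N. c n * phi_mu \<mu> n x" and ?b = "\<lambda>n. complex_of_real (dunkl_root \<mu> n)"
  let ?D = "\<lambda>n x. ?b n * phi_mu \<mu> (n - 1) x - ?b (Suc n) * phi_mu \<mu> (Suc n) x"
  let ?DD = "\<lambda>n x. ?b n * ?D (n - 1) x - ?b (Suc n) * ?D (Suc n) x"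
  let ?l = "\<lambda>n. complex_of_real (\<mu> + 1 / 2 + n)"
  have "has_dunkl \<mu> (?D n) (?DD n)" for n
    by (intro has_dunkl_diff has_dunkl_phi_mu[OF mu])
  then have "has_dunkl \<mu> (\<lambda>x. \<Sum>n<N. (- \<i> * c n) * ?D n x) (\<lambda>x. \<Sum>n<N. (- \<i> * c n) * ?DD n x)"
    by (intro has_dunkl_sum)
  then have "has_dunkl \<mu> (P_fun \<mu> ?f) (\<lambda>x. \<Sum>n<N. (- \<i> * c n) * ?DD n x)"
    by (rule has_dunkl_cong) (subst P_fun_phi_sum, assumption, intro sum.cong refl, simp only: ac_simps)
  then have PP: "P_fun \<mu> (P_fun \<mu> ?f) x = - \<i> * (\<Sum>n<N. (- \<i> * c n) * ?DD n x)" if "x \<noteq> 0" for x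
    using that by (rule P_fun_has_dunkl)
  have "H_fun \<mu> ?f x = (\<Sum>n<N. (c n * ?l n) * phi_mu \<mu> n x)" if x: "x \<noteq> 0" for x
  proof -
    have QQ: "Q_fun (Q_fun ?f) x = (\<Sum>n<N. c n * Q_fun (Q_fun (phi_mu \<mu> n)) x)"
      by (simp only: Q_fun_sum)
    have "- \<i> * (\<Sum>n<N. (- \<i> * c n) * ?DD n x) =
        (\<Sum>n<N. - (c n * (Q_fun (Q_fun (phi_mu \<mu> n)) x - 2 * ?l n * phi_mu \<mu> n x)))"
      unfolding sum_distrib_left diff_Suc_1 dunkl_square_phi
      by (intro sum.cong refl) (simp add: mult.assoc[symmetric])
    then have "H_fun \<mu> ?f x = (1 / 2) * (\<Sum>n<N. 2 * ((c n * ?l n) * phi_mu \<mu> n x))"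
      unfolding H_fun_def PP[OF x] QQ sum.distrib[symmetric]
      by (simp add: sum.distrib[symmetric] algebra_simps)
    also have "\<dots> = (\<Sum>n<N. (c n * ?l n) * phi_mu \<mu> n x)"
      by (simp only: sum_distrib_left[symmetric]) simp
    finally show ?thesis .
  qed
  then have "abs_fclass (H_fun \<mu> ?f) = abs_fclass (\<lambda>x. \<Sum>n<N. (c n * ?l n) * phi_mu \<mu> n x)"
    by (rule abs_fclass_cong_nonzero(2)[OF measurable_sum_scaled[of "phi_mu \<mu>", OF phi_mu_lebesgue[OF mu]]])
  also have "\<dots> = (\<Sum>n<N. (c n * ?l n) *\<^sub>C phi_class n)"
    by (rule abs_fclass_fspan[of "phi_mu \<mu>", OF phi_mu_lebesgue[OF mu]])
  finally show ?thesis by (simp only: scaleC_scaleC)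
qed

end

theorem mainTheorem1:
  fixes P Q H :: "'a::complex_hilbert_space oper"
    and \<mu> :: real and \<phi>0 :: 'a
  assumes "bose_like_oscillator P Q H"
    and "irreducible_oscillator P Q"
    and "\<mu> > - 1 / 2"
    and "is_eigenvalue H (complex_of_real (\<mu> + 1 / 2))"
    and "\<And>r::real. is_eigenvalue H (complex_of_real r) \<Longrightarrow> \<mu> + 1 / 2 \<le> r"
    and "norm \<phi>0 = 1"
    and "(\<phi>0, complex_of_real (\<mu> + 1 / 2) *\<^sub>C \<phi>0) \<in> H"
  shows "(\<exists>!U. unitary_onto_L2 \<mu> U \<and>
            (\<forall>n. U (osc_phi \<mu> P Q \<phi>0 n) = abs_fclass (phi_mu \<mu> n))) \<and>
         (\<forall>U. unitary_onto_L2 \<mu> U \<and>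
            (\<forall>n. U (osc_phi \<mu> P Q \<phi>0 n) = abs_fclass (phi_mu \<mu> n)) \<longrightarrow>
            conjugate_by U P = P_mu \<mu> \<and>
            conjugate_by U Q = Q_mu \<mu> \<and>
            conjugate_by U H = H_mu \<mu> \<and>
            conjugate_by U (osc_J \<mu> H) = J_mu \<mu> \<and>
            conjugate_by U (osc_F \<mu> H) = F_mu \<mu>)"
proof -
  obtain S where "oscillator_ground_state P Q H S \<mu> \<phi>0"
    using oscillator_ground_stateI[OF assms(1,3,5,6,7)] by blast
  then interpret oscillator_ground_state P Q H S \<mu> \<phi>0 .
  have basis: "orthonormal_basis \<phi>" by (rule irreducible_basis[OF assms(2)])
  interpret B: orthonormal_basis \<phi> by (rule basis)
  note l2 = phi_mu_basis[OF mu]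
  have "conjugate_by U P = P_mu \<mu> \<and> conjugate_by U Q = Q_mu \<mu> \<and> conjugate_by U H = H_mu \<mu> \<and>
      conjugate_by U (osc_J \<mu> H) = J_mu \<mu> \<and> conjugate_by U (osc_F \<mu> H) = F_mu \<mu>"
    if "unitary_onto_L2 \<mu> U \<and> (\<forall>n. U (\<phi> n) = abs_fclass (phi_mu \<mu> n))" for U
  proof (intro conjI)
    have U: "unitary_onto_L2 \<mu> U" "\<And>n. U (\<phi> n) = abs_fclass (phi_mu \<mu> n)" using that by blast+
    have P: "P = seq_closure (graph_span \<phi> (jacobi_image b (- \<i>) \<phi>))"
      by (rule B.jacobi_selfadjoint_eq[OF sa(1) P_phi b_0 b_square]) simp
    have Q: "Q = seq_closure (graph_span \<phi> (jacobi_image b 1 \<phi>))"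
      by (rule B.jacobi_selfadjoint_eq[OF sa(2) Q_phi b_0 b_square]) simp
    have H: "H = seq_closure (graph_span \<phi> (\<lambda>n. complex_of_real (\<mu> + 1 / 2 + n) *\<^sub>C \<phi> n))"
      by (rule B.diagonal_selfadjoint_eq(2)[OF sa(3) H_phi])
    show "conjugate_by U P = P_mu \<mu>"
      unfolding P_mu_def
      by (subst P) (rule conjugate_closure[OF mu U unitary_jacobi_image[OF mu U] P_fun_class[OF mu]])
    show "conjugate_by U Q = Q_mu \<mu>"
      unfolding Q_mu_def
      by (subst Q) (rule conjugate_closure[OF mu U unitary_jacobi_image[OF mu U] Q_fun_class[OF mu]])
    have UH: "U (complex_of_real (\<mu> + 1 / 2 + n) *\<^sub>C \<phi> n) =
        complex_of_real (\<mu> + 1 / 2 + n) *\<^sub>C abs_fclass (phi_mu \<mu> n)" for n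
      using unitary_clinear[OF U(1)] by (simp add: clinear_def U(2))
    show "conjugate_by U H = H_mu \<mu>"
      unfolding H_mu_def by (subst H) (rule conjugate_closure[OF mu U UH H_fun_class[OF mu]])
    have "exp (- (pi * \<i>)) = cis (- pi)" "exp (- (pi * \<i> / 2)) = cis (- (pi / 2))"
      by (simp_all add: cis_conv_exp mult.commute)
    moreover have "cis (- pi) = - 1" "cis (- (pi / 2)) = - \<i>"
      by (simp_all add: complex_eq_iff)
    ultimately have "exp (- (pi * \<i>)) = - 1" "exp (- (pi * \<i> / 2)) = - \<i>"
      by (simp_all only:)
    then have "osc_J \<mu> H = B.diag_op (\<lambda>n. (- 1) ^ n)" "osc_F \<mu> H = B.diag_op (\<lambda>n. (- \<i>) ^ n)"
      unfolding osc_J_def osc_F_def osc_exp_op[OF basis] by simp_all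
    then show "conjugate_by U (osc_J \<mu> H) = J_mu \<mu>" "conjugate_by U (osc_F \<mu> H) = F_mu \<mu>"
      using l2_basis.conjugate_diag_op[OF l2 basis U] by (simp_all add: J_mu_eq[OF mu] F_mu_eq[OF mu])
  qed
  with unitary_ex1[OF basis l2] show ?thesis by blast
qed

end
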